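(* Let $u_{h,\varepsilon}$ be the fine-scale finite element solution and let $\psi_{h,\varepsilon}$ be the discrete local particular function on the oversampling domain $\omega^\ast$ of the subdomain $\omega$, and put $\delta^\ast=\mathrm{dist}(\omega,\partial\omega^\ast\setminus\partial\Omega)$. There exist positive constants $c_0$, $c_1$, and $C$, independent of $\varepsilon$ and $h$, such that if $\delta^\ast\ge c_0\max\{\varepsilon,h\}$, then $$\big\Vert I_{h}\big(\chi (u_{h,\varepsilon} - \psi_{h,\varepsilon})\big)\big\Vert_{a,\varepsilon,\omega}\le C\big(1+\varepsilon \Vert\nabla \chi\Vert_{L^{\infty}(\omega)}\big)\,\frac{\varepsilon}{\delta^{\ast}}\,e^{-c_{1}\delta^{\ast}/\varepsilon}\,\big(\Vert u_{h,\varepsilon} \Vert_{L^{2}(\omega^{\ast})} + \Vert \psi_{h,\varepsilon} \Vert_{L^{2}(\omega^{\ast})}\big)\quad\text{if } h\le\varepsilon,$$ and $$\big\Vert I_{h}\big(\chi (u_{h,\varepsilon} - \psi_{h,\varepsilon})\big)\big\Vert_{a,\varepsilon,\omega}\le C\big(1+\varepsilon \Vert\nabla \chi\Vert_{L^{\infty}(\omega)}\big)\,\Big(\frac{h}{\delta^{\ast}}\Big)^{1/2}e^{-c_{1}\delta^{\ast}/h}\,\big(\Vert u_{h,\varepsilon} \Vert_{L^{2}(\omega^{\ast})} + \Vert \psi_{h,\varepsilon} \Vert_{L^{2}(\omega^{\ast})}\big)\quad\text{if } \varepsilon\le h.$$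
   Context: Setting: $\Omega\subset\mathbb{R}^d$ ($d=2,3$) is a bounded Lipschitz polyhedral domain, $\Gamma=\partial\Omega$, $0<\varepsilon\le 1$, $f\in L^2(\Omega)$, and $A\in (L^\infty(\Omega))^{d\times d}$ is pointwise symmetric with $a_{\min}|\xi|^2\le A(x)\xi\cdot\xi\le a_{\max}|\xi|^2$ for all $\xi\in\mathbb{R}^d$, $x\in\Omega$, where $0<a_{\min}<a_{\max}<\infty$. For $D\subset\Omega$ and $u,v\in H^1(D)$ put $a_{\varepsilon,D}(u,v)=\varepsilon^2\int_D A\nabla u\cdot\nabla v\,dx+\int_D uv\,dx$ and $\|u\|_{a,\varepsilon,D}=\sqrt{a_{\varepsilon,D}(u,u)}$. Finite elements: $\{\tau_h\}$ is a shape-regular family of triangulations of $\Omega$, $h_K=\mathrm{diam}(K)$, $h=\max_{K\in\tau_h}h_K$; $V_h\subset H^1(\Omega)$ is the space of continuous piecewise polynomials of (fixed) degree $r$ on $\tau_h$, $V_{h,0}=V_h\cap H^1_0(\Omega)$, and $I_h:C(\overline\Omega)\to V_h$ is the Lagrange interpolation operator (also used locally on unions of elements). The fine-scale FE solution $u_{h,\varepsilon}\in V_{h,0}$ satisfies $a_{\varepsilon,\Omega}(u_{h,\varepsilon},v_h)=\int_\Omega fv_h\,dx$ for all $v_h\in V_{h,0}$. Subdomains: $\omega\subset\omega^\ast\subset\Omega$, where $\omega$ is a member of a cover of $\Omega$ by connected open sets, $\omega^\ast$ is an oversampling domain with Lipschitz boundary, and both are resolved by the mesh (unions of elements). $\chi$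 is the partition-of-unity function of $\omega$: $0\le\chi\le1$, $\chi=0$ on $\Omega\setminus\omega$, $\chi\in W^{1,\infty}(\Omega)$. Discrete local particular function: let $V_h(\omega^\ast)=\{v_h|_{\omega^\ast}:v_h\in V_h\}$ and $V_{h,\Gamma}(\omega^\ast)=\{v_h\in V_h(\omega^\ast):v_h=0\text{ on }\partial\omega^\ast\cap\Gamma\}$; $\psi_{h,\varepsilon}\in V_{h,\Gamma}(\omega^\ast)$ is the unique solution of $a_{\varepsilon,\omega^\ast}(\psi_{h,\varepsilon},v_h)=\int_{\omega^\ast}fv_h\,dx$ for all $v_h\in V_{h,\Gamma}(\omega^\ast)$. *)

theory Defs
  imports "HOL-Analysis.Analysis" "HOL-Probability.Essential_Supremum"
begin

definition L2 :: "('a::euclidean_space) set \<Rightarrow> ('a \<Rightarrow> 'b::euclidean_space) \<Rightarrow> bool" where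
  "L2 D f \<longleftrightarrow> f \<in> borel_measurable (lebesgue_on D) \<and>
              integrable (lebesgue_on D) (\<lambda>x. (norm (f x))\<^sup>2)"

definition norm_L2 :: "('a::euclidean_space) set \<Rightarrow> ('a \<Rightarrow> 'b::euclidean_space) \<Rightarrow> real" where
  "norm_L2 D f = sqrt (\<integral>x. (norm (f x))\<^sup>2 \<partial>lebesgue_on D)"

definition Linf :: "('a::euclidean_space) set \<Rightarrow> ('a \<Rightarrow> 'b::euclidean_space) \<Rightarrow> bool" where
  "Linf D f \<longleftrightarrow> f \<in> borel_measurable (lebesgue_on D) \<and>
                esssup (lebesgue_on D) (\<lambda>x. ereal (norm (f x))) < \<infinity>"

definition norm_Linf :: "('a::euclidean_space) set \<Rightarrow> ('a \<Rightarrow> 'b::euclidean_space) \<Rightarrow> real" where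
  "norm_Linf D f = real_of_ereal (esssup (lebesgue_on D) (\<lambda>x. ereal (norm (f x))))"

definition grad :: "(real^'n \<Rightarrow> real) \<Rightarrow> real^'n \<Rightarrow> real^'n" where
  "grad f x = (\<chi> i. frechet_derivative f (at x) (axis i 1))"

primrec Ck :: "nat \<Rightarrow> (real^'n \<Rightarrow> real) \<Rightarrow> bool" where
  "Ck 0 f \<longleftrightarrow> continuous_on UNIV f"
| "Ck (Suc k) f \<longleftrightarrow> (\<forall>x. f differentiable (at x)) \<and> (\<forall>i. Ck k (\<lambda>x. grad f x $ i))"

text \<open>Test functions: the space \<open>C\<^sub>c\<^sup>\<infinity>(D)\<close>, extended by zero to the whole space.\<close>

definition test_fun :: "(real^'n) set \<Rightarrow> (real^'n \<Rightarrow> real) \<Rightarrow> bool" where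
  "test_fun D \<phi> \<longleftrightarrow> (\<forall>k. Ck k \<phi>) \<and>
     compact (closure {x. \<phi> x \<noteq> 0}) \<and> closure {x. \<phi> x \<noteq> 0} \<subseteq> D"

text \<open>Local integrability is part of the definition: otherwise non-integrable functions, whose
  Bochner integral is 0 by convention, could qualify as weak gradients. With it, the weak gradient
  is unique up to null sets, so that \<open>weak_grad\<close> below is well defined almost everywhere.\<close>

definition loc_integrable :: "('a::euclidean_space) set \<Rightarrow> ('a \<Rightarrow> 'b::euclidean_space) \<Rightarrow> bool" where
  "loc_integrable D f \<longleftrightarrow> (\<forall>K. compact K \<and> K \<subseteq> D \<longrightarrow> f absolutely_integrable_on K)"

definition has_weak_grad ::
    "(real^'n) set \<Rightarrow> (real^'n \<Rightarrow> real) \<Rightarrow> (real^'n \<Rightarrow> real^'n) \<Rightarrow> bool" where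
  "has_weak_grad D u g \<longleftrightarrow> loc_integrable D u \<and> loc_integrable D g \<and>
     (\<forall>\<phi> i. test_fun D \<phi> \<longrightarrow>
        (\<integral>x. u x * grad \<phi> x $ i \<partial>lebesgue_on D) = - (\<integral>x. g x $ i * \<phi> x \<partial>lebesgue_on D))"

definition weak_grad :: "(real^'n) set \<Rightarrow> (real^'n \<Rightarrow> real) \<Rightarrow> real^'n \<Rightarrow> real^'n" where
  "weak_grad D u = (SOME g. has_weak_grad D u g)"

definition H1 :: "(real^'n) set \<Rightarrow> (real^'n \<Rightarrow> real) \<Rightarrow> bool" where
  "H1 D u \<longleftrightarrow> L2 D u \<and> (\<exists>g. has_weak_grad D u g \<and> L2 D g)"

definition norm_H1 :: "(real^'n) set \<Rightarrow> (real^'n \<Rightarrow> real) \<Rightarrow> real" where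
  "norm_H1 D u = sqrt ((norm_L2 D u)\<^sup>2 + (norm_L2 D (weak_grad D u))\<^sup>2)"

definition H10 :: "(real^'n) set \<Rightarrow> (real^'n \<Rightarrow> real) \<Rightarrow> bool" where
  "H10 D u \<longleftrightarrow> H1 D u \<and>
     (\<exists>\<phi>. (\<forall>n::nat. test_fun D (\<phi> n)) \<and> (\<lambda>n. norm_H1 D (\<lambda>x. \<phi> n x - u x)) \<longlonglongrightarrow> 0)"

definition W1inf :: "(real^'n) set \<Rightarrow> (real^'n \<Rightarrow> real) \<Rightarrow> bool" where
  "W1inf D u \<longleftrightarrow> Linf D u \<and> (\<exists>g. has_weak_grad D u g \<and> Linf D g)"

text \<open>Near each boundary point, \<open>D\<close> is the strict supergraph, in some direction \<open>e\<close>, of a Lipschitz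
  function of the coordinates orthogonal to \<open>e\<close>.\<close>

definition lipschitz_boundary :: "(real^'n) set \<Rightarrow> bool" where
  "lipschitz_boundary D \<longleftrightarrow> (\<forall>z\<in>frontier D. \<exists>e \<rho> L (\<gamma>::real^'n \<Rightarrow> real).
     norm e = 1 \<and> \<rho> > 0 \<and> L-lipschitz_on UNIV \<gamma> \<and>
     D \<inter> ball z \<rho> = {x \<in> ball z \<rho>. \<gamma> (x - (x \<bullet> e) *\<^sub>R e) < x \<bullet> e})"

definition lipschitz_polyhedral_domain :: "(real^'n) set \<Rightarrow> bool" where
  "lipschitz_polyhedral_domain \<Omega> \<longleftrightarrow>
     open \<Omega> \<and> connected \<Omega> \<and> bounded \<Omega> \<and> \<Omega> \<noteq> {} \<and> lipschitz_boundary \<Omega> \<and>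
     (\<exists>P. finite P \<and> (\<forall>p\<in>P. polytope p) \<and> closure \<Omega> = \<Union>P)"

definition elliptic_coefficient ::
    "(real^'n) set \<Rightarrow> real \<Rightarrow> real \<Rightarrow> (real^'n \<Rightarrow> real^'n^'n) \<Rightarrow> bool" where
  "elliptic_coefficient \<Omega> amin amax A \<longleftrightarrow>
     (\<forall>i j. Linf \<Omega> (\<lambda>x. A x $ i $ j)) \<and>
     (\<forall>x\<in>\<Omega>. transpose (A x) = A x) \<and>
     (\<forall>x\<in>\<Omega>. \<forall>\<xi>. amin * (norm \<xi>)\<^sup>2 \<le> (A x *v \<xi>) \<bullet> \<xi> \<and> (A x *v \<xi>) \<bullet> \<xi> \<le> amax * (norm \<xi>)\<^sup>2)"

definition a_form :: "(real^'n \<Rightarrow> real^'n^'n) \<Rightarrow> real \<Rightarrow> (real^'n) set \<Rightarrow>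
    (real^'n \<Rightarrow> real) \<Rightarrow> (real^'n \<Rightarrow> real) \<Rightarrow> real" where
  "a_form A \<epsilon> D u v =
     \<epsilon>\<^sup>2 * (\<integral>x. (A x *v weak_grad D u x) \<bullet> weak_grad D v x \<partial>lebesgue_on D) +
     (\<integral>x. u x * v x \<partial>lebesgue_on D)"

definition norm_a :: "(real^'n \<Rightarrow> real^'n^'n) \<Rightarrow> real \<Rightarrow> (real^'n) set \<Rightarrow>
    (real^'n \<Rightarrow> real) \<Rightarrow> real" where
  "norm_a A \<epsilon> D u = sqrt (a_form A \<epsilon> D u u)"

text \<open>Elements are closed simplices. The library notion \<open>triangulation\<close> contains finiteness and
  conformity: any two elements meet in a common face (possibly empty).\<close>

definition mesh_of :: "(real^'n) set \<Rightarrow> (real^'n) set set \<Rightarrow> bool" where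
  "mesh_of \<Omega> T \<longleftrightarrow>
     triangulation T \<and> (\<forall>K\<in>T. int CARD('n) simplex K) \<and> \<Union>T = closure \<Omega>"

definition mesh_size :: "(real^'n) set set \<Rightarrow> real" where
  "mesh_size T = Max (diameter ` T)"

definition shape_regular_family :: "(real^'n) set \<Rightarrow> (real^'n) set set set \<Rightarrow> bool" where
  "shape_regular_family \<Omega> \<T> \<longleftrightarrow>
     (\<forall>T\<in>\<T>. mesh_of \<Omega> T) \<and>
     (\<exists>\<kappa>>0. \<forall>T\<in>\<T>. \<forall>K\<in>T. \<exists>z \<rho>. 0 < \<rho> \<and> cball z \<rho> \<subseteq> K \<and> diameter K \<le> \<kappa> * \<rho>)"

definition mesh_resolved :: "(real^'n) set set \<Rightarrow> (real^'n) set \<Rightarrow> bool" where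
  "mesh_resolved T D \<longleftrightarrow> (\<exists>S\<subseteq>T. D = interior (\<Union>S))"

definition submesh :: "(real^'n) set set \<Rightarrow> (real^'n) set \<Rightarrow> (real^'n) set set" where
  "submesh T D = {K\<in>T. K \<subseteq> closure D}"

definition poly_le :: "nat \<Rightarrow> (real^'n \<Rightarrow> real) \<Rightarrow> bool" where
  "poly_le r p \<longleftrightarrow> (\<exists>c::('n \<Rightarrow> nat) \<Rightarrow> real. \<forall>x.
     p x = (\<Sum>\<alpha> | (\<Sum>i\<in>UNIV. \<alpha> i) \<le> r. c \<alpha> * (\<Prod>i\<in>UNIV. (x $ i) ^ \<alpha> i)))"

text \<open>Finite element functions are determined on \<open>\<Union>T\<close> only; their values elsewhere are
  unconstrained and never used.\<close>

definition fe_space :: "nat \<Rightarrow> (real^'n) set set \<Rightarrow> (real^'n \<Rightarrow> real) set" where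
  "fe_space r T = {v. continuous_on (\<Union>T) v \<and>
     (\<forall>K\<in>T. \<exists>p. poly_le r p \<and> (\<forall>x\<in>K. v x = p x))}"

definition fe_space0 ::
    "nat \<Rightarrow> (real^'n) set set \<Rightarrow> (real^'n) set \<Rightarrow> (real^'n \<Rightarrow> real) set" where
  "fe_space0 r T \<Omega> = {v \<in> fe_space r T. H10 \<Omega> v}"

text \<open>Restrictions to a subdomain \<open>D\<close>. The values on the boundary of \<open>D\<close> are those of the continuous
  extension from \<open>D\<close>, hence the closure.\<close>

definition fe_space_on ::
    "nat \<Rightarrow> (real^'n) set set \<Rightarrow> (real^'n) set \<Rightarrow> (real^'n \<Rightarrow> real) set" where
  "fe_space_on r T D = {v. \<exists>w\<in>fe_space r T. \<forall>x\<in>closure D. v x = w x}"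

definition fe_space_Gamma :: "nat \<Rightarrow> (real^'n) set set \<Rightarrow> (real^'n) set \<Rightarrow> (real^'n) set \<Rightarrow>
    (real^'n \<Rightarrow> real) set" where
  "fe_space_Gamma r T \<Omega> D =
     {v \<in> fe_space_on r T D. \<forall>x \<in> frontier D \<inter> frontier \<Omega>. v x = 0}"

text \<open>Principal lattice of order \<open>r\<close>: the points of \<open>K\<close> whose barycentric coordinates are multiples
  of \<open>1 / r\<close>.\<close>

definition lagrange_nodes :: "nat \<Rightarrow> (real^'n) set \<Rightarrow> (real^'n) set" where
  "lagrange_nodes r K =
     {(\<Sum>a | a extreme_point_of K. (real (k a) / real r) *\<^sub>R a) | k :: real^'n \<Rightarrow> nat.
        (\<Sum>a | a extreme_point_of K. k a) = r}"

definition lagrange_interp ::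
    "nat \<Rightarrow> (real^'n) set set \<Rightarrow> (real^'n \<Rightarrow> real) \<Rightarrow> real^'n \<Rightarrow> real" where
  "lagrange_interp r T g =
     (SOME v. v \<in> fe_space r T \<and> (\<forall>K\<in>T. \<forall>z\<in>lagrange_nodes r K. v z = g z))"

definition fe_solution :: "nat \<Rightarrow> (real^'n) set set \<Rightarrow> (real^'n) set \<Rightarrow>
    (real^'n \<Rightarrow> real^'n^'n) \<Rightarrow> real \<Rightarrow> (real^'n \<Rightarrow> real) \<Rightarrow> (real^'n \<Rightarrow> real) \<Rightarrow> bool" where
  "fe_solution r T \<Omega> A \<epsilon> f u \<longleftrightarrow> u \<in> fe_space0 r T \<Omega> \<and>
     (\<forall>v\<in>fe_space0 r T \<Omega>. a_form A \<epsilon> \<Omega> u v = (\<integral>x. f x * v x \<partial>lebesgue_on \<Omega>))"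

definition local_particular :: "nat \<Rightarrow> (real^'n) set set \<Rightarrow> (real^'n) set \<Rightarrow> (real^'n) set \<Rightarrow>
    (real^'n \<Rightarrow> real^'n^'n) \<Rightarrow> real \<Rightarrow> (real^'n \<Rightarrow> real) \<Rightarrow> (real^'n \<Rightarrow> real) \<Rightarrow> bool" where
  "local_particular r T \<Omega> D A \<epsilon> f \<psi> \<longleftrightarrow> \<psi> \<in> fe_space_Gamma r T \<Omega> D \<and>
     (\<forall>v\<in>fe_space_Gamma r T \<Omega> D. a_form A \<epsilon> D \<psi> v = (\<integral>x. f x * v x \<partial>lebesgue_on D))"

text \<open>Continuity selects the representative of the class in \<open>W\<^sup>1\<^sup>,\<^sup>\<infinity>(\<Omega>)\<close> that is continuous up to the
  boundary; nodal interpolation uses its point values.\<close>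

definition pu_function :: "(real^'n) set \<Rightarrow> (real^'n) set \<Rightarrow> (real^'n \<Rightarrow> real) \<Rightarrow> bool" where
  "pu_function \<Omega> \<omega> chi \<longleftrightarrow> W1inf \<Omega> chi \<and> continuous_on (closure \<Omega>) chi \<and>
     (\<forall>x\<in>\<Omega>. 0 \<le> chi x \<and> chi x \<le> 1) \<and> (\<forall>x\<in>\<Omega> - \<omega>. chi x = 0)"

text \<open>\<open>\<omega>\<close> is the subdomain, \<open>\<omega>'\<close> its oversampling domain; openness follows from
  \<open>mesh_resolved\<close>.\<close>

definition oversampled_subdomain ::
    "(real^'n) set set \<Rightarrow> (real^'n) set \<Rightarrow> (real^'n) set \<Rightarrow> (real^'n) set \<Rightarrow> bool" where
  "oversampled_subdomain T \<Omega> \<omega> \<omega>' \<longleftrightarrow>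
     \<omega> \<noteq> {} \<and> connected \<omega> \<and> \<omega> \<subseteq> \<omega>' \<and> \<omega>' \<subseteq> \<Omega> \<and>
     lipschitz_boundary \<omega>' \<and> mesh_resolved T \<omega> \<and> mesh_resolved T \<omega>'"

text \<open>The library's \<open>setdist\<close> is 0 if one of the sets is empty. Hence for \<open>\<omega>' = \<Omega>\<close>, where the
  distance is not a real number, a condition \<open>oversampling_dist \<Omega> \<omega> \<omega>' \<ge> c\<close> with \<open>c > 0\<close>
  fails.\<close>

definition oversampling_dist :: "(real^'n) set \<Rightarrow> (real^'n) set \<Rightarrow> (real^'n) set \<Rightarrow> real" where
  "oversampling_dist \<Omega> \<omega> \<omega>' = setdist \<omega> (frontier \<omega>' - frontier \<Omega>)"

end

theory Submission
  imports Defs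
begin

text \<open>The difference \<open>w = u - \<psi>\<close> is discretely harmonic on \<open>\<omega>'\<close>. Testing with the nodal interpolant of
  \<open>\<eta>\<^sup>2 w\<close>, where \<open>\<eta>\<close> is a cut-off function of width \<open>d\<close>, bounds the energy of \<open>w\<close> on the elements having a node
  with \<open>\<eta> = 1\<close> by \<open>2 B\<close> times its \<open>L\<^sup>2\<close> norm (squared) on the elements having a node with \<open>\<eta> > 0\<close>, where
  \<open>B\<close> is of order \<open>(\<epsilon> / d)\<^sup>2 + h / d\<close>. Each element contributes separately: the interpolant is
  there the product of \<open>\<eta>\<^sup>2\<close> and \<open>w\<close> at the nodes, and a polynomial is controlled by its nodal values. If \<open>d\<close>
  is a large multiple of \<open>max \<epsilon> h\<close>, then \<open>2 B \<le> exp (- 2)\<close>, and iterating over about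
  \<open>\<delta>\<^sup>* / d\<close> layers yields the exponential factor. The algebraic factors are paid for by half of the
  exponential rate.

  The identification of weak gradients of finite element functions with their elementwise gradients, and of
  membership in \<open>H\<^sup>1\<^sub>0\<close> with vanishing boundary values, rests on their global Lipschitz continuity.\<close>

section \<open>Smooth bump functions\<close>

text \<open>The two halves of the energy scale differently, which is why the rate is set by the
  larger of \<epsilon> and h. On an element of diameter h_K the test function is m^2 w, with m the
  largest nodal value of \<eta>, up to a deviation of nodal size 2 m h_K / d times |w|. The inverse
  estimate divides by h_K, so the gradient of the deviation costs (\<epsilon> / d)^2 whatever h_K
  is, while the mass part keeps h_K / d. The factor m in the deviation matches the weight m^2 on the
  left, so that absorption works even where \<eta> is nearly zero. The obstacle is that one test
  function must be admissible in two problems: the global one asks for membership in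
  H^1_0(\<Omega>), the local one for zero values on \<Gamma>. On the rest of the boundary of
  \<omega>' it vanishes because \<eta> does, so its continuation by zero remains a finite element
  function. Conversely u, known only to lie in H^1_0(\<Omega>), must be shown to vanish pointwise on
  \<Gamma>. Forms and norms use a chosen weak gradient; its uniqueness almost everywhere turns them
  into sums over elements.\<close>

lemma grad_eqI: "(f has_derivative f') (at x) \<Longrightarrow> grad f x $ i = f' (axis i 1)"
  unfolding grad_def using frechet_derivative_at by fastforce

lemma has_derivative_grad:
  fixes f :: "real^'n \<Rightarrow> real"
  assumes "f differentiable (at x)"
  shows "(f has_derivative (\<lambda>h. grad f x \<bullet> h)) (at x)"
proof -
  obtain f' where f': "(f has_derivative f') (at x)"
    using assms unfolding differentiable_def by auto
  interpret f': bounded_linear f' using f' by (rule has_derivative_bounded_linear)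
  have "f' h = grad f x \<bullet> h" for h
  proof -
    have "f' h = f' (\<Sum>i\<in>UNIV. (h $ i) *\<^sub>R axis i 1)"
      by (simp add: basis_expansion flip: scalar_mult_eq_scaleR)
    also have "\<dots> = (\<Sum>i\<in>UNIV. h $ i * grad f x $ i)"
      by (simp add: f'.sum f'.scaleR grad_eqI[OF f'])
    finally show ?thesis by (simp add: inner_vec_def mult.commute)
  qed
  then have "f' = (\<lambda>h. grad f x \<bullet> h)" by blast
  then show ?thesis using f' by simp
qed

lemma has_derivative_grad_eqI:
  assumes "(f has_derivative (\<lambda>h. g \<bullet> h)) (at x)"
  shows "grad f x = g"
  by (simp add: vec_eq_iff grad_eqI[OF assms] inner_axis)

lemma Ck_SucD: "Ck (Suc k) f \<Longrightarrow> Ck k f"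
proof (induction k arbitrary: f)
  case 0
  then show ?case
    by (auto intro!: continuous_at_imp_continuous_on differentiable_imp_continuous_within)
qed simp

lemma Ck_const: "Ck k (\<lambda>x::real^'n. c)"
proof (induction k arbitrary: c)
  case (Suc k)
  have "grad (\<lambda>x::real^'n. c) x $ i = 0" for x i
    by (subst grad_eqI[OF has_derivative_const]) simp
  then have "(\<lambda>x. grad (\<lambda>x::real^'n. c) x $ i) = (\<lambda>x. 0)" for i by blast
  then show ?case using Suc[of 0] by simp
qed simp

lemma Ck_add: "Ck k f \<Longrightarrow> Ck k g \<Longrightarrow> Ck k (\<lambda>x. f x + g x)"
proof (induction k arbitrary: f g)
  case (Suc k)
  have "grad (\<lambda>x. f x + g x) x $ i = grad f x $ i + grad g x $ i" for x i
    using grad_eqI[OF has_derivative_add[OF has_derivative_grad has_derivative_grad], of f x g i]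
      Suc.prems by (simp add: inner_axis)
  then show ?case using Suc by simp
qed (simp add: continuous_on_add)

lemma Ck_mult: "Ck k f \<Longrightarrow> Ck k g \<Longrightarrow> Ck k (\<lambda>x. f x * g x)"
proof (induction k arbitrary: f g)
  case (Suc k)
  have "grad (\<lambda>x. f x * g x) x $ i = f x * grad g x $ i + grad f x $ i * g x" for x i
    using grad_eqI[OF has_derivative_mult[OF has_derivative_grad has_derivative_grad], of f x g i]
      Suc.prems by (simp add: inner_axis)
  moreover have "Ck k f" "Ck k g" using Suc.prems Ck_SucD by auto
  ultimately show ?case using Suc by (simp add: Ck_add)
qed (simp add: continuous_on_mult)

lemma Ck_prod: "finite I \<Longrightarrow> (\<And>i. i \<in> I \<Longrightarrow> Ck k (f i)) \<Longrightarrow> Ck k (\<lambda>x. \<Prod>i\<in>I. f i x)"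
  by (induction I rule: finite_induct) (auto simp: Ck_const Ck_mult)

text \<open>The functions P(1 / t) exp(- 1 / t), continued by 0, form a class closed under
  differentiation; for exp(- 1 / t) alone an induction on the order of differentiation would not go
  through.\<close>

definition flat :: "real poly \<Rightarrow> real \<Rightarrow> real" where
  "flat P t = (if t > 0 then poly P (1 / t) * exp (- (1 / t)) else 0)"

lemma poly_div_exp_tendsto_0: "((\<lambda>x. poly P x * exp (- x)) \<longlongrightarrow> (0::real)) at_top"
proof -
  have "((\<lambda>x. \<Sum>i\<le>degree P. coeff P i * (x ^ i / exp x)) \<longlongrightarrow> (\<Sum>i\<le>degree P. coeff P i * 0)) at_top"
    by (intro tendsto_intros tendsto_power_div_exp_0)
  then show ?thesis
    by (simp add: poly_altdef sum_distrib_right exp_minus divide_inverse mult.assoc)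
qed

text \<open>On the positive axis the product rule gives s^2 (P(s) - P'(s)) exp(- s) with s = 1 / t,
  whence the new polynomial. At 0 both one-sided difference quotients tend to 0, because the
  exponential beats every power of 1 / t.\<close>

lemma flat_has_derivative:
  "(flat P has_real_derivative flat (monom 1 2 * (P - pderiv P)) t) (at t)"
proof -
  consider "t > 0" | "t < 0" | "t = 0" by linarith
  then show ?thesis
  proof cases
    case 1
    have "((\<lambda>t. poly P (1/t) * exp (-(1/t))) has_real_derivative
        flat (monom 1 2 * (P - pderiv P)) t) (at t)"
      using 1 by (auto intro!: derivative_eq_intros DERIV_chain2[OF poly_DERIV]
        simp: flat_def poly_monom field_simps power2_eq_square)
    then show ?thesis
      by (rule has_field_derivative_transform_within_open[of _ _ _ "{0<..}"])
        (use 1 in \<open>auto simp: flat_def\<close>)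
  next
    case 2
    have "((\<lambda>t. 0) has_real_derivative flat (monom 1 2 * (P - pderiv P)) t) (at t)"
      using 2 by (auto simp: flat_def)
    then show ?thesis
      by (rule has_field_derivative_transform_within_open[of _ _ _ "{..<0}"])
        (use 2 in \<open>auto simp: flat_def\<close>)
  next
    case 3
    \<comment> \<open>From the right, \<open>flat P h / h\<close> is again of the same type: the
      factor 1 / h is absorbed into the polynomial as \<open>pCons 0 P\<close>.\<close>
    have lim: "((\<lambda>h. poly (pCons 0 P) (inverse h) * exp (- inverse h)) \<longlongrightarrow> 0) (at_right 0)"
      by (rule filterlim_compose[OF poly_div_exp_tendsto_0 filterlim_inverse_at_top_right])
    have "((\<lambda>h. flat P h / h) \<longlongrightarrow> 0) (at 0)"
      unfolding filterlim_split_at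
    proof (rule filterlim_split_at)
      show "((\<lambda>h. flat P h / h) \<longlongrightarrow> 0) (at_left 0)"
        by (rule Lim_transform_eventually[OF tendsto_const])
          (auto simp: flat_def eventually_at intro!: exI[of _ 1])
      show "((\<lambda>h. flat P h / h) \<longlongrightarrow> 0) (at_right 0)"
        by (rule Lim_transform_eventually[OF lim])
          (auto simp: flat_def eventually_at field_simps intro!: exI[of _ 1])
    qed
    then show ?thesis using 3 by (simp add: DERIV_def flat_def)
  qed
qed

lemma flat_affine_has_derivative:
  "((\<lambda>x::real^'n. flat P (c * x $ i + d)) has_derivative
     (\<lambda>h. flat (monom 1 2 * (P - pderiv P)) (c * x $ i + d) * (c * h $ i))) (at x)"
proof -
  have "((\<lambda>x::real^'n. c * x $ i + d) has_derivative (\<lambda>h. c * h $ i)) (at x)"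
    by (auto intro!: derivative_eq_intros bounded_linear_imp_has_derivative bounded_linear_vec_nth)
  from has_derivative_compose[OF this flat_has_derivative[unfolded has_field_derivative_def]]
  show ?thesis by simp
qed

lemma Ck_flat_affine: "Ck k (\<lambda>x::real^'n. flat P (c * x $ i + d))"
proof (induction k arbitrary: P)
  case 0
  then show ?case
    using has_derivative_continuous[OF flat_affine_has_derivative]
    by (auto intro!: continuous_at_imp_continuous_on)
next
  case (Suc k)
  have "(\<lambda>x. grad (\<lambda>x::real^'n. flat P (c * x $ i + d)) x $ j) =
      (\<lambda>x. flat (monom 1 2 * (P - pderiv P)) (c * x $ i + d) * (c * axis j 1 $ i))" for j
    using grad_eqI[OF flat_affine_has_derivative] by blast
  moreover have "(\<lambda>x::real^'n. flat P (c * x $ i + d)) differentiable (at x)" for x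
    using flat_affine_has_derivative differentiable_def by blast
  ultimately show ?case using Suc by (simp add: Ck_mult Ck_const)
qed

text \<open>For m > 0 this is positive exactly on the open box between a and b. The factor m leaves
  the support unchanged and only steepens the profile: as m grows the functions tend to the
  indicator of the box, which is how integrals over boxes are reached from test functions.\<close>

definition bump :: "real \<Rightarrow> real^'n \<Rightarrow> real^'n \<Rightarrow> real^'n \<Rightarrow> real" where
  "bump m a b x = (\<Prod>i\<in>UNIV. flat 1 (m * (x $ i - a $ i)) * flat 1 (m * (b $ i - x $ i)))"

lemma Ck_bump: "Ck k (bump m a b)"
proof -
  have "Ck k (\<lambda>x. flat 1 (m * x $ i + (- m * a $ i)) * flat 1 ((- m) * x $ i + m * b $ i))" for i
    by (intro Ck_mult Ck_flat_affine)
  then have "Ck k (\<lambda>x. flat 1 (m * (x $ i - a $ i)) * flat 1 (m * (b $ i - x $ i)))" for i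
    by (simp add: algebra_simps)
  then show ?thesis unfolding bump_def[abs_def]
    by (intro Ck_prod) simp_all
qed

lemma bump_bounds: "0 \<le> bump m a b x" "bump m a b x \<le> 1"
proof -
  have f: "0 \<le> flat 1 t" "flat 1 t \<le> 1" for t by (auto simp: flat_def)
  show "0 \<le> bump m a b x" unfolding bump_def by (intro prod_nonneg mult_nonneg_nonneg ballI f)
  show "bump m a b x \<le> 1" unfolding bump_def by (intro prod_le_1 conjI mult_nonneg_nonneg mult_le_one f)
qed

lemma bump_nz_iff: "m > 0 \<Longrightarrow> bump m a b x \<noteq> 0 \<longleftrightarrow> x \<in> box a b"
  by (auto simp: bump_def flat_def mem_box_cart zero_less_mult_iff)

lemma test_fun_bump:
  assumes "m > 0" "box a b = {} \<or> cbox a b \<subseteq> D"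
  shows "test_fun D (bump m a b)"
proof -
  have "{x. bump m a b x \<noteq> 0} = box a b" using bump_nz_iff[OF assms(1)] by auto
  moreover have "compact (closure (box a b)) \<and> closure (box a b) \<subseteq> D"
    using assms(2) by (cases "box a b = {}") (auto simp: closure_box)
  ultimately show ?thesis unfolding test_fun_def by (simp add: Ck_bump)
qed

lemma bump_tendsto_indicator:
  "(\<lambda>k. bump (real (Suc k)) a b x) \<longlonglongrightarrow> indicator (box a b) x"
proof (cases "x \<in> box a b")
  case False
  then have "bump (real (Suc k)) a b x = 0" for k using bump_nz_iff[of "real (Suc k)" a b x] by auto
  then show ?thesis using False by simp
next
  case True
  have *: "(\<lambda>k. flat 1 (real (Suc k) * t)) \<longlonglongrightarrow> 1" if "t > 0" for t
  proof -
    have "(\<lambda>k. inverse (real (Suc k)) * inverse t) \<longlonglongrightarrow> 0 * inverse t"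
      using tendsto_mult[OF LIMSEQ_inverse_real_of_nat tendsto_const] by blast
    then have "(\<lambda>k. exp (- (inverse (real (Suc k)) * inverse t))) \<longlonglongrightarrow> exp (- (0 * inverse t))"
      by (rule tendsto_exp[OF tendsto_minus])
    moreover have "flat 1 (real (Suc k) * t) = exp (- (inverse (real (Suc k)) * inverse t))" for k
      using that by (simp add: flat_def divide_inverse)
    ultimately show ?thesis by (simp only: mult_zero_left minus_zero exp_zero)
  qed
  have "(\<lambda>k. bump (real (Suc k)) a b x) \<longlonglongrightarrow> (\<Prod>i\<in>(UNIV::'a set). 1 * 1)"
    unfolding bump_def using True
    by (intro tendsto_prod tendsto_mult *) (auto simp: mem_box_cart)
  then show ?thesis using True by simp
qed

lemma test_fun_continuous: "test_fun D \<phi> \<Longrightarrow> continuous_on S \<phi>"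
proof -
  assume "test_fun D \<phi>"
  then have "Ck 0 \<phi>" unfolding test_fun_def by blast
  then show ?thesis using continuous_on_subset[OF _ subset_UNIV] by auto
qed

lemma test_fun_differentiable: "test_fun D \<phi> \<Longrightarrow> \<phi> differentiable (at x)"
proof -
  assume "test_fun D \<phi>"
  then have "Ck (Suc 0) \<phi>" unfolding test_fun_def by blast
  then show ?thesis by simp
qed

lemma test_fun_zero: "test_fun D \<phi> \<Longrightarrow> x \<notin> D \<Longrightarrow> \<phi> x = 0"
  unfolding test_fun_def using closure_subset[of "{x. \<phi> x \<noteq> 0}"] by auto

lemma grad_zero_outside:
  fixes \<phi> :: "real^'n \<Rightarrow> real"
  assumes "x \<notin> closure {x. \<phi> x \<noteq> 0}"
  shows "grad \<phi> x = 0"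
proof -
  have "((\<lambda>x. 0) has_derivative (\<lambda>h. 0 \<bullet> h)) (at x)" by simp
  then have "(\<phi> has_derivative (\<lambda>h. 0 \<bullet> h)) (at x)"
    by (rule has_derivative_transform_within_open[of _ _ _ _ "- closure {x. \<phi> x \<noteq> 0}"])
      (use assms closure_subset[of "{x. \<phi> x \<noteq> 0}"] in auto)
  then show ?thesis by (rule has_derivative_grad_eqI)
qed

lemma test_fun_grad: "test_fun D \<phi> \<Longrightarrow> test_fun D (\<lambda>x. grad \<phi> x $ i)"
proof -
  assume t: "test_fun D \<phi>"
  have "{x. grad \<phi> x $ i \<noteq> 0} \<subseteq> closure {x. \<phi> x \<noteq> 0}"
  proof
    fix x assume "x \<in> {x. grad \<phi> x $ i \<noteq> 0}"
    then have nz: "grad \<phi> x \<noteq> 0" by auto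
    show "x \<in> closure {x. \<phi> x \<noteq> 0}"
      by (rule ccontr) (use nz grad_zero_outside[of x \<phi>] in blast)
  qed
  then have sub: "closure {x. grad \<phi> x $ i \<noteq> 0} \<subseteq> closure {x. \<phi> x \<noteq> 0}"
    by (simp add: closure_minimal)
  then have "compact (closure {x. grad \<phi> x $ i \<noteq> 0})"
    using t bounded_subset[OF _ sub] unfolding test_fun_def compact_eq_bounded_closed by simp
  moreover have "Ck k (\<lambda>x. grad \<phi> x $ i)" for k
  proof -
    have "Ck (Suc k) \<phi>" using t unfolding test_fun_def by blast
    then show ?thesis by simp
  qed
  moreover have "closure {x. grad \<phi> x $ i \<noteq> 0} \<subseteq> D"
    using t unfolding test_fun_def by (intro subset_trans[OF sub]) simp
  ultimately show ?thesis unfolding test_fun_def by simp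
qed

lemma test_fun_mono: "test_fun D \<phi> \<Longrightarrow> D \<subseteq> D' \<Longrightarrow> test_fun D' \<phi>"
  unfolding test_fun_def by (elim conjE, intro conjI) (auto dest: subset_trans)

lemma test_fun_bounded:
  assumes "test_fun D \<phi>" shows "\<exists>B\<ge>0. \<forall>x. \<bar>\<phi> x\<bar> \<le> B"
proof -
  let ?S = "closure {x. \<phi> x \<noteq> 0}"
  have "compact (\<phi> ` ?S)"
    using assms unfolding test_fun_def
    by (intro compact_continuous_image test_fun_continuous[OF assms]) simp
  then have "bounded (\<phi> ` ?S)" by (rule compact_imp_bounded)
  then obtain B where B: "\<forall>y\<in>\<phi> ` ?S. norm y \<le> B" unfolding bounded_iff by blast
  have "\<bar>\<phi> x\<bar> \<le> max B 0" for x
  proof (cases "\<phi> x = 0")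
    case False
    then have "x \<in> ?S" using closure_subset[of "{x. \<phi> x \<noteq> 0}"] by auto
    then have "\<bar>\<phi> x\<bar> \<le> B" using B by simp
    then show ?thesis by simp
  qed simp
  then show ?thesis by (intro exI[of _ "max B 0"]) simp
qed

section \<open>The fundamental lemma of the calculus of variations\<close>

text \<open>Used with c = 1 for translations, with c = -1 for the reflections inside convolutions,
  and with c \<ge> 1/2 for the dilations that bound point values of polynomials.\<close>

lemma lebesgue_integral_affine:
  fixes f :: "'a::euclidean_space \<Rightarrow> real"
  assumes c: "c \<noteq> 0" and f: "f \<in> borel_measurable lebesgue"
  shows "(\<integral>x. f x \<partial>lebesgue) = \<bar>c\<bar> ^ DIM('a) * (\<integral>x. f (t + c *\<^sub>R x) \<partial>lebesgue)"
    and "integrable lebesgue (\<lambda>x. f (t + c *\<^sub>R x)) \<longleftrightarrow> integrable lebesgue f"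
proof -
  let ?T = "\<lambda>x. t + c *\<^sub>R x"
  have T: "(\<lambda>x. t + (\<Sum>j\<in>Basis. (c * (x \<bullet> j)) *\<^sub>R j)) = ?T"
    by (auto simp: fun_eq_iff simp flip: scaleR_scaleR scaleR_right.sum euclidean_representation)
      (simp add: euclidean_representation)
  have m: "?T \<in> lebesgue \<rightarrow>\<^sub>M lebesgue"
    using lebesgue_affine_measurable[of "\<lambda>_. c" t] c unfolding T by simp
  have eq: "lebesgue = density (distr lebesgue lebesgue ?T) (\<lambda>_. ennreal (\<bar>c\<bar> ^ DIM('a)))"
    using lebesgue_affine_euclidean[of "\<lambda>_. c" t] c unfolding T
    by (simp add: ennreal_power)
  have fm: "f \<in> borel_measurable (distr lebesgue lebesgue ?T)" using f by simp
  have "(\<integral>x. f x \<partial>lebesgue) = (\<integral>x. f x \<partial>density (distr lebesgue lebesgue ?T) (\<lambda>_. ennreal (\<bar>c\<bar> ^ DIM('a))))"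
    using eq by (rule arg_cong)
  also have "\<dots> = (\<integral>x. \<bar>c\<bar> ^ DIM('a) *\<^sub>R f x \<partial>distr lebesgue lebesgue ?T)"
    using fm by (intro integral_density) auto
  also have "\<dots> = (\<integral>x. \<bar>c\<bar> ^ DIM('a) *\<^sub>R f (?T x) \<partial>lebesgue)"
    using m f by (intro integral_distr) auto
  finally show "(\<integral>x. f x \<partial>lebesgue) = \<bar>c\<bar> ^ DIM('a) * (\<integral>x. f (t + c *\<^sub>R x) \<partial>lebesgue)" by simp
  have "integrable lebesgue f \<longleftrightarrow> integrable (density (distr lebesgue lebesgue ?T) (\<lambda>_. ennreal (\<bar>c\<bar> ^ DIM('a)))) f"
    using eq by (rule arg_cong)
  also have "\<dots> \<longleftrightarrow> integrable (distr lebesgue lebesgue ?T) (\<lambda>x. \<bar>c\<bar> ^ DIM('a) *\<^sub>R f x)"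
    using fm by (intro integrable_density) auto
  also have "\<dots> \<longleftrightarrow> integrable lebesgue (\<lambda>x. \<bar>c\<bar> ^ DIM('a) *\<^sub>R f (?T x))"
    using m f by (intro integrable_distr_eq) auto
  finally show "integrable lebesgue (\<lambda>x. f (t + c *\<^sub>R x)) \<longleftrightarrow> integrable lebesgue f"
    using c by simp
qed

lemma integrable_lebesgue_on_iff:
  "D \<in> sets lebesgue \<Longrightarrow> integrable (lebesgue_on D) (f::_\<Rightarrow>_::euclidean_space) \<longleftrightarrow> integrable lebesgue (\<lambda>x. indicator D x *\<^sub>R f x)"
  by (simp add: integrable_restrict_space)

lemma integral_lebesgue_on_eq:
  "D \<in> sets lebesgue \<Longrightarrow> integral\<^sup>L (lebesgue_on D) (f::_\<Rightarrow>_::euclidean_space) = (\<integral>x. indicator D x *\<^sub>R f x \<partial>lebesgue)"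
  by (simp add: integral_restrict_space)

lemma AE_lebesgue_on_iff:
  "D \<in> sets lebesgue \<Longrightarrow> (AE x in lebesgue_on D. P x) \<longleftrightarrow> (AE x in lebesgue. x \<in> D \<longrightarrow> P x)"
  by (simp add: AE_restrict_space_iff)

lemma open_sets_lebesgue: "open D \<Longrightarrow> D \<in> sets lebesgue"
  by (simp add: borel_open)

lemma integrable_bounded_mult:
  fixes g \<phi> :: "_ \<Rightarrow> real"
  assumes g: "integrable M g" and \<phi>: "\<phi> \<in> borel_measurable M" and B: "\<And>x. \<bar>\<phi> x\<bar> \<le> B"
  shows "integrable M (\<lambda>x. g x * \<phi> x)"
proof (rule Bochner_Integration.integrable_bound[of M "\<lambda>x. B * g x"])
  show "AE x in M. norm (g x * \<phi> x) \<le> norm (B * g x)"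
  proof (rule AE_I2)
    fix x
    have "\<bar>g x\<bar> * \<bar>\<phi> x\<bar> \<le> \<bar>g x\<bar> * \<bar>B\<bar>" using B[of x] by (intro mult_left_mono) auto
    then show "norm (g x * \<phi> x) \<le> norm (B * g x)" by (simp add: abs_mult mult.commute)
  qed
qed (use assms borel_measurable_integrable[OF g] in auto)

lemma test_fun_measurable: "test_fun D \<phi> \<Longrightarrow> \<phi> \<in> borel_measurable lebesgue"
  using test_fun_continuous[of D \<phi> UNIV] borel_measurable_continuous_onI measurable_completion
  by (metis measurable_lborel2)

lemma loc_integrable_test_mult:
  fixes g :: "real^'n \<Rightarrow> real"
  assumes \<phi>: "test_fun D \<phi>" and g: "loc_integrable D g"
  shows "integrable lebesgue (\<lambda>x. indicator D x *\<^sub>R (g x * \<phi> x))"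
proof -
  let ?S = "closure {x. \<phi> x \<noteq> 0}"
  have "integrable lebesgue (\<lambda>x. indicator ?S x *\<^sub>R g x)"
    using \<phi> g unfolding loc_integrable_def test_fun_def set_integrable_def by simp
  moreover obtain B where "\<And>x. \<bar>\<phi> x\<bar> \<le> B" using test_fun_bounded[OF \<phi>] by blast
  ultimately have "integrable lebesgue (\<lambda>x. indicator ?S x *\<^sub>R g x * \<phi> x)"
    using test_fun_measurable[OF \<phi>] by (intro integrable_bounded_mult) auto
  moreover have "(\<lambda>x. indicator ?S x *\<^sub>R g x * \<phi> x) = (\<lambda>x. indicator D x *\<^sub>R (g x * \<phi> x))"
  proof
    fix x show "indicator ?S x *\<^sub>R g x * \<phi> x = indicator D x *\<^sub>R (g x * \<phi> x)"
    using test_fun_zero[OF \<phi>, of x] closure_subset[of "{x. \<phi> x \<noteq> 0}"]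
    by (cases "\<phi> x = 0") (auto simp: indicator_def)
  qed
  ultimately show ?thesis by (simp only:)
qed

text \<open>This is uniqueness of measures in signed form: boxes are stable under intersection and
  generate the Borel sets, so the sets on which the integral vanishes, closed under complements and
  countable disjoint unions, include all of them. Boxes say nothing about Lebesgue sets that are not
  Borel, hence the passage to a Borel function h equal to g almost everywhere.\<close>

lemma integrable_zero_boxes_AE:
  fixes g :: "'a::euclidean_space \<Rightarrow> real"
  assumes g: "integrable lebesgue g"
    and box: "\<And>a b. (\<integral>x. indicator (box a b) x * g x \<partial>lebesgue) = 0"
  shows "AE x in lebesgue. g x = 0"
proof -
  obtain h where h: "h \<in> borel_measurable lborel" and AE: "AE x in lborel. g x = h x"
    using completion_ex_borel_measurable_real[OF borel_measurable_integrable[OF g]] by auto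
  have hm: "h \<in> borel_measurable lebesgue" using h by (rule measurable_completion)
  have AE': "AE x in lebesgue. g x = h x" using AE by (rule AE_completion)
  have hi: "integrable lebesgue h"
    using integrable_cong_AE[OF _ hm AE'] g by (metis borel_measurable_integrable)
  have hil: "integrable lborel h" using hi h by (simp add: integrable_completion)
  have int_eq: "(\<integral>x. indicator A x * h x \<partial>lborel) = (\<integral>x. indicator A x * g x \<partial>lebesgue)"
    if "A \<in> sets borel" for A
  proof -
    have [measurable]: "A \<in> sets lebesgue" using that by simp
    have "(\<integral>x. indicator A x * h x \<partial>lborel) = (\<integral>x. indicator A x * h x \<partial>lebesgue)"
      using that h by (intro integral_completion[symmetric]) auto
    also have "\<dots> = (\<integral>x. indicator A x * g x \<partial>lebesgue)"
      using hm borel_measurable_integrable[OF g] AE'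
      by (intro integral_cong_AE) (auto elim: eventually_mono)
    finally show ?thesis .
  qed
  have ind: "integrable lborel (\<lambda>x. indicator A x * h x)" if "A \<in> sets borel" for A
    using integrable_mult_indicator[OF _ hil, of A] that by simp
  have "(\<integral>x. indicator A x * h x \<partial>lborel) = 0" if A: "A \<in> sets borel" for A
  proof -
    have stable: "Int_stable (range (\<lambda>(a, b). box a b :: 'a set))"
      by (auto simp: Int_stable_def box_Int_box)
    \<comment> \<open>Complements need the integral over the whole space; it is the limit of
      integrals over growing boxes.\<close>
    have total: "(\<integral>x. h x \<partial>lborel) = 0"
    proof -
      have "(\<lambda>k::nat. \<integral>x. indicator (box (- real k *\<^sub>R One) (real k *\<^sub>R One)) x * h x \<partial>lborel)
          \<longlonglongrightarrow> (\<integral>x. h x \<partial>lborel)"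
      proof (rule integral_dominated_convergence[where w="\<lambda>x. norm (h x)"])
        show "AE x in lborel. (\<lambda>k. indicator (box (- real k *\<^sub>R One) (real k *\<^sub>R One)) x * h x) \<longlonglongrightarrow> h x"
        proof (rule AE_I2)
          fix x :: 'a
          obtain N :: nat where N: "norm x < real N" using reals_Archimedean2 by blast
          have "x \<in> box (- real k *\<^sub>R One) (real k *\<^sub>R One)" if "k \<ge> N" for k
          proof -
            have "\<bar>x \<bullet> i\<bar> < real k" if "i \<in> Basis" for i
              using Basis_le_norm[OF that, of x] N \<open>k \<ge> N\<close> by linarith
            then show ?thesis by (auto simp: mem_box abs_less_iff) (metis minus_less_iff)
          qed
          then have "\<forall>\<^sub>F k in sequentially. h x = indicator (box (- real k *\<^sub>R One) (real k *\<^sub>R One)) x * h x"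
            by (auto simp: eventually_sequentially intro!: exI[of _ N])
          then show "(\<lambda>k. indicator (box (- real k *\<^sub>R One) (real k *\<^sub>R One)) x * h x) \<longlonglongrightarrow> h x"
            by (rule Lim_transform_eventually[OF tendsto_const])
        qed
      qed (use h hil in \<open>auto simp: indicator_def\<close>)
      moreover have "(\<integral>x. indicator (box a b) x * h x \<partial>lborel) = 0" for a b
        using int_eq[of "box a b"] box by simp
      ultimately show ?thesis by (simp add: LIMSEQ_const_iff)
    qed
    have As: "A \<in> sigma_sets UNIV (range (\<lambda>(a, b). box a b))"
      using A unfolding borel_eq_box by simp
    have sub: "range (\<lambda>(a, b). box a b :: 'a set) \<subseteq> Pow UNIV" by simp
    have sb: "B \<in> sets borel" if "B \<in> sigma_sets UNIV (range (\<lambda>(a, b). box a b :: 'a set))" for B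
      using that unfolding borel_eq_box by simp
    show ?thesis
    proof (rule sigma_sets_induct_disjoint[OF stable sub As])
      fix B assume "B \<in> range (\<lambda>(a, b). box a b :: 'a set)"
      then obtain a b where "B = box a b" by auto
      then show "(\<integral>x. indicator B x * h x \<partial>lborel) = 0" using int_eq[of B] box by simp
    next
      fix B assume B: "B \<in> sigma_sets UNIV (range (\<lambda>(a, b). box a b :: 'a set))"
        "(\<integral>x. indicator B x * h x \<partial>lborel) = 0"
      have "(\<integral>x. indicator (UNIV - B) x * h x \<partial>lborel) = (\<integral>x. h x - indicator B x * h x \<partial>lborel)"
        by (intro Bochner_Integration.integral_cong) (auto simp: indicator_def)
      also have "\<dots> = 0" using B total ind[OF sb[OF B(1)]] hil by simp
      finally show "(\<integral>x. indicator (UNIV - B) x * h x \<partial>lborel) = 0" .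
    next
      fix F :: "nat \<Rightarrow> 'a set"
      assume F: "disjoint_family F" "range F \<subseteq> sigma_sets UNIV (range (\<lambda>(a, b). box a b))"
        "\<And>i. (\<integral>x. indicator (F i) x * h x \<partial>lborel) = 0"
      have Fb: "F i \<in> sets lborel" for i using F(2) sb by auto
      have "(\<integral>x\<in>(\<Union>i. F i). h x \<partial>lborel) = (\<Sum>i. \<integral>x\<in>F i. h x \<partial>lborel)"
        using F(1) Fb hil
        by (intro lebesgue_integral_countable_add)
          (auto simp: disjoint_family_on_def set_integrable_def intro!: ind sets.countable_UN)
      then show "(\<integral>x. indicator (\<Union>i. F i) x * h x \<partial>lborel) = 0"
        using F(3) by (simp add: set_lebesgue_integral_def)
    qed simp
  qed
  then have "AE x in lborel. h x = 0"
    by (intro density_unique_real[OF hil]) (auto simp: set_lebesgue_integral_def)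
  with AE have "AE x in lborel. g x = 0" by auto
  then show ?thesis by (rule AE_completion)
qed

text \<open>Bump functions tend boundedly to indicators of boxes, so testing with them shows that
  the integral of g vanishes over every box inside a closed box in D. A countable cover of D by
  closed boxes turns this into a statement almost everywhere on D.\<close>

lemma fundamental_lemma:
  fixes g :: "real^'n \<Rightarrow> real"
  assumes D: "open D" and g: "loc_integrable D g"
    and zero: "\<And>\<phi>. test_fun D \<phi> \<Longrightarrow> (\<integral>x. g x * \<phi> x \<partial>lebesgue_on D) = 0"
  shows "AE x in lebesgue_on D. g x = 0"
proof -
  have cbox_AE: "AE x in lebesgue. x \<in> cbox a b \<longrightarrow> g x = 0" if ab: "cbox a b \<subseteq> D" for a b
  proof -
    let ?g = "\<lambda>x. indicator (cbox a b) x * g x"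
    have gi: "integrable lebesgue ?g"
      using g ab unfolding loc_integrable_def set_integrable_def by auto
    have "AE x in lebesgue. ?g x = 0"
    proof (rule integrable_zero_boxes_AE[OF gi])
      fix c d :: "real^'n"
      \<comment> \<open>An arbitrary box is cut down to the interior of \<open>cbox a b\<close>, so
        that the bump over the intersection is a test function on D; the boundary of
        \<open>cbox a b\<close> that is lost in this way is a null set.\<close>
      obtain p q where pq: "box c d \<inter> box a b = box p q" using box_Int_box[of c d a b] by blast
      have pq_sub: "box p q = {} \<or> cbox p q \<subseteq> cbox a b"
      proof (cases "box p q = {}")
        case False
        have "closure (box p q) \<subseteq> cbox a b"
          using pq box_subset_cbox[of a b] by (intro closure_minimal) auto
        then show ?thesis using False by (simp add: closure_box)
      qed simp
      have tf: "test_fun D (bump (real (Suc k)) p q)" for k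
        using pq_sub ab by (intro test_fun_bump) auto
      have AEf: "AE x in lebesgue. x \<notin> cbox a b - box a b"
      proof -
        have "negligible (cbox a b - box a b)" by (rule negligible_frontier_interval)
        then show ?thesis by (intro AE_not_in) (simp only: negligible_iff_null_sets)
      qed
      have "(\<integral>x. indicator (box c d) x * ?g x \<partial>lebesgue) = (\<integral>x. indicator (box p q) x * ?g x \<partial>lebesgue)"
        using AEf by (intro integral_cong_AE borel_measurable_times borel_measurable_indicator
            borel_measurable_integrable[OF gi])
          (auto simp: pq[symmetric] indicator_def elim!: eventually_mono)
      moreover have "(\<lambda>k. \<integral>x. bump (real (Suc k)) p q x * ?g x \<partial>lebesgue)
          \<longlonglongrightarrow> (\<integral>x. indicator (box p q) x * ?g x \<partial>lebesgue)"
      proof (rule integral_dominated_convergence[where w="\<lambda>x. norm (?g x)"])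
        show "AE x in lebesgue. (\<lambda>k. bump (real (Suc k)) p q x * ?g x) \<longlonglongrightarrow> indicator (box p q) x * ?g x"
          by (intro AE_I2 tendsto_mult bump_tendsto_indicator tendsto_const)
        show "AE x in lebesgue. norm (bump (real (Suc k)) p q x * ?g x) \<le> norm (?g x)" for k
          using bump_bounds[of "real (Suc k)" p q]
          by (intro AE_I2) (simp add: abs_mult mult_left_le_one_le)
        show "(\<lambda>x. indicator (box p q) x * ?g x) \<in> borel_measurable lebesgue"
          by (rule borel_measurable_times[OF _ borel_measurable_integrable[OF gi]])
            (rule borel_measurable_indicator, simp)
        show "(\<lambda>x. bump (real (Suc k)) p q x * ?g x) \<in> borel_measurable lebesgue" for k
          by (rule borel_measurable_times[OF test_fun_measurable[OF tf] borel_measurable_integrable[OF gi]])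
      qed (rule integrable_norm[OF gi])
      moreover have "(\<integral>x. bump (real (Suc k)) p q x * ?g x \<partial>lebesgue) = 0" for k
      proof -
        have "(\<integral>x. bump (real (Suc k)) p q x * ?g x \<partial>lebesgue) =
            (\<integral>x. indicator D x *\<^sub>R (g x * bump (real (Suc k)) p q x) \<partial>lebesgue)"
        proof (rule Bochner_Integration.integral_cong[OF refl])
          fix x show "bump (real (Suc k)) p q x * ?g x = indicator D x *\<^sub>R (g x * bump (real (Suc k)) p q x)"
        proof (cases "bump (real (Suc k)) p q x = 0")
          case False
          then have "x \<in> box p q" using bump_nz_iff[of "real (Suc k)" p q x] by auto
          then have "x \<in> cbox a b" using pq box_subset_cbox[of a b] by auto
          then show ?thesis using ab by (auto simp: indicator_def)
        qed simp
        qed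
        then show ?thesis
          by (simp only: zero[OF tf[of k]] integral_lebesgue_on_eq[OF open_sets_lebesgue[OF D], symmetric])
      qed
      ultimately show "(\<integral>x. indicator (box c d) x * ?g x \<partial>lebesgue) = 0"
        by (simp add: LIMSEQ_const_iff)
    qed
    then show ?thesis by eventually_elim (auto simp: indicator_def split: if_splits)
  qed
  obtain \<D> where \<D>: "countable \<D>" "\<D> \<subseteq> Pow D" "\<And>X. X \<in> \<D> \<Longrightarrow> \<exists>a b. X = cbox a b" "\<Union>\<D> = D"
    using open_countable_Union_open_cbox[OF D] by metis
  have "AE x in lebesgue. \<forall>X\<in>\<D>. x \<in> X \<longrightarrow> g x = 0"
    using \<D> cbox_AE by (subst AE_ball_countable) (auto, metis Pow_iff subsetD)
  then have "AE x in lebesgue. x \<in> D \<longrightarrow> g x = 0"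
    by eventually_elim (use \<D>(4) in blast)
  then show ?thesis using D by (simp add: AE_lebesgue_on_iff open_sets_lebesgue)
qed

section \<open>Weak gradients\<close>

lemma loc_integrable_component:
  "loc_integrable D g \<Longrightarrow> loc_integrable D (\<lambda>x. (g x :: real^'n) $ i)"
  unfolding loc_integrable_def
  using absolutely_integrable_component[where f=g and b="axis i 1"] by (simp add: inner_axis)

lemma loc_integrable_diff:
  "loc_integrable D f \<Longrightarrow> loc_integrable D g \<Longrightarrow> loc_integrable D (\<lambda>x. f x - g x)"
  unfolding loc_integrable_def by (auto intro: set_integral_diff)

text \<open>Local integrability refers to compact subsets only; measurability on all of D is glued
  together from countably many closed boxes.\<close>

lemma loc_integrable_measurable:
  fixes g :: "'a::euclidean_space \<Rightarrow> 'b::euclidean_space"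
  assumes D: "open D" and g: "loc_integrable D g"
  shows "g \<in> borel_measurable (lebesgue_on D)"
proof -
  obtain \<D> where \<D>: "countable \<D>" "\<D> \<subseteq> Pow D" "\<And>X. X \<in> \<D> \<Longrightarrow> \<exists>a b. X = cbox a b" "\<Union>\<D> = D"
    using open_countable_Union_open_cbox[OF D] by metis
  show ?thesis
  proof (rule measurable_piecewise_restrict[OF \<D>(1)])
    fix X assume X: "X \<in> \<D>"
    then obtain a b where ab: "X = cbox a b" using \<D>(3) by blast
    have XD: "X \<subseteq> D" using X \<D>(2) by blast
    have "set_integrable lebesgue X g" using g XD ab unfolding loc_integrable_def by simp
    then have "(\<lambda>x. indicator X x *\<^sub>R g x) \<in> borel_measurable lebesgue"
      unfolding set_integrable_def by (rule borel_measurable_integrable)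
    then have "g \<in> borel_measurable (lebesgue_on X)"
      using ab by (simp add: borel_measurable_restrict_space_iff)
    moreover have "restrict_space (lebesgue_on D) X = lebesgue_on X"
      using XD D ab by (simp add: restrict_restrict_space open_sets_lebesgue Int_absorb1)
    ultimately show "g \<in> restrict_space (lebesgue_on D) X \<rightarrow>\<^sub>M borel" by simp
    show "X \<inter> space (lebesgue_on D) \<in> sets (lebesgue_on D)"
      using XD D ab by (auto simp: sets_restrict_space Int_absorb2 intro!: image_eqI[of _ _ X])
  qed (use \<D>(4) in auto)
qed

lemma loc_integrable_test_mult_on:
  fixes g :: "real^'n \<Rightarrow> real"
  assumes "open D" "test_fun D \<phi>" "loc_integrable D g"
  shows "integrable (lebesgue_on D) (\<lambda>x. g x * \<phi> x)"
  using loc_integrable_test_mult[OF assms(2,3)] assms(1)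
  by (simp add: integrable_lebesgue_on_iff open_sets_lebesgue)

text \<open>This makes the chosen \<open>weak_grad\<close> interchangeable, almost everywhere, with
  any weak gradient that is computed by other means.\<close>

lemma weak_grad_unique:
  fixes D :: "(real^'n) set"
  assumes D: "open D" and g: "has_weak_grad D u g" and g': "has_weak_grad D u g'"
  shows "AE x in lebesgue_on D. g x = g' x"
proof -
  have "AE x in lebesgue_on D. g x $ i - g' x $ i = 0" for i
  proof (rule fundamental_lemma[OF D])
    have li: "loc_integrable D (\<lambda>x. g x $ i)" "loc_integrable D (\<lambda>x. g' x $ i)"
      using g g' loc_integrable_component unfolding has_weak_grad_def by auto
    then show "loc_integrable D (\<lambda>x. g x $ i - g' x $ i)" by (rule loc_integrable_diff)
    fix \<phi> assume \<phi>: "test_fun D \<phi>"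
    have "(\<integral>x. (g x $ i - g' x $ i) * \<phi> x \<partial>lebesgue_on D) =
        (\<integral>x. g x $ i * \<phi> x \<partial>lebesgue_on D) - (\<integral>x. g' x $ i * \<phi> x \<partial>lebesgue_on D)"
      unfolding left_diff_distrib
      by (intro Bochner_Integration.integral_diff loc_integrable_test_mult_on D \<phi> li)
    also have "\<dots> = 0"
    proof -
      have "(\<integral>x. u x * grad \<phi> x $ i \<partial>lebesgue_on D) = - (\<integral>x. g x $ i * \<phi> x \<partial>lebesgue_on D)"
        "(\<integral>x. u x * grad \<phi> x $ i \<partial>lebesgue_on D) = - (\<integral>x. g' x $ i * \<phi> x \<partial>lebesgue_on D)"
        using g g' \<phi> unfolding has_weak_grad_def by simp_all
      then show ?thesis by simp
    qed
    finally show "(\<integral>x. (g x $ i - g' x $ i) * \<phi> x \<partial>lebesgue_on D) = 0" .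
  qed
  then have "AE x in lebesgue_on D. \<forall>i. g x $ i - g' x $ i = 0"
    by (simp add: AE_all_countable)
  then show ?thesis by eventually_elim (simp add: vec_eq_iff)
qed

lemma has_weak_grad_weak_grad: "has_weak_grad D u g \<Longrightarrow> has_weak_grad D u (weak_grad D u)"
  unfolding weak_grad_def using someI[of "has_weak_grad D u" g] by simp

lemma weak_grad_AE:
  "open D \<Longrightarrow> has_weak_grad D u g \<Longrightarrow> AE x in lebesgue_on D. weak_grad D u x = g x"
  by (rule weak_grad_unique[OF _ has_weak_grad_weak_grad])

lemma has_weak_grad_measurable:
  assumes "open D" "has_weak_grad D u g"
  shows "g \<in> borel_measurable (lebesgue_on D)" "u \<in> borel_measurable (lebesgue_on D)"
  using assms loc_integrable_measurable unfolding has_weak_grad_def by auto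

lemma has_weak_grad_cong:
  assumes "\<And>x. x \<in> D \<Longrightarrow> u x = v x" and "has_weak_grad D u g"
  shows "has_weak_grad D v g"
proof -
  have "loc_integrable D v"
    unfolding loc_integrable_def
  proof (intro allI impI)
    fix K assume K: "compact K \<and> K \<subseteq> D"
    then have "u absolutely_integrable_on K"
      using assms(2) unfolding has_weak_grad_def loc_integrable_def by simp
    moreover have "(\<lambda>x. indicator K x *\<^sub>R u x) = (\<lambda>x. indicator K x *\<^sub>R v x)"
      using K assms(1) by (auto simp: indicator_def fun_eq_iff)
    ultimately show "v absolutely_integrable_on K" unfolding set_integrable_def by (simp only:)
  qed
  moreover have "(\<integral>x. v x * grad \<phi> x $ i \<partial>lebesgue_on D) = (\<integral>x. u x * grad \<phi> x $ i \<partial>lebesgue_on D)" for \<phi> i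
    using assms by (intro Bochner_Integration.integral_cong) auto
  ultimately show ?thesis using assms(2) unfolding has_weak_grad_def by simp
qed

lemma has_weak_grad_diff:
  fixes D :: "(real^'n) set"
  assumes D: "open D" and u: "has_weak_grad D u g" and v: "has_weak_grad D v k"
  shows "has_weak_grad D (\<lambda>x. u x - v x) (\<lambda>x. g x - k x)"
  unfolding has_weak_grad_def
proof (intro conjI allI impI)
  have l: "loc_integrable D u" "loc_integrable D v" "loc_integrable D g" "loc_integrable D k"
    using u v unfolding has_weak_grad_def by auto
  then show "loc_integrable D (\<lambda>x. u x - v x)" "loc_integrable D (\<lambda>x. g x - k x)"
    by (auto intro: loc_integrable_diff)
  fix \<phi> i assume \<phi>: "test_fun D \<phi>"
  have "(\<integral>x. (u x - v x) * grad \<phi> x $ i \<partial>lebesgue_on D) =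
      (\<integral>x. u x * grad \<phi> x $ i \<partial>lebesgue_on D) - (\<integral>x. v x * grad \<phi> x $ i \<partial>lebesgue_on D)"
    unfolding left_diff_distrib
    by (intro Bochner_Integration.integral_diff loc_integrable_test_mult_on D test_fun_grad \<phi> l)
  also have "\<dots> = - (\<integral>x. g x $ i * \<phi> x \<partial>lebesgue_on D) + (\<integral>x. k x $ i * \<phi> x \<partial>lebesgue_on D)"
    using u v \<phi> unfolding has_weak_grad_def by simp
  also have "\<dots> = - (\<integral>x. (g x - k x) $ i * \<phi> x \<partial>lebesgue_on D)"
    unfolding vector_minus_component left_diff_distrib
    by (subst Bochner_Integration.integral_diff)
      (auto intro!: loc_integrable_test_mult_on D \<phi> loc_integrable_component l)
  finally show "(\<integral>x. (u x - v x) * grad \<phi> x $ i \<partial>lebesgue_on D) = - (\<integral>x. (g x - k x) $ i * \<phi> x \<partial>lebesgue_on D)" .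
qed

lemma diff_quotient_tendsto_grad:
  fixes f :: "real^'n \<Rightarrow> real"
  assumes f: "f differentiable (at x)" and t: "t \<longlonglongrightarrow> 0" "\<And>k. t k \<noteq> 0"
  shows "(\<lambda>k. (f (x + t k *\<^sub>R axis i 1) - f x) / t k) \<longlonglongrightarrow> grad f x $ i"
proof -
  have "((\<lambda>s. x + s *\<^sub>R axis i 1) has_derivative (\<lambda>s. s *\<^sub>R axis i (1::real))) (at 0)"
    by (auto intro!: derivative_eq_intros)
  then have "((\<lambda>s. f (x + s *\<^sub>R axis i 1)) has_derivative (\<lambda>s. grad f x \<bullet> (s *\<^sub>R axis i 1))) (at 0)"
    by (rule has_derivative_compose) (simp add: has_derivative_grad[OF f])
  then have "((\<lambda>s. f (x + s *\<^sub>R axis i 1)) has_real_derivative grad f x $ i) (at 0)"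
    unfolding has_field_derivative_def by (simp add: inner_axis mult_commute_abs)
  then have "((\<lambda>h. (f (x + h *\<^sub>R axis i 1) - f x) / h) \<longlongrightarrow> grad f x $ i) (at 0)"
    unfolding DERIV_def by simp
  moreover have "filterlim t (at 0) sequentially"
    using t by (auto simp: filterlim_at)
  ultimately show ?thesis by (rule filterlim_compose)
qed

lemma test_fun_lipschitz:
  fixes \<phi> :: "real^'n \<Rightarrow> real"
  assumes "test_fun D \<phi>" shows "\<exists>L\<ge>0. \<forall>x y. \<bar>\<phi> x - \<phi> y\<bar> \<le> L * norm (x - y)"
proof -
  have "\<forall>i. \<exists>B\<ge>0. \<forall>x. \<bar>grad \<phi> x $ i\<bar> \<le> B"
    using test_fun_bounded[OF test_fun_grad[OF assms]] by blast
  then obtain B where B: "\<And>i. B i \<ge> 0" "\<And>i x. \<bar>grad \<phi> x $ i\<bar> \<le> B i" by metis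
  define L where "L = sum B UNIV"
  have "norm (grad \<phi> x) \<le> L" for x
    using norm_le_l1_cart[of "grad \<phi> x"] sum_mono[of UNIV "\<lambda>i. \<bar>grad \<phi> x $ i\<bar>" B] B(2)
    unfolding L_def by fastforce
  then have "onorm (\<lambda>h. grad \<phi> x \<bullet> h) \<le> L" for x
    by (intro onorm_le) (simp add: order_trans[OF Cauchy_Schwarz_ineq2] mult_right_mono)
  then have "norm (\<phi> x - \<phi> y) \<le> L * norm (x - y)" for x y
    by (intro differentiable_bound[of UNIV \<phi> "\<lambda>x h. grad \<phi> x \<bullet> h"])
      (auto intro!: has_derivative_at_withinI has_derivative_grad test_fun_differentiable[OF assms])
  moreover have "L \<ge> 0" unfolding L_def by (intro sum_nonneg) (use B in auto)
  ultimately show ?thesis by auto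
qed

lemma lebesgue_measurable_translate:
  fixes f :: "'a::euclidean_space \<Rightarrow> 'b::topological_space"
  assumes "f \<in> borel_measurable lebesgue"
  shows "(\<lambda>x. f (x + a)) \<in> borel_measurable lebesgue"
proof -
  have "(\<lambda>x::'a. a + (\<Sum>j\<in>Basis. (1 * (x \<bullet> j)) *\<^sub>R j)) \<in> lebesgue \<rightarrow>\<^sub>M lebesgue"
    by (rule lebesgue_affine_measurable) simp
  then have "(\<lambda>x::'a. a + x) \<in> lebesgue \<rightarrow>\<^sub>M lebesgue" by (simp add: euclidean_representation)
  from measurable_compose[OF this assms] show ?thesis by (simp add: add.commute)
qed

section \<open>Weak gradients of Lipschitz functions\<close>

lemma measurable_if_open:
  fixes w :: "'a::euclidean_space \<Rightarrow> real"
  assumes "open D" "continuous_on D w"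
  shows "(\<lambda>x. if x \<in> D then w x else 0) \<in> borel_measurable lebesgue"
  using assms continuous_imp_measurable_on_sets_lebesgue[of D w] open_sets_lebesgue[of D]
  by (intro borel_measurable_if_I) auto

lemma difference_quotient_measurable:
  fixes W :: "real^'n \<Rightarrow> real"
  assumes W: "W \<in> borel_measurable lebesgue"
  shows "(\<lambda>x. (W (x + t *\<^sub>R axis i 1) - W x) / t) \<in> borel_measurable lebesgue"
  using W lebesgue_measurable_translate[OF W] by (intro borel_measurable_divide borel_measurable_diff) auto

text \<open>The gradient is the almost everywhere limit of difference quotients, which are
  measurable, and their bound M survives the limit. Completeness of Lebesgue measure takes care of
  the points without a derivative.\<close>

lemma lipschitz_grad_measurable_bounded:
  fixes w :: "real^'n \<Rightarrow> real"
  assumes D: "open D"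
    and lip: "\<forall>x\<in>D. \<exists>e>0. ball x e \<subseteq> D \<and> (\<forall>y\<in>ball x e. \<forall>z\<in>ball x e. \<bar>w y - w z\<bar> \<le> M * norm (y - z))"
    and diff: "AE x in lebesgue_on D. w differentiable (at x)"
  shows "(\<lambda>x. if x \<in> D then grad w x $ i else 0) \<in> borel_measurable lebesgue"
    and "AE x in lebesgue_on D. \<bar>grad w x $ i\<bar> \<le> M"
    and "continuous_on D w"
proof -
  show cont: "continuous_on D w"
    unfolding continuous_on_iff
  proof (intro ballI allI impI)
    fix x \<eta> :: real assume "0 < \<eta>" fix x assume x: "x \<in> D"
    obtain e where e: "e > 0" "\<forall>y\<in>ball x e. \<forall>z\<in>ball x e. \<bar>w y - w z\<bar> \<le> M * norm (y - z)"
      using bspec[OF lip x] by blast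
    have "dist (w y) (w x) < \<eta>" if "dist y x < min e (\<eta> / (\<bar>M\<bar> + 1))" for y
    proof -
      have "\<bar>w y - w x\<bar> \<le> M * norm (y - x)" using e that by (auto simp: dist_commute)
      also have "\<dots> \<le> \<bar>M\<bar> * norm (y - x)" by (intro mult_right_mono) auto
      also have "\<dots> \<le> \<bar>M\<bar> * (\<eta> / (\<bar>M\<bar> + 1))" using that by (intro mult_left_mono) (auto simp: dist_norm)
      also have "\<dots> < \<eta>" using \<open>\<eta> > 0\<close> by (simp add: field_simps)
      finally show ?thesis by (simp add: dist_real_def)
    qed
    then show "\<exists>d>0. \<forall>x'\<in>D. dist x' x < d \<longrightarrow> dist (w x') (w x) < \<eta>"
      using e(1) \<open>\<eta> > 0\<close> by (intro exI[of _ "min e (\<eta> / (\<bar>M\<bar> + 1))"]) auto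
  qed
  \<comment> \<open>Continued by zero, the function has difference quotients on the whole space; at
    a point of D they agree with those of w once the step is small.\<close>
  define W where "W = (\<lambda>x. if x \<in> D then w x else 0)"
  have W: "W \<in> borel_measurable lebesgue" unfolding W_def by (rule measurable_if_open[OF D cont])
  define t where "t k = inverse (real (Suc k))" for k
  have t0: "t \<longlonglongrightarrow> 0" "\<And>k. t k \<noteq> 0"
    unfolding t_def using LIMSEQ_inverse_real_of_nat by auto
  define q where "q k x = (if x \<in> D then (W (x + t k *\<^sub>R axis i 1) - W x) / t k else 0)" for k x
  have qm: "q k \<in> borel_measurable lebesgue" for k
  proof -
    have "(\<lambda>x. indicator D x * ((W (x + t k *\<^sub>R axis i 1) - W x) / t k)) \<in> borel_measurable lebesgue"
      by (intro borel_measurable_times difference_quotient_measurable[OF W] borel_measurable_indicator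
          open_sets_lebesgue[OF D])
    moreover have "(\<lambda>x. indicator D x * ((W (x + t k *\<^sub>R axis i 1) - W x) / t k)) = q k"
      unfolding q_def by (auto simp: fun_eq_iff)
    ultimately show ?thesis by simp
  qed
  have small: "\<forall>\<^sub>F k in sequentially. \<bar>t k\<bar> < e" if "e > 0" for e
    using order_tendstoD(2)[OF tendsto_rabs_zero[OF t0(1)] that] .
  have key: "(\<lambda>k. q k x) \<longlonglongrightarrow> grad w x $ i \<and> \<bar>grad w x $ i\<bar> \<le> M"
    if x: "x \<in> D" and d: "w differentiable (at x)" for x
  proof -
    obtain e where e: "e > 0" "ball x e \<subseteq> D" "\<forall>y\<in>ball x e. \<forall>z\<in>ball x e. \<bar>w y - w z\<bar> \<le> M * norm (y - z)"
      using bspec[OF lip x] by blast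
    have ev: "\<forall>\<^sub>F k in sequentially. (w (x + t k *\<^sub>R axis i 1) - w x) / t k = q k x \<and> \<bar>q k x\<bar> \<le> M"
      using small[OF e(1)]
    proof eventually_elim
      fix k assume k: "\<bar>t k\<bar> < e"
      have inb: "x + t k *\<^sub>R axis i 1 \<in> ball x e" using k by (simp add: dist_norm norm_axis_1)
      then have "(w (x + t k *\<^sub>R axis i 1) - w x) / t k = q k x" using e(2) x by (auto simp: q_def W_def)
      moreover have "\<bar>w (x + t k *\<^sub>R axis i 1) - w x\<bar> \<le> M * \<bar>t k\<bar>"
        using e(3)[rule_format, OF inb, of x] e(1) by (simp add: norm_axis_1)
      ultimately show "(w (x + t k *\<^sub>R axis i 1) - w x) / t k = q k x \<and> \<bar>q k x\<bar> \<le> M"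
        using t0(2)[of k] by (metis abs_divide pos_divide_le_eq zero_less_abs_iff)
    qed
    have lim: "(\<lambda>k. q k x) \<longlonglongrightarrow> grad w x $ i"
      by (rule Lim_transform_eventually[OF diff_quotient_tendsto_grad[OF d t0]])
        (use ev in \<open>auto elim: eventually_mono\<close>)
    moreover have "\<bar>grad w x $ i\<bar> \<le> M"
      by (rule tendsto_upperbound[OF tendsto_rabs[OF lim]])
        (use ev in \<open>auto elim: eventually_mono\<close>)
    ultimately show ?thesis by simp
  qed
  have "(\<lambda>x. lim (\<lambda>k. q k x)) \<in> borel_measurable lebesgue"
    using qm by (intro borel_measurable_lim_metric) auto
  moreover have "AE x in lebesgue. lim (\<lambda>k. q k x) = (if x \<in> D then grad w x $ i else 0)"
    using diff[unfolded AE_lebesgue_on_iff[OF open_sets_lebesgue[OF D]]]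
  proof eventually_elim
    case (elim x)
    then show ?case using key[of x] by (auto simp: limI q_def)
  qed
  ultimately show "(\<lambda>x. if x \<in> D then grad w x $ i else 0) \<in> borel_measurable lebesgue"
    by (rule borel_measurable_AE)
  show "AE x in lebesgue_on D. \<bar>grad w x $ i\<bar> \<le> M"
    using diff key unfolding AE_lebesgue_on_iff[OF open_sets_lebesgue[OF D]]
    by (auto elim: eventually_mono)
qed

lemma bounded_measurable_integrable_compact:
  fixes f :: "'a::euclidean_space \<Rightarrow> 'b::euclidean_space"
  assumes "f \<in> borel_measurable lebesgue" "AE x in lebesgue. norm (f x) \<le> B" "compact K"
  shows "f absolutely_integrable_on K"
proof -
  have Km: "K \<in> lmeasurable" using assms(3) by (rule lmeasurable_compact)
  have "integrable lebesgue (\<lambda>x. B * indicator K x)"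
    using Km by (simp add: lmeasurable_iff_integrable)
  then show ?thesis
    unfolding set_integrable_def
    by (rule Bochner_Integration.integrable_bound)
      (use assms Km in \<open>auto simp: indicator_def elim!: eventually_mono intro!: borel_measurable_scaleR borel_measurable_if\<close>)
qed

lemma integrable_bounded_compact_support:
  fixes f :: "'a::euclidean_space \<Rightarrow> real"
  assumes "f \<in> borel_measurable lebesgue" "compact K" "\<And>x. \<bar>f x\<bar> \<le> B * indicator K x"
  shows "integrable lebesgue f"
proof (rule Bochner_Integration.integrable_bound)
  have "K \<in> lmeasurable" using assms(2) by (rule lmeasurable_compact)
  then show "integrable lebesgue (\<lambda>x. B * indicator K x)"
    by (simp add: lmeasurable_iff_integrable)
  show "AE x in lebesgue. norm (f x) \<le> norm (B * indicator K x :: real)"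
    using assms(3) by (intro AE_I2) (metis abs_ge_self order_trans real_norm_def)
qed (use assms in simp)

lemma continuous_absolutely_integrable_compact:
  fixes f :: "'a::euclidean_space \<Rightarrow> 'b::euclidean_space"
  assumes "compact K" "continuous_on K f"
  shows "f absolutely_integrable_on K"
  unfolding set_integrable_def
  using borel_integrable_compact[OF assms]
  by (subst integrable_completion) (auto dest: borel_measurable_integrable)

text \<open>Integration by parts is carried out for difference quotients, where it is translation
  invariance of the integral, and the step tends to 0 on both sides by dominated convergence. The
  Lipschitz bound supplies the dominating function for the quotients of w; their limit exists almost
  everywhere by hypothesis.\<close>

lemma has_weak_grad_lipschitz:
  fixes w :: "real^'n \<Rightarrow> real"
  assumes D: "open D"
    and lip: "\<forall>x\<in>D. \<exists>e>0. ball x e \<subseteq> D \<and> (\<forall>y\<in>ball x e. \<forall>z\<in>ball x e. \<bar>w y - w z\<bar> \<le> M * norm (y - z))"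
    and diff: "AE x in lebesgue_on D. w differentiable (at x)"
  shows "has_weak_grad D w (grad w)"
proof -
  note mb = lipschitz_grad_measurable_bounded[OF D lip diff]
  have Dm: "D \<in> sets lebesgue" by (rule open_sets_lebesgue[OF D])
  have cont: "continuous_on D w" by (rule mb(3))
  define W where "W = (\<lambda>x. if x \<in> D then w x else 0)"
  define G where "G = (\<lambda>x. if x \<in> D then grad w x else 0)"
  have W: "W \<in> borel_measurable lebesgue" unfolding W_def by (rule measurable_if_open[OF D cont])
  have Gi: "(\<lambda>x. G x $ i) = (\<lambda>x. if x \<in> D then grad w x $ i else 0)" for i
    by (auto simp: G_def)
  have Gm: "G \<in> borel_measurable lebesgue"
    unfolding borel_measurable_euclidean_space[of G]
    using mb(1) by (auto simp: Basis_vec_def inner_axis Gi)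
  have AEG: "AE x in lebesgue. \<forall>i. \<bar>G x $ i\<bar> \<le> \<bar>M\<bar>"
  proof -
    have "AE x in lebesgue. \<bar>G x $ i\<bar> \<le> \<bar>M\<bar>" for i
      using mb(2)[of i] unfolding AE_lebesgue_on_iff[OF Dm] by eventually_elim (auto simp: G_def)
    then show ?thesis by (simp add: AE_all_countable)
  qed
  have liW: "loc_integrable D w"
    unfolding loc_integrable_def
    by (auto intro!: continuous_absolutely_integrable_compact continuous_on_subset[OF cont])
  have liG: "loc_integrable D (grad w)"
    unfolding loc_integrable_def
  proof (intro allI impI)
    fix K assume K: "compact K \<and> K \<subseteq> D"
    have "AE x in lebesgue. norm (G x) \<le> (\<Sum>i\<in>(UNIV::'n set). \<bar>M\<bar>)"
      using AEG
    proof eventually_elim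
      case (elim x)
      have "norm (G x) \<le> (\<Sum>i\<in>UNIV. \<bar>G x $ i\<bar>)" by (rule norm_le_l1_cart)
      also have "\<dots> \<le> (\<Sum>i\<in>(UNIV::'n set). \<bar>M\<bar>)" by (intro sum_mono) (use elim in auto)
      finally show ?case .
    qed
    then have "G absolutely_integrable_on K"
      using Gm K by (intro bounded_measurable_integrable_compact) auto
    moreover have "(\<lambda>x. indicator K x *\<^sub>R G x) = (\<lambda>x. indicator K x *\<^sub>R grad w x)"
      using K by (auto simp: G_def indicator_def fun_eq_iff)
    ultimately show "grad w absolutely_integrable_on K" unfolding set_integrable_def by (simp only:)
  qed
  have "(\<integral>x. w x * grad \<phi> x $ i \<partial>lebesgue_on D) = - (\<integral>x. grad w x $ i * \<phi> x \<partial>lebesgue_on D)"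
    if \<phi>: "test_fun D \<phi>" for \<phi> i
  proof -
    let ?e = "axis i (1::real) :: real^'n"
    define S where "S = closure {x. \<phi> x \<noteq> 0}"
    have S: "compact S" "S \<subseteq> D" using \<phi> unfolding S_def test_fun_def by auto
    have nS: "\<phi> x = 0" if "x \<notin> S" for x
      using that closure_subset[of "{x. \<phi> x \<noteq> 0}"] unfolding S_def by auto
    \<comment> \<open>A Lebesgue number of the cover of the support by balls on which w is
      Lipschitz: one radius works for all points of the support.\<close>
    obtain r where r: "r > 0" "\<And>x y. x \<in> S \<Longrightarrow> y \<in> ball x r \<Longrightarrow> y \<in> D \<and> \<bar>w y - w x\<bar> \<le> M * norm (y - x)"
    proof -
      define \<G> where "\<G> = {B. \<exists>x e. e > 0 \<and> B = ball x e \<and> ball x e \<subseteq> D \<and>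
        (\<forall>y\<in>ball x e. \<forall>z\<in>ball x e. \<bar>w y - w z\<bar> \<le> M * norm (y - z))}"
      have "S \<subseteq> \<Union>\<G>"
      proof
        fix x assume "x \<in> S"
        then obtain e where "e > 0" "ball x e \<subseteq> D"
          "\<forall>y\<in>ball x e. \<forall>z\<in>ball x e. \<bar>w y - w z\<bar> \<le> M * norm (y - z)"
          using bspec[OF lip subsetD[OF S(2)]] by blast
        then have "ball x e \<in> \<G>" unfolding \<G>_def by blast
        then show "x \<in> \<Union>\<G>" using \<open>e > 0\<close> by (meson UnionI centre_in_ball)
      qed
      moreover have "open B" if "B \<in> \<G>" for B using that unfolding \<G>_def by auto
      ultimately obtain r where r: "r > 0" "\<And>x. x \<in> S \<Longrightarrow> \<exists>B\<in>\<G>. ball x r \<subseteq> B"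
        using Heine_Borel_lemma[OF S(1)] by metis
      have "y \<in> D \<and> \<bar>w y - w x\<bar> \<le> M * norm (y - x)" if xy: "x \<in> S" "y \<in> ball x r" for x y
      proof -
        obtain B where B: "B \<in> \<G>" "ball x r \<subseteq> B" using r(2)[OF xy(1)] by blast
        then have "x \<in> B" "y \<in> B" using xy(2) r(1) by auto
        then show ?thesis using B(1) unfolding \<G>_def by auto
      qed
      then show thesis using r(1) that by blast
    qed
    define t where "t k = r / 2 * inverse (real (Suc k))" for k
    have t: "0 < t k" "t k \<le> r / 2" for k
      using r(1) unfolding t_def by (auto simp: field_simps mult_left_le)
    have t0: "t \<longlonglongrightarrow> 0" unfolding t_def
      using tendsto_mult_right_zero[OF LIMSEQ_inverse_real_of_nat, of "r / 2"] by simp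
    have tnz: "t k \<noteq> 0" for k using t(1)[of k] by simp
    \<comment> \<open>The support of \<phi> thickened by r / 2 contains the supports of all
      translates of \<phi> used below and still lies in D.\<close>
    define S' where "S' = {x + y | x y. x \<in> S \<and> y \<in> cball 0 (r / 2)}"
    have S': "compact S'" unfolding S'_def by (intro compact_sums S compact_cball)
    have S'D: "S' \<subseteq> D"
      unfolding S'_def using r by (force simp: dist_norm)
    have SS': "x \<in> S'" if "x + s *\<^sub>R ?e \<in> S" "\<bar>s\<bar> \<le> r / 2" for x s
    proof -
      have "x = (x + s *\<^sub>R ?e) + (- s *\<^sub>R ?e)" by simp
      moreover have "- s *\<^sub>R ?e \<in> cball 0 (r / 2)" using that by (simp add: norm_axis_1)
      ultimately show ?thesis unfolding S'_def using that(1) by blast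
    qed
    have "bounded (w ` S')"
      using compact_continuous_image[OF continuous_on_subset[OF cont S'D] S'] by (rule compact_imp_bounded)
    then obtain B where B: "\<And>x. x \<in> S' \<Longrightarrow> \<bar>w x\<bar> \<le> B" unfolding bounded_iff by auto
    obtain L where L: "L \<ge> 0" "\<And>x y. \<bar>\<phi> x - \<phi> y\<bar> \<le> L * norm (x - y)"
      using test_fun_lipschitz[OF \<phi>] by blast
    obtain B\<phi> where B\<phi>: "B\<phi> \<ge> 0" "\<And>x. \<bar>\<phi> x\<bar> \<le> B\<phi>" using test_fun_bounded[OF \<phi>] by blast
    note \<phi>m = test_fun_measurable[OF \<phi>]
    define F where "F k x = W x * ((\<phi> (x + t k *\<^sub>R ?e) - \<phi> x) / t k)" for k x
    define H where "H k x = (W (x + (- t k) *\<^sub>R ?e) - W x) / t k * \<phi> x" for k x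
    have Fm: "F k \<in> borel_measurable lebesgue" for k
      unfolding F_def[abs_def] by (intro borel_measurable_times W difference_quotient_measurable \<phi>m)
    have Hm: "H k \<in> borel_measurable lebesgue" for k
      unfolding H_def[abs_def]
      by (intro borel_measurable_times[OF _ \<phi>m] borel_measurable_divide borel_measurable_diff
          lebesgue_measurable_translate[OF W] W borel_measurable_const)
    have WB: "\<bar>W x\<bar> \<le> B" if "x \<in> S'" for x using B[OF that] S'D that by (auto simp: W_def)
    have F_bound: "\<bar>F k x\<bar> \<le> \<bar>B\<bar> * L * indicator S' x" for k x
    proof (cases "x \<in> S'")
      case True
      have "\<bar>\<phi> (x + t k *\<^sub>R ?e) - \<phi> x\<bar> / t k \<le> L"
        using L(2)[of "x + t k *\<^sub>R ?e" x] t(1)[of k] by (simp add: norm_axis_1 pos_divide_le_eq)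
      then have "\<bar>W x\<bar> * (\<bar>\<phi> (x + t k *\<^sub>R ?e) - \<phi> x\<bar> / t k) \<le> \<bar>B\<bar> * L"
        using WB[OF True] t(1)[of k] by (intro mult_mono) auto
      then show ?thesis using True t(1)[of k] by (simp add: F_def abs_mult)
    next
      case False
      have "\<phi> (x + t k *\<^sub>R ?e) = 0" using SS'[of x "t k"] t[of k] False by (intro nS) auto
      moreover have "\<phi> x = 0" using SS'[of x 0] r(1) False by (intro nS) auto
      ultimately show ?thesis using False by (simp add: F_def)
    qed
    have inD: "x + (- t k) *\<^sub>R ?e \<in> D \<and> \<bar>w (x + (- t k) *\<^sub>R ?e) - w x\<bar> \<le> M * t k" if "x \<in> S" for x k
      using r(2)[OF that, of "x + (- t k) *\<^sub>R ?e"] t[of k] r(1) by (auto simp: dist_norm norm_axis_1)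
    have H_bound: "\<bar>H k x\<bar> \<le> M * B\<phi> * indicator S x" for k x
    proof (cases "x \<in> S")
      case True
      have "\<bar>W (x + (- t k) *\<^sub>R ?e) - W x\<bar> / t k \<le> M"
        using inD[OF True, of k] t(1)[of k] S(2) True by (auto simp: W_def pos_divide_le_eq)
      then have "\<bar>W (x + (- t k) *\<^sub>R ?e) - W x\<bar> / t k * \<bar>\<phi> x\<bar> \<le> M * B\<phi>"
        using B\<phi> t(1)[of k] by (intro mult_mono) (auto intro: order_trans[rotated])
      then show ?thesis using True t(1)[of k] by (simp add: H_def abs_mult)
    qed (simp add: H_def nS)
    have Wphi: "integrable lebesgue (\<lambda>x. W x * \<phi> (x + s *\<^sub>R ?e))" if s: "\<bar>s\<bar> \<le> r / 2" for s
    proof (rule integrable_bounded_compact_support[OF _ S', of _ "\<bar>B\<bar> * B\<phi>"])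
      show "(\<lambda>x. W x * \<phi> (x + s *\<^sub>R ?e)) \<in> borel_measurable lebesgue"
        by (intro borel_measurable_times W lebesgue_measurable_translate[OF \<phi>m])
      fix x show "\<bar>W x * \<phi> (x + s *\<^sub>R ?e)\<bar> \<le> \<bar>B\<bar> * B\<phi> * indicator S' x"
      proof (cases "x \<in> S'")
        case True
        then show ?thesis using WB[OF True] B\<phi> by (auto simp: abs_mult intro!: mult_mono)
      next
        case False
        then have "\<phi> (x + s *\<^sub>R ?e) = 0" using SS'[OF _ s, of x] by (intro nS) auto
        then show ?thesis using False by simp
      qed
    qed
    \<comment> \<open>Discrete integration by parts: a change of variable moves the shift from
      \<phi> to W and reverses its sign.\<close>
    have FH: "(\<integral>x. F k x \<partial>lebesgue) = (\<integral>x. H k x \<partial>lebesgue)" for k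
    proof -
      have tk: "\<bar>t k\<bar> \<le> r / 2" using t[of k] by simp
      have i1: "integrable lebesgue (\<lambda>x. W x * \<phi> (x + t k *\<^sub>R ?e))" by (rule Wphi[OF tk])
      have i0: "integrable lebesgue (\<lambda>x. W x * \<phi> x)" using Wphi[of 0] r(1) by simp
      have m1: "(\<lambda>x. W x * \<phi> (x + t k *\<^sub>R ?e)) \<in> borel_measurable lebesgue"
        using i1 by (rule borel_measurable_integrable)
      note aff = lebesgue_integral_affine[of 1, OF _ m1, of "- t k *\<^sub>R ?e"]
      have i2: "integrable lebesgue (\<lambda>x. W (x + (- t k) *\<^sub>R ?e) * \<phi> x)"
        using aff(2) i1 by (simp add: add.commute)
      have e2: "(\<integral>x. W x * \<phi> (x + t k *\<^sub>R ?e) \<partial>lebesgue) = (\<integral>x. W (x + (- t k) *\<^sub>R ?e) * \<phi> x \<partial>lebesgue)"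
        using aff(1) by (simp add: add.commute)
      have "(\<integral>x. F k x \<partial>lebesgue) = (\<integral>x. (W x * \<phi> (x + t k *\<^sub>R ?e) - W x * \<phi> x) / t k \<partial>lebesgue)"
        unfolding F_def by (intro Bochner_Integration.integral_cong) (auto simp: right_diff_distrib diff_divide_distrib)
      also have "\<dots> = ((\<integral>x. W x * \<phi> (x + t k *\<^sub>R ?e) \<partial>lebesgue) - (\<integral>x. W x * \<phi> x \<partial>lebesgue)) / t k"
        using i1 i0 by simp
      also have "\<dots> = (\<integral>x. (W (x + (- t k) *\<^sub>R ?e) * \<phi> x - W x * \<phi> x) / t k \<partial>lebesgue)"
        unfolding e2 using i2 i0 by simp
      also have "\<dots> = (\<integral>x. H k x \<partial>lebesgue)"
        unfolding H_def by (intro Bochner_Integration.integral_cong) (auto simp: left_diff_distrib diff_divide_distrib)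
      finally show ?thesis .
    qed
    have lm: "S' \<in> lmeasurable" "S \<in> lmeasurable" using S' S(1) by (auto intro: lmeasurable_compact)
    have limF: "(\<lambda>k. \<integral>x. F k x \<partial>lebesgue) \<longlonglongrightarrow> (\<integral>x. W x * grad \<phi> x $ i \<partial>lebesgue)"
    proof (rule integral_dominated_convergence[where w="\<lambda>x. \<bar>B\<bar> * L * indicator S' x"])
      show "(\<lambda>x. W x * grad \<phi> x $ i) \<in> borel_measurable lebesgue"
        by (intro borel_measurable_times W test_fun_measurable[OF test_fun_grad[OF \<phi>]])
      show "AE x in lebesgue. (\<lambda>k. F k x) \<longlonglongrightarrow> W x * grad \<phi> x $ i"
        unfolding F_def
        by (intro AE_I2 tendsto_mult tendsto_const diff_quotient_tendsto_grad test_fun_differentiable[OF \<phi>] t0 tnz)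
      show "integrable lebesgue (\<lambda>x. \<bar>B\<bar> * L * indicator S' x)"
        using lm by (simp add: lmeasurable_iff_integrable)
    qed (use Fm F_bound in auto)
    have limH: "(\<lambda>k. \<integral>x. H k x \<partial>lebesgue) \<longlonglongrightarrow> (\<integral>x. - G x $ i * \<phi> x \<partial>lebesgue)"
    proof (rule integral_dominated_convergence[where w="\<lambda>x. M * B\<phi> * indicator S x"])
      show "(\<lambda>x. - G x $ i * \<phi> x) \<in> borel_measurable lebesgue"
      proof -
        have "(\<lambda>x. G x $ i) \<in> borel_measurable lebesgue" unfolding Gi by (rule mb(1))
        then show ?thesis by (intro borel_measurable_times borel_measurable_uminus \<phi>m)
      qed
      show "AE x in lebesgue. (\<lambda>k. H k x) \<longlonglongrightarrow> - G x $ i * \<phi> x"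
        using diff[unfolded AE_lebesgue_on_iff[OF Dm]]
      proof eventually_elim
        case (elim x)
        show ?case
        proof (cases "x \<in> S")
          case True
          then have xD: "x \<in> D" using S(2) by blast
          have "(\<lambda>k. (w (x + (- t k) *\<^sub>R ?e) - w x) / (- t k)) \<longlonglongrightarrow> grad w x $ i"
            using elim xD tendsto_minus[OF t0] tnz by (intro diff_quotient_tendsto_grad) auto
          then have "(\<lambda>k. - ((w (x + (- t k) *\<^sub>R ?e) - w x) / (- t k)) * \<phi> x) \<longlonglongrightarrow> - (grad w x $ i) * \<phi> x"
            by (intro tendsto_mult tendsto_minus tendsto_const)
          moreover have "- ((w (x + (- t k) *\<^sub>R ?e) - w x) / (- t k)) * \<phi> x = H k x" for k
            using inD[OF True, of k] xD by (simp add: H_def W_def)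
          ultimately show ?thesis using xD by (simp add: G_def)
        qed (simp add: H_def nS)
      qed
      show "integrable lebesgue (\<lambda>x. M * B\<phi> * indicator S x)"
        using lm by (simp add: lmeasurable_iff_integrable)
    qed (use Hm H_bound in auto)
    have "(\<integral>x. W x * grad \<phi> x $ i \<partial>lebesgue) = (\<integral>x. - G x $ i * \<phi> x \<partial>lebesgue)"
      using LIMSEQ_unique[OF limF] limH unfolding FH by blast
    moreover have "(\<integral>x. w x * grad \<phi> x $ i \<partial>lebesgue_on D) = (\<integral>x. W x * grad \<phi> x $ i \<partial>lebesgue)"
      unfolding integral_lebesgue_on_eq[OF Dm]
      by (intro Bochner_Integration.integral_cong) (auto simp: W_def)
    moreover have "(\<integral>x. grad w x $ i * \<phi> x \<partial>lebesgue_on D) = (\<integral>x. G x $ i * \<phi> x \<partial>lebesgue)"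
      unfolding integral_lebesgue_on_eq[OF Dm]
      by (intro Bochner_Integration.integral_cong) (auto simp: G_def)
    ultimately show ?thesis by simp
  qed
  then show ?thesis using liW liG unfolding has_weak_grad_def by blast
qed

section \<open>Mollification\<close>

lemma Ck_reflect:
  fixes f :: "real^'n \<Rightarrow> real"
  shows "Ck k f \<Longrightarrow> Ck k (\<lambda>y. f (z - y))"
proof (induction k arbitrary: f)
  case 0
  then show ?case by (auto intro!: continuous_on_compose2[of UNIV f] continuous_intros)
next
  case (Suc k)
  have d: "((\<lambda>y. f (z - y)) has_derivative (\<lambda>h. grad f (z - y) \<bullet> (- h))) (at y)" for y
  proof -
    have "((\<lambda>y. z - y) has_derivative (\<lambda>h. - h)) (at y)" by (auto intro!: derivative_eq_intros)
    then show ?thesis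
      by (rule has_derivative_compose) (use Suc.prems in \<open>simp add: has_derivative_grad\<close>)
  qed
  have "(\<lambda>y. grad (\<lambda>y. f (z - y)) y $ i) = (\<lambda>y. (- 1) * (grad f (z - y) $ i))" for i
    using grad_eqI[OF d] by (auto simp: fun_eq_iff inner_axis)
  moreover have "Ck k (\<lambda>y. (- 1) * (grad f (z - y) $ i))" for i
    using Suc by (intro Ck_mult Ck_const) auto
  ultimately show ?case using d by (auto simp: differentiable_def)
qed

lemma grad_reflect:
  fixes f :: "real^'n \<Rightarrow> real"
  assumes "f differentiable (at (z - y))"
  shows "grad (\<lambda>y. f (z - y)) y $ i = - grad f (z - y) $ i"
proof -
  have "((\<lambda>y. z - y) has_derivative (\<lambda>h. - h)) (at y)" by (auto intro!: derivative_eq_intros)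
  then have "((\<lambda>y. f (z - y)) has_derivative (\<lambda>h. grad f (z - y) \<bullet> (- h))) (at y)"
    by (rule has_derivative_compose) (simp add: has_derivative_grad[OF assms])
  from grad_eqI[OF this] show ?thesis by (simp add: inner_axis)
qed

definition conv :: "(real^'n \<Rightarrow> real) \<Rightarrow> (real^'n \<Rightarrow> real) \<Rightarrow> real^'n \<Rightarrow> real" where
  "conv \<rho> u x = (\<integral>y. u y * \<rho> (x - y) \<partial>lebesgue)"

lemma test_fun_measurable_reflect:
  "test_fun D \<rho> \<Longrightarrow> (\<lambda>y. \<rho> (x - y)) \<in> borel_measurable lebesgue"
proof -
  assume "test_fun D \<rho>"
  then have "continuous_on UNIV (\<lambda>y. \<rho> (x - y))"
    by (auto intro!: continuous_on_compose2[OF test_fun_continuous[of D \<rho> UNIV]] continuous_intros)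
  then have "(\<lambda>y. \<rho> (x - y)) \<in> borel_measurable borel" by (rule borel_measurable_continuous_onI)
  then show ?thesis by (simp add: measurable_completion)
qed

lemma conv_integrable:
  assumes "test_fun D \<rho>" "integrable lebesgue u"
  shows "integrable lebesgue (\<lambda>y. u y * \<rho> (x - y))"
proof -
  obtain B where "\<And>x. \<bar>\<rho> x\<bar> \<le> B" using test_fun_bounded[OF assms(1)] by blast
  then show ?thesis
    by (intro integrable_bounded_mult[OF assms(2) test_fun_measurable_reflect[OF assms(1)]])
qed

text \<open>The remainder is quadratic uniformly in x, so it can be integrated against |u|. This
  differentiates a convolution under the integral sign directly from the definition of the
  derivative.\<close>

lemma test_fun_taylor:
  fixes \<rho> :: "real^'n \<Rightarrow> real"
  assumes \<rho>: "test_fun D \<rho>"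
  shows "\<exists>L\<ge>0. \<forall>x h. \<bar>\<rho> (x + h) - \<rho> x - grad \<rho> x \<bullet> h\<bar> \<le> L * (norm h)\<^sup>2"
proof -
  have "\<forall>i. \<exists>L\<ge>0. \<forall>x y. \<bar>grad \<rho> x $ i - grad \<rho> y $ i\<bar> \<le> L * norm (x - y)"
    using test_fun_lipschitz[OF test_fun_grad[OF \<rho>]] by blast
  then obtain B where B: "\<And>i. B i \<ge> 0"
    "\<And>i x y. \<bar>grad \<rho> x $ i - grad \<rho> y $ i\<bar> \<le> B i * norm (x - y)" by metis
  define L where "L = sum B UNIV"
  have L0: "L \<ge> 0" unfolding L_def using B(1) by (simp add: sum_nonneg)
  have gl: "norm (grad \<rho> x - grad \<rho> y) \<le> L * norm (x - y)" for x y
  proof -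
    have "norm (grad \<rho> x - grad \<rho> y) \<le> (\<Sum>i\<in>UNIV. \<bar>(grad \<rho> x - grad \<rho> y) $ i\<bar>)" by (rule norm_le_l1_cart)
    also have "\<dots> \<le> (\<Sum>i\<in>UNIV. B i * norm (x - y))" by (intro sum_mono) (use B(2) in auto)
    finally show ?thesis unfolding L_def sum_distrib_right .
  qed
  have "norm (\<rho> (x + h) - \<rho> x - grad \<rho> x \<bullet> (x + h - x)) \<le> norm (x + h - x) * (L * norm h)" for x h
  proof (rule differentiable_bound_linearization[where S="cball x (norm h)" and f'="\<lambda>y k. grad \<rho> y \<bullet> k"])
    show "x + t *\<^sub>R (x + h - x) \<in> cball x (norm h)" if "t \<in> {0..1}" for t
      using that by (auto simp: dist_norm mult_left_le_one_le)
    show "(\<rho> has_derivative (\<lambda>k. grad \<rho> y \<bullet> k)) (at y within cball x (norm h))" for y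
      by (rule has_derivative_at_withinI[OF has_derivative_grad[OF test_fun_differentiable[OF \<rho>]]])
    have "onorm (\<lambda>k. grad \<rho> y \<bullet> k - grad \<rho> x \<bullet> k) \<le> L * norm h" if "y \<in> cball x (norm h)" for y
    proof (rule onorm_le)
      fix k
      have "norm (grad \<rho> y \<bullet> k - grad \<rho> x \<bullet> k) \<le> norm (grad \<rho> y - grad \<rho> x) * norm k"
        using Cauchy_Schwarz_ineq2[of "grad \<rho> y - grad \<rho> x" k] by (simp add: inner_diff_left)
      also have "\<dots> \<le> (L * norm h) * norm k"
        using that gl[of y x] mult_left_mono[OF _ L0, of "norm (y - x)" "norm h"]
        by (intro mult_right_mono) (auto simp: dist_norm norm_minus_commute)
      finally show "norm (grad \<rho> y \<bullet> k - grad \<rho> x \<bullet> k) \<le> L * norm h * norm k" .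
    qed
    then show "\<And>y. y \<in> cball x (norm h) \<Longrightarrow> onorm ((\<lambda>k. grad \<rho> y \<bullet> k) - (\<lambda>k. grad \<rho> x \<bullet> k)) \<le> L * norm h"
      by (simp add: fun_diff_def)
  qed auto
  then have "\<bar>\<rho> (x + h) - \<rho> x - grad \<rho> x \<bullet> h\<bar> \<le> L * (norm h)\<^sup>2" for x h
    by (simp add: power2_eq_square mult.commute mult.left_commute)
  with L0 show ?thesis by blast
qed

lemma has_derivative_quadratic_bound:
  fixes f :: "'a::real_normed_vector \<Rightarrow> real"
  assumes "bounded_linear f'" "\<And>h. \<bar>f (x + h) - f x - f' h\<bar> \<le> C * (norm h)\<^sup>2"
  shows "(f has_derivative f') (at x)"
  unfolding has_derivative_at_alt
proof (intro conjI allI impI assms(1))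
  fix e :: real assume e: "e > 0"
  have "norm (f y - f x - f' (y - x)) \<le> e * norm (y - x)" if y: "norm (y - x) < e / (\<bar>C\<bar> + 1)" for y
  proof -
    have "\<bar>f y - f x - f' (y - x)\<bar> \<le> C * (norm (y - x))\<^sup>2" using assms(2)[of "y - x"] by simp
    also have "\<dots> \<le> (\<bar>C\<bar> + 1) * norm (y - x) * norm (y - x)"
      unfolding power2_eq_square mult.assoc by (intro mult_right_mono) auto
    also have "\<dots> \<le> e * norm (y - x)"
      using y by (intro mult_right_mono) (auto simp: pos_less_divide_eq mult.commute)
    finally show ?thesis by simp
  qed
  then show "\<exists>d>0. \<forall>y. norm (y - x) < d \<longrightarrow> norm (f y - f x - f' (y - x)) \<le> e * norm (y - x)"
    using e by (intro exI[of _ "e / (\<bar>C\<bar> + 1)"]) auto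
qed

lemma conv_has_derivative:
  fixes \<rho> u :: "real^'n \<Rightarrow> real"
  assumes \<rho>: "test_fun D \<rho>" and u: "integrable lebesgue u"
  shows "(conv \<rho> u has_derivative (\<lambda>h. (\<chi> i. conv (\<lambda>x. grad \<rho> x $ i) u x) \<bullet> h)) (at x)"
proof -
  obtain L where L: "L \<ge> 0" "\<And>x h. \<bar>\<rho> (x + h) - \<rho> x - grad \<rho> x \<bullet> h\<bar> \<le> L * (norm h)\<^sup>2"
    using test_fun_taylor[OF \<rho>] by blast
  show ?thesis
  proof (rule has_derivative_quadratic_bound[where C="L * (\<integral>y. \<bar>u y\<bar> \<partial>lebesgue)"])
    show "bounded_linear (\<lambda>h. (\<chi> i. conv (\<lambda>x. grad \<rho> x $ i) u x) \<bullet> h)" by (rule bounded_linear_inner_right)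
    fix h
    have i1: "integrable lebesgue (\<lambda>y. u y * \<rho> (z - y))" for z by (rule conv_integrable[OF \<rho> u])
    have i2: "integrable lebesgue (\<lambda>y. u y * grad \<rho> (x - y) $ i)" for i
      by (rule conv_integrable[OF test_fun_grad[OF \<rho>] u])
    have i3: "integrable lebesgue (\<lambda>y. \<Sum>i\<in>UNIV. u y * grad \<rho> (x - y) $ i * h $ i)"
      using i2 by (intro Bochner_Integration.integrable_sum integrable_mult_left)
    have e3: "(\<chi> i. conv (\<lambda>x. grad \<rho> x $ i) u x) \<bullet> h = (\<integral>y. (\<Sum>i\<in>UNIV. u y * grad \<rho> (x - y) $ i * h $ i) \<partial>lebesgue)"
      using i2 by (subst Bochner_Integration.integral_sum) (auto simp: inner_vec_def conv_def)
    have "conv \<rho> u (x + h) - conv \<rho> u x - (\<chi> i. conv (\<lambda>x. grad \<rho> x $ i) u x) \<bullet> h =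
      (\<integral>y. u y * \<rho> (x + h - y) - u y * \<rho> (x - y) - (\<Sum>i\<in>UNIV. u y * grad \<rho> (x - y) $ i * h $ i) \<partial>lebesgue)"
      unfolding e3 unfolding conv_def using i1 i3 by simp
    also have "\<bar>\<dots>\<bar> \<le> (\<integral>y. \<bar>u y\<bar> * (L * (norm h)\<^sup>2) \<partial>lebesgue)"
    proof (rule order_trans[OF integral_abs_bound integral_mono])
      show "integrable lebesgue (\<lambda>y. \<bar>u y * \<rho> (x + h - y) - u y * \<rho> (x - y) - (\<Sum>i\<in>UNIV. u y * grad \<rho> (x - y) $ i * h $ i)\<bar>)"
        using i1 i3 by (intro integrable_abs Bochner_Integration.integrable_diff)
      show "integrable lebesgue (\<lambda>y. \<bar>u y\<bar> * (L * (norm h)\<^sup>2))" using u by simp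
      fix y
      have "u y * \<rho> (x + h - y) - u y * \<rho> (x - y) - (\<Sum>i\<in>UNIV. u y * grad \<rho> (x - y) $ i * h $ i) =
          u y * (\<rho> ((x - y) + h) - \<rho> (x - y) - grad \<rho> (x - y) \<bullet> h)"
        by (simp add: inner_vec_def algebra_simps sum_distrib_left)
      then show "\<bar>u y * \<rho> (x + h - y) - u y * \<rho> (x - y) - (\<Sum>i\<in>UNIV. u y * grad \<rho> (x - y) $ i * h $ i)\<bar>
          \<le> \<bar>u y\<bar> * (L * (norm h)\<^sup>2)"
        using L(2)[of "x - y" h] by (simp add: abs_mult mult_left_mono)
    qed
    also have "\<dots> = L * (\<integral>y. \<bar>u y\<bar> \<partial>lebesgue) * (norm h)\<^sup>2" by simp
    finally show "\<bar>conv \<rho> u (x + h) - conv \<rho> u x - (\<chi> i. conv (\<lambda>x. grad \<rho> x $ i) u x) \<bullet> h\<bar>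
        \<le> L * (\<integral>y. \<bar>u y\<bar> \<partial>lebesgue) * (norm h)\<^sup>2" .
  qed
qed

text \<open>Every derivative falls on the kernel, which remains a test function; u is never
  differentiated and has to be integrable only.\<close>

lemma Ck_conv:
  fixes \<rho> u :: "real^'n \<Rightarrow> real"
  assumes u: "integrable lebesgue u"
  shows "test_fun D \<rho> \<Longrightarrow> Ck k (conv \<rho> u)"
proof (induction k arbitrary: \<rho>)
  case 0
  then show ?case
    using has_derivative_continuous[OF conv_has_derivative[OF 0 u]]
    by (auto intro!: continuous_at_imp_continuous_on)
next
  case (Suc k)
  note d = conv_has_derivative[OF Suc.prems u]
  have "(\<lambda>x. grad (conv \<rho> u) x $ i) = conv (\<lambda>x. grad \<rho> x $ i) u" for i
    using has_derivative_grad_eqI[OF d] by (auto simp: fun_eq_iff)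
  then show ?case using d Suc.IH[OF test_fun_grad[OF Suc.prems]] by (auto simp: differentiable_def)
qed

lemma mollifier_exists:
  assumes "\<delta> > 0"
  obtains \<rho> :: "real^'n \<Rightarrow> real" where "test_fun UNIV \<rho>" "\<And>x. 0 \<le> \<rho> x" "\<And>x. \<rho> x \<noteq> 0 \<Longrightarrow> norm x < \<delta>"
    "integrable lebesgue \<rho>" "(\<integral>x. \<rho> x \<partial>lebesgue) = 1"
proof -
  \<comment> \<open>The cube of half-side s lies in the ball of radius \<delta>, because the
    Euclidean norm is at most the sum of the absolute values of the coordinates.\<close>
  define s where "s = \<delta> / real CARD('n)"
  have s: "s > 0" using assms by (simp add: s_def)
  define b where "b = bump 1 (vec (- s)) (vec s :: real^'n)"
  have tb: "test_fun UNIV b" unfolding b_def by (intro test_fun_bump) auto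
  have nz: "b x \<noteq> 0 \<longleftrightarrow> x \<in> box (vec (- s)) (vec s)" for x unfolding b_def by (intro bump_nz_iff) simp
  have small: "norm x < \<delta>" if "b x \<noteq> 0" for x
  proof -
    have "norm x \<le> (\<Sum>i\<in>UNIV. \<bar>x $ i\<bar>)" by (rule norm_le_l1_cart)
    also have "\<dots> < (\<Sum>i\<in>(UNIV::'n set). s)"
      using that nz[of x] by (intro sum_strict_mono) (auto simp: mem_box_cart abs_less_iff minus_less_iff)
    also have "\<dots> = \<delta>" by (simp add: s_def)
    finally show ?thesis .
  qed
  have bb: "0 \<le> b x" "b x \<le> 1" for x unfolding b_def by (rule bump_bounds)+
  have bi: "integrable lebesgue b"
  proof (rule integrable_bounded_compact_support[OF test_fun_measurable[OF tb] compact_cbox])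
    fix x show "\<bar>b x\<bar> \<le> 1 * indicator (cbox (vec (- s)) (vec s)) x"
      using bb[of x] nz[of x] box_subset_cbox[of "vec (- s)" "vec s :: real^'n"]
      by (cases "b x = 0") (auto simp: indicator_def)
  qed
  have pos: "(\<integral>x. b x \<partial>lebesgue) > 0"
  proof -
    \<comment> \<open>If the integral vanished, so would b almost everywhere, and the open box on
      which b is positive would be a null set.\<close>
    have "(\<integral>x. b x \<partial>lebesgue) \<noteq> 0"
    proof
      assume "(\<integral>x. b x \<partial>lebesgue) = 0"
      then have "AE x in lebesgue. b x = 0"
        using integral_nonneg_eq_0_iff_AE[OF bi] bb(1) by simp
      then have "AE x in lebesgue. x \<notin> box (vec (- s)) (vec s :: real^'n)"
        by eventually_elim (use nz in blast)
      then have "negligible (box (vec (- s)) (vec s :: real^'n))"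
        by (simp add: negligible_iff_null_sets AE_iff_null_sets)
      then have "box (vec (- s)) (vec s :: real^'n) = {}"
        using open_not_negligible open_box by blast
      moreover have "(0::real^'n) \<in> box (vec (- s)) (vec s)" using s by (simp add: mem_box_cart)
      ultimately show False by blast
    qed
    moreover have "(\<integral>x. b x \<partial>lebesgue) \<ge> 0" by (intro integral_nonneg_AE) (simp add: bb)
    ultimately show ?thesis by simp
  qed
  define c where "c = inverse (\<integral>x. b x \<partial>lebesgue)"
  have c: "c > 0" using pos by (simp add: c_def)
  show thesis
  proof (rule that[of "\<lambda>x. c * b x"])
    have "{x. c * b x \<noteq> 0} = {x. b x \<noteq> 0}" using c by auto
    then show "test_fun UNIV (\<lambda>x. c * b x)"
      using tb unfolding test_fun_def by (simp add: Ck_mult Ck_const)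
    show "0 \<le> c * b x" for x using bb(1)[of x] c by simp
    show "norm x < \<delta>" if "c * b x \<noteq> 0" for x using small[of x] that by auto
    show "integrable lebesgue (\<lambda>x. c * b x)" using bi by simp
    show "(\<integral>x. c * b x \<partial>lebesgue) = 1" using pos by (simp add: c_def)
  qed
qed

lemma mollifier_test_fun_reflect:
  fixes \<rho> :: "real^'n \<Rightarrow> real"
  assumes \<rho>: "test_fun D \<rho>" and small: "\<And>x. \<rho> x \<noteq> 0 \<Longrightarrow> norm x < r" and sub: "cball z r \<subseteq> U"
  shows "test_fun U (\<lambda>y. \<rho> (z - y))"
proof -
  have "{y. \<rho> (z - y) \<noteq> 0} \<subseteq> cball z r"
  proof
    fix y assume "y \<in> {y. \<rho> (z - y) \<noteq> 0}"
    then show "y \<in> cball z r" using small[of "z - y"] by (simp add: dist_norm)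
  qed
  then have cl: "closure {y. \<rho> (z - y) \<noteq> 0} \<subseteq> cball z r" by (intro closure_minimal) auto
  then have "bounded (closure {y. \<rho> (z - y) \<noteq> 0})" using bounded_cball bounded_subset by blast
  then show ?thesis
    using \<rho> subset_trans[OF cl sub] Ck_reflect[where f=\<rho> and z=z]
    unfolding test_fun_def compact_eq_bounded_closed by simp
qed

lemma mollifier_reflect_integral:
  fixes \<rho> :: "real^'n \<Rightarrow> real"
  assumes "test_fun D \<rho>" "integrable lebesgue \<rho>"
  shows "integrable lebesgue (\<lambda>y. \<rho> (x - y))" "(\<integral>y. \<rho> (x - y) \<partial>lebesgue) = (\<integral>y. \<rho> y \<partial>lebesgue)"
  using lebesgue_integral_affine[of "- 1" \<rho> x] assms borel_measurable_integrable[OF assms(2)] by auto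

text \<open>The kernel is a probability density, so the convolution at x is an average of u over the
  points that the kernel reaches, and inherits any bound valid there.\<close>

lemma conv_close:
  fixes \<rho> u :: "real^'n \<Rightarrow> real"
  assumes \<rho>: "test_fun D \<rho>" "\<And>x. 0 \<le> \<rho> x" "integrable lebesgue \<rho>" "(\<integral>x. \<rho> x \<partial>lebesgue) = 1"
    and u: "integrable lebesgue u"
    and close: "\<And>y. \<rho> (x - y) \<noteq> 0 \<Longrightarrow> \<bar>u y - c\<bar> \<le> \<eta>"
  shows "\<bar>conv \<rho> u x - c\<bar> \<le> \<eta>"
proof -
  note r = mollifier_reflect_integral[OF \<rho>(1,3), of x]
  have i: "integrable lebesgue (\<lambda>y. u y * \<rho> (x - y))" by (rule conv_integrable[OF \<rho>(1) u])
  have ic: "integrable lebesgue (\<lambda>y. c * \<rho> (x - y))" using r by simp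
  have "conv \<rho> u x - c = (\<integral>y. u y * \<rho> (x - y) \<partial>lebesgue) - (\<integral>y. c * \<rho> (x - y) \<partial>lebesgue)"
    using r \<rho>(4) by (simp add: conv_def)
  also have "\<dots> = (\<integral>y. u y * \<rho> (x - y) - c * \<rho> (x - y) \<partial>lebesgue)"
    using i ic by simp
  also have "\<bar>\<dots>\<bar> \<le> (\<integral>y. \<eta> * \<rho> (x - y) \<partial>lebesgue)"
  proof (rule order_trans[OF integral_abs_bound integral_mono])
    show "integrable lebesgue (\<lambda>y. \<bar>u y * \<rho> (x - y) - c * \<rho> (x - y)\<bar>)"
      using i ic by (intro integrable_abs Bochner_Integration.integrable_diff)
    show "integrable lebesgue (\<lambda>y. \<eta> * \<rho> (x - y))" using r by simp
    fix y
    show "\<bar>u y * \<rho> (x - y) - c * \<rho> (x - y)\<bar> \<le> \<eta> * \<rho> (x - y)"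
      using close[of y] \<rho>(2)[of "x - y"]
      by (cases "\<rho> (x - y) = 0") (auto simp: abs_mult mult_right_mono simp flip: left_diff_distrib)
  qed
  also have "\<dots> = \<eta>" using r \<rho>(4) by simp
  finally show ?thesis .
qed

text \<open>A mollification of u has at z a gradient that is an average of g over points of U near
  z, hence of norm at most M along the segment from x to y, and the mean value inequality applies to
  it. At points of continuity the mollifications approach u; a single value of u elsewhere carries
  no information about its weak gradient.\<close>

lemma weak_grad_bounded_lipschitz:
  fixes u :: "real^'n \<Rightarrow> real"
  assumes \<Omega>: "open \<Omega>" and wg: "has_weak_grad \<Omega> u g" and ui: "integrable lebesgue u"
    and U: "open U" "convex U" "U \<subseteq> \<Omega>"
    and M: "AE x in lebesgue_on U. norm (g x) \<le> M" "0 \<le> M"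
    and x: "x \<in> U" "isCont u x" and y: "y \<in> U" "isCont u y"
  shows "\<bar>u x - u y\<bar> \<le> M * norm (x - y)"
proof (rule field_le_epsilon)
  fix e :: real assume e: "e > 0"
  define \<eta> where "\<eta> = e / 2"
  have \<eta>: "\<eta> > 0" using e by (simp add: \<eta>_def)
  have \<Omega>m: "\<Omega> \<in> sets lebesgue" using \<Omega> by (rule open_sets_lebesgue)
  let ?S = "closed_segment x y"
  have SU: "?S \<subseteq> U" using x y U(2) by (simp add: closed_segment_subset)
  \<comment> \<open>Kernels of radius below r keep the averages inside U for every centre on the
    segment, which lies in U by convexity.\<close>
  obtain r where r: "r > 0" "(\<Union>z\<in>?S. cball z r) \<subseteq> U"
    using compact_subset_open_imp_cball_epsilon_subset[OF compact_segment U(1) SU] by blast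
  obtain d1 where d1: "d1 > 0" "\<And>z. dist z x < d1 \<Longrightarrow> dist (u z) (u x) < \<eta>"
    using x(2) \<eta> unfolding continuous_at_eps_delta by blast
  obtain d2 where d2: "d2 > 0" "\<And>z. dist z y < d2 \<Longrightarrow> dist (u z) (u y) < \<eta>"
    using y(2) \<eta> unfolding continuous_at_eps_delta by blast
  have dpos: "min r (min d1 d2) > 0" using r(1) d1(1) d2(1) by simp
  obtain \<rho> :: "real^'n \<Rightarrow> real" where \<rho>: "test_fun UNIV \<rho>" "\<And>x. 0 \<le> \<rho> x"
    "\<And>x. \<rho> x \<noteq> 0 \<Longrightarrow> norm x < min r (min d1 d2)"
    "integrable lebesgue \<rho>" "(\<integral>x. \<rho> x \<partial>lebesgue) = 1"
    using mollifier_exists[OF dpos] by metis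
  have cx: "\<bar>conv \<rho> u x - u x\<bar> \<le> \<eta>"
    using \<rho>(3) d1(2) by (intro conv_close[OF \<rho>(1,2,4,5) ui]) (force simp: dist_norm norm_minus_commute)
  have cy: "\<bar>conv \<rho> u y - u y\<bar> \<le> \<eta>"
    using \<rho>(3) d2(2) by (intro conv_close[OF \<rho>(1,2,4,5) ui]) (force simp: dist_norm norm_minus_commute)
  define J where "J z = (\<chi> i. conv (\<lambda>x. grad \<rho> x $ i) u z)" for z
  have dJ: "(conv \<rho> u has_derivative (\<lambda>h. J z \<bullet> h)) (at z)" for z
    unfolding J_def by (rule conv_has_derivative[OF \<rho>(1) ui])
  have Jb: "\<bar>J z \<bullet> h\<bar> \<le> M * norm h" if z: "z \<in> ?S" for z h
  proof -
    have czU: "cball z r \<subseteq> U" using r(2) z by blast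
    define \<phi> where "\<phi> = (\<lambda>y. \<rho> (z - y))"
    have \<rho>r: "norm x < r" if "\<rho> x \<noteq> 0" for x using \<rho>(3)[OF that] by simp
    have \<phi>U: "test_fun U \<phi>" unfolding \<phi>_def by (rule mollifier_test_fun_reflect[OF \<rho>(1) \<rho>r czU])
    have \<phi>: "test_fun \<Omega> \<phi>" by (rule test_fun_mono[OF \<phi>U U(3)])
    have gphi: "grad \<phi> y $ i = - grad \<rho> (z - y) $ i" for y i
      unfolding \<phi>_def by (rule grad_reflect[OF test_fun_differentiable[OF \<rho>(1)]])
    have z0: "grad \<phi> y = 0" if "y \<notin> \<Omega>" for y
      using test_fun_zero[OF test_fun_grad[OF \<phi>] that] by (simp add: vec_eq_iff)
    have gl: "loc_integrable \<Omega> (\<lambda>x. g x $ i)" for i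
      using wg loc_integrable_component unfolding has_weak_grad_def by blast
    \<comment> \<open>In a convolution the derivative falls on the kernel. As a function of y,
      \<rho>(z - y) is a test function on \<Omega>, so the definition of the weak gradient moves the
      derivative over to u.\<close>
    have comp: "J z $ i = (\<integral>y. g y $ i * \<phi> y \<partial>lebesgue_on \<Omega>)" for i
    proof -
      have "J z $ i = - (\<integral>y. u y * grad \<phi> y $ i \<partial>lebesgue)"
        unfolding J_def conv_def by (simp add: gphi)
      also have "(\<integral>y. u y * grad \<phi> y $ i \<partial>lebesgue) = (\<integral>y. u y * grad \<phi> y $ i \<partial>lebesgue_on \<Omega>)"
        unfolding integral_lebesgue_on_eq[OF \<Omega>m] using z0
        by (intro Bochner_Integration.integral_cong) (auto simp: indicator_def)
      also have "- \<dots> = (\<integral>y. g y $ i * \<phi> y \<partial>lebesgue_on \<Omega>)"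
        using wg \<phi> unfolding has_weak_grad_def by simp
      finally show ?thesis .
    qed
    have ig: "integrable (lebesgue_on \<Omega>) (\<lambda>y. g y $ i * \<phi> y)" for i
      by (rule loc_integrable_test_mult_on[OF \<Omega> \<phi> gl])
    have igs: "integrable (lebesgue_on \<Omega>) (\<lambda>y. \<Sum>i\<in>UNIV. g y $ i * \<phi> y * h $ i)"
      using ig by (intro Bochner_Integration.integrable_sum integrable_mult_left)
    have "J z \<bullet> h = (\<integral>y. (\<Sum>i\<in>UNIV. g y $ i * \<phi> y * h $ i) \<partial>lebesgue_on \<Omega>)"
      using ig by (subst Bochner_Integration.integral_sum) (auto simp: inner_vec_def comp)
    also have "\<bar>\<dots>\<bar> \<le> (\<integral>y. (M * norm h) * \<phi> y \<partial>lebesgue_on \<Omega>)"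
    proof (rule order_trans[OF integral_abs_bound integral_mono_AE])
      show "integrable (lebesgue_on \<Omega>) (\<lambda>y. \<bar>\<Sum>i\<in>UNIV. g y $ i * \<phi> y * h $ i\<bar>)"
        using igs by (rule integrable_abs)
      have "loc_integrable \<Omega> (\<lambda>y. M * norm h)" unfolding loc_integrable_def by (auto intro: continuous_absolutely_integrable_compact)
      then show "integrable (lebesgue_on \<Omega>) (\<lambda>y. (M * norm h) * \<phi> y)"
        by (rule loc_integrable_test_mult_on[OF \<Omega> \<phi>])
      show "AE y in lebesgue_on \<Omega>. \<bar>\<Sum>i\<in>UNIV. g y $ i * \<phi> y * h $ i\<bar> \<le> (M * norm h) * \<phi> y"
        unfolding AE_lebesgue_on_iff[OF \<Omega>m]
        using M(1)[unfolded AE_lebesgue_on_iff[OF open_sets_lebesgue[OF U(1)]]]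
      proof eventually_elim
        case (elim y)
        have "(\<Sum>i\<in>UNIV. g y $ i * \<phi> y * h $ i) = \<phi> y * (g y \<bullet> h)"
          by (simp add: inner_vec_def sum_distrib_left algebra_simps)
        then have "\<bar>\<Sum>i\<in>UNIV. g y $ i * \<phi> y * h $ i\<bar> = \<phi> y * \<bar>g y \<bullet> h\<bar>"
          using \<rho>(2) by (simp add: abs_mult \<phi>_def)
        also have "\<dots> \<le> \<phi> y * (M * norm h)"
        proof (cases "y \<in> U")
          case True
          have "\<bar>g y \<bullet> h\<bar> \<le> norm (g y) * norm h" by (rule Cauchy_Schwarz_ineq2)
          also have "\<dots> \<le> M * norm h" using elim True by (intro mult_right_mono) auto
          finally show ?thesis using \<rho>(2) by (intro mult_left_mono) (auto simp: \<phi>_def)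
        qed (simp add: test_fun_zero[OF \<phi>U])
        finally show ?case by (simp add: mult.commute)
      qed
    qed
    also have "\<dots> = (M * norm h) * (\<integral>y. \<phi> y \<partial>lebesgue_on \<Omega>)" by simp
    also have "(\<integral>y. \<phi> y \<partial>lebesgue_on \<Omega>) = (\<integral>y. \<phi> y \<partial>lebesgue)"
      unfolding integral_lebesgue_on_eq[OF \<Omega>m] using test_fun_zero[OF \<phi>]
      by (intro Bochner_Integration.integral_cong) (auto simp: indicator_def)
    also have "\<dots> = 1" using mollifier_reflect_integral(2)[OF \<rho>(1,4)] \<rho>(5) by (simp add: \<phi>_def)
    finally show ?thesis by simp
  qed
  have "norm (conv \<rho> u x - conv \<rho> u y) \<le> M * norm (x - y)"
  proof (rule differentiable_bound[of ?S])
    show "(conv \<rho> u has_derivative (\<lambda>h. J z \<bullet> h)) (at z within ?S)" for z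
      by (rule has_derivative_at_withinI[OF dJ])
    show "onorm (\<lambda>h. J z \<bullet> h) \<le> M" if "z \<in> ?S" for z
      by (rule onorm_le) (use Jb[OF that] in simp)
  qed (auto intro: convex_closed_segment)
  then show "\<bar>u x - u y\<bar> \<le> M * norm (x - y) + e"
    using cx cy unfolding \<eta>_def real_norm_def by linarith
qed

section \<open>Bounded functions on bounded sets, and invariance of \<open>H10\<close> under changes
  off the domain\<close>

lemma integrable_bounded_on:
  fixes f :: "'a::euclidean_space \<Rightarrow> 'b::euclidean_space"
  assumes "D \<in> sets lebesgue" "bounded D" "f \<in> borel_measurable (lebesgue_on D)" "AE x in lebesgue_on D. norm (f x) \<le> B"
  shows "integrable (lebesgue_on D) f"
proof -
  interpret finite_measure "lebesgue_on D"
    using assms(1,2) by (intro finite_measure_lebesgue_on bounded_set_imp_lmeasurable)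
  show ?thesis using assms(3,4) by (intro integrable_const_bound)
qed

lemma L2_bounded:
  fixes f :: "'a::euclidean_space \<Rightarrow> 'b::euclidean_space"
  assumes "D \<in> sets lebesgue" "bounded D" "f \<in> borel_measurable (lebesgue_on D)" "AE x in lebesgue_on D. norm (f x) \<le> B"
  shows "L2 D f"
  unfolding L2_def
proof
  have "AE x in lebesgue_on D. norm ((norm (f x))\<^sup>2) \<le> B\<^sup>2"
    using assms(4) by eventually_elim (simp add: power_mono)
  moreover have "(\<lambda>x. (norm (f x))\<^sup>2) \<in> borel_measurable (lebesgue_on D)" using assms(3) by simp
  ultimately show "integrable (lebesgue_on D) (\<lambda>x. (norm (f x))\<^sup>2)"
    by (intro integrable_bounded_on[OF assms(1,2)])
qed (rule assms(3))

lemma norm_H1_cong: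
  assumes "\<And>x. x \<in> D \<Longrightarrow> u x = v x"
  shows "norm_H1 D u = norm_H1 D v"
proof -
  have "has_weak_grad D u = has_weak_grad D v"
    using has_weak_grad_cong[of D u v] has_weak_grad_cong[of D v u] assms by (auto simp: fun_eq_iff)
  then have "weak_grad D u = weak_grad D v" unfolding weak_grad_def by simp
  moreover have "norm_L2 D u = norm_L2 D v"
    unfolding norm_L2_def using assms by (intro arg_cong[of _ _ sqrt] Bochner_Integration.integral_cong) auto
  ultimately show ?thesis unfolding norm_H1_def by simp
qed

lemma H10_cong:
  assumes eq: "\<And>x. x \<in> D \<Longrightarrow> u x = v x" and u: "H10 D u"
  shows "H10 D v"
proof -
  have "L2 D v"
  proof -
    have "L2 D u" using u unfolding H10_def H1_def by simp
    moreover have "u \<in> borel_measurable (lebesgue_on D) \<longleftrightarrow> v \<in> borel_measurable (lebesgue_on D)"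
      by (rule measurable_cong) (simp add: eq)
    moreover have "integrable (lebesgue_on D) (\<lambda>x. (norm (u x))\<^sup>2) \<longleftrightarrow> integrable (lebesgue_on D) (\<lambda>x. (norm (v x))\<^sup>2)"
      by (rule Bochner_Integration.integrable_cong) (simp_all add: eq)
    ultimately show ?thesis unfolding L2_def by simp
  qed
  moreover have "\<exists>g. has_weak_grad D v g \<and> L2 D g"
    using u has_weak_grad_cong[of D u v, OF eq] unfolding H10_def H1_def by blast
  moreover have "norm_H1 D (\<lambda>x. \<phi> x - u x) = norm_H1 D (\<lambda>x. \<phi> x - v x)" for \<phi>
    by (rule norm_H1_cong) (simp add: eq)
  ultimately show ?thesis using u unfolding H10_def H1_def by simp
qed

lemma conv_commute:
  fixes \<rho> u :: "real^'n \<Rightarrow> real"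
  assumes "test_fun D \<rho>" "integrable lebesgue u"
  shows "conv \<rho> u x = (\<integral>z. u (x - z) * \<rho> z \<partial>lebesgue)" "integrable lebesgue (\<lambda>z. u (x - z) * \<rho> z)"
  using lebesgue_integral_affine[of "- 1" "\<lambda>y. u y * \<rho> (x - y)" x] conv_integrable[OF assms, of x]
    borel_measurable_integrable[OF conv_integrable[OF assms, of x]]
  by (auto simp: conv_def)

text \<open>The difference of two values of a convolution averages the differences u(x - z) - u(y -
  z) over small z. With c = 0 this hands Lipschitz constants over to mollifications; with c =
  \<open>grad v x \<bullet> (y - x)\<close> it hands over strict differentiability.\<close>

lemma conv_difference_close:
  fixes \<rho> u :: "real^'n \<Rightarrow> real"
  assumes \<rho>: "test_fun D \<rho>" "\<And>x. 0 \<le> \<rho> x" "integrable lebesgue \<rho>" "(\<integral>x. \<rho> x \<partial>lebesgue) = 1"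
    and u: "integrable lebesgue u"
    and close: "\<And>z. \<rho> z \<noteq> 0 \<Longrightarrow> \<bar>u (x - z) - u (y - z) - c\<bar> \<le> \<eta>"
  shows "\<bar>conv \<rho> u x - conv \<rho> u y - c\<bar> \<le> \<eta>"
proof -
  note i = conv_commute(2)[OF \<rho>(1) u]
  have ic: "integrable lebesgue (\<lambda>z. c * \<rho> z)" using \<rho>(3) by simp
  have "conv \<rho> u x - conv \<rho> u y - c =
      (\<integral>z. u (x - z) * \<rho> z - u (y - z) * \<rho> z - c * \<rho> z \<partial>lebesgue)"
    using i[of x] i[of y] ic \<rho>(3,4) by (simp add: conv_commute(1)[OF \<rho>(1) u])
  also have "\<bar>\<dots>\<bar> \<le> (\<integral>z. \<eta> * \<rho> z \<partial>lebesgue)"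
  proof (rule order_trans[OF integral_abs_bound integral_mono])
    show "integrable lebesgue (\<lambda>z. \<bar>u (x - z) * \<rho> z - u (y - z) * \<rho> z - c * \<rho> z\<bar>)"
      using i ic by (intro integrable_abs Bochner_Integration.integrable_diff)
    show "integrable lebesgue (\<lambda>z. \<eta> * \<rho> z)" using \<rho>(3) by simp
    fix z
    show "\<bar>u (x - z) * \<rho> z - u (y - z) * \<rho> z - c * \<rho> z\<bar> \<le> \<eta> * \<rho> z"
      using close[of z] \<rho>(2)[of z]
      by (cases "\<rho> z = 0") (auto simp: abs_mult mult_right_mono simp flip: left_diff_distrib)
  qed
  also have "\<dots> = \<eta>" using \<rho>(3,4) by simp
  finally show ?thesis .
qed

text \<open>It suffices to test the hypothesis in the direction of \<open>grad f x - c\<close>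
  itself. If this vector is zero, what remains is that \<eta> is nonnegative, and one point near x
  shows it.\<close>

lemma grad_close_of_local_bound:
  fixes f :: "real^'n \<Rightarrow> real"
  assumes f: "f differentiable (at x)" and d: "d > 0"
    and close: "\<And>y. y \<in> ball x d \<Longrightarrow> \<bar>f y - f x - c \<bullet> (y - x)\<bar> \<le> \<eta> * norm (y - x)"
  shows "norm (grad f x - c) \<le> \<eta>"
proof (cases "grad f x = c")
  case True
  define y where "y = x + (d / 2) *\<^sub>R axis undefined 1"
  have ny: "norm (y - x) = d / 2" using d by (simp add: y_def)
  have "0 \<le> \<eta> * norm (y - x)"
    using d by (intro order_trans[OF abs_ge_zero close]) (simp add: y_def dist_norm)
  then show ?thesis using d True unfolding ny by (simp add: zero_le_mult_iff)
next
  case False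
  define g where "g = grad f x - c"
  have g: "norm g > 0" using False by (simp add: g_def)
  have "((\<lambda>s. x + s *\<^sub>R g) has_derivative (\<lambda>s. s *\<^sub>R g)) (at 0)"
    by (auto intro!: derivative_eq_intros)
  then have "((\<lambda>s. f (x + s *\<^sub>R g)) has_derivative (\<lambda>s. grad f x \<bullet> (s *\<^sub>R g))) (at 0)"
    by (rule has_derivative_compose) (simp add: has_derivative_grad[OF f])
  then have "((\<lambda>s. f (x + s *\<^sub>R g)) has_real_derivative grad f x \<bullet> g) (at 0)"
    unfolding has_field_derivative_def by (simp add: mult_commute_abs)
  then have "((\<lambda>h. (f (x + h *\<^sub>R g) - f x) / h) \<longlongrightarrow> grad f x \<bullet> g) (at 0)"
    unfolding DERIV_def by simp
  then have "((\<lambda>h. (f (x + h *\<^sub>R g) - f x) / h - c \<bullet> g) \<longlongrightarrow> grad f x \<bullet> g - c \<bullet> g) (at_right 0)"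
    by (intro tendsto_diff tendsto_const) (rule filterlim_mono[OF _ order_refl at_le], auto)
  moreover have "\<forall>\<^sub>F h in at_right 0. (f (x + h *\<^sub>R g) - f x) / h - c \<bullet> g \<le> \<eta> * norm g"
    unfolding eventually_at_right_field
  proof (intro exI[of _ "d / norm g"] conjI allI impI)
    show "0 < d / norm g" using d g by simp
    fix h :: real assume h: "0 < h" "h < d / norm g"
    have "x + h *\<^sub>R g \<in> ball x d" using h g by (simp add: dist_norm pos_less_divide_eq)
    from close[OF this] have "\<bar>f (x + h *\<^sub>R g) - f x - h * (c \<bullet> g)\<bar> \<le> \<eta> * norm g * h"
      using h(1) by (simp add: ac_simps)
    then have "f (x + h *\<^sub>R g) - f x \<le> (\<eta> * norm g + c \<bullet> g) * h"
      by (simp add: algebra_simps)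
    then have "(f (x + h *\<^sub>R g) - f x) / h \<le> \<eta> * norm g + c \<bullet> g"
      using h(1) by (simp add: pos_divide_le_eq)
    then show "(f (x + h *\<^sub>R g) - f x) / h - c \<bullet> g \<le> \<eta> * norm g" by simp
  qed
  ultimately have "grad f x \<bullet> g - c \<bullet> g \<le> \<eta> * norm g"
    by (rule tendsto_upperbound) simp
  moreover have "grad f x \<bullet> g - c \<bullet> g = norm g * norm g"
    using power2_norm_eq_inner[of g] by (simp add: g_def inner_diff_left power2_eq_square)
  ultimately have "norm g * norm g \<le> \<eta> * norm g" by simp
  then show ?thesis using g by (simp add: g_def)
qed

section \<open>Lipschitz functions with zero trace\<close>

text \<open>Strict (Peano) differentiability compares two points near x, neither of which need be x.
  Mollification produces just such differences, so this notion, rather than differentiability at x,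
  makes the gradients of mollifications converge at x.\<close>

definition strictly_differentiable :: "(real^'n \<Rightarrow> real) \<Rightarrow> real^'n \<Rightarrow> bool" where
  "strictly_differentiable f x \<longleftrightarrow> f differentiable (at x) \<and>
     (\<forall>\<eta>>0. \<exists>d>0. \<forall>y\<in>ball x d. \<forall>z\<in>ball x d. \<bar>f y - f z - grad f x \<bullet> (y - z)\<bar> \<le> \<eta> * norm (y - z))"

lemma lipschitz_continuous_on:
  fixes v :: "real^'n \<Rightarrow> real"
  assumes "\<And>x y. \<bar>v x - v y\<bar> \<le> M * norm (x - y)"
  shows "continuous_on S v"
proof -
  have "(\<bar>M\<bar>)-lipschitz_on UNIV v"
  proof (rule lipschitz_onI)
    fix x y show "dist (v x) (v y) \<le> \<bar>M\<bar> * dist x y"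
      using assms[of x y] mult_right_mono[OF abs_ge_self norm_ge_zero, of M "x - y"]
      by (simp add: dist_norm)
  qed simp
  then show ?thesis using lipschitz_on_continuous_on continuous_on_subset by blast
qed

lemma continuous_lebesgue_measurable:
  fixes v :: "'a::euclidean_space \<Rightarrow> 'b::euclidean_space"
  assumes "continuous_on UNIV v" shows "v \<in> borel_measurable lebesgue"
  using borel_measurable_continuous_onI[OF assms] by (simp add: measurable_completion)

lemma has_weak_grad_globally_lipschitz:
  fixes v :: "real^'n \<Rightarrow> real"
  assumes "open D" "\<And>x y. \<bar>v x - v y\<bar> \<le> M * norm (x - y)" "AE x in lebesgue_on D. v differentiable (at x)"
  shows "has_weak_grad D v (grad v)"
proof (rule has_weak_grad_lipschitz[OF assms(1) _ assms(3)])
  show "\<forall>x\<in>D. \<exists>e>0. ball x e \<subseteq> D \<and> (\<forall>y\<in>ball x e. \<forall>z\<in>ball x e. \<bar>v y - v z\<bar> \<le> M * norm (y - z))"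
    using assms(1,2) unfolding open_contains_ball by blast
qed

lemma infdist_lipschitz:
  fixes A :: "'a::real_normed_vector set"
  shows "\<bar>infdist x A - infdist y A\<bar> \<le> norm (x - y)"
proof -
  have "infdist x A \<le> infdist y A + dist x y" by (rule infdist_triangle)
  moreover have "infdist y A \<le> infdist x A + dist y x" by (rule infdist_triangle)
  ultimately show ?thesis by (simp add: dist_norm norm_minus_commute abs_le_iff)
qed

lemma tendsto_integral_zero_bounded:
  fixes f :: "nat \<Rightarrow> 'a::euclidean_space \<Rightarrow> real"
  assumes D: "D \<in> sets lebesgue" "bounded D"
    and m: "\<And>k. f k \<in> borel_measurable (lebesgue_on D)"
    and b: "\<And>k. AE x in lebesgue_on D. norm (f k x) \<le> B"
    and lim: "AE x in lebesgue_on D. (\<lambda>k. f k x) \<longlonglongrightarrow> 0"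
  shows "(\<lambda>k. \<integral>x. f k x \<partial>lebesgue_on D) \<longlonglongrightarrow> 0"
proof -
  interpret finite_measure "lebesgue_on D"
    using D by (intro finite_measure_lebesgue_on bounded_set_imp_lmeasurable)
  have "(\<lambda>k. \<integral>x. f k x \<partial>lebesgue_on D) \<longlonglongrightarrow> (\<integral>x. 0 \<partial>lebesgue_on D)"
    by (rule integral_dominated_convergence[where w="\<lambda>_. B"]) (use m b lim in auto)
  then show ?thesis by simp
qed

text \<open>The approximating test functions arise by switching v off near the boundary and
  mollifying at a smaller scale. The cut-off has slope 2 / \<open>s k\<close>, but where it acts v
  is at most M times the distance to the complement, so that the products share the Lipschitz
  constant 3 M. Hence the gradients are bounded uniformly and converge at points of strict
  differentiability, and dominated convergence on the bounded set \<Omega> gives convergence in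
  H^1.\<close>

lemma H10_lipschitz:
  fixes v :: "real^'n \<Rightarrow> real"
  assumes \<Omega>: "open \<Omega>" "bounded \<Omega>"
    and lip: "\<And>x y. \<bar>v x - v y\<bar> \<le> M * norm (x - y)"
    and zero: "\<And>x. x \<notin> \<Omega> \<Longrightarrow> v x = 0"
    and sd: "AE x in lebesgue_on \<Omega>. strictly_differentiable v x"
  shows "H10 \<Omega> v"
proof -
  have M: "M \<ge> 0"
  proof -
    have "0 \<le> M * norm (axis undefined 1 - (0::real^'n))" by (rule order_trans[OF abs_ge_zero lip])
    then show ?thesis by simp
  qed
  have \<Omega>m: "\<Omega> \<in> sets lebesgue" by (rule open_sets_lebesgue[OF \<Omega>(1)])
  have ne: "- \<Omega> \<noteq> {}" using \<Omega>(2) not_bounded_UNIV by (metis Compl_empty_eq double_complement)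
  define \<delta> where "\<delta> x = infdist x (- \<Omega>)" for x
  have \<delta>0: "\<delta> x \<ge> 0" for x by (simp add: \<delta>_def infdist_nonneg)
  have \<delta>pos: "\<delta> x > 0 \<longleftrightarrow> x \<in> \<Omega>" for x
    using in_closed_iff_infdist_zero[of "- \<Omega>" x] \<Omega>(1) ne infdist_nonneg[of x "- \<Omega>"]
    by (auto simp: \<delta>_def less_le closed_Compl)
  have \<delta>lip: "\<bar>\<delta> x - \<delta> y\<bar> \<le> norm (x - y)" for x y unfolding \<delta>_def by (rule infdist_lipschitz)
  have v\<delta>: "\<bar>v x\<bar> \<le> M * \<delta> x" for x
  proof -
    obtain y where y: "y \<in> - \<Omega>" "infdist x (- \<Omega>) = dist x y"
      using infdist_attains_inf[of "- \<Omega>" x] \<Omega>(1) ne by (auto simp: closed_Compl)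
    then show ?thesis using lip[of x y] zero[of y] by (simp add: \<delta>_def dist_norm)
  qed
  have vdiff: "AE x in lebesgue_on \<Omega>. v differentiable (at x)"
    using sd by eventually_elim (simp add: strictly_differentiable_def)
  have hwv: "has_weak_grad \<Omega> v (grad v)" by (rule has_weak_grad_globally_lipschitz[OF \<Omega>(1) lip vdiff])
  have vcont: "continuous_on S v" for S using lip by (rule lipschitz_continuous_on)
  have gvM: "norm (grad v x) \<le> M" if "v differentiable (at x)" for x
    using grad_close_of_local_bound[OF that, of 1 0 M] lip by simp
  have gvb: "AE x in lebesgue_on \<Omega>. norm (grad v x) \<le> M"
    using vdiff by eventually_elim (rule gvM)
  note gvm = has_weak_grad_measurable[OF \<Omega>(1) hwv]
  have "L2 \<Omega> (grad v)" by (rule L2_bounded[OF \<Omega>m \<Omega>(2) gvm(1) gvb])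
  moreover have "L2 \<Omega> v"
  proof -
    have "bounded (v ` closure \<Omega>)"
      using compact_continuous_image[OF vcont, of "closure \<Omega>"] \<Omega>(2) compact_closure
      by (intro compact_imp_bounded) auto
    then obtain B where B: "\<forall>x\<in>closure \<Omega>. norm (v x) \<le> B" unfolding bounded_iff by auto
    have "AE x in lebesgue_on \<Omega>. norm (v x) \<le> B"
      using B closure_subset[of \<Omega>] by (intro AE_I2) (auto simp: subset_iff)
    then show ?thesis by (rule L2_bounded[OF \<Omega>m \<Omega>(2) gvm(2)])
  qed
  ultimately have H1: "H1 \<Omega> v" unfolding H1_def using hwv by blast
  define s where "s k = inverse (real (Suc k))" for k
  have s: "s k > 0" "s k \<le> 1" for k by (auto simp: s_def field_simps)
  have s0: "s \<longlonglongrightarrow> 0" unfolding s_def by (rule LIMSEQ_inverse_real_of_nat)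
  \<comment> \<open>Equal to 0 up to distance \<open>s k / 2\<close> from the complement and to 1
    from distance \<open>s k\<close> on. The kernel radius \<open>s k / 4\<close> below leaves a
    margin of \<open>s k / 4\<close> between the support and the complement.\<close>
  define \<zeta> where "\<zeta> k x = max 0 (min 1 (2 * \<delta> x / s k - 1))" for k x
  define w where "w k x = v x * \<zeta> k x" for k x
  have \<zeta>01: "0 \<le> \<zeta> k x" "\<zeta> k x \<le> 1" for k x by (auto simp: \<zeta>_def)
  have \<zeta>1: "\<zeta> k x = 1" if "s k \<le> \<delta> x" for k x using that s(1)[of k] by (simp add: \<zeta>_def field_simps)
  have \<zeta>0: "\<zeta> k x = 0" if "\<delta> x \<le> s k / 2" for k x using that s(1)[of k] by (simp add: \<zeta>_def field_simps)
  have \<zeta>lip: "\<bar>\<zeta> k x - \<zeta> k y\<bar> \<le> 2 / s k * norm (x - y)" for k x y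
  proof -
    have "\<bar>\<zeta> k x - \<zeta> k y\<bar> \<le> \<bar>(2 * \<delta> x / s k - 1) - (2 * \<delta> y / s k - 1)\<bar>"
      unfolding \<zeta>_def by (auto simp: max_def min_def abs_if)
    also have "\<dots> = 2 / s k * \<bar>\<delta> x - \<delta> y\<bar>"
    proof -
      have "(2 * \<delta> x / s k - 1) - (2 * \<delta> y / s k - 1) = 2 / s k * (\<delta> x - \<delta> y)"
        by (simp add: diff_divide_distrib right_diff_distrib)
      then show ?thesis using s(1)[of k] by (simp only: abs_mult) simp
    qed
    also have "\<dots> \<le> 2 / s k * norm (x - y)"
      using s(1)[of k] by (intro mult_left_mono \<delta>lip) simp
    finally show ?thesis .
  qed
  \<comment> \<open>In the product rule the increment of the cut-off is multiplied by v y, of size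
    at most M \<open>s k\<close>, which cancels the slope 2 / \<open>s k\<close>: the two terms
    contribute M and 2 M.\<close>
  have wlip1: "\<bar>w k x - w k y\<bar> \<le> 3 * M * norm (x - y)" if "\<delta> y \<le> s k" for k x y
  proof -
    have "w k x - w k y = (v x - v y) * \<zeta> k x + v y * (\<zeta> k x - \<zeta> k y)" by (simp add: w_def algebra_simps)
    also have "\<bar>\<dots>\<bar> \<le> \<bar>v x - v y\<bar> * \<zeta> k x + \<bar>v y\<bar> * \<bar>\<zeta> k x - \<zeta> k y\<bar>"
      using abs_triangle_ineq[of "(v x - v y) * \<zeta> k x" "v y * (\<zeta> k x - \<zeta> k y)"] \<zeta>01[of k x] by (simp add: abs_mult)
    also have "\<dots> \<le> M * norm (x - y) * 1 + (M * s k) * (2 / s k * norm (x - y))"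
    proof (intro add_mono mult_mono lip \<zeta>01 \<zeta>lip)
      show "\<bar>v y\<bar> \<le> M * s k" using v\<delta>[of y] mult_left_mono[OF that M] by linarith
    qed (use M s(1)[of k] in auto)
    also have "\<dots> = 3 * M * norm (x - y)" using s(1)[of k] by simp
    finally show ?thesis .
  qed
  have wlip: "\<bar>w k x - w k y\<bar> \<le> 3 * M * norm (x - y)" for k x y
  proof -
    consider "\<delta> y \<le> s k" | "\<delta> x \<le> s k" | "s k \<le> \<delta> x \<and> s k \<le> \<delta> y" by linarith
    then show ?thesis
    proof cases
      case 2
      then show ?thesis using wlip1[of x k y] by (simp add: abs_minus_commute norm_minus_commute)
    next
      case 3
      then show ?thesis using lip[of x y] M mult_nonneg_nonneg[OF M norm_ge_zero, of "x - y"]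
        by (simp add: w_def \<zeta>1)
    qed (rule wlip1)
  qed
  have wcont: "continuous_on S (w k)" for S k by (rule lipschitz_continuous_on[OF wlip])
  have wi: "integrable lebesgue (w k)" for k
  proof -
    have comp: "compact (closure \<Omega>)" using \<Omega>(2) by simp
    have "bounded (w k ` closure \<Omega>)"
      by (intro compact_imp_bounded compact_continuous_image wcont comp)
    then obtain B where B: "\<forall>x\<in>closure \<Omega>. norm (w k x) \<le> B" unfolding bounded_iff by auto
    show ?thesis
    proof (rule integrable_bounded_compact_support[OF continuous_lebesgue_measurable[OF wcont] comp])
      fix x show "\<bar>w k x\<bar> \<le> B * indicator (closure \<Omega>) x"
        using B zero[of x] closure_subset[of \<Omega>] by (cases "x \<in> closure \<Omega>") (auto simp: w_def)
    qed
  qed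
  have "\<exists>\<rho>::real^'n \<Rightarrow> real. test_fun UNIV \<rho> \<and> (\<forall>x. 0 \<le> \<rho> x) \<and> (\<forall>x. \<rho> x \<noteq> 0 \<longrightarrow> norm x < s k / 4) \<and>
      integrable lebesgue \<rho> \<and> (\<integral>x. \<rho> x \<partial>lebesgue) = 1" for k
  proof -
    have "s k / 4 > 0" using s(1)[of k] by simp
    from mollifier_exists[OF this] show ?thesis by metis
  qed
  then obtain \<rho> :: "nat \<Rightarrow> real^'n \<Rightarrow> real" where \<rho>: "\<And>k. test_fun UNIV (\<rho> k)" "\<And>k x. 0 \<le> \<rho> k x"
      "\<And>k x. \<rho> k x \<noteq> 0 \<Longrightarrow> norm x < s k / 4" "\<And>k. integrable lebesgue (\<rho> k)" "\<And>k. (\<integral>x. \<rho> k x \<partial>lebesgue) = 1"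
    by metis
  define \<phi> where "\<phi> k = conv (\<rho> k) (w k)" for k
  have \<phi>t: "test_fun \<Omega> (\<phi> k)" for k
  proof -
    let ?C = "{x. s k / 4 \<le> \<delta> x}"
    have "{x. \<phi> k x \<noteq> 0} \<subseteq> ?C"
    proof
      fix x assume x: "x \<in> {x. \<phi> k x \<noteq> 0}"
      have "\<exists>y. w k y * \<rho> k (x - y) \<noteq> 0"
      proof (rule ccontr)
        assume "\<nexists>y. w k y * \<rho> k (x - y) \<noteq> 0"
        then have "(\<lambda>y. w k y * \<rho> k (x - y)) = (\<lambda>y. 0)" by blast
        then have "\<phi> k x = 0" by (simp add: \<phi>_def conv_def)
        then show False using x by simp
      qed
      then obtain y where y: "w k y \<noteq> 0" "\<rho> k (x - y) \<noteq> 0" by auto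
      have "\<delta> y > s k / 2" using y(1) \<zeta>0[of y k] unfolding w_def by fastforce
      moreover have "norm (x - y) < s k / 4" using \<rho>(3) y(2) by blast
      ultimately show "x \<in> ?C" using \<delta>lip[of x y] by auto
    qed
    moreover have "closed ?C"
      unfolding \<delta>_def by (intro closed_Collect_le continuous_intros)
    ultimately have cl: "closure {x. \<phi> k x \<noteq> 0} \<subseteq> ?C" by (rule closure_minimal)
    have C\<Omega>: "?C \<subseteq> \<Omega>" using s(1)[of k] \<delta>pos by fastforce
    then have "bounded (closure {x. \<phi> k x \<noteq> 0})"
      using cl bounded_subset[OF \<Omega>(2)] by blast
    moreover have "Ck j (\<phi> k)" for j unfolding \<phi>_def by (rule Ck_conv[OF wi \<rho>(1)])
    ultimately show ?thesis using subset_trans[OF cl C\<Omega>] unfolding test_fun_def compact_eq_bounded_closed by simp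
  qed
  have \<phi>lip: "\<bar>\<phi> k x - \<phi> k y\<bar> \<le> 3 * M * norm (x - y)" for k x y
  proof -
    have "\<bar>\<phi> k x - \<phi> k y - 0\<bar> \<le> 3 * M * norm (x - y)"
      unfolding \<phi>_def
    proof (rule conv_difference_close[OF \<rho>(1,2,4,5) wi])
      fix z show "\<bar>w k (x - z) - w k (y - z) - 0\<bar> \<le> 3 * M * norm (x - y)"
        using wlip[of k "x - z" "y - z"] by simp
    qed
    then show ?thesis by simp
  qed
  have g\<phi>: "norm (grad (\<phi> k) x) \<le> 3 * M" for k x
    using grad_close_of_local_bound[OF test_fun_differentiable[OF \<phi>t[of k]], of 1 x 0 "3 * M"] \<phi>lip by simp
  have \<phi>close: "\<bar>\<phi> k x - v x\<bar> \<le> 2 * M * s k" for k x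
  proof -
    have "\<bar>\<phi> k x - w k x\<bar> \<le> 3 * M * (s k / 4)"
      unfolding \<phi>_def
    proof (rule conv_close[OF \<rho>(1,2,4,5) wi])
      fix y assume "\<rho> k (x - y) \<noteq> 0"
      then have "norm (x - y) < s k / 4" by (rule \<rho>(3))
      then have "3 * M * norm (x - y) \<le> 3 * M * (s k / 4)" using M by (intro mult_left_mono) auto
      then show "\<bar>w k y - w k x\<bar> \<le> 3 * M * (s k / 4)" using wlip[of k y x] by (simp add: norm_minus_commute)
    qed
    moreover have "\<bar>w k x - v x\<bar> \<le> M * s k"
    proof (cases "s k \<le> \<delta> x")
      case True
      then show ?thesis using M s(1)[of k] by (simp add: w_def \<zeta>1)
    next
      case False
      have "\<bar>w k x - v x\<bar> = \<bar>v x\<bar> * (1 - \<zeta> k x)"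
      proof -
        have "w k x - v x = - (v x * (1 - \<zeta> k x))" by (simp add: w_def algebra_simps)
        then show ?thesis using \<zeta>01[of k x] by (simp add: abs_mult)
      qed
      also have "\<dots> \<le> \<bar>v x\<bar> * 1" using \<zeta>01[of k x] by (intro mult_left_mono) auto
      also have "\<dots> \<le> M * \<delta> x" using v\<delta>[of x] by simp
      also have "\<dots> \<le> M * s k" using False M by (intro mult_left_mono) auto
      finally show ?thesis .
    qed
    moreover have "0 \<le> M * s k" using M s(1)[of k] by simp
    ultimately show ?thesis by linarith
  qed
  have conv_grad: "(\<lambda>k. grad (\<phi> k) x - grad v x) \<longlonglongrightarrow> 0" if x: "x \<in> \<Omega>" and sdx: "strictly_differentiable v x" for x
    unfolding LIMSEQ_iff
  proof (intro allI impI)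
    fix e :: real assume e: "e > 0"
    define \<eta> where "\<eta> = e / 2"
    have \<eta>: "\<eta> > 0" using e by (simp add: \<eta>_def)
    obtain d where d: "d > 0" "\<forall>y\<in>ball x d. \<forall>z\<in>ball x d. \<bar>v y - v z - grad v x \<bullet> (y - z)\<bar> \<le> \<eta> * norm (y - z)"
      using sdx \<eta> unfolding strictly_differentiable_def by blast
    define d' where "d' = min (d / 2) (\<delta> x / 4)"
    have d': "d' > 0" using d(1) \<delta>pos[of x] x by (simp add: d'_def)
    have "\<forall>\<^sub>F k in sequentially. s k < min (d / 2) (\<delta> x / 2)"
      using d(1) \<delta>pos[of x] x by (intro order_tendstoD(2)[OF s0]) simp
    then obtain k0 where k0: "\<And>k. k \<ge> k0 \<Longrightarrow> s k < min (d / 2) (\<delta> x / 2)"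
      unfolding eventually_sequentially by blast
    \<comment> \<open>For large k the kernel reaches only points within distance d of x at which the
      cut-off is 1, so differences of \<open>w k\<close> are differences of v there.\<close>
    have "norm (grad (\<phi> k) x - grad v x) \<le> \<eta>" if k: "k \<ge> k0" for k
    proof (rule grad_close_of_local_bound[OF test_fun_differentiable[OF \<phi>t] d'])
      fix y assume y: "y \<in> ball x d'"
      have near: "p - z \<in> ball x d \<and> w k (p - z) = v (p - z)" if "p \<in> ball x d'" "norm z < s k / 4" for p z
      proof -
        have np: "norm (x - p) < d'" using that(1) by (simp add: dist_norm)
        have nz: "norm (x - (p - z)) \<le> norm (x - p) + norm z"
          using norm_triangle_ineq[of "x - p" z] by (simp add: algebra_simps)
        have "norm (x - (p - z)) < d" using np nz that(2) k0[OF k] s(1)[of k] d(1) unfolding d'_def by linarith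
        moreover have "s k \<le> \<delta> (p - z)"
          using \<delta>lip[of x "p - z"] np nz that(2) k0[OF k] s(1)[of k] unfolding d'_def by linarith
        ultimately show ?thesis by (simp add: dist_norm w_def \<zeta>1)
      qed
      show "\<bar>\<phi> k y - \<phi> k x - grad v x \<bullet> (y - x)\<bar> \<le> \<eta> * norm (y - x)"
        unfolding \<phi>_def
      proof (rule conv_difference_close[OF \<rho>(1,2,4,5) wi])
        fix z assume "\<rho> k z \<noteq> 0"
        then have z: "norm z < s k / 4" by (rule \<rho>(3))
        have xb: "x \<in> ball x d'" using d' by simp
        have "\<bar>v (y - z) - v (x - z) - grad v x \<bullet> ((y - z) - (x - z))\<bar> \<le> \<eta> * norm ((y - z) - (x - z))"
          using d(2) near[OF y z] near[OF xb z] by blast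
        then show "\<bar>w k (y - z) - w k (x - z) - grad v x \<bullet> (y - x)\<bar> \<le> \<eta> * norm (y - x)"
          using near[OF y z] near[OF xb z] by simp
      qed
    qed
    then show "\<exists>no. \<forall>n\<ge>no. norm (grad (\<phi> n) x - grad v x - 0) < e"
      using \<eta>_def e by (intro exI[of _ k0]) force
  qed
  have hw\<phi>: "has_weak_grad \<Omega> (\<lambda>x. \<phi> k x - v x) (\<lambda>x. grad (\<phi> k) x - grad v x)" for k
    by (intro has_weak_grad_diff[OF \<Omega>(1) _ hwv] has_weak_grad_globally_lipschitz[OF \<Omega>(1) \<phi>lip] AE_I2
        test_fun_differentiable[OF \<phi>t])
  note m = has_weak_grad_measurable[OF \<Omega>(1) hw\<phi>]
  have lim0: "(\<lambda>k. \<integral>x. (norm (\<phi> k x - v x))\<^sup>2 \<partial>lebesgue_on \<Omega>) \<longlonglongrightarrow> 0"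
  proof (rule tendsto_integral_zero_bounded[OF \<Omega>m \<Omega>(2)])
    show "(\<lambda>x. (norm (\<phi> k x - v x))\<^sup>2) \<in> borel_measurable (lebesgue_on \<Omega>)" for k using m(2)[of k] by simp
    show "AE x in lebesgue_on \<Omega>. norm ((norm (\<phi> k x - v x))\<^sup>2) \<le> (2 * M)\<^sup>2" for k
    proof (rule AE_I2)
      fix x
      have "2 * M * s k \<le> 2 * M * 1" using s(2)[of k] M by (intro mult_left_mono) auto
      then have "norm (\<phi> k x - v x) \<le> 2 * M" using \<phi>close[of k x] by simp
      then have "(norm (\<phi> k x - v x))\<^sup>2 \<le> (2 * M)\<^sup>2" by (intro power_mono) auto
      then show "norm ((norm (\<phi> k x - v x))\<^sup>2) \<le> (2 * M)\<^sup>2" by simp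
    qed
    show "AE x in lebesgue_on \<Omega>. (\<lambda>k. (norm (\<phi> k x - v x))\<^sup>2) \<longlonglongrightarrow> 0"
    proof (rule AE_I2)
      fix x
      have "(\<lambda>k. \<phi> k x - v x) \<longlonglongrightarrow> 0"
        by (rule Lim_null_comparison[OF _ tendsto_mult_right_zero[OF s0, of "2 * M"]]) (simp add: \<phi>close)
      from tendsto_power[OF tendsto_norm_zero[OF this], of 2]
      show "(\<lambda>k. (norm (\<phi> k x - v x))\<^sup>2) \<longlonglongrightarrow> 0" by simp
    qed
  qed
  have lim1: "(\<lambda>k. \<integral>x. (norm (weak_grad \<Omega> (\<lambda>x. \<phi> k x - v x) x))\<^sup>2 \<partial>lebesgue_on \<Omega>) \<longlonglongrightarrow> 0"
  proof -
    have eq: "(\<integral>x. (norm (weak_grad \<Omega> (\<lambda>x. \<phi> k x - v x) x))\<^sup>2 \<partial>lebesgue_on \<Omega>) =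
        (\<integral>x. (norm (grad (\<phi> k) x - grad v x))\<^sup>2 \<partial>lebesgue_on \<Omega>)" for k
    proof (rule integral_cong_AE)
      show "(\<lambda>x. (norm (weak_grad \<Omega> (\<lambda>x. \<phi> k x - v x) x))\<^sup>2) \<in> borel_measurable (lebesgue_on \<Omega>)"
        using has_weak_grad_measurable(1)[OF \<Omega>(1) has_weak_grad_weak_grad[OF hw\<phi>[of k]]] by simp
      show "(\<lambda>x. (norm (grad (\<phi> k) x - grad v x))\<^sup>2) \<in> borel_measurable (lebesgue_on \<Omega>)"
        using m(1)[of k] by simp
      show "AE x in lebesgue_on \<Omega>. (norm (weak_grad \<Omega> (\<lambda>x. \<phi> k x - v x) x))\<^sup>2 = (norm (grad (\<phi> k) x - grad v x))\<^sup>2"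
        using weak_grad_AE[OF \<Omega>(1) hw\<phi>[of k]] by eventually_elim simp
    qed
    show ?thesis
      unfolding eq
    proof (rule tendsto_integral_zero_bounded[OF \<Omega>m \<Omega>(2)])
      show "(\<lambda>x. (norm (grad (\<phi> k) x - grad v x))\<^sup>2) \<in> borel_measurable (lebesgue_on \<Omega>)" for k using m(1)[of k] by simp
      show "AE x in lebesgue_on \<Omega>. norm ((norm (grad (\<phi> k) x - grad v x))\<^sup>2) \<le> (4 * M)\<^sup>2" for k
        using gvb
      proof eventually_elim
        case (elim x)
        have "norm (grad (\<phi> k) x - grad v x) \<le> 4 * M"
          using norm_triangle_ineq4[of "grad (\<phi> k) x" "grad v x"] elim g\<phi>[of k x] by linarith
        then have "(norm (grad (\<phi> k) x - grad v x))\<^sup>2 \<le> (4 * M)\<^sup>2" by (intro power_mono) auto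
        then show ?case by simp
      qed
      show "AE x in lebesgue_on \<Omega>. (\<lambda>k. (norm (grad (\<phi> k) x - grad v x))\<^sup>2) \<longlonglongrightarrow> 0"
        unfolding AE_lebesgue_on_iff[OF \<Omega>m] using sd[unfolded AE_lebesgue_on_iff[OF \<Omega>m]]
      proof eventually_elim
        case (elim x)
        show ?case
        proof
          assume "x \<in> \<Omega>"
          from tendsto_power[OF tendsto_norm_zero[OF conv_grad[OF this]], of 2] elim \<open>x \<in> \<Omega>\<close>
          show "(\<lambda>k. (norm (grad (\<phi> k) x - grad v x))\<^sup>2) \<longlonglongrightarrow> 0" by simp
        qed
      qed
    qed
  qed
  have "(\<lambda>k. norm_H1 \<Omega> (\<lambda>x. \<phi> k x - v x)) \<longlonglongrightarrow> 0"
  proof -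
    have sq: "(norm_L2 D f)\<^sup>2 = (\<integral>x. (norm (f x))\<^sup>2 \<partial>lebesgue_on D)" for D :: "(real^'n) set" and f :: "real^'n \<Rightarrow> 'c::euclidean_space"
      unfolding norm_L2_def by (simp add: Bochner_Integration.integral_nonneg)
    show ?thesis
      unfolding norm_H1_def sq using tendsto_real_sqrt[OF tendsto_add[OF lim0 lim1]] by simp
  qed
  then show ?thesis unfolding H10_def using H1 \<phi>t by blast
qed

section \<open>Zero extension and boundary values of functions in \<open>H10\<close>\<close>

lemma integral_Cauchy_Schwarz:
  fixes f g :: "'a \<Rightarrow> real"
  assumes m: "f \<in> borel_measurable M" "g \<in> borel_measurable M"
    and f: "integrable M (\<lambda>x. (f x)\<^sup>2)" and g: "integrable M (\<lambda>x. (g x)\<^sup>2)"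
  shows "integrable M (\<lambda>x. f x * g x)"
    and "\<bar>\<integral>x. f x * g x \<partial>M\<bar> \<le> sqrt (\<integral>x. (f x)\<^sup>2 \<partial>M) * sqrt (\<integral>x. (g x)\<^sup>2 \<partial>M)"
proof -
  show i: "integrable M (\<lambda>x. f x * g x)"
  proof (rule Bochner_Integration.integrable_bound[of M "\<lambda>x. (f x)\<^sup>2 + (g x)\<^sup>2"])
    show "AE x in M. norm (f x * g x) \<le> norm ((f x)\<^sup>2 + (g x)\<^sup>2)"
    proof (rule AE_I2)
      fix x
      have "2 * \<bar>f x * g x\<bar> \<le> (f x)\<^sup>2 + (g x)\<^sup>2"
        using sum_squares_bound[of "\<bar>f x\<bar>" "\<bar>g x\<bar>"] by (simp add: abs_mult)
      then show "norm (f x * g x) \<le> norm ((f x)\<^sup>2 + (g x)\<^sup>2)" by simp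
    qed
  qed (use m f g in auto)
  define a b c where "a = (\<integral>x. (g x)\<^sup>2 \<partial>M)" and "b = (\<integral>x. (f x)\<^sup>2 \<partial>M)" and "c = (\<integral>x. f x * g x \<partial>M)"
  have a0: "a \<ge> 0" "b \<ge> 0" by (simp_all add: a_def b_def)
  have quad: "0 \<le> b + 2 * t * c + t\<^sup>2 * a" for t
  proof -
    have "0 \<le> (\<integral>x. (f x + t * g x)\<^sup>2 \<partial>M)" by simp
    also have "\<dots> = (\<integral>x. (f x)\<^sup>2 + (2 * t) * (f x * g x) + t\<^sup>2 * (g x)\<^sup>2 \<partial>M)"
      by (intro Bochner_Integration.integral_cong) (auto simp: power2_eq_square algebra_simps)
    also have "\<dots> = b + 2 * t * c + t\<^sup>2 * a" using f g i by (simp add: a_def b_def c_def)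
    finally show ?thesis .
  qed
  have "c\<^sup>2 \<le> b * a"
  proof (cases "a = 0")
    case True
    have "c = 0"
    proof (rule ccontr)
      assume "c \<noteq> 0"
      then have "b + 2 * (- (b + 1) / (2 * c)) * c = - 1" by (simp add: field_simps)
      then show False using quad[of "- (b + 1) / (2 * c)"] True by simp
    qed
    then show ?thesis using True by simp
  next
    case False
    then have "a > 0" using a0 by simp
    then show ?thesis using quad[of "- c / a"] by (simp add: power2_eq_square field_simps)
  qed
  then have "\<bar>c\<bar> \<le> sqrt (b * a)" using real_le_rsqrt[of "\<bar>c\<bar>" "b * a"] by simp
  then show "\<bar>\<integral>x. f x * g x \<partial>M\<bar> \<le> sqrt (\<integral>x. (f x)\<^sup>2 \<partial>M) * sqrt (\<integral>x. (g x)\<^sup>2 \<partial>M)"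
    by (simp add: a_def b_def c_def real_sqrt_mult)
qed

text \<open>The content is that integration by parts over \<Omega> leaves no boundary term even
  against a test function that does not vanish on the boundary. For the approximating functions this
  is clear, as they have compact support in \<Omega>, and the boundary term depends continuously on
  the function in the norm of H^1.\<close>

lemma H10_zero_extension:
  fixes u :: "real^'n \<Rightarrow> real"
  assumes \<Omega>: "open \<Omega>" "bounded \<Omega>" and u: "H10 \<Omega> u"
    and wg: "has_weak_grad \<Omega> u g" and gM: "AE x in lebesgue_on \<Omega>. norm (g x) \<le> M"
    and uB: "\<And>x. x \<in> \<Omega> \<Longrightarrow> \<bar>u x\<bar> \<le> B"
  shows "has_weak_grad UNIV (\<lambda>x. if x \<in> \<Omega> then u x else 0) (\<lambda>x. if x \<in> \<Omega> then g x else 0)"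
proof -
  let ?u = "\<lambda>x. if x \<in> \<Omega> then u x else 0" and ?g = "\<lambda>x. if x \<in> \<Omega> then g x else 0"
  have \<Omega>m: "\<Omega> \<in> sets lebesgue" by (rule open_sets_lebesgue[OF \<Omega>(1)])
  note m = has_weak_grad_measurable[OF \<Omega>(1) wg]
  have um: "?u \<in> borel_measurable lebesgue" and gm: "?g \<in> borel_measurable lebesgue"
    using m \<Omega>m by (auto intro: borel_measurable_if_I)
  have "loc_integrable UNIV ?u"
    unfolding loc_integrable_def
  proof (intro allI impI)
    fix K :: "(real^'n) set" assume K: "compact K \<and> K \<subseteq> UNIV"
    have "AE x in lebesgue. norm (?u x) \<le> \<bar>B\<bar>" using uB by (intro AE_I2) (auto intro: order_trans[OF _ abs_ge_self])
    then show "?u absolutely_integrable_on K" using bounded_measurable_integrable_compact[OF um] K by blast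
  qed
  moreover have "loc_integrable UNIV ?g"
    unfolding loc_integrable_def
  proof (intro allI impI)
    fix K :: "(real^'n) set" assume K: "compact K \<and> K \<subseteq> UNIV"
    have "AE x in lebesgue. norm (?g x) \<le> \<bar>M\<bar>"
      using gM[unfolded AE_lebesgue_on_iff[OF \<Omega>m]] by eventually_elim auto
    then show "?g absolutely_integrable_on K" using bounded_measurable_integrable_compact[OF gm] K by blast
  qed
  moreover have "(\<integral>x. ?u x * grad \<theta> x $ i \<partial>lebesgue_on UNIV) = - (\<integral>x. ?g x $ i * \<theta> x \<partial>lebesgue_on UNIV)"
    if \<theta>: "test_fun UNIV \<theta>" for \<theta> i
  proof -
    obtain \<phi> where \<phi>: "\<And>n::nat. test_fun \<Omega> (\<phi> n)" and lim: "(\<lambda>n. norm_H1 \<Omega> (\<lambda>x. \<phi> n x - u x)) \<longlonglongrightarrow> 0"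
      using u unfolding H10_def by blast
    define \<theta>' where "\<theta>' x = grad \<theta> x $ i" for x
    have \<theta>'t: "test_fun UNIV \<theta>'" unfolding \<theta>'_def by (rule test_fun_grad[OF \<theta>])
    have restrict_m: "f \<in> borel_measurable (lebesgue_on \<Omega>)" if "f \<in> borel_measurable lebesgue" for f :: "real^'n \<Rightarrow> real"
      using that by (rule measurable_restrict_space1)
    have bi: "integrable (lebesgue_on \<Omega>) f"
      if "f \<in> borel_measurable (lebesgue_on \<Omega>)" "AE x in lebesgue_on \<Omega>. norm (f x) \<le> b" for f :: "real^'n \<Rightarrow> real" and b
      by (rule integrable_bounded_on[OF \<Omega>m \<Omega>(2) that])
    have sqi: "integrable (lebesgue_on \<Omega>) (\<lambda>x. (f x)\<^sup>2)"
      if "f \<in> borel_measurable (lebesgue_on \<Omega>)" "AE x in lebesgue_on \<Omega>. \<bar>f x\<bar> \<le> b" for f :: "real^'n \<Rightarrow> real" and b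
      using L2_bounded[OF \<Omega>m \<Omega>(2) that(1), of b] that(2) unfolding L2_def by simp
    obtain b0 b1 where b: "\<And>x. \<bar>\<theta> x\<bar> \<le> b0" "\<And>x. \<bar>\<theta>' x\<bar> \<le> b1"
      using test_fun_bounded[OF \<theta>] test_fun_bounded[OF \<theta>'t] by blast
    have t2: "integrable (lebesgue_on \<Omega>) (\<lambda>x. (\<theta> x)\<^sup>2)" "integrable (lebesgue_on \<Omega>) (\<lambda>x. (\<theta>' x)\<^sup>2)"
      using b by (auto intro!: sqi restrict_m test_fun_measurable[OF \<theta>] test_fun_measurable[OF \<theta>'t] AE_I2)
    have tm: "\<theta> \<in> borel_measurable (lebesgue_on \<Omega>)" "\<theta>' \<in> borel_measurable (lebesgue_on \<Omega>)"
      by (intro restrict_m test_fun_measurable[OF \<theta>] test_fun_measurable[OF \<theta>'t])+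
    \<comment> \<open>The boundary term of the integration by parts; the rest of the argument shows
      that it is 0.\<close>
    define I where "I = (\<integral>x. u x * \<theta>' x \<partial>lebesgue_on \<Omega>) + (\<integral>x. g x $ i * \<theta> x \<partial>lebesgue_on \<Omega>)"
    have gim: "(\<lambda>x. g x $ i) \<in> borel_measurable (lebesgue_on \<Omega>)"
      using m(1) borel_measurable_euclidean_space[of g] by (auto simp: Basis_vec_def inner_axis)
    have giM: "AE x in lebesgue_on \<Omega>. \<bar>g x $ i\<bar> \<le> M"
      using gM by eventually_elim (use component_le_norm_cart order_trans in blast)
    have uAE: "AE x in lebesgue_on \<Omega>. \<bar>u x\<bar> \<le> B" using uB by (intro AE_I2) auto
    have bound: "\<bar>I\<bar> \<le> norm_H1 \<Omega> (\<lambda>x. \<phi> n x - u x) * (norm_L2 \<Omega> \<theta>' + norm_L2 \<Omega> \<theta>)" for n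
    proof -
      obtain L where L: "\<And>x y. \<bar>\<phi> n x - \<phi> n y\<bar> \<le> L * norm (x - y)" using test_fun_lipschitz[OF \<phi>] by blast
      have hw: "has_weak_grad D (\<phi> n) (grad (\<phi> n))" if "open D" for D
        by (rule has_weak_grad_globally_lipschitz[OF that L]) (simp add: test_fun_differentiable[OF \<phi>])
      have hd: "has_weak_grad \<Omega> (\<lambda>x. \<phi> n x - u x) (\<lambda>x. grad (\<phi> n) x - g x)"
        by (rule has_weak_grad_diff[OF \<Omega>(1) hw[OF \<Omega>(1)] wg])
      define d where "d = (\<lambda>x. \<phi> n x - u x)"
      define d' where "d' = (\<lambda>x. grad (\<phi> n) x - g x)"
      have dm: "d \<in> borel_measurable (lebesgue_on \<Omega>)" "d' \<in> borel_measurable (lebesgue_on \<Omega>)"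
        using has_weak_grad_measurable[OF \<Omega>(1) hd] unfolding d_def d'_def by auto
      have d'im: "(\<lambda>x. d' x $ i) \<in> borel_measurable (lebesgue_on \<Omega>)"
        using dm(2) borel_measurable_euclidean_space[of d'] by (auto simp: Basis_vec_def inner_axis)
      obtain c0 where c0: "\<And>x. \<bar>\<phi> n x\<bar> \<le> c0" using test_fun_bounded[OF \<phi>] by blast
      have gL: "norm (grad (\<phi> n) x) \<le> L" for x
        using grad_close_of_local_bound[OF test_fun_differentiable[OF \<phi>[of n]], of 1 x 0 L] L by simp
      have dB: "AE x in lebesgue_on \<Omega>. \<bar>d x\<bar> \<le> c0 + B"
        using uAE by eventually_elim (use c0 in \<open>auto simp: d_def intro: order_trans[OF abs_triangle_ineq4] add_mono\<close>)
      have d'B: "AE x in lebesgue_on \<Omega>. norm (d' x) \<le> L + M"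
        using gM by eventually_elim (use gL in \<open>auto simp: d'_def intro: order_trans[OF norm_triangle_ineq4] add_mono\<close>)
      have d'iB: "AE x in lebesgue_on \<Omega>. \<bar>d' x $ i\<bar> \<le> L + M"
        using d'B by eventually_elim (use component_le_norm_cart order_trans in blast)
      have dsq: "integrable (lebesgue_on \<Omega>) (\<lambda>x. (d x)\<^sup>2)" by (rule sqi[OF dm(1) dB])
      have d'isq: "integrable (lebesgue_on \<Omega>) (\<lambda>x. (d' x $ i)\<^sup>2)" by (rule sqi[OF d'im d'iB])
      have d'sq: "integrable (lebesgue_on \<Omega>) (\<lambda>x. (norm (d' x))\<^sup>2)"
        using L2_bounded[OF \<Omega>m \<Omega>(2) dm(2) d'B] unfolding L2_def by simp
      note cs1 = integral_Cauchy_Schwarz[OF dm(1) tm(2) dsq t2(2)]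
      note cs2 = integral_Cauchy_Schwarz[OF d'im tm(1) d'isq t2(1)]
      have "(\<integral>x. \<phi> n x * \<theta>' x \<partial>lebesgue_on UNIV) = - (\<integral>x. grad (\<phi> n) x $ i * \<theta> x \<partial>lebesgue_on UNIV)"
        using hw[of UNIV] \<theta> unfolding has_weak_grad_def \<theta>'_def by simp
      moreover have "(\<integral>x. \<phi> n x * \<theta>' x \<partial>lebesgue_on UNIV) = (\<integral>x. \<phi> n x * \<theta>' x \<partial>lebesgue_on \<Omega>)"
        unfolding integral_lebesgue_on_eq[OF \<Omega>m] lebesgue_on_UNIV_eq using test_fun_zero[OF \<phi>[of n]]
        by (intro Bochner_Integration.integral_cong) (auto simp: indicator_def)
      moreover have "(\<integral>x. grad (\<phi> n) x $ i * \<theta> x \<partial>lebesgue_on UNIV) = (\<integral>x. grad (\<phi> n) x $ i * \<theta> x \<partial>lebesgue_on \<Omega>)"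
        unfolding integral_lebesgue_on_eq[OF \<Omega>m] lebesgue_on_UNIV_eq using test_fun_zero[OF test_fun_grad[OF \<phi>[of n]]]
        by (intro Bochner_Integration.integral_cong) (auto simp: indicator_def)
      ultimately have z: "(\<integral>x. \<phi> n x * \<theta>' x \<partial>lebesgue_on \<Omega>) + (\<integral>x. grad (\<phi> n) x $ i * \<theta> x \<partial>lebesgue_on \<Omega>) = 0" by simp
      have iu: "integrable (lebesgue_on \<Omega>) (\<lambda>x. u x * \<theta>' x)"
        by (rule integral_Cauchy_Schwarz(1)[OF m(2) tm(2) sqi[OF m(2) uAE] t2(2)])
      have ig: "integrable (lebesgue_on \<Omega>) (\<lambda>x. g x $ i * \<theta> x)"
        by (rule integral_Cauchy_Schwarz(1)[OF gim tm(1) sqi[OF gim giM] t2(1)])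
      have "(\<integral>x. d x * \<theta>' x \<partial>lebesgue_on \<Omega>) = (\<integral>x. \<phi> n x * \<theta>' x \<partial>lebesgue_on \<Omega>) - (\<integral>x. u x * \<theta>' x \<partial>lebesgue_on \<Omega>)"
      proof -
        have "integrable (lebesgue_on \<Omega>) (\<lambda>x. d x * \<theta>' x + u x * \<theta>' x)" using cs1(1) iu by simp
        then have "integrable (lebesgue_on \<Omega>) (\<lambda>x. \<phi> n x * \<theta>' x)" by (simp add: d_def algebra_simps)
        then show ?thesis using iu by (simp add: d_def left_diff_distrib)
      qed
      moreover have "(\<integral>x. d' x $ i * \<theta> x \<partial>lebesgue_on \<Omega>) = (\<integral>x. grad (\<phi> n) x $ i * \<theta> x \<partial>lebesgue_on \<Omega>) - (\<integral>x. g x $ i * \<theta> x \<partial>lebesgue_on \<Omega>)"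
      proof -
        have "integrable (lebesgue_on \<Omega>) (\<lambda>x. d' x $ i * \<theta> x + g x $ i * \<theta> x)" using cs2(1) ig by simp
        then have "integrable (lebesgue_on \<Omega>) (\<lambda>x. grad (\<phi> n) x $ i * \<theta> x)" by (simp add: d'_def algebra_simps)
        then show ?thesis using ig by (simp add: d'_def left_diff_distrib)
      qed
      ultimately have "I = - ((\<integral>x. d x * \<theta>' x \<partial>lebesgue_on \<Omega>) + (\<integral>x. d' x $ i * \<theta> x \<partial>lebesgue_on \<Omega>))"
        using z unfolding I_def by simp
      then have "\<bar>I\<bar> \<le> \<bar>\<integral>x. d x * \<theta>' x \<partial>lebesgue_on \<Omega>\<bar> + \<bar>\<integral>x. d' x $ i * \<theta> x \<partial>lebesgue_on \<Omega>\<bar>" by simp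
      also have "\<dots> \<le> norm_L2 \<Omega> d * norm_L2 \<Omega> \<theta>' + norm_L2 \<Omega> d' * norm_L2 \<Omega> \<theta>"
      proof (intro add_mono)
        show "\<bar>\<integral>x. d x * \<theta>' x \<partial>lebesgue_on \<Omega>\<bar> \<le> norm_L2 \<Omega> d * norm_L2 \<Omega> \<theta>'"
          using cs1(2) by (simp add: norm_L2_def)
        have "(\<integral>x. (d' x $ i)\<^sup>2 \<partial>lebesgue_on \<Omega>) \<le> (\<integral>x. (norm (d' x))\<^sup>2 \<partial>lebesgue_on \<Omega>)"
          using d'isq d'sq by (intro integral_mono) (auto simp: component_le_norm_cart abs_le_square_iff[symmetric])
        then have "sqrt (\<integral>x. (d' x $ i)\<^sup>2 \<partial>lebesgue_on \<Omega>) \<le> norm_L2 \<Omega> d'" by (simp add: norm_L2_def)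
        then have "sqrt (\<integral>x. (d' x $ i)\<^sup>2 \<partial>lebesgue_on \<Omega>) * sqrt (\<integral>x. (\<theta> x)\<^sup>2 \<partial>lebesgue_on \<Omega>) \<le> norm_L2 \<Omega> d' * norm_L2 \<Omega> \<theta>"
          by (intro mult_mono) (auto simp: norm_L2_def)
        then show "\<bar>\<integral>x. d' x $ i * \<theta> x \<partial>lebesgue_on \<Omega>\<bar> \<le> norm_L2 \<Omega> d' * norm_L2 \<Omega> \<theta>"
          using cs2(2) by linarith
      qed
      also have "\<dots> \<le> norm_H1 \<Omega> d * norm_L2 \<Omega> \<theta>' + norm_H1 \<Omega> d * norm_L2 \<Omega> \<theta>"
      proof -
        have "norm_L2 \<Omega> (weak_grad \<Omega> d) = norm_L2 \<Omega> d'"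
          unfolding norm_L2_def
        proof (rule arg_cong[of _ _ sqrt], rule integral_cong_AE)
          show "(\<lambda>x. (norm (weak_grad \<Omega> d x))\<^sup>2) \<in> borel_measurable (lebesgue_on \<Omega>)"
            using has_weak_grad_measurable(1)[OF \<Omega>(1) has_weak_grad_weak_grad[OF hd]] by (simp add: d_def)
          show "(\<lambda>x. (norm (d' x))\<^sup>2) \<in> borel_measurable (lebesgue_on \<Omega>)" using dm(2) by simp
          show "AE x in lebesgue_on \<Omega>. (norm (weak_grad \<Omega> d x))\<^sup>2 = (norm (d' x))\<^sup>2"
            using weak_grad_AE[OF \<Omega>(1) hd] unfolding d_def d'_def by eventually_elim simp
        qed
        then have "norm_L2 \<Omega> d \<le> norm_H1 \<Omega> d" "norm_L2 \<Omega> d' \<le> norm_H1 \<Omega> d"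
          unfolding norm_H1_def by (auto intro!: real_le_rsqrt)
        then show ?thesis by (intro add_mono mult_right_mono) (auto simp: norm_L2_def)
      qed
      finally show ?thesis by (simp add: d_def distrib_left)
    qed
    have "(\<lambda>n. norm_H1 \<Omega> (\<lambda>x. \<phi> n x - u x) * (norm_L2 \<Omega> \<theta>' + norm_L2 \<Omega> \<theta>)) \<longlonglongrightarrow> 0"
      by (rule tendsto_mult_left_zero[OF lim])
    then have "\<bar>I\<bar> \<le> 0" by (rule LIMSEQ_le_const) (use bound in blast)
    then have I0: "(\<integral>x. u x * \<theta>' x \<partial>lebesgue_on \<Omega>) = - (\<integral>x. g x $ i * \<theta> x \<partial>lebesgue_on \<Omega>)" unfolding I_def by simp
    have "(\<integral>x. ?u x * \<theta>' x \<partial>lebesgue) = (\<integral>x. u x * \<theta>' x \<partial>lebesgue_on \<Omega>)"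
      unfolding integral_lebesgue_on_eq[OF \<Omega>m]
      by (intro Bochner_Integration.integral_cong) (auto simp: indicator_def)
    moreover have "(\<integral>x. ?g x $ i * \<theta> x \<partial>lebesgue) = (\<integral>x. g x $ i * \<theta> x \<partial>lebesgue_on \<Omega>)"
      unfolding integral_lebesgue_on_eq[OF \<Omega>m]
      by (intro Bochner_Integration.integral_cong) (auto simp: indicator_def)
    ultimately show ?thesis using I0 by (simp add: lebesgue_on_UNIV_eq \<theta>'_def)
  qed
  ultimately show ?thesis unfolding has_weak_grad_def by blast
qed

text \<open>Continued by zero, u has a bounded weak gradient on the whole space and is therefore
  Lipschitz between points of continuity. Comparing a point x of \<Omega> with a point y outside its
  closure gives |u x| \<le> M |x - y|, and both may tend to z. The argument needs exterior points
  arbitrarily close to z, at which the extension is zero and continuous.\<close>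

lemma H10_zero_on_frontier:
  fixes u :: "real^'n \<Rightarrow> real"
  assumes \<Omega>: "open \<Omega>" "bounded \<Omega>" and u: "H10 \<Omega> u"
    and wg: "has_weak_grad \<Omega> u g" and gM: "AE x in lebesgue_on \<Omega>. norm (g x) \<le> M" "0 \<le> M"
    and cont: "continuous_on (closure \<Omega>) u"
    and z: "z \<in> frontier \<Omega>" "z \<in> closure (- closure \<Omega>)"
  shows "u z = 0"
proof -
  have \<Omega>m: "\<Omega> \<in> sets lebesgue" by (rule open_sets_lebesgue[OF \<Omega>(1)])
  have comp: "compact (closure \<Omega>)" using \<Omega>(2) by simp
  have "bounded (u ` closure \<Omega>)" by (intro compact_imp_bounded compact_continuous_image cont comp)
  then obtain B where B: "\<And>x. x \<in> closure \<Omega> \<Longrightarrow> \<bar>u x\<bar> \<le> B" unfolding bounded_iff by auto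
  have B': "\<And>x. x \<in> \<Omega> \<Longrightarrow> \<bar>u x\<bar> \<le> B" using B closure_subset[of \<Omega>] by auto
  define w where "w = (\<lambda>x. if x \<in> \<Omega> then u x else 0)"
  define k where "k = (\<lambda>x. if x \<in> \<Omega> then g x else 0)"
  have hw: "has_weak_grad UNIV w k" unfolding w_def k_def by (rule H10_zero_extension[OF \<Omega> u wg gM(1) B'])
  have wi: "integrable lebesgue w"
  proof (rule integrable_bounded_compact_support[OF _ comp])
    show "w \<in> borel_measurable lebesgue"
      unfolding w_def using has_weak_grad_measurable(2)[OF \<Omega>(1) wg] \<Omega>m by (intro borel_measurable_if_I)
    show "\<bar>w x\<bar> \<le> B * indicator (closure \<Omega>) x" for x
      using B'[of x] B[of x] closure_subset[of \<Omega>] by (cases "x \<in> \<Omega>"; cases "x \<in> closure \<Omega>") (auto simp: w_def)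
  qed
  have kM: "AE x in lebesgue_on UNIV. norm (k x) \<le> M"
    using gM(1)[unfolded AE_lebesgue_on_iff[OF \<Omega>m]] unfolding lebesgue_on_UNIV_eq
    by eventually_elim (use gM(2) in \<open>auto simp: k_def\<close>)
  have key: "\<bar>u x\<bar> \<le> M * norm (x - y)" if "x \<in> \<Omega>" "y \<notin> closure \<Omega>" for x y
  proof -
    have cx: "isCont w x"
    proof -
      have "isCont u x"
        using cont that(1) closure_subset[of \<Omega>] \<Omega>(1) continuous_on_subset continuous_on_eq_continuous_at by metis
      moreover have "\<forall>\<^sub>F y in nhds x. u y = w y"
        using \<Omega>(1) that(1) unfolding eventually_nhds by (auto simp: w_def)
      ultimately show ?thesis using isCont_cong by blast
    qed
    have cy: "isCont w y"
    proof -
      have "\<forall>\<^sub>F x in nhds y. (\<lambda>_. 0) x = w x"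
        using that(2) closure_subset[of \<Omega>] unfolding eventually_nhds
        by (intro exI[of _ "- closure \<Omega>"]) (auto simp: w_def)
      moreover have "isCont (\<lambda>_. 0::real) y" by simp
      ultimately show ?thesis using isCont_cong[of "\<lambda>_. 0" w y] by simp
    qed
    have "\<bar>w x - w y\<bar> \<le> M * norm (x - y)"
      by (rule weak_grad_bounded_lipschitz[OF open_UNIV hw wi open_UNIV convex_UNIV subset_UNIV kM gM(2) UNIV_I cx UNIV_I cy])
    moreover have "y \<notin> \<Omega>" using that(2) closure_subset[of \<Omega>] by auto
    ultimately show ?thesis using that by (simp add: w_def)
  qed
  have zc: "z \<in> closure \<Omega>" using z(1) unfolding frontier_def by blast
  then obtain xs where xs: "\<And>n. xs n \<in> \<Omega>" "xs \<longlonglongrightarrow> z" using closure_sequential by metis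
  obtain ys where ys: "\<And>n. ys n \<in> - closure \<Omega>" "ys \<longlonglongrightarrow> z" using z(2) closure_sequential by metis
  have "(\<lambda>n. u (xs n)) \<longlonglongrightarrow> u z"
    by (rule continuous_on_tendsto_compose[OF cont xs(2) zc]) (use xs(1) closure_subset[of \<Omega>] in \<open>auto intro!: always_eventually\<close>)
  moreover have "(\<lambda>n. u (xs n)) \<longlonglongrightarrow> 0"
  proof (rule Lim_null_comparison)
    show "\<forall>\<^sub>F n in sequentially. norm (u (xs n)) \<le> M * norm (xs n - ys n)"
      using key xs(1) ys(1) by (intro always_eventually) auto
    have "(\<lambda>n. M * norm (xs n - ys n)) \<longlonglongrightarrow> M * norm (z - z)" by (intro tendsto_intros xs ys)
    then show "(\<lambda>n. M * norm (xs n - ys n)) \<longlonglongrightarrow> 0" by simp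
  qed
  ultimately show ?thesis by (rule LIMSEQ_unique)
qed

section \<open>Polynomials\<close>

definition monomial :: "('n \<Rightarrow> nat) \<Rightarrow> real^'n \<Rightarrow> real" where
  "monomial \<alpha> x = (\<Prod>i\<in>UNIV. (x $ i) ^ \<alpha> i)"

lemma finite_multi_indices: "finite {\<alpha>::'n::finite \<Rightarrow> nat. (\<Sum>i\<in>UNIV. \<alpha> i) \<le> r}"
proof (rule finite_subset)
  show "{\<alpha>::'n \<Rightarrow> nat. (\<Sum>i\<in>UNIV. \<alpha> i) \<le> r} \<subseteq> PiE UNIV (\<lambda>_. {..r})"
  proof
    fix \<alpha> :: "'n \<Rightarrow> nat" assume "\<alpha> \<in> {\<alpha>. (\<Sum>i\<in>UNIV. \<alpha> i) \<le> r}"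
    then have "\<alpha> i \<le> r" for i
      using member_le_sum[of i UNIV \<alpha>] by (simp add: le_trans[of "\<alpha> i" "sum \<alpha> UNIV" r])
    then show "\<alpha> \<in> PiE UNIV (\<lambda>_. {..r})" by (simp add: PiE_UNIV_domain)
  qed
qed (simp add: finite_PiE)

lemma poly_le_iff: "poly_le r p \<longleftrightarrow> (\<exists>c. \<forall>x. p x = (\<Sum>\<alpha> | (\<Sum>i\<in>UNIV. \<alpha> i) \<le> r. c \<alpha> * monomial \<alpha> x))"
  unfolding poly_le_def monomial_def by simp

lemma poly_le_monomial:
  assumes "(\<Sum>i\<in>UNIV. \<alpha> i) \<le> r" shows "poly_le r (monomial \<alpha>)"
  unfolding poly_le_iff
proof (intro exI[of _ "\<lambda>\<beta>. if \<beta> = \<alpha> then 1 else 0"] allI)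
  fix x
  have "(\<Sum>\<beta> | (\<Sum>i\<in>UNIV. \<beta> i) \<le> r. (if \<beta> = \<alpha> then 1 else 0) * monomial \<beta> x) =
      (\<Sum>\<beta> | (\<Sum>i\<in>UNIV. \<beta> i) \<le> r. if \<beta> = \<alpha> then monomial \<beta> x else 0)"
    by (intro sum.cong) auto
  also have "\<dots> = monomial \<alpha> x" using assms by (simp add: sum.delta[OF finite_multi_indices])
  finally show "monomial \<alpha> x = (\<Sum>\<beta> | (\<Sum>i\<in>UNIV. \<beta> i) \<le> r. (if \<beta> = \<alpha> then 1 else 0) * monomial \<beta> x)" by simp
qed

lemma poly_le_add: "poly_le r p \<Longrightarrow> poly_le r q \<Longrightarrow> poly_le r (\<lambda>x. p x + q x)"
proof -
  assume "poly_le r p" "poly_le r q"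
  then obtain c d where "\<And>x. p x = (\<Sum>\<alpha> | (\<Sum>i\<in>UNIV. \<alpha> i) \<le> r. c \<alpha> * monomial \<alpha> x)"
    "\<And>x. q x = (\<Sum>\<alpha> | (\<Sum>i\<in>UNIV. \<alpha> i) \<le> r. d \<alpha> * monomial \<alpha> x)" unfolding poly_le_iff by blast
  then show ?thesis unfolding poly_le_iff
    by (intro exI[of _ "\<lambda>\<alpha>. c \<alpha> + d \<alpha>"]) (simp add: distrib_right sum.distrib)
qed

lemma poly_le_cmult: "poly_le r p \<Longrightarrow> poly_le r (\<lambda>x. a * p x)"
proof -
  assume "poly_le r p"
  then obtain c where "\<And>x. p x = (\<Sum>\<alpha> | (\<Sum>i\<in>UNIV. \<alpha> i) \<le> r. c \<alpha> * monomial \<alpha> x)" unfolding poly_le_iff by blast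
  then show ?thesis unfolding poly_le_iff
    by (intro exI[of _ "\<lambda>\<alpha>. a * c \<alpha>"]) (simp add: sum_distrib_left mult.assoc)
qed

lemma poly_le_const: "poly_le r (\<lambda>x. a)"
  using poly_le_cmult[OF poly_le_monomial[of "\<lambda>_. 0" r], of a] by (simp add: monomial_def)

lemma poly_le_diff: "poly_le r p \<Longrightarrow> poly_le r q \<Longrightarrow> poly_le r (\<lambda>x. p x - q x)"
  using poly_le_add[of r p "\<lambda>x. - 1 * q x"] poly_le_cmult[of r q "- 1"] by simp

lemma poly_le_sum: "(\<And>i. i \<in> I \<Longrightarrow> poly_le r (f i)) \<Longrightarrow> poly_le r (\<lambda>x. \<Sum>i\<in>I. f i x)"
  by (induction I rule: infinite_finite_induct) (auto simp: poly_le_const poly_le_add)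

lemma poly_le_component: "1 \<le> r \<Longrightarrow> poly_le r (\<lambda>x::real^'n. x $ i)"
proof -
  assume "1 \<le> r"
  then have "poly_le r (monomial (\<lambda>j. if j = i then 1 else 0))" by (intro poly_le_monomial) simp
  moreover have "monomial (\<lambda>j. if j = i then 1 else 0) = (\<lambda>x::real^'n. x $ i)"
    unfolding monomial_def by (rule ext, subst prod.remove[of UNIV i]) (auto intro!: prod.neutral)
  ultimately show ?thesis by (simp only:)
qed

lemma poly_le_mult:
  assumes p: "poly_le r p" and q: "poly_le s q" shows "poly_le (r + s) (\<lambda>x. p x * q x)"
proof -
  obtain c where c: "\<And>x. p x = (\<Sum>\<alpha> | (\<Sum>i\<in>UNIV. \<alpha> i) \<le> r. c \<alpha> * monomial \<alpha> x)" using p unfolding poly_le_iff by blast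
  obtain d where d: "\<And>x. q x = (\<Sum>\<beta> | (\<Sum>i\<in>UNIV. \<beta> i) \<le> s. d \<beta> * monomial \<beta> x)" using q unfolding poly_le_iff by blast
  have "poly_le (r + s) (\<lambda>x. \<Sum>\<alpha> | (\<Sum>i\<in>UNIV. \<alpha> i) \<le> r. \<Sum>\<beta> | (\<Sum>i\<in>UNIV. \<beta> i) \<le> s.
      (c \<alpha> * d \<beta>) * monomial (\<lambda>i. \<alpha> i + \<beta> i) x)"
    by (intro poly_le_sum poly_le_cmult poly_le_monomial) (auto simp: sum.distrib)
  moreover have "p x * q x = (\<Sum>\<alpha> | (\<Sum>i\<in>UNIV. \<alpha> i) \<le> r. \<Sum>\<beta> | (\<Sum>i\<in>UNIV. \<beta> i) \<le> s.
      (c \<alpha> * d \<beta>) * monomial (\<lambda>i. \<alpha> i + \<beta> i) x)" for x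
    unfolding c d sum_product by (intro sum.cong refl) (simp add: monomial_def power_add prod.distrib)
  ultimately show ?thesis by simp
qed

lemma poly_le_prod:
  "finite I \<Longrightarrow> (\<And>i. i \<in> I \<Longrightarrow> poly_le (d i) (f i)) \<Longrightarrow> poly_le (sum d I) (\<lambda>x. \<Prod>i\<in>I. f i x)"
  by (induction I rule: finite_induct) (auto simp: poly_le_const poly_le_mult)

lemma Ck_component: "Ck k (\<lambda>x::real^'n. x $ i)"
proof (cases k)
  case 0
  then show ?thesis by (auto intro!: continuous_intros)
next
  case (Suc j)
  have d: "((\<lambda>x::real^'n. x $ i) has_derivative (\<lambda>h. h $ i)) (at x)" for x
    by (intro bounded_linear_imp_has_derivative bounded_linear_vec_nth)
  have "(\<lambda>x. grad (\<lambda>x::real^'n. x $ i) x $ l) = (\<lambda>x. axis l 1 $ i)" for l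
    using grad_eqI[OF d] by (auto simp: fun_eq_iff)
  then show ?thesis unfolding Suc using d by (auto simp: differentiable_def Ck_const)
qed

lemma Ck_poly_le: "poly_le r (p :: real^'n \<Rightarrow> real) \<Longrightarrow> Ck k p"
proof -
  assume "poly_le r p"
  then obtain c where c: "\<And>x. p x = (\<Sum>\<alpha> | (\<Sum>i\<in>UNIV. \<alpha> i) \<le> r. c \<alpha> * monomial \<alpha> x)" unfolding poly_le_iff by blast
  have pw: "Ck k (\<lambda>x::real^'n. (x $ i) ^ m)" for i :: 'n and m
    by (induction m) (auto simp: Ck_const Ck_mult Ck_component)
  have mon: "Ck k (monomial \<alpha> :: real^'n \<Rightarrow> real)" for \<alpha>
    unfolding monomial_def[abs_def] by (intro Ck_prod pw) simp
  have "Ck k (\<lambda>x::real^'n. \<Sum>\<alpha>\<in>I. c \<alpha> * monomial \<alpha> x)" for I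
    by (induction I rule: infinite_finite_induct) (auto simp: Ck_const Ck_add Ck_mult mon)
  moreover have "p = (\<lambda>x. \<Sum>\<alpha> | (\<Sum>i\<in>UNIV. \<alpha> i) \<le> r. c \<alpha> * monomial \<alpha> x)" using c by blast
  ultimately show ?thesis by simp
qed

lemma poly_le_continuous: "poly_le r p \<Longrightarrow> continuous_on S p"
  using Ck_poly_le[of r p 0] continuous_on_subset[OF _ subset_UNIV] by auto

lemma poly_le_differentiable: "poly_le r p \<Longrightarrow> p differentiable (at x)"
  using Ck_poly_le[of r p "Suc 0"] by auto

lemma poly_le_continuous_grad: "poly_le r p \<Longrightarrow> continuous_on S (grad p)"
proof -
  assume "poly_le r p"
  then have "continuous_on UNIV (\<lambda>x. grad p x $ i)" for i
    using Ck_poly_le[of r p "Suc 0"] by auto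
  then show ?thesis
    unfolding continuous_on_componentwise[of S "grad p"]
    by (auto simp: Basis_vec_def inner_axis intro: continuous_on_subset[OF _ subset_UNIV])
qed

lemma grad_onorm_le:
  fixes c :: "real^'n"
  assumes "norm c \<le> B" shows "onorm (\<lambda>h. c \<bullet> h) \<le> B"
proof (rule onorm_le)
  fix h
  have "\<bar>c \<bullet> h\<bar> \<le> norm c * norm h" by (rule Cauchy_Schwarz_ineq2)
  also have "\<dots> \<le> B * norm h" using assms by (intro mult_right_mono) auto
  finally show "norm (c \<bullet> h) \<le> B * norm h" by simp
qed

text \<open>Continuity of the gradient suffices: the mean value inequality is applied on a small
  ball to p minus its linear part at x.\<close>

lemma poly_le_strictly_differentiable:
  assumes p: "poly_le r p" shows "strictly_differentiable p x"
  unfolding strictly_differentiable_def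
proof (intro conjI allI impI poly_le_differentiable[OF p])
  fix \<eta> :: real assume \<eta>: "\<eta> > 0"
  have "isCont (grad p) x" using poly_le_continuous_grad[OF p, of UNIV] by (simp add: continuous_on_eq_continuous_at)
  then obtain d where d: "d > 0" "\<And>y. dist y x < d \<Longrightarrow> dist (grad p y) (grad p x) < \<eta>"
    using \<eta> unfolding continuous_at_eps_delta by blast
  have "\<bar>p y - p z - grad p x \<bullet> (y - z)\<bar> \<le> \<eta> * norm (y - z)" if "y \<in> ball x d" "z \<in> ball x d" for y z
  proof -
    have "norm ((p y - grad p x \<bullet> y) - (p z - grad p x \<bullet> z)) \<le> \<eta> * norm (y - z)"
    proof (rule differentiable_bound[OF convex_ball[of x d]])
      fix y assume y: "y \<in> ball x d"
      show "((\<lambda>y. p y - grad p x \<bullet> y) has_derivative (\<lambda>h. (grad p y - grad p x) \<bullet> h)) (at y within ball x d)"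
        unfolding inner_diff_left
        by (intro has_derivative_diff has_derivative_at_withinI[OF has_derivative_grad[OF poly_le_differentiable[OF p]]]
            bounded_linear_imp_has_derivative bounded_linear_inner_right)
      show "onorm (\<lambda>h. (grad p y - grad p x) \<bullet> h) \<le> \<eta>"
        using d(2)[of y] y by (intro grad_onorm_le) (auto simp: dist_norm norm_minus_commute)
    qed (use that in auto)
    then show ?thesis by (simp add: inner_diff_right algebra_simps)
  qed
  with d(1) show "\<exists>d>0. \<forall>y\<in>ball x d. \<forall>z\<in>ball x d. \<bar>p y - p z - grad p x \<bullet> (y - z)\<bar> \<le> \<eta> * norm (y - z)" by blast
qed

lemma poly_le_lipschitz_compact:
  assumes p: "poly_le r p" and K: "compact K" "convex K"
  shows "\<exists>M\<ge>0. \<forall>x\<in>K. norm (grad p x) \<le> M \<and> (\<forall>y\<in>K. \<bar>p x - p y\<bar> \<le> M * norm (x - y))"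
proof -
  have "bounded (grad p ` K)"
    by (intro compact_imp_bounded compact_continuous_image poly_le_continuous_grad[OF p] K)
  then obtain M where M: "\<And>x. x \<in> K \<Longrightarrow> norm (grad p x) \<le> M" unfolding bounded_iff by auto
  have "norm (p x - p y) \<le> \<bar>M\<bar> * norm (x - y)" if "x \<in> K" "y \<in> K" for x y
  proof (rule differentiable_bound[OF K(2)])
    fix z assume "z \<in> K"
    show "(p has_derivative (\<lambda>h. grad p z \<bullet> h)) (at z within K)"
      by (rule has_derivative_at_withinI[OF has_derivative_grad[OF poly_le_differentiable[OF p]]])
    show "onorm (\<lambda>h. grad p z \<bullet> h) \<le> \<bar>M\<bar>" using M[OF \<open>z \<in> K\<close>] by (intro grad_onorm_le) auto
  qed (use that in auto)
  then show ?thesis using M by (intro exI[of _ "\<bar>M\<bar>"]) (auto intro: order_trans[OF _ abs_ge_self])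
qed

section \<open>Polynomials along lines, extrapolation and inverse estimates\<close>

lemma poly_le_line:
  assumes p: "poly_le r (p :: real^'n \<Rightarrow> real)"
  shows "\<exists>q. degree q \<le> r \<and> (\<forall>t. p (a + t *\<^sub>R d) = poly q t)"
proof -
  obtain c where c: "\<And>x. p x = (\<Sum>\<alpha> | (\<Sum>i\<in>UNIV. \<alpha> i) \<le> r. c \<alpha> * monomial \<alpha> x)" using p unfolding poly_le_iff by blast
  define m where "m \<alpha> = (\<Prod>i\<in>UNIV. [:a $ i, d $ i:] ^ \<alpha> i)" for \<alpha>
  have dm: "degree (m \<alpha>) \<le> (\<Sum>i\<in>UNIV. \<alpha> i)" for \<alpha>
  proof -
    have "degree (m \<alpha>) \<le> (\<Sum>i\<in>UNIV. degree ([:a $ i, d $ i:] ^ \<alpha> i))"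
      unfolding m_def using degree_prod_sum_le[of UNIV "\<lambda>i. [:a $ i, d $ i:] ^ \<alpha> i"] by (simp add: o_def)
    also have "\<dots> \<le> (\<Sum>i\<in>UNIV. \<alpha> i)"
    proof (rule sum_mono)
      fix i
      have "degree ([:a $ i, d $ i:] ^ \<alpha> i) \<le> degree [:a $ i, d $ i:] * \<alpha> i" by (rule degree_power_le)
      also have "\<dots> \<le> 1 * \<alpha> i" by (intro mult_right_mono) auto
      finally show "degree ([:a $ i, d $ i:] ^ \<alpha> i) \<le> \<alpha> i" by simp
    qed
    finally show ?thesis .
  qed
  have pm: "poly (m \<alpha>) t = monomial \<alpha> (a + t *\<^sub>R d)" for \<alpha> t
    unfolding m_def monomial_def by (simp add: poly_prod)
  define q where "q = (\<Sum>\<alpha> | (\<Sum>i\<in>UNIV. \<alpha> i) \<le> r. smult (c \<alpha>) (m \<alpha>))"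
  have "degree q \<le> r"
    unfolding q_def using dm
    by (intro degree_sum_le finite_multi_indices) (auto intro: order_trans[OF degree_smult_le] order_trans)
  moreover have "p (a + t *\<^sub>R d) = poly q t" for t
    unfolding q_def c by (simp add: poly_sum pm)
  ultimately show ?thesis by blast
qed

lemma pderiv_sum: "pderiv (\<Sum>i\<in>A. f i) = (\<Sum>i\<in>A. pderiv (f i))"
  by (induction A rule: infinite_finite_induct) (auto simp: pderiv_add)

text \<open>A polynomial of degree at most r is determined by its values at r + 1 points, so value
  and derivative at 0 are fixed combinations of them; the weights are the values and derivatives of
  the Lagrange basis at 0. Keeping the points at distance at least 1/2 from 0 bounds the Jacobians
  of the dilations by \<open>s j\<close> from below.\<close>

lemma univariate_extrapolation:
  "\<exists>(s::nat \<Rightarrow> real) a b. (\<forall>j. 1/2 \<le> s j \<and> (j \<le> r \<longrightarrow> s j \<le> 1)) \<and>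
     (\<forall>q. degree q \<le> r \<longrightarrow> poly q 0 = (\<Sum>j\<le>r. a j * poly q (s j)) \<and>
        poly (pderiv q) 0 = (\<Sum>j\<le>r. b j * poly q (s j)))"
proof -
  define s :: "nat \<Rightarrow> real" where "s j = 1/2 + real j / (2 * (real r + 1))" for j
  have s: "1/2 \<le> s j \<and> (j \<le> r \<longrightarrow> s j \<le> 1)" for j by (auto simp: s_def field_simps)
  have inj: "s i = s j \<longleftrightarrow> i = j" for i j by (simp add: s_def)
  define l where "l j = (\<Prod>k\<in>{..r} - {j}. smult (1 / (s j - s k)) [:- s k, 1:])" for j
  have dl: "degree (l j) \<le> r" if "j \<le> r" for j
  proof -
    have "degree (l j) \<le> (\<Sum>k\<in>{..r} - {j}. degree (smult (1 / (s j - s k)) [:- s k, 1:]))"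
      unfolding l_def using degree_prod_sum_le[of "{..r} - {j}" "\<lambda>k. smult (1 / (s j - s k)) [:- s k, 1:]"] by (simp add: o_def)
    also have "\<dots> \<le> (\<Sum>k\<in>{..r} - {j}. 1)" by (intro sum_mono) simp
    also have "\<dots> = r" using that by simp
    finally show ?thesis .
  qed
  have pl: "poly (l j) (s i) = (if i = j then 1 else 0)" if "i \<le> r" "j \<le> r" for i j
  proof (cases "i = j")
    case True
    have "poly (smult (1 / (s j - s k)) [:- s k, 1:]) (s j) = 1" if "k \<noteq> j" for k
    proof -
      have "s j - s k \<noteq> 0" using inj[of j k] that by simp
      then show ?thesis by (simp flip: diff_divide_distrib)
    qed
    then have "poly (l j) (s j) = 1" unfolding l_def poly_prod by (intro prod.neutral) auto
    then show ?thesis using True by simp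
  next
    case False
    have "poly (l j) (s i) = 0"
      unfolding l_def poly_prod by (rule prod_zero) (use that False in \<open>auto intro!: bexI[of _ i]\<close>)
    then show ?thesis using False by simp
  qed
  have rep: "q = (\<Sum>j\<le>r. smult (poly q (s j)) (l j))" if "degree q \<le> r" for q
  proof (rule poly_eqI_degree[of "s ` {..r}"])
    have card: "card (s ` {..r}) = Suc r" using inj by (subst card_image) (auto simp: inj_on_def)
    show "degree q < card (s ` {..r})" using that card by simp
    have "degree (\<Sum>j\<le>r. smult (poly q (s j)) (l j)) \<le> r"
      using dl by (intro degree_sum_le) (auto intro: order_trans[OF degree_smult_le])
    then show "degree (\<Sum>j\<le>r. smult (poly q (s j)) (l j)) < card (s ` {..r})" using card by simp
    fix x assume "x \<in> s ` {..r}"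
    then obtain i where i: "i \<le> r" "x = s i" by auto
    have "poly (\<Sum>j\<le>r. smult (poly q (s j)) (l j)) x = (\<Sum>j\<le>r. if i = j then poly q (s j) else 0)"
      unfolding i(2) poly_sum using pl[OF i(1)] by (intro sum.cong) auto
    also have "\<dots> = poly q x" using i by simp
    finally show "poly q x = poly (\<Sum>j\<le>r. smult (poly q (s j)) (l j)) x" by simp
  qed
  have "poly q 0 = (\<Sum>j\<le>r. poly (l j) 0 * poly q (s j)) \<and>
      poly (pderiv q) 0 = (\<Sum>j\<le>r. poly (pderiv (l j)) 0 * poly q (s j))" if "degree q \<le> r" for q
  proof
    have "poly q 0 = poly (\<Sum>j\<le>r. smult (poly q (s j)) (l j)) 0"
      by (rule arg_cong[OF rep[OF that], of "\<lambda>p. poly p 0"])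
    also have "\<dots> = (\<Sum>j\<le>r. poly (l j) 0 * poly q (s j))" unfolding poly_sum poly_smult by (simp only: mult.commute)
    finally show "poly q 0 = (\<Sum>j\<le>r. poly (l j) 0 * poly q (s j))" .
    have "poly (pderiv q) 0 = poly (pderiv (\<Sum>j\<le>r. smult (poly q (s j)) (l j))) 0"
      by (rule arg_cong[OF rep[OF that], of "\<lambda>p. poly (pderiv p) 0"])
    also have "\<dots> = (\<Sum>j\<le>r. poly (pderiv (l j)) 0 * poly q (s j))"
      unfolding pderiv_sum pderiv_smult poly_sum poly_smult by (simp only: mult.commute)
    finally show "poly (pderiv q) 0 = (\<Sum>j\<le>r. poly (pderiv (l j)) 0 * poly q (s j))" .
  qed
  note ext = this
  show ?thesis
    by (rule exI[of _ s], rule exI[of _ "\<lambda>j. poly (l j) 0"], rule exI[of _ "\<lambda>j. poly (pderiv (l j)) 0"],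
        intro conjI allI impI) (use s ext in \<open>blast+\<close>)
qed

text \<open>Extrapolating to \<open>x\<close> from the points \<open>x + s\<^sub>j (y - x)\<close> with \<open>s\<^sub>j \<ge> 1/2\<close> and integrating over \<open>y\<close>
  reduces the bound to finitely many dilations, with a constant that does not depend on the
  shape of \<open>D\<close>.\<close>

lemma poly_point_le_L2:
  "\<exists>C\<ge>0. \<forall>(p::real^'n \<Rightarrow> real) D x. poly_le r p \<longrightarrow> open D \<longrightarrow> bounded D \<longrightarrow>
     (\<forall>y\<in>D. \<forall>s. 1/2 \<le> s \<longrightarrow> s \<le> 1 \<longrightarrow> x + s *\<^sub>R (y - x) \<in> D) \<longrightarrow>
     measure lebesgue D * (p x)\<^sup>2 \<le> C * (\<integral>y. (p y)\<^sup>2 \<partial>lebesgue_on D)"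
proof -
  obtain s :: "nat \<Rightarrow> real" and a b where s: "\<And>j. 1/2 \<le> s j" "\<And>j. j \<le> r \<Longrightarrow> s j \<le> 1"
    and ab: "\<And>q. degree q \<le> r \<Longrightarrow> poly q 0 = (\<Sum>j\<le>r. a j * poly q (s j))"
    using univariate_extrapolation[of r] by blast
  define A where "A = (\<Sum>j\<le>r. (a j)\<^sup>2)"
  have A0: "A \<ge> 0" unfolding A_def by (simp add: sum_nonneg)
  \<comment> \<open>A is the Cauchy-Schwarz factor of the extrapolation, r + 1 the number of
    dilations, and \<open>2 ^ CARD('n)\<close> bounds the inverse Jacobian of each, since no
    dilation factor is below 1/2.\<close>
  define C where "C = A * (real (Suc r) * 2 ^ CARD('n))"
  have key: "measure lebesgue D * (p x)\<^sup>2 \<le> C * (\<integral>y. (p y)\<^sup>2 \<partial>lebesgue_on D)"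
    if p: "poly_le r p" and D: "open D" "bounded D"
      and star: "\<And>y s. y \<in> D \<Longrightarrow> 1/2 \<le> s \<Longrightarrow> s \<le> 1 \<Longrightarrow> x + s *\<^sub>R (y - x) \<in> D"
    for p :: "real^'n \<Rightarrow> real" and D x
  proof -
    have Dm: "D \<in> sets lebesgue" by (rule open_sets_lebesgue[OF D(1)])
    have Dl: "D \<in> lmeasurable" using Dm D(2) by (rule bounded_set_imp_lmeasurable[rotated])
    define f where "f y = indicator D y * (p y)\<^sup>2" for y
    define I where "I = (\<integral>y. f y \<partial>lebesgue)"
    have Ieq: "I = (\<integral>y. (p y)\<^sup>2 \<partial>lebesgue_on D)" unfolding I_def f_def integral_lebesgue_on_eq[OF Dm] by simp
    have pm: "p \<in> borel_measurable lebesgue" by (rule continuous_lebesgue_measurable[OF poly_le_continuous[OF p]])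
    have fi: "integrable lebesgue f"
    proof -
      have comp: "compact (closure D)" using D(2) by simp
      have "bounded (p ` closure D)"
        by (intro compact_imp_bounded compact_continuous_image poly_le_continuous[OF p] comp)
      then obtain B where B: "\<And>x. x \<in> closure D \<Longrightarrow> \<bar>p x\<bar> \<le> B" unfolding bounded_iff by auto
      show ?thesis
      proof (rule integrable_bounded_compact_support[OF _ comp])
        show "f \<in> borel_measurable lebesgue"
          unfolding f_def[abs_def] by (intro borel_measurable_times borel_measurable_indicator borel_measurable_power Dm pm)
        show "\<bar>f y\<bar> \<le> B\<^sup>2 * indicator (closure D) y" for y
        proof (cases "y \<in> D")
          case True
          then have "y \<in> closure D" using closure_subset by blast
          moreover from B[OF this] have "\<bar>p y\<bar>\<^sup>2 \<le> B\<^sup>2" by (intro power_mono) auto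
          ultimately show ?thesis using True by (simp add: f_def)
        qed (simp add: f_def)
      qed
    qed
    have fm: "f \<in> borel_measurable lebesgue" using fi by (rule borel_measurable_integrable)
    let ?T = "\<lambda>j y. (1 - s j) *\<^sub>R x + s j *\<^sub>R y"
    have Ti: "integrable lebesgue (\<lambda>y. f (?T j y))" and TI: "(\<integral>y. f (?T j y) \<partial>lebesgue) \<le> 2 ^ CARD('n) * I" for j
    proof -
      have sj: "s j > 0" using s(1)[of j] by linarith
      show "integrable lebesgue (\<lambda>y. f (?T j y))"
        using lebesgue_integral_affine(2)[of "s j" f "(1 - s j) *\<^sub>R x"] sj fi fm by simp
      have "I = \<bar>s j\<bar> ^ DIM(real^'n) * (\<integral>y. f (?T j y) \<partial>lebesgue)"
        unfolding I_def using sj by (intro lebesgue_integral_affine(1) fm) auto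
      then have e: "I = s j ^ CARD('n) * (\<integral>y. f (?T j y) \<partial>lebesgue)" using sj by simp
      have n: "0 \<le> (\<integral>y. f (?T j y) \<partial>lebesgue)" by (intro Bochner_Integration.integral_nonneg) (simp add: f_def)
      have "(1/2) ^ CARD('n) * (\<integral>y. f (?T j y) \<partial>lebesgue) \<le> I"
        unfolding e using s(1)[of j] n by (intro mult_right_mono power_mono) auto
      then show "(\<integral>y. f (?T j y) \<partial>lebesgue) \<le> 2 ^ CARD('n) * I"
        by (simp add: power_one_over field_simps)
    qed
    have pt: "indicator D y * (p x)\<^sup>2 \<le> A * (\<Sum>j\<le>r. f (?T j y))" for y
    proof (cases "y \<in> D")
      case True
      obtain q where q: "degree q \<le> r" "\<And>t. p (x + t *\<^sub>R (y - x)) = poly q t" using poly_le_line[OF p, of x "y - x"] by blast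
      have "p x = (\<Sum>j\<le>r. a j * poly q (s j))" using ab[OF q(1)] q(2)[of 0] by simp
      also have "\<dots>\<^sup>2 \<le> A * (\<Sum>j\<le>r. (poly q (s j))\<^sup>2)" unfolding A_def by (rule Cauchy_Schwarz_ineq_sum)
      also have "(\<Sum>j\<le>r. (poly q (s j))\<^sup>2) = (\<Sum>j\<le>r. f (?T j y))"
      proof (intro sum.cong refl)
        fix j assume "j \<in> {..r}"
        then have "x + s j *\<^sub>R (y - x) \<in> D" using star[OF True s(1) s(2)] by simp
        moreover have "x + s j *\<^sub>R (y - x) = ?T j y" by (simp add: algebra_simps)
        ultimately show "(poly q (s j))\<^sup>2 = f (?T j y)" using q(2)[of "s j"] by (simp add: f_def)
      qed
      finally show ?thesis using True by simp
    next
      case False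
      then show ?thesis using A0 by (auto simp: f_def intro!: mult_nonneg_nonneg sum_nonneg)
    qed
    have "measure lebesgue D * (p x)\<^sup>2 = (\<integral>y. indicator D y * (p x)\<^sup>2 \<partial>lebesgue)"
      using Dl by (simp add: lmeasurable_iff_integrable)
    also have "\<dots> \<le> (\<integral>y. A * (\<Sum>j\<le>r. f (?T j y)) \<partial>lebesgue)"
      using Dl Ti pt by (intro integral_mono) (auto simp: lmeasurable_iff_integrable)
    also have "\<dots> = A * (\<Sum>j\<le>r. (\<integral>y. f (?T j y) \<partial>lebesgue))" using Ti by simp
    also have "\<dots> \<le> A * (\<Sum>j\<le>r. 2 ^ CARD('n) * I)" by (intro mult_left_mono sum_mono TI A0)
    also have "\<dots> = C * I" by (simp add: C_def)
    finally show ?thesis unfolding Ieq .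
  qed
  have "C \<ge> 0" unfolding C_def using A0 by simp
  then show ?thesis by (intro exI[of _ C] conjI allI impI key) simp_all
qed

text \<open>Along the segment from x to a point y of K the derivative at x is extrapolated from
  values of p on K, which bounds \<open>grad p x \<bullet> (y - x)\<close> for every y in K. Taking
  for y two opposite points of the inscribed sphere, in the direction of the gradient, cancels x and
  leaves 2 \<rho> times the norm of the gradient.\<close>

lemma poly_grad_le_sup:
  "\<exists>C\<ge>0. \<forall>(p::real^'n \<Rightarrow> real) K z \<rho> x B. poly_le r p \<longrightarrow> convex K \<longrightarrow> 0 < \<rho> \<longrightarrow> cball z \<rho> \<subseteq> K \<longrightarrow>
     x \<in> K \<longrightarrow> (\<forall>y\<in>K. \<bar>p y\<bar> \<le> B) \<longrightarrow> norm (grad p x) \<le> C * B / \<rho>"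
proof -
  obtain s :: "nat \<Rightarrow> real" and a b where s: "\<And>j. 1/2 \<le> s j" "\<And>j. j \<le> r \<Longrightarrow> s j \<le> 1"
    and ab: "\<And>q. degree q \<le> r \<Longrightarrow> poly (pderiv q) 0 = (\<Sum>j\<le>r. b j * poly q (s j))"
    using univariate_extrapolation[of r] by blast
  define C where "C = (\<Sum>j\<le>r. \<bar>b j\<bar>)"
  have key: "norm (grad p x) \<le> C * B / \<rho>"
    if p: "poly_le r p" and K: "convex K" and \<rho>: "0 < \<rho>" "cball z \<rho> \<subseteq> K" and x: "x \<in> K" and B: "\<And>y. y \<in> K \<Longrightarrow> \<bar>p y\<bar> \<le> B"
    for p :: "real^'n \<Rightarrow> real" and K z \<rho> x B
  proof -
    have dir: "\<bar>grad p x \<bullet> (y - x)\<bar> \<le> C * B" if y: "y \<in> K" for y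
    proof -
      obtain q where q: "degree q \<le> r" "\<And>t. p (x + t *\<^sub>R (y - x)) = poly q t" using poly_le_line[OF p, of x "y - x"] by blast
      have "((\<lambda>t. x + t *\<^sub>R (y - x)) has_derivative (\<lambda>t. t *\<^sub>R (y - x))) (at 0)" by (auto intro!: derivative_eq_intros)
      then have "((\<lambda>t. p (x + t *\<^sub>R (y - x))) has_derivative (\<lambda>t. grad p x \<bullet> (t *\<^sub>R (y - x)))) (at 0)"
        by (rule has_derivative_compose) (simp add: has_derivative_grad[OF poly_le_differentiable[OF p]])
      then have "(poly q has_real_derivative grad p x \<bullet> (y - x)) (at 0)"
        unfolding has_field_derivative_def q(2) by (simp add: mult_commute_abs)
      then have "grad p x \<bullet> (y - x) = poly (pderiv q) 0" by (rule DERIV_unique[OF _ poly_DERIV])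
      also have "\<dots> = (\<Sum>j\<le>r. b j * poly q (s j))" by (rule ab[OF q(1)])
      also have "\<bar>\<dots>\<bar> \<le> (\<Sum>j\<le>r. \<bar>b j\<bar> * B)"
      proof (rule order_trans[OF sum_abs sum_mono])
        fix j assume j: "j \<in> {..r}"
        have "x + s j *\<^sub>R (y - x) = (1 - s j) *\<^sub>R x + s j *\<^sub>R y" by (simp add: algebra_simps)
        also have "\<dots> \<in> K" using s(1)[of j] s(2)[of j] j by (intro convexD[OF K x y]) auto
        finally have "\<bar>poly q (s j)\<bar> \<le> B" using B q(2) by metis
        then show "\<bar>b j * poly q (s j)\<bar> \<le> \<bar>b j\<bar> * B" by (simp add: abs_mult mult_left_mono)
      qed
      finally show ?thesis by (simp add: C_def sum_distrib_right)
    qed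
    show ?thesis
    proof (cases "grad p x = 0")
      case True
      have "0 \<le> C * B" using dir[OF x] by simp
      then show ?thesis using True \<rho>(1) by simp
    next
      case False
      define e where "e = (\<rho> / norm (grad p x)) *\<^sub>R grad p x"
      have ne: "norm e = \<rho>" using False \<rho>(1) by (simp add: e_def)
      have "z + e \<in> K" "z - e \<in> K" using ne \<rho>(2) by (auto simp: dist_norm subset_iff)
      from dir[OF this(1)] dir[OF this(2)]
      have "grad p x \<bullet> (z + e - x) - grad p x \<bullet> (z - e - x) \<le> 2 * (C * B)" by linarith
      moreover have "grad p x \<bullet> (z + e - x) - grad p x \<bullet> (z - e - x) = 2 * (grad p x \<bullet> e)"
        by (simp add: inner_diff_right inner_add_right)
      moreover have "grad p x \<bullet> e = \<rho> * norm (grad p x)"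
        using False by (simp add: e_def power2_norm_eq_inner[symmetric] power2_eq_square)
      ultimately have "\<rho> * norm (grad p x) \<le> C * B" by simp
      then show ?thesis using \<rho>(1) by (simp add: pos_le_divide_eq mult.commute)
    qed
  qed
  have "C \<ge> 0" unfolding C_def by (simp add: sum_nonneg)
  then show ?thesis
  proof (intro exI[of _ C] conjI allI impI)
    fix p :: "real^'n \<Rightarrow> real" and K z \<rho> x B
    assume "poly_le r p" "convex K" "0 < \<rho>" "cball z \<rho> \<subseteq> K" "x \<in> K" "\<forall>y\<in>K. \<bar>p y\<bar> \<le> B"
    then show "norm (grad p x) \<le> C * B / \<rho>" by (intro key[of p K]) auto
  qed
qed

section \<open>Lagrange interpolation on simplices\<close>

definition vertex_set :: "(real^'n) set \<Rightarrow> bool" where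
  "vertex_set C \<longleftrightarrow> \<not> affine_dependent C \<and> card C = CARD('n) + 1"

text \<open>Barycentric coordinates at every point of the space, not only in the simplex, so that
  they are affine functions of x. For a vertex set C, demanding 0 off C makes them unique as
  functions on the whole type.\<close>

definition bary :: "(real^'n) set \<Rightarrow> real^'n \<Rightarrow> real^'n \<Rightarrow> real" where
  "bary C x = (SOME b. (\<forall>v. v \<notin> C \<longrightarrow> b v = 0) \<and> sum b C = 1 \<and> (\<Sum>v\<in>C. b v *\<^sub>R v) = x)"

lemma vertex_set_finite: "vertex_set C \<Longrightarrow> finite C"
  unfolding vertex_set_def using aff_independent_finite by blast

lemma bary:
  fixes C :: "(real^'n) set"
  assumes C: "vertex_set C"
  shows "v \<notin> C \<Longrightarrow> bary C x v = 0" "sum (bary C x) C = 1" "(\<Sum>v\<in>C. bary C x v *\<^sub>R v) = x"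
proof -
  have fin: "finite C" by (rule vertex_set_finite[OF C])
  have "aff_dim C = int DIM(real^'n)"
    using C aff_dim_affine_independent[of C] unfolding vertex_set_def by simp
  then have "affine hull C = UNIV" by (simp only: aff_dim_eq_full)
  then have "x \<in> affine hull C" by simp
  then obtain u where u: "sum u C = 1" "(\<Sum>v\<in>C. u v *\<^sub>R v) = x" unfolding affine_hull_finite[OF fin] by auto
  have "\<exists>b. (\<forall>v. v \<notin> C \<longrightarrow> b v = 0) \<and> sum b C = 1 \<and> (\<Sum>v\<in>C. b v *\<^sub>R v) = x"
  proof (intro exI[of _ "\<lambda>v. if v \<in> C then u v else 0"] conjI)
    have "(\<Sum>v\<in>C. (if v \<in> C then u v else 0)) = sum u C"
      "(\<Sum>v\<in>C. (if v \<in> C then u v else 0) *\<^sub>R v) = (\<Sum>v\<in>C. u v *\<^sub>R v)"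
      by (intro sum.cong; simp)+
    then show "(\<Sum>v\<in>C. (if v \<in> C then u v else 0)) = 1"
      "(\<Sum>v\<in>C. (if v \<in> C then u v else 0) *\<^sub>R v) = x" using u by auto
  qed simp
  from someI_ex[OF this]
  show "v \<notin> C \<Longrightarrow> bary C x v = 0" "sum (bary C x) C = 1" "(\<Sum>v\<in>C. bary C x v *\<^sub>R v) = x"
    unfolding bary_def by auto
qed

lemma bary_unique:
  assumes C: "vertex_set C" and u: "\<And>v. v \<notin> C \<Longrightarrow> u v = 0" "sum u C = 1" "(\<Sum>v\<in>C. u v *\<^sub>R v) = x"
  shows "bary C x = u"
proof (rule ext, rule ccontr)
  fix v assume ne: "bary C x v \<noteq> u v"
  have fin: "finite C" by (rule vertex_set_finite[OF C])
  have "v \<in> C" using ne u(1)[of v] bary(1)[OF C, of v x] by metis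
  moreover have "(\<Sum>v\<in>C. bary C x v - u v) = 0" using u bary[OF C] by (simp add: sum_subtractf)
  moreover have "(\<Sum>v\<in>C. (bary C x v - u v) *\<^sub>R v) = 0"
    using u bary[OF C] by (simp add: scaleR_diff_left sum_subtractf)
  ultimately have "affine_dependent C"
    unfolding affine_dependent_explicit_finite[OF fin] using ne by (intro exI[of _ "\<lambda>v. bary C x v - u v"]) auto
  then show False using C unfolding vertex_set_def by simp
qed

text \<open>The right-hand side satisfies the equations that define the coordinates. It is written
  with the values at the origin and at the unit vectors so that its degree in x is visible.\<close>

lemma bary_affine:
  fixes C :: "(real^'n) set"
  assumes C: "vertex_set C"
  shows "bary C x v = bary C 0 v + (\<Sum>i\<in>UNIV. x $ i * (bary C (axis i 1) v - bary C 0 v))"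
proof -
  define u where "u v = bary C 0 v + (\<Sum>i\<in>UNIV. x $ i * (bary C (axis i 1) v - bary C 0 v))" for v
  have "bary C x = u"
  proof (rule bary_unique[OF C])
    show "u v = 0" if "v \<notin> C" for v using bary(1)[OF C that] by (simp add: u_def)
    have "sum u C = sum (bary C 0) C + (\<Sum>i\<in>UNIV. \<Sum>v\<in>C. x $ i * (bary C (axis i 1) v - bary C 0 v))"
      unfolding u_def by (simp add: sum.distrib sum.swap[of _ UNIV C])
    also have "\<dots> = 1" by (simp add: bary(2)[OF C] sum_subtractf flip: sum_distrib_left)
    finally show "sum u C = 1" .
    have "(\<Sum>v\<in>C. u v *\<^sub>R v) = (\<Sum>v\<in>C. bary C 0 v *\<^sub>R v) +
        (\<Sum>v\<in>C. \<Sum>i\<in>UNIV. x $ i *\<^sub>R ((bary C (axis i 1) v - bary C 0 v) *\<^sub>R v))"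
      unfolding u_def by (simp add: scaleR_add_left sum.distrib scaleR_left.sum)
    also have "\<dots> = (\<Sum>i\<in>UNIV. \<Sum>v\<in>C. x $ i *\<^sub>R ((bary C (axis i 1) v - bary C 0 v) *\<^sub>R v))"
      by (subst sum.swap) (simp add: bary(3)[OF C])
    also have "\<dots> = (\<Sum>i\<in>UNIV. x $ i *\<^sub>R axis i 1)"
      by (simp add: bary(3)[OF C] scaleR_diff_left sum_subtractf flip: scaleR_right.sum)
    also have "\<dots> = x" using basis_expansion[of x] by (simp add: scalar_mult_eq_scaleR)
    finally show "(\<Sum>v\<in>C. u v *\<^sub>R v) = x" .
  qed
  then show ?thesis by (simp add: u_def)
qed

lemma poly_le_bary: "vertex_set C \<Longrightarrow> poly_le 1 (\<lambda>x. bary C x v)"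
proof -
  assume C: "vertex_set C"
  have "poly_le 1 (\<lambda>x. bary C 0 v + (\<Sum>i\<in>UNIV. (bary C (axis i 1) v - bary C 0 v) * x $ i))"
    by (intro poly_le_add poly_le_sum poly_le_cmult poly_le_const poly_le_component) simp
  moreover have "(\<lambda>x. bary C x v) = (\<lambda>x. bary C 0 v + (\<Sum>i\<in>UNIV. (bary C (axis i 1) v - bary C 0 v) * x $ i))"
    by (rule ext, subst bary_affine[OF C]) (simp add: mult.commute)
  ultimately show ?thesis by (simp only:)
qed

lemma mem_convex_hull_bary:
  assumes C: "vertex_set C" shows "x \<in> convex hull C \<longleftrightarrow> (\<forall>v. 0 \<le> bary C x v)"
proof
  assume "x \<in> convex hull C"
  then obtain u where u: "\<forall>v\<in>C. 0 \<le> u v" "sum u C = 1" "(\<Sum>v\<in>C. u v *\<^sub>R v) = x"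
    unfolding convex_hull_finite[OF vertex_set_finite[OF C]] by auto
  have "bary C x = (\<lambda>v. if v \<in> C then u v else 0)"
  proof (rule bary_unique[OF C])
    have "(\<Sum>v\<in>C. (if v \<in> C then u v else 0)) = sum u C"
      "(\<Sum>v\<in>C. (if v \<in> C then u v else 0) *\<^sub>R v) = (\<Sum>v\<in>C. u v *\<^sub>R v)"
      by (intro sum.cong; simp)+
    then show "(\<Sum>v\<in>C. (if v \<in> C then u v else 0)) = 1"
      "(\<Sum>v\<in>C. (if v \<in> C then u v else 0) *\<^sub>R v) = x" using u by auto
  qed simp
  then show "\<forall>v. 0 \<le> bary C x v" using u(1) by simp
next
  assume "\<forall>v. 0 \<le> bary C x v"
  then show "x \<in> convex hull C"
    unfolding convex_hull_finite[OF vertex_set_finite[OF C]] using bary[OF C] by blast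
qed

lemma bary_le_1:
  assumes "vertex_set C" "x \<in> convex hull C" shows "bary C x v \<le> 1"
proof (cases "v \<in> C")
  case True
  then have "bary C x v \<le> sum (bary C x) C"
    using assms mem_convex_hull_bary[OF assms(1)] vertex_set_finite by (intro member_le_sum) auto
  then show ?thesis using bary(2)[OF assms(1)] by simp
qed (simp add: bary(1)[OF assms(1)])

section \<open>The principal lattice and its Lagrange basis\<close>

definition node_ix :: "nat \<Rightarrow> (real^'n) set \<Rightarrow> (real^'n \<Rightarrow> nat) set" where
  "node_ix r C = {k. (\<forall>v. v \<notin> C \<longrightarrow> k v = 0) \<and> sum k C = r}"

definition node :: "nat \<Rightarrow> (real^'n) set \<Rightarrow> (real^'n \<Rightarrow> nat) \<Rightarrow> real^'n" where
  "node r C k = (\<Sum>v\<in>C. (real (k v) / real r) *\<^sub>R v)"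

definition gbin :: "nat \<Rightarrow> (real^'n) set \<Rightarrow> (real^'n \<Rightarrow> nat) \<Rightarrow> real^'n \<Rightarrow> real" where
  "gbin r C k x = (\<Prod>v\<in>C. (real r * bary C x v) gchoose (k v))"

text \<open>An index is determined by its restriction to C, with values at most r. The crude count
  is the same for all simplices with the same number of vertices, as uniform constants
  require.\<close>

lemma node_ix_bound: "finite C \<Longrightarrow> finite (node_ix r C) \<and> card (node_ix r C) \<le> Suc r ^ card C"
proof -
  assume fin: "finite C"
  let ?f = "\<lambda>k. restrict k C"
  have inj: "inj_on ?f (node_ix r C)"
  proof (rule inj_onI)
    fix k l assume kl: "k \<in> node_ix r C" "l \<in> node_ix r C" "restrict k C = restrict l C"
    show "k = l"
    proof
      fix v show "k v = l v"
        using kl(1,2) fun_cong[OF kl(3), of v] by (cases "v \<in> C") (auto simp: node_ix_def)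
    qed
  qed
  have sub: "?f ` node_ix r C \<subseteq> PiE C (\<lambda>_. {..r})"
  proof -
    have "k v \<le> sum k C" if "v \<in> C" for k :: "real^'a \<Rightarrow> nat" and v by (rule member_le_sum[OF that _ fin]) simp
    then show ?thesis by (auto simp: node_ix_def)
  qed
  have finP: "finite (PiE C (\<lambda>_. {..r}))" using fin by (simp add: finite_PiE)
  have "finite (node_ix r C)" using inj sub finP by (meson finite_imageD finite_subset)
  moreover have "card (node_ix r C) \<le> card (PiE C (\<lambda>_. {..r}))" by (rule card_inj_on_le[OF inj sub finP])
  ultimately show ?thesis using fin by (simp add: card_PiE)
qed

lemma lagrange_nodes_simplex:
  assumes C: "vertex_set C"
  shows "lagrange_nodes r (convex hull C) = node r C ` node_ix r C"
proof -
  have ext: "{a. a extreme_point_of (convex hull C)} = C"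
    using C extreme_point_of_convex_hull_affine_independent unfolding vertex_set_def by blast
  show ?thesis
    unfolding lagrange_nodes_def ext
  proof (intro subset_antisym subsetI)
    fix x assume "x \<in> {(\<Sum>a\<in>C. (real (k a) / real r) *\<^sub>R a) | k. sum k C = r}"
    then obtain k where k: "x = (\<Sum>a\<in>C. (real (k a) / real r) *\<^sub>R a)" "sum k C = r" by auto
    define l where "l v = (if v \<in> C then k v else 0)" for v
    have "l \<in> node_ix r C" using k(2) by (auto simp: node_ix_def l_def cong: sum.cong)
    moreover have "x = node r C l" unfolding node_def k(1) by (intro sum.cong) (auto simp: l_def)
    ultimately show "x \<in> node r C ` node_ix r C" by blast
  next
    fix x assume "x \<in> node r C ` node_ix r C"
    then show "x \<in> {(\<Sum>a\<in>C. (real (k a) / real r) *\<^sub>R a) | k. sum k C = r}"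
      unfolding node_def node_ix_def by auto
  qed
qed

lemma bary_node:
  assumes C: "vertex_set C" and r: "1 \<le> r" and k: "k \<in> node_ix r C"
  shows "bary C (node r C k) = (\<lambda>v. real (k v) / real r)"
proof (rule bary_unique[OF C])
  have sk: "sum k C = r" using k by (simp add: node_ix_def)
  have "(\<Sum>v\<in>C. real (k v) / real r) = real (sum k C) / real r"
    unfolding of_nat_sum by (rule sum_divide_distrib[symmetric])
  then show "(\<Sum>v\<in>C. real (k v) / real r) = 1" unfolding sk using r by simp
qed (use k in \<open>auto simp: node_ix_def node_def\<close>)

text \<open>If j and k differ but have the same sum, some component of j is smaller than that of k,
  and the corresponding binomial coefficient is 0.\<close>

lemma gbin_node:
  assumes C: "vertex_set C" and r: "1 \<le> r" and j: "j \<in> node_ix r C" and k: "k \<in> node_ix r C"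
  shows "gbin r C k (node r C j) = (if j = k then 1 else 0)"
proof -
  have e: "gbin r C k (node r C j) = (\<Prod>v\<in>C. real (j v choose k v))"
    unfolding gbin_def bary_node[OF C r j] using r by (simp add: binomial_gbinomial)
  show ?thesis
  proof (cases "j = k")
    case True
    then show ?thesis unfolding e by simp
  next
    case False
    have "\<exists>v\<in>C. j v < k v"
    proof (rule ccontr)
      assume "\<not> (\<exists>v\<in>C. j v < k v)"
      then have le: "\<And>v. v \<in> C \<Longrightarrow> k v \<le> j v" by (meson not_le)
      have "sum k C = sum j C" using j k by (simp add: node_ix_def)
      then have eqC: "\<And>v. v \<in> C \<Longrightarrow> k v = j v"
        using sum_mono_inv[of k C j] le vertex_set_finite[OF C] by blast
      have "j v = k v" for v using eqC[of v] j k by (cases "v \<in> C") (auto simp: node_ix_def)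
      then show False using False by blast
    qed
    then have "(\<Prod>v\<in>C. real (j v choose k v)) = 0"
      using vertex_set_finite[OF C] by (auto simp: prod_zero_iff)
    then show ?thesis unfolding e using False by simp
  qed
qed

text \<open>Reproduction: \<open>gbin r C \<gamma>\<close> is a Lagrange basis function if \<open>|\<gamma>| = r\<close>; the case \<open>|\<gamma>| < r\<close> is reduced
  to it by \<open>\<Sum>\<^sub>v (r \<lambda>\<^sub>v - \<gamma>\<^sub>v) = r - |\<gamma>|\<close>, where \<open>\<lambda>\<^sub>v\<close> are the barycentric coordinates.\<close>

definition reproduced :: "nat \<Rightarrow> (real^'n) set \<Rightarrow> (real^'n \<Rightarrow> real) \<Rightarrow> bool" where
  "reproduced r C f \<longleftrightarrow> (\<forall>x. f x = (\<Sum>k\<in>node_ix r C. f (node r C k) * gbin r C k x))"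

lemma reproduced_add:
  assumes f: "reproduced r C f" and g: "reproduced r C g"
  shows "reproduced r C (\<lambda>x. f x + g x)"
  unfolding reproduced_def
proof
  fix x
  have "f x + g x = (\<Sum>k\<in>node_ix r C. f (node r C k) * gbin r C k x) + (\<Sum>k\<in>node_ix r C. g (node r C k) * gbin r C k x)"
    by (rule arg_cong2[OF f[unfolded reproduced_def, rule_format] g[unfolded reproduced_def, rule_format]])
  then show "f x + g x = (\<Sum>k\<in>node_ix r C. (f (node r C k) + g (node r C k)) * gbin r C k x)"
    by (simp only: distrib_right sum.distrib)
qed

lemma reproduced_cmult:
  assumes f: "reproduced r C f" shows "reproduced r C (\<lambda>x. a * f x)"
  unfolding reproduced_def
proof
  fix x
  have "a * f x = a * (\<Sum>k\<in>node_ix r C. f (node r C k) * gbin r C k x)"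
    by (rule arg_cong[OF f[unfolded reproduced_def, rule_format]])
  then show "a * f x = (\<Sum>k\<in>node_ix r C. (a * f (node r C k)) * gbin r C k x)"
    by (simp only: sum_distrib_left mult.assoc)
qed

lemma reproduced_sum: "(\<And>i. i \<in> I \<Longrightarrow> reproduced r C (f i)) \<Longrightarrow> reproduced r C (\<lambda>x. \<Sum>i\<in>I. f i x)"
proof (induction I rule: infinite_finite_induct)
  case (insert i I)
  then show ?case by (simp add: reproduced_add)
qed (simp_all add: reproduced_def)

text \<open>The identity (t - k) binom(t, k) = (k + 1) binom(t, k + 1) in the factor of the vertex
  u; the other factors are untouched.\<close>

lemma gbin_raise:
  assumes C: "finite C" "u \<in> C"
  shows "(real r * bary C x u - real (\<gamma> u)) * gbin r C \<gamma> x = real (Suc (\<gamma> u)) * gbin r C (\<gamma>(u := Suc (\<gamma> u))) x"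
proof -
  let ?t = "real r * bary C x u" and ?P = "\<Prod>v\<in>C - {u}. (real r * bary C x v) gchoose (\<gamma> v)"
  have "gbin r C \<gamma> x = (?t gchoose (\<gamma> u)) * ?P" unfolding gbin_def using C by (simp add: prod.remove)
  moreover have "gbin r C (\<gamma>(u := Suc (\<gamma> u))) x = (?t gchoose Suc (\<gamma> u)) * ?P"
    unfolding gbin_def using C by (subst prod.remove[of C u]) (auto intro!: prod.cong)
  moreover have "(?t - real (\<gamma> u)) * (?t gchoose (\<gamma> u)) = real (Suc (\<gamma> u)) * (?t gchoose Suc (\<gamma> u))"
    unfolding left_diff_distrib gbinomial_mult_1[of ?t "\<gamma> u"] by simp
  ultimately show ?thesis by (simp only: mult.assoc[symmetric])
qed

lemma reproduced_gbin:
  assumes C: "vertex_set C" and r: "1 \<le> r"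
  shows "(\<forall>v. v \<notin> C \<longrightarrow> \<gamma> v = 0) \<Longrightarrow> sum \<gamma> C \<le> r \<Longrightarrow> reproduced r C (gbin r C \<gamma>)"
proof (induction "r - sum \<gamma> C" arbitrary: \<gamma>)
  case 0
  then have k: "\<gamma> \<in> node_ix r C" by (simp add: node_ix_def)
  have "(\<Sum>k\<in>node_ix r C. gbin r C \<gamma> (node r C k) * gbin r C k x) = (\<Sum>k\<in>node_ix r C. if k = \<gamma> then gbin r C k x else 0)" for x
    by (intro sum.cong refl) (simp add: gbin_node[OF C r _ k])
  then show ?case
    unfolding reproduced_def using k node_ix_bound[OF vertex_set_finite[OF C], of r] by (simp add: sum.delta)
next
  case (Suc m)
  have fin: "finite C" by (rule vertex_set_finite[OF C])
  have raise: "reproduced r C (gbin r C (\<gamma>(u := Suc (\<gamma> u))))" if u: "u \<in> C" for u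
  proof -
    have s: "sum (\<gamma>(u := Suc (\<gamma> u))) C = Suc (sum \<gamma> C)"
      using fin u by (simp add: sum.remove[of C u])
    show ?thesis using Suc u s by (intro Suc.hyps(1)) auto
  qed
  have "gbin r C \<gamma> x = (1 / real (Suc m)) * (\<Sum>u\<in>C. real (Suc (\<gamma> u)) * gbin r C (\<gamma>(u := Suc (\<gamma> u))) x)" for x
  proof -
    have "(\<Sum>u\<in>C. real (Suc (\<gamma> u)) * gbin r C (\<gamma>(u := Suc (\<gamma> u))) x) =
        (\<Sum>u\<in>C. (real r * bary C x u - real (\<gamma> u)) * gbin r C \<gamma> x)"
      using gbin_raise[OF fin] by (intro sum.cong) auto
    also have "\<dots> = (real r * sum (bary C x) C - real (sum \<gamma> C)) * gbin r C \<gamma> x"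
      by (simp add: sum_subtractf flip: sum_distrib_right sum_distrib_left)
    also have "real r * sum (bary C x) C - real (sum \<gamma> C) = real (Suc m)"
      using Suc.hyps(2) Suc.prems(2) bary(2)[OF C, of x] by simp
    finally have e: "(\<Sum>u\<in>C. real (Suc (\<gamma> u)) * gbin r C (\<gamma>(u := Suc (\<gamma> u))) x) = real (Suc m) * gbin r C \<gamma> x" .
    show ?thesis unfolding e by simp
  qed
  then have "gbin r C \<gamma> = (\<lambda>x. (1 / real (Suc m)) * (\<Sum>u\<in>C. real (Suc (\<gamma> u)) * gbin r C (\<gamma>(u := Suc (\<gamma> u))) x))" by blast
  moreover have "reproduced r C (\<lambda>x. (1 / real (Suc m)) * (\<Sum>u\<in>C. real (Suc (\<gamma> u)) * gbin r C (\<gamma>(u := Suc (\<gamma> u))) x))"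
    by (intro reproduced_cmult reproduced_sum raise)
  ultimately show ?case by (simp only:)
qed

text \<open>The invariant of the induction over polynomials: m counts the degree of f, and what is
  left of r may be filled by any product of binomial coefficients. This free factor is what makes
  reproduction stable under multiplication by a coordinate.\<close>

definition reproduced_deg :: "nat \<Rightarrow> (real^'n) set \<Rightarrow> nat \<Rightarrow> (real^'n \<Rightarrow> real) \<Rightarrow> bool" where
  "reproduced_deg r C m f \<longleftrightarrow> (\<forall>\<gamma>. (\<forall>v. v \<notin> C \<longrightarrow> \<gamma> v = 0) \<longrightarrow> sum \<gamma> C + m \<le> r \<longrightarrow> reproduced r C (\<lambda>x. f x * gbin r C \<gamma> x))"

text \<open>Writing r \<lambda>_u = \<gamma>_u + (r \<lambda>_u - \<gamma>_u), the first summand is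
  a constant and the second raises the index \<gamma> at u; both stay within the degree that is
  left.\<close>

lemma reproduced_deg_bary:
  assumes C: "vertex_set C" and f: "reproduced_deg r C m f" and u: "u \<in> C"
  shows "reproduced_deg r C (Suc m) (\<lambda>x. real r * bary C x u * f x)"
  unfolding reproduced_deg_def
proof (intro allI impI)
  fix \<gamma> :: "real^'a \<Rightarrow> nat" assume g: "\<forall>v. v \<notin> C \<longrightarrow> \<gamma> v = 0" "sum \<gamma> C + Suc m \<le> r"
  have fin: "finite C" by (rule vertex_set_finite[OF C])
  have s: "sum (\<gamma>(u := Suc (\<gamma> u))) C = Suc (sum \<gamma> C)" using fin u by (simp add: sum.remove[of C u])
  have "reproduced r C (\<lambda>x. f x * gbin r C \<gamma> x)"
    using f g unfolding reproduced_deg_def by simp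
  moreover have "reproduced r C (\<lambda>x. f x * gbin r C (\<gamma>(u := Suc (\<gamma> u))) x)"
    using f g s u unfolding reproduced_deg_def by auto
  ultimately have "reproduced r C (\<lambda>x. real (\<gamma> u) * (f x * gbin r C \<gamma> x) + real (Suc (\<gamma> u)) * (f x * gbin r C (\<gamma>(u := Suc (\<gamma> u))) x))"
    by (intro reproduced_add reproduced_cmult)
  moreover have "(\<lambda>x. real (\<gamma> u) * (f x * gbin r C \<gamma> x) + real (Suc (\<gamma> u)) * (f x * gbin r C (\<gamma>(u := Suc (\<gamma> u))) x)) =
      (\<lambda>x. real r * bary C x u * f x * gbin r C \<gamma> x)"
  proof
    fix x
    have "real (Suc (\<gamma> u)) * (f x * gbin r C (\<gamma>(u := Suc (\<gamma> u))) x) = f x * ((real r * bary C x u - real (\<gamma> u)) * gbin r C \<gamma> x)"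
      unfolding gbin_raise[OF fin u] by (simp only: mult.left_commute)
    then show "real (\<gamma> u) * (f x * gbin r C \<gamma> x) + real (Suc (\<gamma> u)) * (f x * gbin r C (\<gamma>(u := Suc (\<gamma> u))) x) =
      real r * bary C x u * f x * gbin r C \<gamma> x" by (simp only:) (simp add: algebra_simps)
  qed
  ultimately show "reproduced r C (\<lambda>x. real r * bary C x u * f x * gbin r C \<gamma> x)" by (simp only:)
qed

lemma reproduced_deg_component:
  assumes C: "vertex_set C" and r: "1 \<le> r" and f: "reproduced_deg r C m f"
  shows "reproduced_deg r C (Suc m) (\<lambda>x. x $ i * f x)"
  unfolding reproduced_deg_def
proof (intro allI impI)
  fix \<gamma> :: "real^'a \<Rightarrow> nat" assume g: "\<forall>v. v \<notin> C \<longrightarrow> \<gamma> v = 0" "sum \<gamma> C + Suc m \<le> r"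
  have "reproduced r C (\<lambda>x. \<Sum>u\<in>C. (u $ i / real r) * (real r * bary C x u * f x * gbin r C \<gamma> x))"
    using reproduced_deg_bary[OF C f] g unfolding reproduced_deg_def
    by (intro reproduced_sum reproduced_cmult) simp
  moreover have "(\<lambda>x. \<Sum>u\<in>C. (u $ i / real r) * (real r * bary C x u * f x * gbin r C \<gamma> x)) = (\<lambda>x. x $ i * f x * gbin r C \<gamma> x)"
  proof
    fix x
    have "x $ i = (\<Sum>u\<in>C. bary C x u *\<^sub>R u) $ i" using bary(3)[OF C, of x] by simp
    then have xi: "x $ i = (\<Sum>u\<in>C. bary C x u * u $ i)" by (simp add: sum_component)
    show "(\<Sum>u\<in>C. (u $ i / real r) * (real r * bary C x u * f x * gbin r C \<gamma> x)) = x $ i * f x * gbin r C \<gamma> x"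
      unfolding xi sum_distrib_right using r by (intro sum.cong) (auto simp: field_simps)
  qed
  ultimately show "reproduced r C (\<lambda>x. x $ i * f x * gbin r C \<gamma> x)" by (simp only:)
qed

text \<open>Monomials are built up from the constant 1 by multiplying with coordinates, one degree
  at a time; at the end the free factor is taken with index 0, where it is 1. This is unisolvence of
  the principal lattice, in a form that delivers the explicit basis.\<close>

lemma poly_le_reproduced:
  assumes C: "vertex_set C" and r: "1 \<le> r" and p: "poly_le r p"
  shows "reproduced r C p"
proof -
  have one: "reproduced_deg r C 0 (\<lambda>x. 1)"
    unfolding reproduced_deg_def using reproduced_gbin[OF C r] by simp
  have pow: "reproduced_deg r C (l + m) (\<lambda>x. (x $ i) ^ l * f x)" if "reproduced_deg r C m f" for i l m f
    by (induction l) (use that reproduced_deg_component[OF C r, of _ _ i] in \<open>auto simp: mult.assoc\<close>)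
  have "reproduced_deg r C (sum \<alpha> I) (\<lambda>x. \<Prod>i\<in>I. (x $ i) ^ \<alpha> i)" if "finite I" for \<alpha> :: "'a \<Rightarrow> nat" and I
    using that by (induction I rule: finite_induct) (auto simp: one pow)
  then have "reproduced_deg r C (sum \<alpha> UNIV) (monomial \<alpha>)" for \<alpha> :: "'a \<Rightarrow> nat"
    unfolding monomial_def[abs_def] by simp
  then have mon: "reproduced r C (monomial \<alpha>)" if "sum \<alpha> UNIV \<le> r" for \<alpha> :: "'a \<Rightarrow> nat"
  proof -
    have "reproduced r C (\<lambda>x. monomial \<alpha> x * gbin r C (\<lambda>_. 0) x)"
      using \<open>\<And>\<alpha>. reproduced_deg r C (sum \<alpha> UNIV) (monomial \<alpha>)\<close>[of \<alpha>] that
      unfolding reproduced_deg_def by simp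
    then show ?thesis by (simp add: gbin_def)
  qed
  obtain c where c: "\<And>x. p x = (\<Sum>\<alpha> | (\<Sum>i\<in>UNIV. \<alpha> i) \<le> r. c \<alpha> * monomial \<alpha> x)" using p unfolding poly_le_iff by blast
  have "reproduced r C (\<lambda>x. \<Sum>\<alpha> | (\<Sum>i\<in>UNIV. \<alpha> i) \<le> r. c \<alpha> * monomial \<alpha> x)"
    by (intro reproduced_sum reproduced_cmult mon) simp
  moreover have "p = (\<lambda>x. \<Sum>\<alpha> | (\<Sum>i\<in>UNIV. \<alpha> i) \<le> r. c \<alpha> * monomial \<alpha> x)" using c by blast
  ultimately show ?thesis by simp
qed

lemma gbinomial_abs_le:
  fixes t :: real
  assumes "0 \<le> t" "t \<le> real r" "k \<le> r"
  shows "\<bar>t gchoose k\<bar> \<le> real r ^ k"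
proof -
  have "\<bar>t gchoose k\<bar> = (\<Prod>i = 0..<k. \<bar>t - real i\<bar>) / fact k"
    by (simp add: gbinomial_prod_rev abs_prod)
  also have "\<dots> \<le> (\<Prod>i = 0..<k. \<bar>t - real i\<bar>) / 1"
    by (intro divide_left_mono prod_nonneg) (auto simp: fact_ge_1)
  also have "\<dots> \<le> (\<Prod>i = 0..<k. real r)"
  proof -
    have "(\<Prod>i = 0..<k. \<bar>t - real i\<bar>) \<le> (\<Prod>i = 0..<k. real r)"
      by (rule prod_mono) (use assms in auto)
    then show ?thesis by simp
  qed
  finally show ?thesis by simp
qed

lemma gbin_abs_le:
  assumes C: "vertex_set C" and k: "k \<in> node_ix r C" and x: "x \<in> convex hull C"
  shows "\<bar>gbin r C k x\<bar> \<le> real r ^ r"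
proof -
  have fin: "finite C" by (rule vertex_set_finite[OF C])
  have sk: "sum k C = r" using k by (simp add: node_ix_def)
  have "\<bar>gbin r C k x\<bar> = (\<Prod>v\<in>C. \<bar>(real r * bary C x v) gchoose (k v)\<bar>)" by (simp add: gbin_def abs_prod)
  also have "\<dots> \<le> (\<Prod>v\<in>C. real r ^ k v)"
  proof (intro prod_mono conjI abs_ge_zero gbinomial_abs_le)
    fix v assume v: "v \<in> C"
    show "0 \<le> real r * bary C x v" using x mem_convex_hull_bary[OF C] by simp
    show "real r * bary C x v \<le> real r" using bary_le_1[OF C x, of v] by (simp add: mult_left_le)
    have "k v \<le> sum k C" by (rule member_le_sum[OF v _ fin]) simp
    then show "k v \<le> r" by (simp only: sk)
  qed
  also have "\<dots> = real r ^ r" unfolding power_sum[symmetric] sk ..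
  finally show ?thesis .
qed

definition interp_elem :: "nat \<Rightarrow> (real^'n) set \<Rightarrow> (real^'n \<Rightarrow> real) \<Rightarrow> real^'n \<Rightarrow> real" where
  "interp_elem r C c x = (\<Sum>k\<in>node_ix r C. c (node r C k) * gbin r C k x)"

lemma poly_le_interp_elem:
  assumes C: "vertex_set C" shows "poly_le r (interp_elem r C c)"
proof -
  have g: "poly_le k (\<lambda>x. (real r * bary C x v) gchoose k)" for v k
  proof (induction k)
    case 0
    then show ?case by (simp add: poly_le_const)
  next
    case (Suc k)
    have "poly_le (k + 1) (\<lambda>x. ((real r * bary C x v) gchoose k) * ((1 / real (Suc k)) * (real r * bary C x v - real k)))"
      by (intro poly_le_mult Suc poly_le_cmult poly_le_diff poly_le_bary[OF C] poly_le_const)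
    moreover have "(\<lambda>x. ((real r * bary C x v) gchoose k) * ((1 / real (Suc k)) * (real r * bary C x v - real k))) =
        (\<lambda>x. (real r * bary C x v) gchoose Suc k)"
    proof
      fix x
      have "(real r * bary C x v) * ((real r * bary C x v) gchoose k) - real k * ((real r * bary C x v) gchoose k) =
          real (Suc k) * ((real r * bary C x v) gchoose Suc k)"
        using gbinomial_mult_1[of "real r * bary C x v" k] by simp
      then show "((real r * bary C x v) gchoose k) * ((1 / real (Suc k)) * (real r * bary C x v - real k)) = (real r * bary C x v) gchoose Suc k"
        by (simp add: divide_simps) (simp add: algebra_simps)
    qed
    ultimately show ?case by simp
  qed
  have "poly_le r (gbin r C k)" if "k \<in> node_ix r C" for k
  proof -
    have "poly_le (sum k C) (\<lambda>x. \<Prod>v\<in>C. (real r * bary C x v) gchoose (k v))"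
      by (intro poly_le_prod g vertex_set_finite[OF C])
    then show ?thesis using that by (simp add: gbin_def[abs_def] node_ix_def)
  qed
  then show ?thesis unfolding interp_elem_def[abs_def] by (intro poly_le_sum poly_le_cmult)
qed

lemma interp_elem_node:
  assumes C: "vertex_set C" and r: "1 \<le> r" and z: "z \<in> lagrange_nodes r (convex hull C)"
  shows "interp_elem r C c z = c z"
proof -
  obtain j where j: "j \<in> node_ix r C" "z = node r C j" using z lagrange_nodes_simplex[OF C] by auto
  have "interp_elem r C c z = (\<Sum>k\<in>node_ix r C. if k = j then c (node r C k) else 0)"
    unfolding interp_elem_def j(2) by (intro sum.cong refl) (auto simp: gbin_node[OF C r j(1)])
  then show ?thesis using j node_ix_bound[OF vertex_set_finite[OF C], of r] by (simp add: sum.delta)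
qed

lemma poly_le_eq_interp_elem:
  assumes C: "vertex_set C" and r: "1 \<le> r" and p: "poly_le r p"
    and c: "\<And>z. z \<in> lagrange_nodes r (convex hull C) \<Longrightarrow> p z = c z"
  shows "p x = interp_elem r C c x"
proof -
  have "p x = interp_elem r C p x"
    using poly_le_reproduced[OF C r p] unfolding reproduced_def interp_elem_def by (rule spec)
  also have "\<dots> = interp_elem r C c x"
    unfolding interp_elem_def using c lagrange_nodes_simplex[OF C, of r] by (intro sum.cong) auto
  finally show ?thesis .
qed

text \<open>On the simplex each basis function is at most r^r, as r times a barycentric coordinate
  lies in [0, r] there, and the number of nodes is at most (r + 1)^(n + 1) in dimension n. The
  constant is independent of the shape of the simplex.\<close>

lemma poly_sup_le_nodes:
  fixes C :: "(real^'n) set"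
  assumes C: "vertex_set C" and r: "1 \<le> r" and p: "poly_le r p"
    and B: "\<And>z. z \<in> lagrange_nodes r (convex hull C) \<Longrightarrow> \<bar>p z\<bar> \<le> B" "0 \<le> B" and x: "x \<in> convex hull C"
  shows "\<bar>p x\<bar> \<le> (real (Suc r ^ (CARD('n) + 1)) * real r ^ r) * B"
proof -
  have card: "card (node_ix r C) \<le> Suc r ^ (CARD('n) + 1)"
    using node_ix_bound[OF vertex_set_finite[OF C], of r] C unfolding vertex_set_def by simp
  have "p x = (\<Sum>k\<in>node_ix r C. p (node r C k) * gbin r C k x)"
    using poly_le_eq_interp_elem[OF C r p refl, of x] by (simp add: interp_elem_def)
  then have "\<bar>p x\<bar> \<le> (\<Sum>k\<in>node_ix r C. \<bar>p (node r C k) * gbin r C k x\<bar>)" by (simp only: sum_abs)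
  also have "\<dots> \<le> (\<Sum>k\<in>node_ix r C. B * real r ^ r)"
  proof (rule sum_mono)
    fix k assume k: "k \<in> node_ix r C"
    have "\<bar>p (node r C k)\<bar> \<le> B" using k lagrange_nodes_simplex[OF C, of r] by (intro B(1)) auto
    then show "\<bar>p (node r C k) * gbin r C k x\<bar> \<le> B * real r ^ r"
      unfolding abs_mult using gbin_abs_le[OF C k x] B(2) by (intro mult_mono) auto
  qed
  also have "\<dots> = real (card (node_ix r C)) * (B * real r ^ r)" by simp
  also have "\<dots> \<le> real (Suc r ^ (CARD('n) + 1)) * (B * real r ^ r)"
    using B(2) by (intro mult_right_mono of_nat_mono[OF card]) simp
  finally show ?thesis by (simp add: ac_simps)
qed

section \<open>Comparison of polynomials through their nodal values\<close>

lemma continuous_integrable_bounded_open: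
  fixes f :: "real^'n \<Rightarrow> real"
  assumes "open D" "bounded D" "continuous_on UNIV f"
  shows "integrable (lebesgue_on D) f"
proof -
  have "bounded (f ` closure D)"
    using assms by (intro compact_imp_bounded compact_continuous_image continuous_on_subset[OF assms(3)]) auto
  then obtain B where B: "\<And>x. x \<in> closure D \<Longrightarrow> norm (f x) \<le> B" unfolding bounded_iff by auto
  show ?thesis
  proof (rule integrable_bounded_on[OF open_sets_lebesgue[OF assms(1)] assms(2)])
    show "f \<in> borel_measurable (lebesgue_on D)"
      using continuous_lebesgue_measurable[OF assms(3)] by (rule measurable_restrict_space1)
    show "AE x in lebesgue_on D. norm (f x) \<le> B" using B closure_subset[of D] by (intro AE_I2) auto
  qed
qed

lemma integral_le_measure_mult:
  fixes f :: "real^'n \<Rightarrow> real"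
  assumes "open D" "bounded D" "continuous_on UNIV f" "\<And>x. x \<in> D \<Longrightarrow> f x \<le> b"
  shows "(\<integral>x. f x \<partial>lebesgue_on D) \<le> measure lebesgue D * b"
proof -
  have "(\<integral>x. f x \<partial>lebesgue_on D) \<le> (\<integral>x. b \<partial>lebesgue_on D)"
    using assms by (intro integral_mono continuous_integrable_bounded_open) auto
  also have "\<dots> = measure lebesgue D * b"
    using open_sets_lebesgue[OF assms(1)] by (simp add: measure_restrict_space)
  finally show ?thesis .
qed

text \<open>The mean square of p controls its nodal values, these control the nodal values of q, and
  these control q on the whole simplex; integrating over the simplex cancels its volume. For the
  gradient the inverse estimate contributes 1 / \<rho>, at most \<kappa> divided by the diameter. No
  reference element is involved: the constants come from extrapolation along lines and from the
  explicit basis, and depend on r, \<kappa> and the dimension only.\<close>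

lemma nodal_estimate:
  assumes r: "1 \<le> r" and \<kappa>: "\<kappa> > 0"
  shows "\<exists>Ce\<ge>0. \<forall>(C::(real^'n) set) p q z \<rho> \<eta>. vertex_set C \<longrightarrow> poly_le r p \<longrightarrow> poly_le r q \<longrightarrow> 0 \<le> \<eta> \<longrightarrow>
     (\<forall>y\<in>lagrange_nodes r (convex hull C). \<bar>q y\<bar> \<le> \<eta> * \<bar>p y\<bar>) \<longrightarrow>
     0 < \<rho> \<longrightarrow> cball z \<rho> \<subseteq> convex hull C \<longrightarrow> diameter (convex hull C) \<le> \<kappa> * \<rho> \<longrightarrow>
     (\<integral>x. (q x)\<^sup>2 \<partial>lebesgue_on (interior (convex hull C))) \<le> Ce * \<eta>\<^sup>2 * (\<integral>x. (p x)\<^sup>2 \<partial>lebesgue_on (interior (convex hull C))) \<and>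
     (\<integral>x. (norm (grad q x))\<^sup>2 \<partial>lebesgue_on (interior (convex hull C))) \<le>
        Ce * (\<eta> / diameter (convex hull C))\<^sup>2 * (\<integral>x. (p x)\<^sup>2 \<partial>lebesgue_on (interior (convex hull C)))"
proof -
  obtain C1 where C1: "C1 \<ge> 0" "\<And>(p::real^'n \<Rightarrow> real) D x. poly_le r p \<Longrightarrow> open D \<Longrightarrow> bounded D \<Longrightarrow>
     (\<forall>y\<in>D. \<forall>s. 1/2 \<le> s \<longrightarrow> s \<le> 1 \<longrightarrow> x + s *\<^sub>R (y - x) \<in> D) \<Longrightarrow>
     measure lebesgue D * (p x)\<^sup>2 \<le> C1 * (\<integral>y. (p y)\<^sup>2 \<partial>lebesgue_on D)"
    using poly_point_le_L2[of r] by blast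
  obtain C2 where C2: "C2 \<ge> 0" "\<And>(p::real^'n \<Rightarrow> real) K z \<rho> x B. poly_le r p \<Longrightarrow> convex K \<Longrightarrow> 0 < \<rho> \<Longrightarrow> cball z \<rho> \<subseteq> K \<Longrightarrow>
     x \<in> K \<Longrightarrow> (\<forall>y\<in>K. \<bar>p y\<bar> \<le> B) \<Longrightarrow> norm (grad p x) \<le> C2 * B / \<rho>"
    using poly_grad_le_sup[of r] by blast
  define \<Lambda> where "\<Lambda> = real (Suc r ^ (CARD('n) + 1)) * real r ^ r"
  have \<Lambda>0: "\<Lambda> \<ge> 0" by (simp add: \<Lambda>_def)
  \<comment> \<open>\<Lambda> bounds a polynomial by its nodal values, C1 these by the mean square,
    and \<open>C2 * \<kappa>\<close> enters with the gradient. The summand 1 lets one constant serve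
    both estimates.\<close>
  define Ce where "Ce = \<Lambda>\<^sup>2 * C1 * (1 + (C2 * \<kappa>)\<^sup>2)"
  have key: "(\<integral>x. (q x)\<^sup>2 \<partial>lebesgue_on (interior (convex hull C))) \<le> Ce * \<eta>\<^sup>2 * (\<integral>x. (p x)\<^sup>2 \<partial>lebesgue_on (interior (convex hull C))) \<and>
     (\<integral>x. (norm (grad q x))\<^sup>2 \<partial>lebesgue_on (interior (convex hull C))) \<le>
        Ce * (\<eta> / diameter (convex hull C))\<^sup>2 * (\<integral>x. (p x)\<^sup>2 \<partial>lebesgue_on (interior (convex hull C)))"
    if C: "vertex_set C" and p: "poly_le r p" and q: "poly_le r q" and \<eta>: "0 \<le> \<eta>"
      and pq: "\<forall>y\<in>lagrange_nodes r (convex hull C). \<bar>q y\<bar> \<le> \<eta> * \<bar>p y\<bar>"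
      and \<rho>: "0 < \<rho>" "cball z \<rho> \<subseteq> convex hull C" "diameter (convex hull C) \<le> \<kappa> * \<rho>"
    for C :: "(real^'n) set" and p q z \<rho> \<eta>
  proof -
    define K where "K = convex hull C"
    define D where "D = interior K"
    define P where "P = (\<integral>x. (p x)\<^sup>2 \<partial>lebesgue_on D)"
    have Kc: "compact K" "convex K"
      unfolding K_def using finite_imp_compact_convex_hull[OF vertex_set_finite[OF C]] by auto
    have D: "open D" "bounded D" unfolding D_def using Kc(1) by (auto intro: bounded_interior compact_imp_bounded)
    have Dm: "D \<in> lmeasurable" using D by (simp add: lmeasurable_open)
    have mD: "measure lebesgue D > 0"
    proof -
      have "ball z \<rho> \<subseteq> D" unfolding D_def K_def using \<rho>(2) ball_subset_cball by (intro interior_maximal) auto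
      then have "D \<noteq> {}" using \<rho>(1) by auto
      then have "\<not> negligible D" using open_not_negligible D(1) by blast
      then show ?thesis using negligible_iff_measure0[OF Dm] measure_nonneg[of lebesgue D] by linarith
    qed
    have P0: "P \<ge> 0" unfolding P_def by simp
    have ptw: "(p x)\<^sup>2 \<le> C1 * P / measure lebesgue D" if x: "x \<in> K" for x
    proof -
      \<comment> \<open>Contracting the open simplex towards any point of the closed one, boundary
        points included, stays in the open simplex; hence the pointwise bound also holds at nodes on
        the boundary.\<close>
      have "x + s *\<^sub>R (y - x) \<in> D" if "y \<in> D" "1/2 \<le> s" "s \<le> 1" for y s
        using mem_interior_convex_shrink[OF Kc(2), of y x s] that x unfolding D_def by (simp add: algebra_simps)
      then have "measure lebesgue D * (p x)\<^sup>2 \<le> C1 * P" unfolding P_def by (intro C1(2) p D) blast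
      then show ?thesis using mD by (simp add: pos_le_divide_eq mult.commute)
    qed
    define B where "B = \<eta> * sqrt (C1 * P / measure lebesgue D)"
    have B0: "B \<ge> 0" unfolding B_def using \<eta> C1(1) P0 by simp
    have B2: "B\<^sup>2 = \<eta>\<^sup>2 * (C1 * P / measure lebesgue D)"
      unfolding B_def using C1(1) P0 by (simp add: power_mult_distrib)
    have nodeK: "y \<in> K" if y: "y \<in> lagrange_nodes r K" for y
    proof -
      obtain k where k: "k \<in> node_ix r C" "y = node r C k" using y lagrange_nodes_simplex[OF C] unfolding K_def by auto
      have "bary C y = (\<lambda>v. real (k v) / real r)" unfolding k(2) by (rule bary_node[OF C r k(1)])
      then show ?thesis unfolding K_def mem_convex_hull_bary[OF C] by simp
    qed
    have "\<bar>q y\<bar> \<le> B" if y: "y \<in> lagrange_nodes r K" for y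
    proof -
      have "\<bar>p y\<bar> \<le> sqrt (C1 * P / measure lebesgue D)" using ptw[OF nodeK[OF y]] by (simp add: real_le_rsqrt)
      then have "\<eta> * \<bar>p y\<bar> \<le> B" unfolding B_def using \<eta> by (rule mult_left_mono)
      then show ?thesis using pq y unfolding K_def by fastforce
    qed
    then have qK: "\<bar>q x\<bar> \<le> \<Lambda> * B" if "x \<in> K" for x
      using that B0 unfolding \<Lambda>_def K_def by (intro poly_sup_le_nodes[OF C r q]) auto
    have DK: "x \<in> K" if "x \<in> D" for x using that interior_subset unfolding D_def by blast
    have "(\<integral>x. (q x)\<^sup>2 \<partial>lebesgue_on D) \<le> measure lebesgue D * (\<Lambda> * B)\<^sup>2"
    proof (rule integral_le_measure_mult[OF D])
      show "continuous_on UNIV (\<lambda>x. (q x)\<^sup>2)" by (intro continuous_on_power poly_le_continuous[OF q])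
      show "(q x)\<^sup>2 \<le> (\<Lambda> * B)\<^sup>2" if "x \<in> D" for x
        using power_mono[OF qK[OF DK[OF that]] abs_ge_zero, of 2] by simp
    qed
    also have mB: "measure lebesgue D * (\<Lambda> * B)\<^sup>2 = \<Lambda>\<^sup>2 * C1 * \<eta>\<^sup>2 * P"
      unfolding power_mult_distrib B2 using mD by simp
    also have "\<dots> \<le> \<Lambda>\<^sup>2 * C1 * \<eta>\<^sup>2 * P * (1 + (C2 * \<kappa>)\<^sup>2)"
    proof -
      have "0 \<le> \<Lambda>\<^sup>2 * C1 * \<eta>\<^sup>2 * P" using C1(1) P0 by simp
      from mult_left_mono[OF _ this, of 1 "1 + (C2 * \<kappa>)\<^sup>2"] show ?thesis by simp
    qed
    finally have e1: "(\<integral>x. (q x)\<^sup>2 \<partial>lebesgue_on D) \<le> Ce * \<eta>\<^sup>2 * P" by (simp add: Ce_def ac_simps)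
    define h where "h = diameter K"
    have h0: "h > 0"
    proof -
      have "ball z \<rho> \<subseteq> K" using \<rho>(2) ball_subset_cball unfolding K_def by blast
      then have "diameter (ball z \<rho>) \<le> h" unfolding h_def using Kc(1) by (intro diameter_subset compact_imp_bounded)
      then show ?thesis using \<rho>(1) by simp
    qed
    have gq: "norm (grad q x) \<le> C2 * \<kappa> * (\<Lambda> * B) / h" if "x \<in> D" for x
    proof -
      have "norm (grad q x) \<le> C2 * (\<Lambda> * B) / \<rho>"
        using qK \<rho> Kc(2) by (intro C2(2)[OF q, of K _ z] DK[OF that]) (auto simp: K_def)
      also have "\<dots> \<le> C2 * (\<Lambda> * B) * (\<kappa> / h)"
      proof -
        have "1 / \<rho> \<le> \<kappa> / h" using \<rho>(1,3) h0 by (simp add: divide_simps h_def K_def mult.commute)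
        then have "C2 * (\<Lambda> * B) * (1 / \<rho>) \<le> C2 * (\<Lambda> * B) * (\<kappa> / h)"
          using C2(1) \<Lambda>0 B0 by (intro mult_left_mono) auto
        then show ?thesis by simp
      qed
      finally show ?thesis by (simp add: ac_simps)
    qed
    have "(\<integral>x. (norm (grad q x))\<^sup>2 \<partial>lebesgue_on D) \<le> measure lebesgue D * (C2 * \<kappa> * (\<Lambda> * B) / h)\<^sup>2"
    proof (rule integral_le_measure_mult[OF D])
      show "continuous_on UNIV (\<lambda>x. (norm (grad q x))\<^sup>2)"
        by (intro continuous_on_power continuous_on_norm poly_le_continuous_grad[OF q])
      show "(norm (grad q x))\<^sup>2 \<le> (C2 * \<kappa> * (\<Lambda> * B) / h)\<^sup>2" if "x \<in> D" for x
        by (intro power_mono gq that) simp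
    qed
    also have "\<dots> = (C2 * \<kappa>)\<^sup>2 / h\<^sup>2 * (measure lebesgue D * (\<Lambda> * B)\<^sup>2)" by (simp add: power_mult_distrib power_divide)
    also have "\<dots> = (C2 * \<kappa>)\<^sup>2 * (\<Lambda>\<^sup>2 * C1 * (\<eta> / h)\<^sup>2 * P)" unfolding mB by (simp add: power_divide)
    also have "\<dots> \<le> (1 + (C2 * \<kappa>)\<^sup>2) * (\<Lambda>\<^sup>2 * C1 * (\<eta> / h)\<^sup>2 * P)"
      using C1(1) P0 by (intro mult_right_mono) auto
    finally have e2: "(\<integral>x. (norm (grad q x))\<^sup>2 \<partial>lebesgue_on D) \<le> Ce * (\<eta> / h)\<^sup>2 * P" by (simp add: Ce_def ac_simps)
    show ?thesis using e1 e2 unfolding D_def K_def P_def h_def by simp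
  qed
  have "Ce \<ge> 0" unfolding Ce_def using C1(1) by simp
  then show ?thesis
  proof (intro exI[of _ Ce] conjI[of "0 \<le> Ce"] allI impI)
    fix C :: "(real^'n) set" and p q z \<rho> \<eta>
    assume "vertex_set C" "poly_le r p" "poly_le r q" "0 \<le> \<eta>"
      "\<forall>y\<in>lagrange_nodes r (convex hull C). \<bar>q y\<bar> \<le> \<eta> * \<bar>p y\<bar>"
      "0 < \<rho>" "cball z \<rho> \<subseteq> convex hull C" "diameter (convex hull C) \<le> \<kappa> * \<rho>"
    then show "(\<integral>x. (q x)\<^sup>2 \<partial>lebesgue_on (interior (convex hull C))) \<le> Ce * \<eta>\<^sup>2 * (\<integral>x. (p x)\<^sup>2 \<partial>lebesgue_on (interior (convex hull C))) \<and>
     (\<integral>x. (norm (grad q x))\<^sup>2 \<partial>lebesgue_on (interior (convex hull C))) \<le>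
        Ce * (\<eta> / diameter (convex hull C))\<^sup>2 * (\<integral>x. (p x)\<^sup>2 \<partial>lebesgue_on (interior (convex hull C)))"
      by (rule key)
  qed
qed

section \<open>Simplicial meshes\<close>

text \<open>The conditions on a mesh that do not mention \<Omega>. Unlike \<open>mesh_of\<close>
  they pass to subfamilies, so that all lemmas apply to submeshes as well.\<close>

definition fe_mesh :: "(real^'n) set set \<Rightarrow> bool" where
  "fe_mesh T \<longleftrightarrow> triangulation T \<and> (\<forall>K\<in>T. int CARD('n) simplex K)"

definition verts :: "(real^'n) set \<Rightarrow> (real^'n) set" where
  "verts K = {v. v extreme_point_of K}"

lemma fe_mesh_finite: "fe_mesh T \<Longrightarrow> finite T"
  unfolding fe_mesh_def triangulation_def by blast

lemma fe_mesh_subset: "fe_mesh T \<Longrightarrow> S \<subseteq> T \<Longrightarrow> fe_mesh S"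
  unfolding fe_mesh_def triangulation_def by (meson finite_subset subsetD)

lemma fe_mesh_verts:
  fixes T :: "(real^'n) set set"
  assumes "fe_mesh T" "K \<in> T"
  shows "vertex_set (verts K)" "convex hull (verts K) = K"
proof -
  have "int CARD('n) simplex K" using assms unfolding fe_mesh_def by blast
  then obtain C where C: "\<not> affine_dependent C" "int (card C) = int CARD('n) + 1" "K = convex hull C"
    unfolding simplex_def by blast
  have "verts K = C" unfolding verts_def C(3) using extreme_point_of_convex_hull_affine_independent[OF C(1)] by blast
  moreover have "card C = CARD('n) + 1" using C(2) by linarith
  ultimately show "vertex_set (verts K)" "convex hull (verts K) = K" using C unfolding vertex_set_def by auto
qed

lemma fe_mesh_elem:
  assumes "fe_mesh T" "K \<in> T"
  shows "compact K" "convex K" "closed K" "bounded K"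
proof -
  have c: "compact (convex hull (verts K))"
    by (rule finite_imp_compact_convex_hull[OF vertex_set_finite[OF fe_mesh_verts(1)[OF assms]]])
  then show "compact K" unfolding fe_mesh_verts(2)[OF assms] .
  then show "closed K" "bounded K" by (auto intro: compact_imp_closed compact_imp_bounded)
  show "convex K" using convex_convex_hull[of "verts K"] unfolding fe_mesh_verts(2)[OF assms] .
qed

lemma fe_mesh_interior_nonempty:
  fixes T :: "(real^'n) set set"
  assumes "fe_mesh T" "K \<in> T" shows "interior K \<noteq> {}"
proof -
  have "int CARD('n) simplex K" using assms unfolding fe_mesh_def by blast
  then have "aff_dim K = int DIM(real^'n)" using aff_dim_simplex by fastforce
  then have "affine hull K = UNIV" by (simp only: aff_dim_eq_full)
  moreover have "K \<noteq> {}"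
  proof
    assume "K = {}"
    then have "verts K = {}" by (simp add: verts_def extreme_point_of_def)
    then show False using fe_mesh_verts(1)[OF assms] unfolding vertex_set_def by simp
  qed
  ultimately show ?thesis
    using rel_interior_interior rel_interior_eq_empty[OF fe_mesh_elem(2)[OF assms]] by blast
qed

lemma fe_mesh_closure_interior: "fe_mesh T \<Longrightarrow> K \<in> T \<Longrightarrow> closure (interior K) = K"
  using convex_closure_interior[OF fe_mesh_elem(2) fe_mesh_interior_nonempty] closure_closed[OF fe_mesh_elem(3)] by metis

text \<open>A face of a simplex is the hull of some of its vertices, and these are the extreme
  points of the face. For a common face both simplices describe one and the same set, so they give
  the same vertices.\<close>

lemma fe_mesh_common_face:
  assumes T: "fe_mesh T" and K: "K \<in> T" "K' \<in> T"
  obtains c where "c \<subseteq> verts K" "c \<subseteq> verts K'" "K \<inter> K' = convex hull c"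
proof -
  have f: "K \<inter> K' face_of K" "K \<inter> K' face_of K'"
    using T K unfolding fe_mesh_def triangulation_def by (metis, metis inf_commute)
  have V: "\<not> affine_dependent (verts K)" "\<not> affine_dependent (verts K')"
    using fe_mesh_verts(1)[OF T] K unfolding vertex_set_def by auto
  obtain c where c: "c \<subseteq> verts K" "K \<inter> K' = convex hull c"
    using f(1) face_of_convex_hull_affine_independent[OF V(1)] fe_mesh_verts(2)[OF T K(1)] by metis
  obtain c' where c': "c' \<subseteq> verts K'" "K \<inter> K' = convex hull c'"
    using f(2) face_of_convex_hull_affine_independent[OF V(2)] fe_mesh_verts(2)[OF T K(2)] by metis
  have ind: "\<not> affine_dependent c" "\<not> affine_dependent c'"
    using V c(1) c'(1) affine_independent_subset by blast+
  have "c = {v. v extreme_point_of (K \<inter> K')}"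
    unfolding c(2) using extreme_point_of_convex_hull_affine_independent[OF ind(1)] by blast
  moreover have "c' = {v. v extreme_point_of (K \<inter> K')}"
    unfolding c'(2) using extreme_point_of_convex_hull_affine_independent[OF ind(2)] by blast
  ultimately have "c = c'" by simp
  then show thesis using that c c' by simp
qed

section \<open>Continuity of interpolation across element faces\<close>

lemma bary_convex_hull_subset:
  assumes C: "vertex_set C" and c: "c \<subseteq> C" and x: "x \<in> convex hull c"
  obtains u where "\<And>v. v \<notin> c \<Longrightarrow> u v = 0" "sum u c = 1" "(\<Sum>v\<in>c. u v *\<^sub>R v) = x" "bary C x = u"
proof -
  have fin: "finite C" "finite c" using vertex_set_finite[OF C] c finite_subset by auto
  obtain u where u: "\<forall>v\<in>c. 0 \<le> u v" "sum u c = 1" "(\<Sum>v\<in>c. u v *\<^sub>R v) = x"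
    using x unfolding convex_hull_finite[OF fin(2)] by auto
  define w where "w v = (if v \<in> c then u v else 0)" for v
  have w: "sum w c = 1" "(\<Sum>v\<in>c. w v *\<^sub>R v) = x" using u unfolding w_def by (auto cong: sum.cong)
  have "sum w C = sum w c" by (rule sum.mono_neutral_right) (use fin c in \<open>auto simp: w_def\<close>)
  moreover have "(\<Sum>v\<in>C. w v *\<^sub>R v) = (\<Sum>v\<in>c. w v *\<^sub>R v)"
    by (rule sum.mono_neutral_right) (use fin c in \<open>auto simp: w_def\<close>)
  ultimately have "bary C x = w" using w c by (intro bary_unique[OF C]) (auto simp: w_def)
  then show thesis using that[of w] w by (simp add: w_def)
qed

text \<open>The coordinates of x with respect to the vertices of the common face, continued by 0,
  satisfy the defining equations in both simplices.\<close>

lemma bary_agree: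
  assumes T: "fe_mesh T" and K: "K \<in> T" "K' \<in> T" and x: "x \<in> K" "x \<in> K'"
  shows "bary (verts K) x = bary (verts K') x"
    and "bary (verts K) x v \<noteq> 0 \<Longrightarrow> v \<in> verts K \<inter> verts K'"
proof -
  obtain c where c: "c \<subseteq> verts K" "c \<subseteq> verts K'" "K \<inter> K' = convex hull c" using fe_mesh_common_face[OF T K] by blast
  have xc: "x \<in> convex hull c" using x c(3) by blast
  note V = fe_mesh_verts(1)[OF T K(1)] and V' = fe_mesh_verts(1)[OF T K(2)]
  obtain u where u: "\<And>v. v \<notin> c \<Longrightarrow> u v = 0" "sum u c = 1" "(\<Sum>v\<in>c. u v *\<^sub>R v) = x" "bary (verts K) x = u"
    using bary_convex_hull_subset[OF V c(1) xc] by blast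
  have fin: "finite (verts K')" "finite c" using vertex_set_finite[OF V'] c(2) finite_subset by auto
  have "sum u (verts K') = sum u c" by (rule sum.mono_neutral_right) (use fin c u in auto)
  moreover have "(\<Sum>v\<in>verts K'. u v *\<^sub>R v) = (\<Sum>v\<in>c. u v *\<^sub>R v)"
    by (rule sum.mono_neutral_right) (use fin c u in auto)
  ultimately have "bary (verts K') x = u" using u c(2) by (intro bary_unique[OF V']) auto
  then show "bary (verts K) x = bary (verts K') x" using u by simp
  show "v \<in> verts K \<inter> verts K'" if "bary (verts K) x v \<noteq> 0" using that u c by auto
qed

text \<open>For x in the simplex these are the vertices of the smallest face containing x.\<close>

definition bsupp :: "(real^'n) set \<Rightarrow> real^'n \<Rightarrow> (real^'n) set" where
  "bsupp C x = {v. bary C x v \<noteq> 0}"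

lemma bsupp_subset: "vertex_set C \<Longrightarrow> bsupp C x \<subseteq> C"
  unfolding bsupp_def using bary(1) by auto

text \<open>A basis function whose index is positive at a vertex where the coordinate of x is 0
  vanishes at x, because \<open>0 gchoose k\<close> is 0 for k > 0. The interpolant at x is thus
  given by nodes and coordinates on the smallest face alone; continuity across elements and zero
  boundary values both rest on this.\<close>

lemma interp_elem_bsupp:
  assumes C: "vertex_set C"
  shows "interp_elem r C c x = (\<Sum>k\<in>node_ix r (bsupp C x). c (node r (bsupp C x) k) * (\<Prod>v\<in>bsupp C x. (real r * bary C x v) gchoose (k v)))"
proof -
  let ?s = "bsupp C x"
  have fin: "finite C" by (rule vertex_set_finite[OF C])
  have sC: "?s \<subseteq> C" by (rule bsupp_subset[OF C])
  have sub: "node_ix r ?s \<subseteq> node_ix r C"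
  proof
    fix k assume k: "k \<in> node_ix r ?s"
    then have "sum k C = sum k ?s" by (intro sum.mono_neutral_right fin sC) (auto simp: node_ix_def)
    then show "k \<in> node_ix r C" using k sC by (auto simp: node_ix_def)
  qed
  have "interp_elem r C c x = (\<Sum>k\<in>node_ix r ?s. c (node r C k) * gbin r C k x)"
    unfolding interp_elem_def
  proof (rule sum.mono_neutral_right)
    show "finite (node_ix r C)" using node_ix_bound[OF fin] by blast
    show "\<forall>k\<in>node_ix r C - node_ix r ?s. c (node r C k) * gbin r C k x = 0"
    proof
      fix k assume k: "k \<in> node_ix r C - node_ix r ?s"
      have "\<exists>v\<in>C - ?s. k v \<noteq> 0"
      proof (rule ccontr)
        assume "\<not> ?thesis"
        then have z: "\<And>v. v \<notin> ?s \<Longrightarrow> k v = 0" using k by (auto simp: node_ix_def)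
        have "sum k C = sum k ?s" by (intro sum.mono_neutral_right fin sC) (use z in auto)
        then have "k \<in> node_ix r ?s" using k z by (auto simp: node_ix_def)
        then show False using k by blast
      qed
      then obtain v where v: "v \<in> C" "bary C x v = 0" "k v \<noteq> 0" by (auto simp: bsupp_def)
      have "(real r * bary C x v) gchoose (k v) = 0" using v by (cases "k v") auto
      then have "gbin r C k x = 0" unfolding gbin_def using fin v(1) by (intro prod_zero) auto
      then show "c (node r C k) * gbin r C k x = 0" by simp
    qed
  qed (rule sub)
  also have "\<dots> = (\<Sum>k\<in>node_ix r ?s. c (node r ?s k) * (\<Prod>v\<in>?s. (real r * bary C x v) gchoose (k v)))"
  proof (rule sum.cong[OF refl])
    fix k assume k: "k \<in> node_ix r ?s"
    then have k0: "k v = 0" if "v \<notin> ?s" for v using that by (simp add: node_ix_def)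
    have "node r C k = node r ?s k"
      unfolding node_def by (rule sum.mono_neutral_right[OF fin sC]) (use k0 in auto)
    moreover have "gbin r C k x = (\<Prod>v\<in>?s. (real r * bary C x v) gchoose (k v))"
      unfolding gbin_def by (rule prod.mono_neutral_right[OF fin sC]) (use k0 in auto)
    ultimately show "c (node r C k) * gbin r C k x = c (node r ?s k) * (\<Prod>v\<in>?s. (real r * bary C x v) gchoose (k v))" by simp
  qed
  finally show ?thesis .
qed

lemma interp_elem_agree:
  assumes T: "fe_mesh T" and K: "K \<in> T" "K' \<in> T" and x: "x \<in> K" "x \<in> K'"
  shows "interp_elem r (verts K) c x = interp_elem r (verts K') c x"
proof -
  have b: "bary (verts K) x = bary (verts K') x" by (rule bary_agree(1)[OF T K x])
  then have "bsupp (verts K) x = bsupp (verts K') x" by (simp add: bsupp_def)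
  with b show ?thesis
    by (simp add: interp_elem_bsupp[OF fe_mesh_verts(1)[OF T K(1)]] interp_elem_bsupp[OF fe_mesh_verts(1)[OF T K(2)]])
qed

text \<open>The element is chosen arbitrarily among those containing x; by agreement on common faces
  the choice does not matter on the mesh. The function witnesses that the choice in
  \<open>lagrange_interp\<close> is not void.\<close>

definition fe_interp :: "nat \<Rightarrow> (real^'n) set set \<Rightarrow> (real^'n \<Rightarrow> real) \<Rightarrow> real^'n \<Rightarrow> real" where
  "fe_interp r T c x = interp_elem r (verts (SOME K. K \<in> T \<and> x \<in> K)) c x"

lemma fe_interp_elem:
  assumes T: "fe_mesh T" and K: "K \<in> T" "x \<in> K"
  shows "fe_interp r T c x = interp_elem r (verts K) c x"
proof -
  have "(SOME K. K \<in> T \<and> x \<in> K) \<in> T \<and> x \<in> (SOME K. K \<in> T \<and> x \<in> K)"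
    using K by (intro someI[of "\<lambda>K. K \<in> T \<and> x \<in> K" K]) simp
  then show ?thesis unfolding fe_interp_def using interp_elem_agree[OF T] K by blast
qed

lemma fe_interp_mem:
  assumes T: "fe_mesh T" shows "fe_interp r T c \<in> fe_space r T"
  unfolding fe_space_def
proof (intro CollectI conjI ballI)
  have "continuous_on (\<Union>K\<in>T. K) (fe_interp r T c)"
  proof (rule continuous_on_closed_Union[OF fe_mesh_finite[OF T]])
    fix K assume K: "K \<in> T"
    show "closed K" by (rule fe_mesh_elem(3)[OF T K])
    show "continuous_on K (fe_interp r T c)"
      using poly_le_continuous[OF poly_le_interp_elem[OF fe_mesh_verts(1)[OF T K]]]
      by (rule continuous_on_eq) (simp add: fe_interp_elem[OF T K])
  qed
  then show "continuous_on (\<Union>T) (fe_interp r T c)" by simp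
  fix K assume K: "K \<in> T"
  show "\<exists>p. poly_le r p \<and> (\<forall>x\<in>K. fe_interp r T c x = p x)"
    using poly_le_interp_elem[OF fe_mesh_verts(1)[OF T K]] fe_interp_elem[OF T K] by blast
qed

lemma lagrange_nodes_subset:
  assumes T: "fe_mesh T" and r: "1 \<le> r" and K: "K \<in> T" and z: "z \<in> lagrange_nodes r K" shows "z \<in> K"
proof -
  note C = fe_mesh_verts[OF T K]
  obtain k where k: "k \<in> node_ix r (verts K)" "z = node r (verts K) k"
    using z lagrange_nodes_simplex[OF C(1), of r] unfolding C(2) by blast
  have "bary (verts K) z = (\<lambda>v. real (k v) / real r)" unfolding k(2) by (rule bary_node[OF C(1) r k(1)])
  then have "z \<in> convex hull (verts K)" unfolding mem_convex_hull_bary[OF C(1)] by simp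
  then show ?thesis unfolding C(2) .
qed

lemma lagrange_nodes_nonempty:
  assumes T: "fe_mesh T" and K: "K \<in> T" shows "lagrange_nodes r K \<noteq> {}" "finite (lagrange_nodes r K)"
proof -
  note C = fe_mesh_verts[OF T K]
  have "verts K \<noteq> {}" using C(1) unfolding vertex_set_def by auto
  then obtain a where a: "a \<in> verts K" by blast
  have "(\<lambda>v. if v = a then r else 0) \<in> node_ix r (verts K)"
    using a vertex_set_finite[OF C(1)] by (auto simp: node_ix_def sum.delta)
  then show "lagrange_nodes r K \<noteq> {}" using lagrange_nodes_simplex[OF C(1), of r] unfolding C(2) by blast
  show "finite (lagrange_nodes r K)"
    using lagrange_nodes_simplex[OF C(1), of r] node_ix_bound[OF vertex_set_finite[OF C(1)], of r] unfolding C(2) by simp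
qed

lemma fe_interp_node:
  assumes T: "fe_mesh T" and r: "1 \<le> r" and K: "K \<in> T" and z: "z \<in> lagrange_nodes r K"
  shows "fe_interp r T c z = c z"
  using fe_interp_elem[OF T K lagrange_nodes_subset[OF T r K z]]
    interp_elem_node[OF fe_mesh_verts(1)[OF T K] r, of z c] z fe_mesh_verts(2)[OF T K] by simp

lemma lagrange_interp_props:
  assumes T: "fe_mesh T" and r: "1 \<le> r"
  shows "lagrange_interp r T g \<in> fe_space r T"
    and "K \<in> T \<Longrightarrow> z \<in> lagrange_nodes r K \<Longrightarrow> lagrange_interp r T g z = g z"
proof -
  have "\<exists>v. v \<in> fe_space r T \<and> (\<forall>K\<in>T. \<forall>z\<in>lagrange_nodes r K. v z = g z)"
    using fe_interp_mem[OF T] fe_interp_node[OF T r] by blast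
  from someI_ex[OF this, folded lagrange_interp_def]
  show "lagrange_interp r T g \<in> fe_space r T"
    "K \<in> T \<Longrightarrow> z \<in> lagrange_nodes r K \<Longrightarrow> lagrange_interp r T g z = g z" by auto
qed

section \<open>Lipschitz boundaries and the boundary faces of a mesh\<close>

lemma bary_combine:
  assumes C: "vertex_set C" and ab: "a + b = 1"
  shows "bary C (a *\<^sub>R x + b *\<^sub>R y) = (\<lambda>v. a * bary C x v + b * bary C y v)"
proof (rule bary_unique[OF C])
  show "a * bary C x v + b * bary C y v = 0" if "v \<notin> C" for v using bary(1)[OF C that] by simp
  show "(\<Sum>v\<in>C. a * bary C x v + b * bary C y v) = 1"
    by (simp add: sum.distrib bary(2)[OF C] ab flip: sum_distrib_left)
  have "(\<Sum>v\<in>C. (a * bary C x v + b * bary C y v) *\<^sub>R v) = a *\<^sub>R (\<Sum>v\<in>C. bary C x v *\<^sub>R v) + b *\<^sub>R (\<Sum>v\<in>C. bary C y v *\<^sub>R v)"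
    by (simp add: scaleR_add_left sum.distrib scaleR_sum_right)
  then show "(\<Sum>v\<in>C. (a * bary C x v + b * bary C y v) *\<^sub>R v) = a *\<^sub>R x + b *\<^sub>R y" by (simp add: bary(3)[OF C])
qed

text \<open>Near z the strict subgraph of the Lipschitz function is open and disjoint from D, hence
  disjoint from the closure of D as well. The points z - t e with small t > 0 lie in it, since
  moving along e changes the height and not the base point.\<close>

lemma lipschitz_boundary_exterior:
  fixes D :: "(real^'n) set"
  assumes D: "open D" "lipschitz_boundary D" and z: "z \<in> frontier D"
  shows "z \<in> closure (- closure D)"
proof -
  obtain e \<rho> L and \<gamma> :: "real^'n \<Rightarrow> real" where e: "norm e = 1" and \<rho>: "\<rho> > 0" and \<gamma>: "L-lipschitz_on UNIV \<gamma>"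
    and graph: "D \<inter> ball z \<rho> = {x \<in> ball z \<rho>. \<gamma> (x - (x \<bullet> e) *\<^sub>R e) < x \<bullet> e}"
    using D(2) z unfolding lipschitz_boundary_def by blast
  define E where "E = {x. x \<bullet> e < \<gamma> (x - (x \<bullet> e) *\<^sub>R e)} \<inter> ball z \<rho>"
  have "continuous_on UNIV (\<lambda>x. \<gamma> (x - (x \<bullet> e) *\<^sub>R e))"
    by (rule continuous_on_compose2[OF lipschitz_on_continuous_on[OF \<gamma>]]) (auto intro!: continuous_intros)
  then have "open E" unfolding E_def by (intro open_Int open_Collect_less continuous_intros) auto
  moreover have "E \<inter> D = {}"
  proof -
    have False if x: "x \<in> E" "x \<in> D" for x
    proof -
      have "x \<in> D \<inter> ball z \<rho>" using x unfolding E_def by simp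
      then have "\<gamma> (x - (x \<bullet> e) *\<^sub>R e) < x \<bullet> e" unfolding graph by simp
      then show False using x(1) unfolding E_def by simp
    qed
    then show ?thesis by blast
  qed
  ultimately have Ec: "E \<inter> closure D = {}" by (simp add: open_Int_closure_eq_empty)
  have zD: "z \<notin> D" using z D(1) unfolding frontier_def by (simp add: interior_open)
  have zg: "z \<bullet> e \<le> \<gamma> (z - (z \<bullet> e) *\<^sub>R e)"
  proof (rule ccontr)
    assume "\<not> ?thesis"
    then have "z \<in> {x \<in> ball z \<rho>. \<gamma> (x - (x \<bullet> e) *\<^sub>R e) < x \<bullet> e}" using \<rho> by simp
    then show False using graph zD by blast
  qed
  have ee: "e \<bullet> e = 1" using e by (simp add: norm_eq_sqrt_inner)
  show ?thesis
    unfolding closure_approachable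
  proof (intro allI impI)
    fix d :: real assume d: "d > 0"
    define t where "t = min d \<rho> / 2"
    have t: "t > 0" "t < d" "t < \<rho>" using d \<rho> by (auto simp: t_def min_def)
    define y where "y = z - t *\<^sub>R e"
    have dy: "dist y z = t" using t e by (simp add: y_def dist_norm)
    have "y \<bullet> e = z \<bullet> e - t" by (simp add: y_def inner_diff_left ee)
    moreover have "y - (y \<bullet> e) *\<^sub>R e = z - (z \<bullet> e) *\<^sub>R e"
      by (simp add: y_def inner_diff_left ee algebra_simps)
    ultimately have "y \<in> E" unfolding E_def using zg t dy by (auto simp: dist_commute)
    then have "y \<in> - closure D" using Ec by blast
    then show "\<exists>y\<in>- closure D. dist y z < d" using dy t by blast
  qed
qed

lemma interior_closure_lipschitz:
  assumes D: "open D" "lipschitz_boundary D"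
  shows "interior (closure D) = D"
proof
  show "D \<subseteq> interior (closure D)" by (rule interior_maximal[OF closure_subset D(1)])
  show "interior (closure D) \<subseteq> D"
  proof
    fix x assume x: "x \<in> interior (closure D)"
    show "x \<in> D"
    proof (rule ccontr)
      assume "x \<notin> D"
      then have "x \<in> frontier D" using x interior_subset D(1) unfolding frontier_def by (auto simp: interior_open)
      then have "x \<in> closure (- closure D)" by (rule lipschitz_boundary_exterior[OF D])
      then show False using x by (simp add: closure_complement)
    qed
  qed
qed

text \<open>A point supported by vertices of the smallest face of y lies in that face, and this face
  belongs to every other element containing y.\<close>

lemma bsupp_hull_subset:
  assumes T: "fe_mesh T" and K: "K \<in> T" "K' \<in> T" and y: "y \<in> K" "y \<in> K'"
    and x: "x \<in> K" "bsupp (verts K) x \<subseteq> bsupp (verts K) y"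
  shows "x \<in> K'"
proof -
  note C = fe_mesh_verts[OF T K(1)] and C' = fe_mesh_verts[OF T K(2)]
  have sub: "v \<in> verts K'" if "bary (verts K) x v \<noteq> 0" for v
    using that x(2) bary_agree(2)[OF T K y] by (auto simp: bsupp_def)
  have fin: "finite (verts K')" "finite (verts K)" using C(1) C'(1) by (auto intro: vertex_set_finite)
  have "sum (bary (verts K) x) (verts K') = sum (bary (verts K) x) (verts K' \<inter> verts K)"
    by (rule sum.mono_neutral_right) (use fin bary(1)[OF C(1)] in auto)
  also have "\<dots> = sum (bary (verts K) x) (verts K)"
    by (rule sum.mono_neutral_left) (use fin sub in auto)
  finally have s1: "sum (bary (verts K) x) (verts K') = 1" using bary(2)[OF C(1)] by simp
  have "(\<Sum>v\<in>verts K'. bary (verts K) x v *\<^sub>R v) = (\<Sum>v\<in>verts K' \<inter> verts K. bary (verts K) x v *\<^sub>R v)"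
    by (rule sum.mono_neutral_right) (use fin bary(1)[OF C(1)] in auto)
  also have "\<dots> = (\<Sum>v\<in>verts K. bary (verts K) x v *\<^sub>R v)"
    by (rule sum.mono_neutral_left) (use fin sub in auto)
  finally have s2: "(\<Sum>v\<in>verts K'. bary (verts K) x v *\<^sub>R v) = x" using bary(3)[OF C(1)] by simp
  have "bary (verts K') x = bary (verts K) x"
    using s1 s2 sub by (intro bary_unique[OF C'(1)]) auto
  then have "x \<in> convex hull (verts K')"
    using x(1) mem_convex_hull_bary[OF C'(1)] mem_convex_hull_bary[OF C(1)] C(2) by simp
  then show ?thesis unfolding C'(2) .
qed

text \<open>The relative interior of a face lies either in the interior of the meshed set or on its
  boundary: the elements at two of its points are the same.\<close>

lemma minimal_face_frontier_aux:
  fixes T :: "(real^'n) set set"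
  assumes T: "fe_mesh T" and K: "K \<in> T" and x: "x \<in> K" and y: "y \<in> K"
    and s: "bsupp (verts K) x = bsupp (verts K) y" and yi: "y \<in> interior (\<Union>T)"
  shows "x \<in> interior (\<Union>T)"
proof -
  note C = fe_mesh_verts[OF T K]
  have fin: "finite (verts K)" by (rule vertex_set_finite[OF C(1)])
  have b0: "0 \<le> bary (verts K) w v" if "w \<in> K" for w v using that mem_convex_hull_bary[OF C(1)] C(2) by simp
  \<comment> \<open>A length by which the segment from y can be prolonged beyond x without leaving
    the element: the smallest positive coordinate of x, capped at 1, is short enough, since the
    coordinates of y do not exceed 1.\<close>
  obtain \<tau> where \<tau>: "\<tau> > 0" "\<And>v. 0 \<le> bary (verts K) x v + \<tau> * (bary (verts K) x v - bary (verts K) y v)"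
  proof -
    let ?A = "insert 1 (bary (verts K) x ` bsupp (verts K) x)"
    define \<tau> where "\<tau> = Min ?A"
    have finA: "finite ?A" using fin bsupp_subset[OF C(1)] finite_subset by blast
    have "\<tau> > 0" unfolding \<tau>_def using finA b0[OF x] by (subst Min_gr_iff) (auto simp: bsupp_def less_le)
    moreover have "0 \<le> bary (verts K) x v + \<tau> * (bary (verts K) x v - bary (verts K) y v)" for v
    proof (cases "v \<in> bsupp (verts K) x")
      case True
      then have "\<tau> \<le> bary (verts K) x v" unfolding \<tau>_def using finA by (intro Min_le) auto
      moreover have "bary (verts K) y v \<le> 1" using bary_le_1[OF C(1), of y v] y C(2) by simp
      then have "\<tau> * bary (verts K) y v \<le> \<tau> * 1" using \<open>\<tau> > 0\<close> by (intro mult_left_mono) auto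
      moreover have "0 \<le> \<tau> * bary (verts K) x v" using \<open>\<tau> > 0\<close> b0[OF x] by simp
      ultimately show ?thesis by (simp add: right_diff_distrib)
    next
      case False
      then have "bary (verts K) x v = 0" "bary (verts K) y v = 0" using s by (auto simp: bsupp_def)
      then show ?thesis by simp
    qed
    ultimately show thesis using that by blast
  qed
  define x' where "x' = (1 + \<tau>) *\<^sub>R x + (- \<tau>) *\<^sub>R y"
  have bx': "bary (verts K) x' = (\<lambda>v. (1 + \<tau>) * bary (verts K) x v + (- \<tau>) * bary (verts K) y v)"
    unfolding x'_def by (rule bary_combine[OF C(1)]) simp
  have "x' \<in> convex hull (verts K)"
    using \<tau>(2) unfolding mem_convex_hull_bary[OF C(1)] bx' by (simp add: algebra_simps)
  then have x'K: "x' \<in> K" unfolding C(2) .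
  have sx': "bsupp (verts K) x' \<subseteq> bsupp (verts K) y"
  proof
    fix v assume "v \<in> bsupp (verts K) x'"
    then have "bary (verts K) x v \<noteq> 0 \<or> bary (verts K) y v \<noteq> 0" by (auto simp: bsupp_def bx')
    then show "v \<in> bsupp (verts K) y" using s by (auto simp: bsupp_def)
  qed
  \<comment> \<open>The elements near y all contain y, hence also x'. A small ball about y is
    therefore covered by elements through x', and the homothety with centre x' taking y to x carries
    it to a ball about x, which is still covered because the elements are convex.\<close>
  define F where "F = \<Union>{K'\<in>T. y \<notin> K'}"
  have "closed F" unfolding F_def using fe_mesh_finite[OF T] fe_mesh_elem(3)[OF T] by (intro closed_Union) auto
  moreover have "y \<notin> F" unfolding F_def by blast
  ultimately have "open (interior (\<Union>T) - F)" "y \<in> interior (\<Union>T) - F" using yi by auto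
  then obtain e where e: "e > 0" "ball y e \<subseteq> interior (\<Union>T) - F" using openE by blast
  define t where "t = \<tau> / (1 + \<tau>)"
  have t: "0 < t" "t < 1" using \<tau>(1) by (auto simp: t_def)
  have xt: "x = (1 - t) *\<^sub>R x' + t *\<^sub>R y"
  proof -
    have "(1 - t) * (1 + \<tau>) = 1" "(1 - t) * \<tau> = t" using \<tau>(1) by (auto simp: t_def field_simps)
    moreover have "(1 - t) *\<^sub>R x' = ((1 - t) * (1 + \<tau>)) *\<^sub>R x - ((1 - t) * \<tau>) *\<^sub>R y"
      by (simp add: x'_def scaleR_diff_right)
    ultimately show ?thesis by simp
  qed
  have "ball x (t * e) \<subseteq> \<Union>T"
  proof
    fix p assume p: "p \<in> ball x (t * e)"
    define q where "q = (1 / t) *\<^sub>R (p - x)"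
    have "norm (p - x) < t * e" using p by (simp add: dist_norm norm_minus_commute)
    then have nq: "norm q < e" using t(1) unfolding q_def by (simp add: pos_divide_less_eq mult.commute)
    have "y + q \<in> ball y e" using nq by (simp add: dist_norm)
    then have "y + q \<in> interior (\<Union>T) - F" using e(2) by blast
    then have "y + q \<in> \<Union>T" "y + q \<notin> F" using interior_subset[of "\<Union>T"] by auto
    then obtain K' where K': "K' \<in> T" "y + q \<in> K'" "y \<in> K'" unfolding F_def by blast
    have "x' \<in> K'" by (rule bsupp_hull_subset[OF T K K'(1) y K'(3) x'K sx'])
    then have "(1 - t) *\<^sub>R x' + t *\<^sub>R (y + q) \<in> K'"
      using t by (intro convexD[OF fe_mesh_elem(2)[OF T K'(1)] _ K'(2)]) auto
    moreover have "(1 - t) *\<^sub>R x' + t *\<^sub>R (y + q) = p"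
      using xt t(1) by (simp add: q_def scaleR_add_right algebra_simps)
    ultimately show "p \<in> \<Union>T" using K'(1) by blast
  qed
  then show ?thesis unfolding mem_interior using t(1) e(1) by (intro exI[of _ "t * e"]) simp
qed

text \<open>Were y interior, so would be a point w slightly displaced from y towards x. Since
  coordinates are nonnegative, the support of w is the union of both supports, which is that of x,
  and x would be interior too.\<close>

lemma minimal_face_frontier:
  fixes T :: "(real^'n) set set"
  assumes T: "fe_mesh T" and K: "K \<in> T" and x: "x \<in> K" "x \<notin> interior (\<Union>T)"
    and y: "y \<in> K" "bsupp (verts K) y \<subseteq> bsupp (verts K) x"
  shows "y \<notin> interior (\<Union>T)"
proof
  assume yi: "y \<in> interior (\<Union>T)"
  note C = fe_mesh_verts[OF T K]
  obtain e where e: "e > 0" "ball y e \<subseteq> interior (\<Union>T)" using openE[OF open_interior yi] by blast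
  \<comment> \<open>Small enough to keep w in the ball about y; the summand 1 avoids a division by
    zero if x = y.\<close>
  define t where "t = min (1/2) (e / (2 * (norm (x - y) + 1)))"
  have Np: "0 < 2 * (norm (x - y) + 1)" by (simp add: add_nonneg_pos)
  then have t: "0 < t" "t < 1" using e(1) unfolding t_def by (auto simp only: min_less_iff_conj divide_pos_pos)
  have te: "t * norm (x - y) < e"
  proof -
    have "t * norm (x - y) \<le> (e / (2 * (norm (x - y) + 1))) * norm (x - y)" by (intro mult_right_mono) (auto simp: t_def)
    also have "\<dots> < e"
    proof -
      have "e * norm (x - y) < e * (2 * (norm (x - y) + 1))"
        using e(1) by (intro mult_strict_left_mono) (auto intro: add_nonneg_pos)
      then show ?thesis using Np by (simp only: times_divide_eq_left pos_divide_less_eq)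
    qed
    finally show ?thesis .
  qed
  define w where "w = (1 - t) *\<^sub>R y + t *\<^sub>R x"
  have "w - y = t *\<^sub>R (x - y)" by (simp add: w_def algebra_simps)
  then have "w \<in> ball y e" using te t(1) by (simp add: dist_norm norm_minus_commute)
  then have wi: "w \<in> interior (\<Union>T)" using e(2) by blast
  have wK: "w \<in> K" unfolding w_def using t by (intro convexD[OF fe_mesh_elem(2)[OF T K] y(1) x(1)]) auto
  have bw: "bary (verts K) w = (\<lambda>v. (1 - t) * bary (verts K) y v + t * bary (verts K) x v)"
    unfolding w_def by (rule bary_combine[OF C(1)]) simp
  have b0: "0 \<le> bary (verts K) u v" if "u \<in> K" for u v using that mem_convex_hull_bary[OF C(1)] C(2) by simp
  have "bsupp (verts K) x = bsupp (verts K) w"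
  proof (intro set_eqI iffI)
    fix v assume "v \<in> bsupp (verts K) x"
    then have "0 < t * bary (verts K) x v" using t(1) b0[OF x(1), of v] by (simp add: bsupp_def less_le)
    moreover have "0 \<le> (1 - t) * bary (verts K) y v" using t b0[OF y(1), of v] by simp
    ultimately show "v \<in> bsupp (verts K) w" by (simp add: bsupp_def bw)
  next
    fix v assume "v \<in> bsupp (verts K) w"
    then have "bary (verts K) y v \<noteq> 0 \<or> bary (verts K) x v \<noteq> 0" by (auto simp: bsupp_def bw)
    then show "v \<in> bsupp (verts K) x" using y(2) by (auto simp: bsupp_def)
  qed
  then have "x \<in> interior (\<Union>T)" by (rule minimal_face_frontier_aux[OF T K x(1) wK _ wi])
  then show False using x(2) by simp
qed

text \<open>The value at x involves only nodes of the smallest face containing x, and none of these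
  is interior if x is not.\<close>

lemma fe_interp_zero_outside_interior:
  fixes T :: "(real^'n) set set"
  assumes T: "fe_mesh T" and r: "1 \<le> r"
    and c: "\<And>K z. K \<in> T \<Longrightarrow> z \<in> lagrange_nodes r K \<Longrightarrow> z \<notin> interior (\<Union>T) \<Longrightarrow> c z = 0"
    and x: "x \<in> \<Union>T" "x \<notin> interior (\<Union>T)"
  shows "fe_interp r T c x = 0"
proof -
  obtain K where K: "K \<in> T" "x \<in> K" using x(1) by blast
  note C = fe_mesh_verts[OF T K(1)]
  let ?s = "bsupp (verts K) x"
  have sC: "?s \<subseteq> verts K" by (rule bsupp_subset[OF C(1)])
  have fin: "finite (verts K)" by (rule vertex_set_finite[OF C(1)])
  have "c (node r ?s k) = 0" if k: "k \<in> node_ix r ?s" for k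
  proof -
    have k0: "k v = 0" if "v \<notin> ?s" for v using k that by (simp add: node_ix_def)
    have "sum k (verts K) = sum k ?s" by (rule sum.mono_neutral_right[OF fin sC]) (use k0 in auto)
    then have kC: "k \<in> node_ix r (verts K)" using k k0 sC by (auto simp: node_ix_def)
    have nd: "node r (verts K) k = node r ?s k"
      unfolding node_def by (rule sum.mono_neutral_right[OF fin sC]) (use k0 in auto)
    have zn: "node r ?s k \<in> lagrange_nodes r K"
      using lagrange_nodes_simplex[OF C(1), of r] kC nd unfolding C(2) by force
    have "bary (verts K) (node r ?s k) = (\<lambda>v. real (k v) / real r)" unfolding nd[symmetric] by (rule bary_node[OF C(1) r kC])
    then have bn: "bary (verts K) (node r ?s k) v = real (k v) / real r" for v by simp
    have "bsupp (verts K) (node r ?s k) \<subseteq> ?s"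
    proof
      fix v assume "v \<in> bsupp (verts K) (node r ?s k)"
      then have "k v \<noteq> 0" unfolding bsupp_def[of _ "node r ?s k"] mem_Collect_eq bn by auto
      then show "v \<in> ?s" using k0[of v] by (cases "v \<in> ?s") simp_all
    qed
    then have "node r ?s k \<notin> interior (\<Union>T)"
      by (intro minimal_face_frontier[OF T K(1) K(2) x(2)] lagrange_nodes_subset[OF T r K(1) zn])
    then show ?thesis by (rule c[OF K(1) zn])
  qed
  then show ?thesis unfolding fe_interp_elem[OF T K] interp_elem_bsupp[OF C(1)] by simp
qed

section \<open>Weak gradients and traces of finite element functions\<close>

text \<open>A proper face of a convex set misses its interior, so the common face must be all of
  either element.\<close>

lemma fe_mesh_interiors_disjoint:
  assumes T: "fe_mesh T" and K: "K \<in> T" "K' \<in> T" and x: "x \<in> interior K" "x \<in> interior K'"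
  shows "K = K'"
proof -
  have f: "K \<inter> K' face_of K" "K \<inter> K' face_of K'"
    using T K unfolding fe_mesh_def triangulation_def by (metis, metis inf_commute)
  have xx: "x \<in> K \<inter> K'" using x interior_subset[of K] interior_subset[of K'] by auto
  have "K \<inter> K' = K"
    by (rule ccontr) (use face_of_disjoint_interior[OF f(1)] xx x(1) in auto)
  moreover have "K \<inter> K' = K'"
    by (rule ccontr) (use face_of_disjoint_interior[OF f(2)] xx x(2) in auto)
  ultimately show ?thesis by simp
qed

lemma interior_elem_subset: "K \<in> S \<Longrightarrow> interior K \<subseteq> interior (\<Union>S)"
  by (rule interior_mono) blast

lemma negligible_mesh_skeleton:
  assumes S: "fe_mesh S"
  shows "negligible (\<Union>S - (\<Union>K\<in>S. interior K))"
proof (rule negligible_subset)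
  show "negligible (\<Union>K\<in>S. frontier K)"
    using fe_mesh_finite[OF S] fe_mesh_elem(2)[OF S] by (intro negligible_Union) (auto intro: negligible_convex_frontier)
  show "\<Union>S - (\<Union>K\<in>S. interior K) \<subseteq> (\<Union>K\<in>S. frontier K)"
  proof
    fix x assume "x \<in> \<Union>S - (\<Union>K\<in>S. interior K)"
    then obtain K where "K \<in> S" "x \<in> K" "x \<notin> interior K" by blast
    then show "x \<in> (\<Union>K\<in>S. frontier K)" using closure_subset[of K] unfolding frontier_def by blast
  qed
qed

lemma AE_mesh_interior:
  assumes S: "fe_mesh S" and D: "D = interior (\<Union>S)"
  shows "AE x in lebesgue_on D. \<exists>K\<in>S. x \<in> interior K"
proof -
  have Dm: "D \<in> sets lebesgue" unfolding D by (rule open_sets_lebesgue[OF open_interior])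
  have "\<Union>S - (\<Union>K\<in>S. interior K) \<in> null_sets lebesgue"
    using negligible_mesh_skeleton[OF S] by (simp only: negligible_iff_null_sets)
  then have "AE x in lebesgue. x \<notin> \<Union>S - (\<Union>K\<in>S. interior K)" by (rule AE_not_in)
  then show ?thesis unfolding AE_lebesgue_on_iff[OF Dm]
    by eventually_elim (use interior_subset[of "\<Union>S"] D in blast)
qed

text \<open>Almost every point of D lies in exactly one open element, so the indicator of D is the
  sum of their indicators up to a null set.\<close>

lemma integral_mesh:
  fixes f :: "real^'n \<Rightarrow> real"
  assumes S: "fe_mesh S" and D: "D = interior (\<Union>S)" and f: "integrable (lebesgue_on D) f"
  shows "(\<integral>x. f x \<partial>lebesgue_on D) = (\<Sum>K\<in>S. \<integral>x. f x \<partial>lebesgue_on (interior K))"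
    and "K \<in> S \<Longrightarrow> integrable (lebesgue_on (interior K)) f"
proof -
  have fin: "finite S" by (rule fe_mesh_finite[OF S])
  have Dm: "D \<in> sets lebesgue" unfolding D by (rule open_sets_lebesgue[OF open_interior])
  have Km: "interior K \<in> sets lebesgue" for K :: "(real^'n) set" by (rule open_sets_lebesgue[OF open_interior])
  have fD: "integrable lebesgue (\<lambda>x. indicator D x *\<^sub>R f x)" using f by (simp only: integrable_lebesgue_on_iff[OF Dm])
  have iK: "integrable lebesgue (\<lambda>x. indicator (interior K) x *\<^sub>R f x)" if K: "K \<in> S" for K
  proof -
    have "integrable lebesgue (\<lambda>x. indicator (interior K) x *\<^sub>R (indicator D x *\<^sub>R f x))"
      by (rule integrable_mult_indicator[OF Km fD])
    moreover have "(\<lambda>x. indicator (interior K) x *\<^sub>R (indicator D x *\<^sub>R f x)) = (\<lambda>x. indicator (interior K) x *\<^sub>R f x)"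
      using interior_elem_subset[OF K] unfolding D by (auto simp: fun_eq_iff indicator_def)
    ultimately show ?thesis by (simp only:)
  qed
  then show "K \<in> S \<Longrightarrow> integrable (lebesgue_on (interior K)) f" by (simp only: integrable_lebesgue_on_iff[OF Km])
  have "(\<integral>x. f x \<partial>lebesgue_on D) = (\<integral>x. indicator D x *\<^sub>R f x \<partial>lebesgue)" by (rule integral_lebesgue_on_eq[OF Dm])
  also have "\<dots> = (\<integral>x. (\<Sum>K\<in>S. indicator (interior K) x *\<^sub>R f x) \<partial>lebesgue)"
  proof (rule integral_cong_AE)
    show "(\<lambda>x. indicator D x *\<^sub>R f x) \<in> borel_measurable lebesgue" by (rule borel_measurable_integrable[OF fD])
    show "(\<lambda>x. \<Sum>K\<in>S. indicator (interior K) x *\<^sub>R f x) \<in> borel_measurable lebesgue"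
      by (intro borel_measurable_sum borel_measurable_integrable[OF iK])
    show "AE x in lebesgue. indicator D x *\<^sub>R f x = (\<Sum>K\<in>S. indicator (interior K) x *\<^sub>R f x)"
      using AE_mesh_interior[OF S D, unfolded AE_lebesgue_on_iff[OF Dm]]
    proof eventually_elim
      case (elim x)
      show ?case
      proof (cases "x \<in> D")
        case True
        then obtain K where K: "K \<in> S" "x \<in> interior K" using elim by blast
        have "indicator (interior K') x *\<^sub>R f x = (if K' = K then f x else 0)" if "K' \<in> S" for K'
        proof (cases "x \<in> interior K'")
          case True
          then have "K' = K" by (rule fe_mesh_interiors_disjoint[OF S that K(1) _ K(2)])
          then show ?thesis using K(2) by simp
        next
          case False
          then have "K' \<noteq> K" using K(2) by blast
          then show ?thesis using False by simp
        qed
        then have "(\<Sum>K\<in>S. indicator (interior K) x *\<^sub>R f x) = (\<Sum>K'\<in>S. if K' = K then f x else 0)"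
          by (intro sum.cong) auto
        then show ?thesis using True K(1) fin by simp
      next
        case False
        have "x \<notin> interior K" if "K \<in> S" for K
          using interior_elem_subset[OF that] False unfolding D by (auto dest: subsetD)
        then show ?thesis using False by simp
      qed
    qed
  qed
  also have "\<dots> = (\<Sum>K\<in>S. \<integral>x. indicator (interior K) x *\<^sub>R f x \<partial>lebesgue)"
    by (rule Bochner_Integration.integral_sum[OF iK])
  also have "\<dots> = (\<Sum>K\<in>S. \<integral>x. f x \<partial>lebesgue_on (interior K))"
    by (intro sum.cong refl integral_lebesgue_on_eq[OF Km, symmetric])
  finally show "(\<integral>x. f x \<partial>lebesgue_on D) = (\<Sum>K\<in>S. \<integral>x. f x \<partial>lebesgue_on (interior K))" .
qed

section \<open>Elementwise gradients and Lipschitz continuity\<close>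

lemma grad_transform_open:
  fixes f g :: "real^'n \<Rightarrow> real"
  assumes U: "open U" "x \<in> U" and eq: "\<And>y. y \<in> U \<Longrightarrow> f y = g y" and f: "f differentiable (at x)"
  shows "g differentiable (at x)" "grad g x = grad f x"
proof -
  have "(g has_derivative (\<lambda>h. grad f x \<bullet> h)) (at x)"
    by (rule has_derivative_transform_within_open[OF has_derivative_grad[OF f] U eq])
  then show "g differentiable (at x)" "grad g x = grad f x"
    by (auto simp: differentiable_def intro: has_derivative_grad_eqI)
qed

lemma strictly_differentiable_transform:
  fixes f g :: "real^'n \<Rightarrow> real"
  assumes U: "open U" "x \<in> U" and eq: "\<And>y. y \<in> U \<Longrightarrow> f y = g y" and f: "strictly_differentiable f x"
  shows "strictly_differentiable g x"
  unfolding strictly_differentiable_def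
proof (intro conjI allI impI)
  have fd: "f differentiable (at x)" using f unfolding strictly_differentiable_def by simp
  note g = grad_transform_open[OF U eq fd]
  show "g differentiable (at x)" by (rule g(1))
  fix \<eta> :: real assume "\<eta> > 0"
  then obtain d where d: "d > 0" "\<forall>y\<in>ball x d. \<forall>z\<in>ball x d. \<bar>f y - f z - grad f x \<bullet> (y - z)\<bar> \<le> \<eta> * norm (y - z)"
    using f unfolding strictly_differentiable_def by blast
  obtain e where e: "e > 0" "ball x e \<subseteq> U" using U openE by blast
  have "\<bar>g y - g z - grad g x \<bullet> (y - z)\<bar> \<le> \<eta> * norm (y - z)" if "y \<in> ball x (min d e)" "z \<in> ball x (min d e)" for y z
  proof -
    have U': "y \<in> U" "z \<in> U" using that e(2) by auto
    have "\<bar>f y - f z - grad f x \<bullet> (y - z)\<bar> \<le> \<eta> * norm (y - z)" using d(2) that by simp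
    then show ?thesis using eq[OF U'(1)] eq[OF U'(2)] g(2) by simp
  qed
  then show "\<exists>d>0. \<forall>y\<in>ball x d. \<forall>z\<in>ball x d. \<bar>g y - g z - grad g x \<bullet> (y - z)\<bar> \<le> \<eta> * norm (y - z)"
    using d(1) e(1) by (intro exI[of _ "min d e"]) auto
qed

lemma fe_elem_grad:
  assumes p: "poly_le r p" and eq: "\<And>x. x \<in> K \<Longrightarrow> w x = p x" and x: "x \<in> interior K"
  shows "strictly_differentiable w x" "grad w x = grad p x"
proof -
  have eq': "p y = w y" if "y \<in> interior K" for y using eq[of y] that interior_subset[of K] by auto
  show "strictly_differentiable w x"
    by (rule strictly_differentiable_transform[OF open_interior x eq' poly_le_strictly_differentiable[OF p]])
  show "grad w x = grad p x"
    by (rule grad_transform_open(2)[OF open_interior x eq' poly_le_differentiable[OF p]])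
qed

text \<open>A common Lipschitz constant on closed pieces persists along a segment that they cover,
  in whatever pattern the segment crosses them; the reduction is to a function of one real
  parameter.\<close>

lemma lipschitz_closed_cover:
  fixes f :: "real^'n \<Rightarrow> real"
  assumes "finite I" "\<And>i. i \<in> I \<Longrightarrow> closed (U i)" "0 \<le> M"
    and lip: "\<And>i x y. i \<in> I \<Longrightarrow> x \<in> U i \<Longrightarrow> y \<in> U i \<Longrightarrow> \<bar>f x - f y\<bar> \<le> M * norm (x - y)"
    and seg: "closed_segment a b \<subseteq> (\<Union>i\<in>I. U i)"
  shows "\<bar>f a - f b\<bar> \<le> M * norm (a - b)"
proof -
  let ?l = "\<lambda>t. a + t *\<^sub>R (b - a)"
  have "(M * norm (a - b))-lipschitz_on {0..1} (\<lambda>t. f (?l t))"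
  proof (rule lipschitz_on_closed_Union[where I=I and U="\<lambda>i. ?l -` U i"])
    fix i assume i: "i \<in> I"
    show "(M * norm (a - b))-lipschitz_on (?l -` U i) (\<lambda>t. f (?l t))"
    proof (rule lipschitz_onI)
      fix s t assume st: "s \<in> ?l -` U i" "t \<in> ?l -` U i"
      have "\<bar>f (?l s) - f (?l t)\<bar> \<le> M * norm (?l s - ?l t)"
        by (rule lip[OF i]) (use st in auto)
      also have "?l s - ?l t = (s - t) *\<^sub>R (b - a)" by (simp add: algebra_simps)
      finally show "dist (f (?l s)) (f (?l t)) \<le> M * norm (a - b) * dist s t"
        by (simp add: dist_real_def norm_minus_commute ac_simps)
    qed (use assms(3) in simp)
    show "closed (?l -` U i)"
      by (intro closed_vimage assms(2)[OF i] continuous_intros)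
  next
    show "{0..1} \<subseteq> (\<Union>i\<in>I. ?l -` U i)"
    proof
      fix t :: real assume "t \<in> {0..1}"
      then have "?l t \<in> closed_segment a b" unfolding in_segment by (intro exI[of _ t]) (auto simp: algebra_simps)
      then show "t \<in> (\<Union>i\<in>I. ?l -` U i)" using seg by blast
    qed
  qed (use assms in auto)
  then have "dist (f (?l 0)) (f (?l 1)) \<le> M * norm (a - b) * dist 0 (1::real)"
    by (rule lipschitz_onD) auto
  then show ?thesis by (simp add: dist_real_def)
qed

lemma fe_space_elem:
  assumes "w \<in> fe_space r T" "K \<in> T"
  obtains p where "poly_le r p" "\<And>x. x \<in> K \<Longrightarrow> w x = p x"
  using assms unfolding fe_space_def by blast

lemma fe_elem_lipschitz:
  assumes S: "fe_mesh S" and w: "w \<in> fe_space r S"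
  obtains M where "0 \<le> M" "\<And>K x y. K \<in> S \<Longrightarrow> x \<in> K \<Longrightarrow> y \<in> K \<Longrightarrow> \<bar>w x - w y\<bar> \<le> M * norm (x - y)"
    "\<And>K x. K \<in> S \<Longrightarrow> x \<in> interior K \<Longrightarrow> norm (grad w x) \<le> M"
proof -
  have "\<exists>M\<ge>0. (\<forall>x\<in>K. \<forall>y\<in>K. \<bar>w x - w y\<bar> \<le> M * norm (x - y)) \<and> (\<forall>x\<in>interior K. norm (grad w x) \<le> M)" if K: "K \<in> S" for K
  proof -
    obtain p where p: "poly_le r p" "\<And>x. x \<in> K \<Longrightarrow> w x = p x" using fe_space_elem[OF w K] by blast
    obtain M where M: "M \<ge> 0" "\<And>x. x \<in> K \<Longrightarrow> norm (grad p x) \<le> M \<and> (\<forall>y\<in>K. \<bar>p x - p y\<bar> \<le> M * norm (x - y))"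
      using poly_le_lipschitz_compact[OF p(1) fe_mesh_elem(1,2)[OF S K]] by blast
    have "norm (grad w x) \<le> M" if "x \<in> interior K" for x
      using fe_elem_grad(2)[OF p that] M(2)[of x] that interior_subset[of K] by auto
    then show ?thesis using M p(2) by (intro exI[of _ M]) auto
  qed
  then obtain M where M: "\<And>K. K \<in> S \<Longrightarrow> M K \<ge> 0"
    "\<And>K x y. K \<in> S \<Longrightarrow> x \<in> K \<Longrightarrow> y \<in> K \<Longrightarrow> \<bar>w x - w y\<bar> \<le> M K * norm (x - y)"
    "\<And>K x. K \<in> S \<Longrightarrow> x \<in> interior K \<Longrightarrow> norm (grad w x) \<le> M K" by metis
  \<comment> \<open>There are finitely many elements, so the sum of the elementwise constants bounds
    them all.\<close>
  have le: "M K \<le> sum M S" if "K \<in> S" for K using M(1) that fe_mesh_finite[OF S] by (intro member_le_sum) auto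
  show thesis
  proof (rule that[of "sum M S"])
    show "0 \<le> sum M S" using M(1) by (rule sum_nonneg)
    show "\<bar>w x - w y\<bar> \<le> sum M S * norm (x - y)" if "K \<in> S" "x \<in> K" "y \<in> K" for K x y
      using M(2)[OF that] mult_right_mono[OF le[OF that(1)] norm_ge_zero, of "x - y"] by linarith
    show "norm (grad w x) \<le> sum M S" if "K \<in> S" "x \<in> interior K" for K x
      using M(3)[OF that] le[OF that(1)] by linarith
  qed
qed

text \<open>A segment inside D meets elements of S only, so w is locally Lipschitz with one constant
  for all elements, and it is differentiable off the skeleton, a null set. A single M bounds both
  the values and the gradient.\<close>

lemma fe_weak_grad:
  fixes w :: "real^'n \<Rightarrow> real"
  assumes S: "fe_mesh S" and w: "w \<in> fe_space r S" and D: "D = interior (\<Union>S)"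
  obtains M where "0 \<le> M" "has_weak_grad D w (grad w)" "AE x in lebesgue_on D. norm (grad w x) \<le> M"
    "AE x in lebesgue_on D. norm (w x) \<le> M"
proof -
  obtain M where M: "0 \<le> M" "\<And>K x y. K \<in> S \<Longrightarrow> x \<in> K \<Longrightarrow> y \<in> K \<Longrightarrow> \<bar>w x - w y\<bar> \<le> M * norm (x - y)"
    "\<And>K x. K \<in> S \<Longrightarrow> x \<in> interior K \<Longrightarrow> norm (grad w x) \<le> M" using fe_elem_lipschitz[OF S w] by blast
  have oD: "open D" unfolding D by (rule open_interior)
  have lip: "\<forall>x\<in>D. \<exists>e>0. ball x e \<subseteq> D \<and> (\<forall>y\<in>ball x e. \<forall>z\<in>ball x e. \<bar>w y - w z\<bar> \<le> M * norm (y - z))"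
  proof
    fix x assume "x \<in> D"
    then obtain e where e: "e > 0" "ball x e \<subseteq> D" using oD openE by blast
    have "\<bar>w y - w z\<bar> \<le> M * norm (y - z)" if yz: "y \<in> ball x e" "z \<in> ball x e" for y z
    proof (rule lipschitz_closed_cover[where I=S and U="\<lambda>K. K"])
      have "closed_segment y z \<subseteq> ball x e" using yz by (simp add: closed_segment_subset)
      then show "closed_segment y z \<subseteq> (\<Union>K\<in>S. K)" using e(2) interior_subset[of "\<Union>S"] unfolding D by auto
    qed (use M fe_mesh_finite[OF S] fe_mesh_elem(3)[OF S] in auto)
    then show "\<exists>e>0. ball x e \<subseteq> D \<and> (\<forall>y\<in>ball x e. \<forall>z\<in>ball x e. \<bar>w y - w z\<bar> \<le> M * norm (y - z))"
      using e by blast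
  qed
  have diff: "AE x in lebesgue_on D. w differentiable (at x)"
    using AE_mesh_interior[OF S D]
  proof eventually_elim
    case (elim x)
    then obtain K where K: "K \<in> S" "x \<in> interior K" by blast
    obtain p where p: "poly_le r p" "\<And>x. x \<in> K \<Longrightarrow> w x = p x" using fe_space_elem[OF w K(1)] by blast
    show ?case using fe_elem_grad(1)[OF p K(2)] unfolding strictly_differentiable_def by simp
  qed
  have "has_weak_grad D w (grad w)" by (rule has_weak_grad_lipschitz[OF oD lip diff])
  moreover have gM: "AE x in lebesgue_on D. norm (grad w x) \<le> M"
    using AE_mesh_interior[OF S D] by eventually_elim (use M(3) in blast)
  moreover obtain B where B: "\<And>x. x \<in> \<Union>S \<Longrightarrow> norm (w x) \<le> B"
  proof -
    have "compact (\<Union>S)" using fe_mesh_finite[OF S] fe_mesh_elem(1)[OF S] by (intro compact_Union) auto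
    moreover have "continuous_on (\<Union>S) w" using w unfolding fe_space_def by simp
    ultimately have "bounded (w ` \<Union>S)" by (intro compact_imp_bounded compact_continuous_image)
    then show thesis using that unfolding bounded_iff by blast
  qed
  moreover have "AE x in lebesgue_on D. norm (w x) \<le> max M B"
  proof (rule AE_I2)
    fix x assume "x \<in> space (lebesgue_on D)"
    then have "x \<in> \<Union>S" using interior_subset[of "\<Union>S"] unfolding D by auto
    from B[OF this] show "norm (w x) \<le> max M B" by linarith
  qed
  moreover have "AE x in lebesgue_on D. norm (grad w x) \<le> max M B" using gM by eventually_elim simp
  moreover have "0 \<le> max M B" using M(1) by simp
  ultimately show thesis using that[of "max M B"] by blast
qed

text \<open>The complement of \<Omega> is one more closed set in a cover of the space by elements,
  and the zero extension is constant on it; so the extension is globally Lipschitz. Values of a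
  finite element function outside the mesh are arbitrary, which is why v is replaced by w.\<close>

lemma fe_H10:
  fixes v :: "real^'n \<Rightarrow> real"
  assumes T: "fe_mesh T" "\<Union>T = closure \<Omega>" and \<Omega>: "open \<Omega>" "bounded \<Omega>" "interior (closure \<Omega>) = \<Omega>"
    and v: "v \<in> fe_space r T" and zero: "\<And>x. x \<in> frontier \<Omega> \<Longrightarrow> v x = 0"
  shows "H10 \<Omega> v"
proof -
  define w where "w x = (if x \<in> \<Omega> then v x else 0)" for x
  have wv: "w x = v x" if "x \<in> closure \<Omega>" for x
    using zero[of x] that \<Omega>(1) unfolding frontier_def w_def by (auto simp: interior_open)
  obtain M where M: "0 \<le> M" "\<And>K x y. K \<in> T \<Longrightarrow> x \<in> K \<Longrightarrow> y \<in> K \<Longrightarrow> \<bar>v x - v y\<bar> \<le> M * norm (x - y)"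
    using fe_elem_lipschitz[OF T(1) v] by metis
  have "H10 \<Omega> w"
  proof (rule H10_lipschitz[OF \<Omega>(1,2)])
    show "w x = 0" if "x \<notin> \<Omega>" for x using that by (simp add: w_def)
    fix x y
    show "\<bar>w x - w y\<bar> \<le> M * norm (x - y)"
    proof (rule lipschitz_closed_cover[where I="insert (- \<Omega>) T" and U="\<lambda>K. K"])
      show "finite (insert (- \<Omega>) T)" using fe_mesh_finite[OF T(1)] by simp
      show "closed K" if "K \<in> insert (- \<Omega>) T" for K using that \<Omega>(1) fe_mesh_elem(3)[OF T(1)] by auto
      show "\<bar>w x - w y\<bar> \<le> M * norm (x - y)" if "K \<in> insert (- \<Omega>) T" "x \<in> K" "y \<in> K" for K x y
      proof (cases "K \<in> T")
        case True
        then have "x \<in> closure \<Omega>" "y \<in> closure \<Omega>" using that T(2) by auto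
        then show ?thesis using M(2)[OF True that(2,3)] by (simp add: wv)
      next
        case False
        then have "x \<notin> \<Omega>" "y \<notin> \<Omega>" using that by auto
        then show ?thesis using M(1) by (simp add: w_def)
      qed
      have "(\<Union>K\<in>insert (- \<Omega>) T. K) = UNIV" using T(2) closure_subset[of \<Omega>] by auto
      then show "closed_segment x y \<subseteq> (\<Union>K\<in>insert (- \<Omega>) T. K)" by simp
    qed (rule M(1))
  next
    have D: "\<Omega> = interior (\<Union>T)" using T(2) \<Omega>(3) by simp
    show "AE x in lebesgue_on \<Omega>. strictly_differentiable w x"
      using AE_mesh_interior[OF T(1) D]
    proof eventually_elim
      case (elim x)
      then obtain K where K: "K \<in> T" "x \<in> interior K" by blast
      obtain p where p: "poly_le r p" "\<And>x. x \<in> K \<Longrightarrow> v x = p x" using fe_space_elem[OF v K(1)] by blast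
      have "w y = p y" if "y \<in> K" for y using p(2)[OF that] wv[of y] that K(1) T(2) by auto
      then show ?case by (rule fe_elem_grad(1)[OF p(1) _ K(2)])
    qed
  qed
  then show ?thesis by (rule H10_cong[rotated]) (simp add: w_def)
qed

lemma fe_H10_zero_frontier:
  fixes u :: "real^'n \<Rightarrow> real"
  assumes T: "fe_mesh T" "\<Union>T = closure \<Omega>" and \<Omega>: "open \<Omega>" "bounded \<Omega>" "lipschitz_boundary \<Omega>"
    and u: "u \<in> fe_space r T" "H10 \<Omega> u" and z: "z \<in> frontier \<Omega>"
  shows "u z = 0"
proof -
  have D: "\<Omega> = interior (\<Union>T)" using T(2) interior_closure_lipschitz[OF \<Omega>(1,3)] by simp
  obtain M where M: "0 \<le> M" "has_weak_grad \<Omega> u (grad u)" "AE x in lebesgue_on \<Omega>. norm (grad u x) \<le> M"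
    "AE x in lebesgue_on \<Omega>. norm (u x) \<le> M"
    by (rule fe_weak_grad[OF T(1) u(1) D])
  have "continuous_on (closure \<Omega>) u" using u(1) T(2) unfolding fe_space_def by simp
  then show ?thesis
    by (rule H10_zero_on_frontier[OF \<Omega>(1,2) u(2) M(2,3,1) _ z lipschitz_boundary_exterior[OF \<Omega>(1,3) z]])
qed

section \<open>The energy form on finite element functions\<close>

lemma elliptic_symmetric:
  assumes "elliptic_coefficient \<Omega> amin amax A" "x \<in> \<Omega>"
  shows "(A x *v \<xi>) \<bullet> \<eta> = (A x *v \<eta>) \<bullet> \<xi>"
proof -
  have "transpose (A x) = A x" using assms unfolding elliptic_coefficient_def by blast
  then have "(A x *v \<xi>) \<bullet> \<eta> = (\<xi> v* A x) \<bullet> \<eta>" by (metis transpose_matrix_vector)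
  also have "\<dots> = \<xi> \<bullet> (A x *v \<eta>)" by (rule dot_lmul_matrix)
  finally show ?thesis by (simp add: inner_commute)
qed

lemma elliptic_bounds:
  assumes "elliptic_coefficient \<Omega> amin amax A" "x \<in> \<Omega>"
  shows "amin * (norm \<xi>)\<^sup>2 \<le> (A x *v \<xi>) \<bullet> \<xi>" "(A x *v \<xi>) \<bullet> \<xi> \<le> amax * (norm \<xi>)\<^sup>2"
  using assms unfolding elliptic_coefficient_def by blast+

lemma elliptic_nonneg:
  assumes "elliptic_coefficient \<Omega> amin amax A" "0 < amin" "x \<in> \<Omega>"
  shows "0 \<le> (A x *v \<xi>) \<bullet> \<xi>"
proof -
  have "0 \<le> amin * (norm \<xi>)\<^sup>2" using assms(2) by simp
  also have "\<dots> \<le> (A x *v \<xi>) \<bullet> \<xi>" by (rule elliptic_bounds(1)[OF assms(1,3)])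
  finally show ?thesis .
qed

text \<open>Nonnegativity of the quadratic form at s \<xi> + \<eta> and at s \<xi> - \<eta>. The
  weight s decides how much of which square is to be absorbed later.\<close>

lemma elliptic_weighted_Cauchy:
  assumes A: "elliptic_coefficient \<Omega> amin amax A" "0 < amin" "x \<in> \<Omega>" and s: "s > 0"
  shows "\<bar>(A x *v \<xi>) \<bullet> \<eta>\<bar> \<le> s / 2 * ((A x *v \<xi>) \<bullet> \<xi>) + 1 / (2 * s) * ((A x *v \<eta>) \<bullet> \<eta>)"
proof -
  let ?a = "(A x *v \<xi>) \<bullet> \<xi>" and ?b = "(A x *v \<eta>) \<bullet> \<eta>" and ?c = "(A x *v \<xi>) \<bullet> \<eta>"
  have ex: "(A x *v (s *\<^sub>R \<xi> + t *\<^sub>R \<eta>)) \<bullet> (s *\<^sub>R \<xi> + t *\<^sub>R \<eta>) = s\<^sup>2 * ?a + 2 * s * t * ?c + t\<^sup>2 * ?b" for t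
    using elliptic_symmetric[OF A(1,3), of \<eta> \<xi>]
    by (simp add: matrix_vector_right_distrib matrix_vector_mult_scaleR inner_add_left inner_add_right power2_eq_square algebra_simps)
  have p: "0 \<le> s\<^sup>2 * ?a + 2 * s * 1 * ?c + 1\<^sup>2 * ?b" unfolding ex[symmetric] by (rule elliptic_nonneg[OF A])
  have m: "0 \<le> s\<^sup>2 * ?a + 2 * s * (- 1) * ?c + (- 1)\<^sup>2 * ?b" unfolding ex[symmetric] by (rule elliptic_nonneg[OF A])
  have "2 * s * \<bar>?c\<bar> = \<bar>2 * s * ?c\<bar>" using s by (simp add: abs_mult)
  also have "\<dots> \<le> s\<^sup>2 * ?a + ?b" using p m by (simp add: abs_le_iff)
  finally have "\<bar>?c\<bar> \<le> (s\<^sup>2 * ?a + ?b) / (2 * s)" using s by (simp add: pos_le_divide_eq mult.commute)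
  also have "\<dots> = s / 2 * ?a + 1 / (2 * s) * ?b" using s by (simp add: add_divide_distrib power2_eq_square)
  finally show ?thesis .
qed

text \<open>The bound comes from the quadratic forms of the two gradients and amax; the single
  entries of A enter through measurability.\<close>

lemma elliptic_form_integrable:
  fixes A :: "real^'n \<Rightarrow> real^'n^'n"
  assumes A: "elliptic_coefficient \<Omega> amin amax A" "0 < amin" and \<Omega>: "open \<Omega>" and D: "open D" "bounded D" "D \<subseteq> \<Omega>"
    and g: "g \<in> borel_measurable (lebesgue_on D)" "AE x in lebesgue_on D. norm (g x) \<le> M"
    and k: "k \<in> borel_measurable (lebesgue_on D)" "AE x in lebesgue_on D. norm (k x) \<le> N"
  shows "integrable (lebesgue_on D) (\<lambda>x. (A x *v g x) \<bullet> k x)"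
proof (rule integrable_bounded_on[OF open_sets_lebesgue[OF D(1)] D(2)])
  have sub: "f \<in> borel_measurable (lebesgue_on D)" if "f \<in> borel_measurable (lebesgue_on \<Omega>)" for f :: "real^'n \<Rightarrow> real"
    by (rule measurable_restrict_mono[OF that D(3)])
  have Am: "(\<lambda>x. A x $ i $ j) \<in> borel_measurable (lebesgue_on D)" for i j
    using A(1) unfolding elliptic_coefficient_def Linf_def by (intro sub) blast
  have gm: "(\<lambda>x. g x $ j) \<in> borel_measurable (lebesgue_on D)" for j
    using g(1) borel_measurable_euclidean_space[of g] by (auto simp: Basis_vec_def inner_axis)
  have km: "(\<lambda>x. k x $ j) \<in> borel_measurable (lebesgue_on D)" for j
    using k(1) borel_measurable_euclidean_space[of k] by (auto simp: Basis_vec_def inner_axis)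
  have "(\<lambda>x. \<Sum>i\<in>UNIV. (\<Sum>j\<in>UNIV. A x $ i $ j * g x $ j) * k x $ i) \<in> borel_measurable (lebesgue_on D)"
    by (intro borel_measurable_sum borel_measurable_times Am gm km)
  then show "(\<lambda>x. (A x *v g x) \<bullet> k x) \<in> borel_measurable (lebesgue_on D)"
    by (simp add: inner_vec_def matrix_vector_mult_def)
  show "AE x in lebesgue_on D. norm ((A x *v g x) \<bullet> k x) \<le> 1 / 2 * (\<bar>amax\<bar> * M\<^sup>2) + 1 / 2 * (\<bar>amax\<bar> * N\<^sup>2)"
    using g(2) k(2) AE_space[of "lebesgue_on D"]
  proof eventually_elim
    case (elim x)
    then have x: "x \<in> \<Omega>" using D(3) by auto
    have up: "(A x *v \<xi>) \<bullet> \<xi> \<le> \<bar>amax\<bar> * b\<^sup>2" if "norm \<xi> \<le> b" for \<xi> b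
    proof -
      have "(A x *v \<xi>) \<bullet> \<xi> \<le> amax * (norm \<xi>)\<^sup>2" by (rule elliptic_bounds(2)[OF A(1) x])
      also have "\<dots> \<le> \<bar>amax\<bar> * (norm \<xi>)\<^sup>2" by (intro mult_right_mono) auto
      also have "\<dots> \<le> \<bar>amax\<bar> * b\<^sup>2" using that by (intro mult_left_mono power_mono) auto
      finally show ?thesis .
    qed
    have "\<bar>(A x *v g x) \<bullet> k x\<bar> \<le> 1 / 2 * ((A x *v g x) \<bullet> g x) + 1 / 2 * ((A x *v k x) \<bullet> k x)"
      using elliptic_weighted_Cauchy[OF A x, of 1 "g x" "k x"] by simp
    also have "\<dots> \<le> 1 / 2 * (\<bar>amax\<bar> * M\<^sup>2) + 1 / 2 * (\<bar>amax\<bar> * N\<^sup>2)"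
      using up elim by (intro add_mono mult_left_mono) auto
    finally show ?case by simp
  qed
qed

text \<open>The share of one element in \<open>a_form\<close>, with the classical gradient, which
  for finite element functions exists throughout the open element.\<close>

definition elem_form :: "(real^'n \<Rightarrow> real^'n^'n) \<Rightarrow> real \<Rightarrow> (real^'n) set \<Rightarrow> (real^'n \<Rightarrow> real) \<Rightarrow> (real^'n \<Rightarrow> real) \<Rightarrow> real" where
  "elem_form A \<epsilon> K u v = \<epsilon>\<^sup>2 * (\<integral>x. (A x *v grad u x) \<bullet> grad v x \<partial>lebesgue_on (interior K)) +
     (\<integral>x. u x * v x \<partial>lebesgue_on (interior K))"

lemma fe_product_integrable:
  assumes S: "fe_mesh S" and D: "D = interior (\<Union>S)" "bounded D" and u: "u \<in> fe_space r S" and v: "v \<in> fe_space r S"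
  shows "integrable (lebesgue_on D) (\<lambda>x. u x * v x)"
proof -
  obtain M where M: "0 \<le> M" "has_weak_grad D u (grad u)" "AE x in lebesgue_on D. norm (grad u x) \<le> M"
    "AE x in lebesgue_on D. norm (u x) \<le> M" by (rule fe_weak_grad[OF S u D(1)])
  obtain N where N: "0 \<le> N" "has_weak_grad D v (grad v)" "AE x in lebesgue_on D. norm (grad v x) \<le> N"
    "AE x in lebesgue_on D. norm (v x) \<le> N" by (rule fe_weak_grad[OF S v D(1)])
  have oD: "open D" unfolding D by (rule open_interior)
  show ?thesis
  proof (rule integrable_bounded_on[OF open_sets_lebesgue[OF oD] D(2)])
    show "(\<lambda>x. u x * v x) \<in> borel_measurable (lebesgue_on D)"
      by (intro borel_measurable_times has_weak_grad_measurable(2)[OF oD M(2)] has_weak_grad_measurable(2)[OF oD N(2)])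
    show "AE x in lebesgue_on D. norm (u x * v x) \<le> M * N"
      using M(4) N(4)
    proof eventually_elim
      case (elim x)
      then show ?case unfolding norm_mult using M(1) by (intro mult_mono) auto
    qed
  qed
qed

lemma fe_form_integrable:
  fixes A :: "real^'n \<Rightarrow> real^'n^'n"
  assumes A: "elliptic_coefficient \<Omega> amin amax A" "0 < amin" and \<Omega>: "open \<Omega>"
    and S: "fe_mesh S" and D: "D = interior (\<Union>S)" "bounded D" "D \<subseteq> \<Omega>" and u: "u \<in> fe_space r S" and v: "v \<in> fe_space r S"
  shows "integrable (lebesgue_on D) (\<lambda>x. (A x *v grad u x) \<bullet> grad v x)"
proof -
  obtain M where M: "0 \<le> M" "has_weak_grad D u (grad u)" "AE x in lebesgue_on D. norm (grad u x) \<le> M"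
    "AE x in lebesgue_on D. norm (u x) \<le> M" by (rule fe_weak_grad[OF S u D(1)])
  obtain N where N: "0 \<le> N" "has_weak_grad D v (grad v)" "AE x in lebesgue_on D. norm (grad v x) \<le> N"
    "AE x in lebesgue_on D. norm (v x) \<le> N" by (rule fe_weak_grad[OF S v D(1)])
  have oD: "open D" unfolding D by (rule open_interior)
  show ?thesis
    by (rule elliptic_form_integrable[OF A \<Omega> oD D(2,3) has_weak_grad_measurable(1)[OF oD M(2)] M(3)
        has_weak_grad_measurable(1)[OF oD N(2)] N(3)])
qed

text \<open>The chosen weak gradient agrees almost everywhere with the classical one, and the
  skeleton, where the latter may not exist, is a null set.\<close>

lemma a_form_fe:
  fixes A :: "real^'n \<Rightarrow> real^'n^'n"
  assumes A: "elliptic_coefficient \<Omega> amin amax A" "0 < amin" and \<Omega>: "open \<Omega>"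
    and S: "fe_mesh S" and D: "D = interior (\<Union>S)" "bounded D" "D \<subseteq> \<Omega>" and u: "u \<in> fe_space r S" and v: "v \<in> fe_space r S"
  shows "a_form A \<epsilon> D u v = (\<Sum>K\<in>S. elem_form A \<epsilon> K u v)"
proof -
  obtain M where M: "0 \<le> M" "has_weak_grad D u (grad u)" "AE x in lebesgue_on D. norm (grad u x) \<le> M"
    "AE x in lebesgue_on D. norm (u x) \<le> M" by (rule fe_weak_grad[OF S u D(1)])
  obtain N where N: "0 \<le> N" "has_weak_grad D v (grad v)" "AE x in lebesgue_on D. norm (grad v x) \<le> N"
    "AE x in lebesgue_on D. norm (v x) \<le> N" by (rule fe_weak_grad[OF S v D(1)])
  have oD: "open D" unfolding D by (rule open_interior)
  note i = fe_form_integrable[OF A \<Omega> S D u v]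
  note wu = weak_grad_AE[OF oD M(2)] and wv = weak_grad_AE[OF oD N(2)]
  have wub: "AE x in lebesgue_on D. norm (weak_grad D u x) \<le> M" using wu M(3) by eventually_elim simp
  have wvb: "AE x in lebesgue_on D. norm (weak_grad D v x) \<le> N" using wv N(3) by eventually_elim simp
  have "(\<integral>x. (A x *v weak_grad D u x) \<bullet> weak_grad D v x \<partial>lebesgue_on D) = (\<integral>x. (A x *v grad u x) \<bullet> grad v x \<partial>lebesgue_on D)"
  proof (rule integral_cong_AE)
    show "(\<lambda>x. (A x *v weak_grad D u x) \<bullet> weak_grad D v x) \<in> borel_measurable (lebesgue_on D)"
      by (rule borel_measurable_integrable, rule elliptic_form_integrable[OF A \<Omega> oD D(2,3)
        has_weak_grad_measurable(1)[OF oD has_weak_grad_weak_grad[OF M(2)]] wub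
        has_weak_grad_measurable(1)[OF oD has_weak_grad_weak_grad[OF N(2)]] wvb])
    show "(\<lambda>x. (A x *v grad u x) \<bullet> grad v x) \<in> borel_measurable (lebesgue_on D)" by (rule borel_measurable_integrable[OF i])
    show "AE x in lebesgue_on D. (A x *v weak_grad D u x) \<bullet> weak_grad D v x = (A x *v grad u x) \<bullet> grad v x"
      using wu wv by eventually_elim simp
  qed
  then show ?thesis
    unfolding a_form_def elem_form_def
    by (simp add: integral_mesh(1)[OF S D(1) i] integral_mesh(1)[OF S D(1) fe_product_integrable[OF S D(1,2) u v]]
        sum.distrib sum_distrib_left)
qed

section \<open>Element contributions and submeshes\<close>

lemma fe_space_subset: "w \<in> fe_space r T \<Longrightarrow> S \<subseteq> T \<Longrightarrow> w \<in> fe_space r S"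
  unfolding fe_space_def using continuous_on_subset[of "\<Union>T" w "\<Union>S"] by blast

lemma fe_space_diff:
  assumes "u \<in> fe_space r T" "v \<in> fe_space r T" shows "(\<lambda>x. u x - v x) \<in> fe_space r T"
  unfolding fe_space_def
proof (intro CollectI conjI ballI)
  show "continuous_on (\<Union>T) (\<lambda>x. u x - v x)" using assms unfolding fe_space_def by (auto intro: continuous_on_diff)
  fix K assume K: "K \<in> T"
  obtain p where p: "poly_le r p" "\<And>x. x \<in> K \<Longrightarrow> u x = p x" using fe_space_elem[OF assms(1) K] by blast
  obtain q where q: "poly_le r q" "\<And>x. x \<in> K \<Longrightarrow> v x = q x" using fe_space_elem[OF assms(2) K] by blast
  show "\<exists>p. poly_le r p \<and> (\<forall>x\<in>K. u x - v x = p x)"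
    using poly_le_diff[OF p(1) q(1)] p(2) q(2) by (intro exI[of _ "\<lambda>x. p x - q x"]) auto
qed

lemma elem_form_cong:
  assumes "\<And>x. x \<in> K \<Longrightarrow> u x = p x" "poly_le r p" "\<And>x. x \<in> K \<Longrightarrow> v x = q x" "poly_le r q"
  shows "elem_form A \<epsilon> K u v = elem_form A \<epsilon> K p q"
proof -
  have "grad u x = grad p x" "grad v x = grad q x" "u x = p x" "v x = q x" if "x \<in> interior K" for x
    using fe_elem_grad(2)[OF assms(2,1) that] fe_elem_grad(2)[OF assms(4,3) that] assms(1)[of x] assms(3)[of x] that
      interior_subset[of K] by auto
  then show ?thesis unfolding elem_form_def
    by (intro arg_cong2[of _ _ _ _ "(+)"] arg_cong2[of _ _ _ _ "(*)"] refl Bochner_Integration.integral_cong) auto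
qed

lemma elem_interior_bounded:
  assumes "fe_mesh T" "K \<in> T" shows "open (interior K)" "bounded (interior K)"
  using fe_mesh_elem(4)[OF assms] by (auto intro: bounded_interior)

lemma poly_form_integrable:
  fixes A :: "real^'n \<Rightarrow> real^'n^'n"
  assumes A: "elliptic_coefficient \<Omega> amin amax A" "0 < amin" and \<Omega>: "open \<Omega>" and D: "open D" "bounded D" "D \<subseteq> \<Omega>"
    and p: "poly_le r p" and q: "poly_le s q"
  shows "integrable (lebesgue_on D) (\<lambda>x. (A x *v grad p x) \<bullet> grad q x)"
proof -
  have "\<exists>M. AE x in lebesgue_on D. norm (grad f x) \<le> M" if f: "poly_le t f" for f t
  proof -
    have "bounded (grad f ` closure D)"
      using D(2) by (intro compact_imp_bounded compact_continuous_image poly_le_continuous_grad[OF f]) simp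
    then obtain M where "\<forall>x\<in>closure D. norm (grad f x) \<le> M" unfolding bounded_iff by auto
    then show ?thesis using closure_subset[of D] by (intro exI[of _ M] AE_I2) auto
  qed
  then obtain M N where MN: "AE x in lebesgue_on D. norm (grad p x) \<le> M" "AE x in lebesgue_on D. norm (grad q x) \<le> N"
    using p q by meson
  have m: "grad f \<in> borel_measurable (lebesgue_on D)" if f: "poly_le t f" for f t
    using continuous_lebesgue_measurable[OF poly_le_continuous_grad[OF f]] by (rule measurable_restrict_space1)
  show ?thesis by (rule elliptic_form_integrable[OF A \<Omega> D m[OF p] MN(1) m[OF q] MN(2)])
qed

lemma elem_form_diff_left:
  fixes A :: "real^'n \<Rightarrow> real^'n^'n"
  assumes A: "elliptic_coefficient \<Omega> amin amax A" "0 < amin" and \<Omega>: "open \<Omega>" and T: "fe_mesh T" "K \<in> T" "interior K \<subseteq> \<Omega>"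
    and u: "u \<in> fe_space r T" and w: "w \<in> fe_space r T" and v: "v \<in> fe_space r T"
  shows "elem_form A \<epsilon> K (\<lambda>x. u x - w x) v = elem_form A \<epsilon> K u v - elem_form A \<epsilon> K w v"
proof -
  obtain p where p: "poly_le r p" "\<And>x. x \<in> K \<Longrightarrow> u x = p x" using fe_space_elem[OF u T(2)] by blast
  obtain p' where p': "poly_le r p'" "\<And>x. x \<in> K \<Longrightarrow> w x = p' x" using fe_space_elem[OF w T(2)] by blast
  obtain q where q: "poly_le r q" "\<And>x. x \<in> K \<Longrightarrow> v x = q x" using fe_space_elem[OF v T(2)] by blast
  note D = elem_interior_bounded[OF T(1,2)]
  have pd: "poly_le r (\<lambda>x. p x - p' x)" by (rule poly_le_diff[OF p(1) p'(1)])
  have pe: "u x - w x = p x - p' x" if "x \<in> K" for x using p(2)[OF that] p'(2)[OF that] by simp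
  have g: "grad (\<lambda>x. p x - p' x) x = grad p x - grad p' x" for x
    by (rule has_derivative_grad_eqI) (simp add: inner_diff_left has_derivative_diff has_derivative_grad poly_le_differentiable[OF p(1)] poly_le_differentiable[OF p'(1)])
  have i: "integrable (lebesgue_on (interior K)) (\<lambda>x. p x * q x)" "integrable (lebesgue_on (interior K)) (\<lambda>x. p' x * q x)"
    by (intro continuous_integrable_bounded_open D continuous_on_mult poly_le_continuous[OF p(1)] poly_le_continuous[OF p'(1)] poly_le_continuous[OF q(1)])+
  note j = poly_form_integrable[OF A \<Omega> D T(3) p(1) q(1)] poly_form_integrable[OF A \<Omega> D T(3) p'(1) q(1)]
  have "elem_form A \<epsilon> K (\<lambda>x. p x - p' x) q = elem_form A \<epsilon> K p q - elem_form A \<epsilon> K p' q"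
    unfolding elem_form_def g using i j
    by (simp add: matrix_vector_mult_diff_distrib inner_diff_left left_diff_distrib right_diff_distrib)
  then show ?thesis
    by (simp add: elem_form_cong[OF pe pd q(2,1)] elem_form_cong[OF p(2,1) q(2,1)] elem_form_cong[OF p'(2,1) q(2,1)])
qed

text \<open>Otherwise a nonempty open set would lie in the union of the element boundaries, which is
  a null set.\<close>

lemma interior_meets_imp_mem:
  fixes T :: "(real^'n) set set"
  assumes T: "fe_mesh T" "S \<subseteq> T" "K \<in> T" and ne: "interior K \<inter> interior (\<Union>S) \<noteq> {}"
  shows "K \<in> S"
proof (rule ccontr)
  assume "K \<notin> S"
  have S: "fe_mesh S" by (rule fe_mesh_subset[OF T(1,2)])
  have "interior K \<inter> interior (\<Union>S) \<subseteq> \<Union>S - (\<Union>K\<in>S. interior K)"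
  proof
    fix x assume x: "x \<in> interior K \<inter> interior (\<Union>S)"
    have "x \<notin> interior K'" if "K' \<in> S" for K'
      using fe_mesh_interiors_disjoint[OF T(1) T(3), of K' x] that T(2) x \<open>K \<notin> S\<close> by auto
    then show "x \<in> \<Union>S - (\<Union>K\<in>S. interior K)" using x interior_subset[of "\<Union>S"] by auto
  qed
  then have "negligible (interior K \<inter> interior (\<Union>S))" using negligible_mesh_skeleton[OF S] negligible_subset by blast
  then show False using open_not_negligible[of "interior K \<inter> interior (\<Union>S)"] ne by auto
qed

text \<open>The family S behind \<open>mesh_resolved\<close> is recovered from D: an element inside
  the closure of D has interior points in D, and so belongs to S.\<close>

lemma mesh_resolved_submesh:
  fixes T :: "(real^'n) set set"
  assumes T: "fe_mesh T" and D: "mesh_resolved T D"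
  shows "D = interior (\<Union>(submesh T D))" "closure D = \<Union>(submesh T D)"
proof -
  obtain S where S: "S \<subseteq> T" "D = interior (\<Union>S)" using D unfolding mesh_resolved_def by blast
  have Sm: "fe_mesh S" by (rule fe_mesh_subset[OF T S(1)])
  have cl: "closure D = \<Union>S"
  proof
    have "closed (\<Union>S)" using fe_mesh_finite[OF Sm] fe_mesh_elem(3)[OF Sm] by (intro closed_Union) auto
    then show "closure D \<subseteq> \<Union>S" unfolding S(2) by (intro closure_minimal interior_subset)
    have "K \<subseteq> closure D" if K: "K \<in> S" for K
      using closure_mono[OF interior_elem_subset[OF K]] fe_mesh_closure_interior[OF Sm K] unfolding S(2) by simp
    then show "\<Union>S \<subseteq> closure D" by blast
  qed
  have "submesh T D = S"
  proof
    show "S \<subseteq> submesh T D" unfolding submesh_def cl using S(1) by blast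
    show "submesh T D \<subseteq> S"
    proof
      fix K assume "K \<in> submesh T D"
      then have K: "K \<in> T" "K \<subseteq> \<Union>S" unfolding submesh_def cl by auto
      have "interior K \<subseteq> interior (\<Union>S)" by (rule interior_mono[OF K(2)])
      then have "interior K \<inter> interior (\<Union>S) \<noteq> {}" using fe_mesh_interior_nonempty[OF T K(1)] by blast
      then show "K \<in> S" by (rule interior_meets_imp_mem[OF T S(1) K(1)])
    qed
  qed
  then show "D = interior (\<Union>(submesh T D))" "closure D = \<Union>(submesh T D)" using S(2) cl by auto
qed

lemma grad_add_cmult:
  assumes p: "poly_le r p" and q: "poly_le s q"
  shows "grad (\<lambda>x. a * p x + q x) x = a *\<^sub>R grad p x + grad q x"
proof (rule has_derivative_grad_eqI)
  have "((\<lambda>x. a * p x + q x) has_derivative (\<lambda>h. a * (grad p x \<bullet> h) + grad q x \<bullet> h)) (at x)"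
    by (intro has_derivative_add has_derivative_mult_right has_derivative_grad poly_le_differentiable[OF p] poly_le_differentiable[OF q])
  then show "((\<lambda>x. a * p x + q x) has_derivative (\<lambda>h. (a *\<^sub>R grad p x + grad q x) \<bullet> h)) (at x)"
    by (simp add: inner_add_left)
qed

section \<open>Energy estimates on one element\<close>

lemma poly_form_le_grad:
  fixes A :: "real^'n \<Rightarrow> real^'n^'n"
  assumes A: "elliptic_coefficient \<Omega> amin amax A" "0 < amin" and \<Omega>: "open \<Omega>" and D: "open D" "bounded D" "D \<subseteq> \<Omega>"
    and e: "poly_le r e"
  shows "(\<integral>x. (A x *v grad e x) \<bullet> grad e x \<partial>lebesgue_on D) \<le> amax * (\<integral>x. (norm (grad e x))\<^sup>2 \<partial>lebesgue_on D)"
proof -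
  have i: "integrable (lebesgue_on D) (\<lambda>x. (norm (grad e x))\<^sup>2)"
    by (intro continuous_integrable_bounded_open D continuous_on_power continuous_on_norm poly_le_continuous_grad[OF e])
  have "(\<integral>x. (A x *v grad e x) \<bullet> grad e x \<partial>lebesgue_on D) \<le> (\<integral>x. amax * (norm (grad e x))\<^sup>2 \<partial>lebesgue_on D)"
  proof (rule integral_mono)
    fix x assume "x \<in> space (lebesgue_on D)"
    then have "x \<in> \<Omega>" using D(3) by auto
    then show "(A x *v grad e x) \<bullet> grad e x \<le> amax * (norm (grad e x))\<^sup>2" by (rule elliptic_bounds(2)[OF A(1)])
  qed (use i poly_form_integrable[OF A \<Omega> D e e] in auto)
  then show ?thesis by simp
qed

lemma elem_form_nonneg:
  fixes A :: "real^'n \<Rightarrow> real^'n^'n"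
  assumes A: "elliptic_coefficient \<Omega> amin amax A" "0 < amin" and D: "interior K \<subseteq> \<Omega>"
  shows "0 \<le> (\<integral>x. (A x *v grad p x) \<bullet> grad p x \<partial>lebesgue_on (interior K))"
    "(\<integral>x. (p x)\<^sup>2 \<partial>lebesgue_on (interior K)) \<le> elem_form A \<epsilon> K p p" "0 \<le> elem_form A \<epsilon> K p p"
proof -
  show a: "0 \<le> (\<integral>x. (A x *v grad p x) \<bullet> grad p x \<partial>lebesgue_on (interior K))"
    by (rule integral_nonneg_AE, rule AE_I2) (use elliptic_nonneg[OF A] D in auto)
  have b: "0 \<le> (\<integral>x. (p x)\<^sup>2 \<partial>lebesgue_on (interior K))" by simp
  show "(\<integral>x. (p x)\<^sup>2 \<partial>lebesgue_on (interior K)) \<le> elem_form A \<epsilon> K p p" "0 \<le> elem_form A \<epsilon> K p p"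
    unfolding elem_form_def using a b by (auto simp: power2_eq_square)
qed

text \<open>The cut-off enters only through its nodal values, so that the deviation of the test function
  from a multiple of \<open>p\<close> is again a nodal product and no superapproximation is needed.\<close>

lemma elem_form_cutoff_ge:
  fixes A :: "real^'n \<Rightarrow> real^'n^'n"
  assumes A: "elliptic_coefficient \<Omega> amin amax A" "0 < amin" "0 \<le> amax" and \<Omega>: "open \<Omega>" and K: "bounded K" "interior K \<subseteq> \<Omega>"
    and p: "poly_le r p" and q: "poly_le r q" and m: "0 < m" "m \<le> 1" and d: "0 < d" and h: "h = diameter K" "0 < h" "h \<le> H"
    and Ce: "0 \<le> Ce"
    and e2: "(\<integral>x. (q x - m\<^sup>2 * p x)\<^sup>2 \<partial>lebesgue_on (interior K)) \<le> Ce * (2 * m * h / d)\<^sup>2 * (\<integral>x. (p x)\<^sup>2 \<partial>lebesgue_on (interior K))"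
    and e1: "(\<integral>x. (norm (grad (\<lambda>x. q x - m\<^sup>2 * p x) x))\<^sup>2 \<partial>lebesgue_on (interior K)) \<le>
      Ce * (2 * m * h / d / h)\<^sup>2 * (\<integral>x. (p x)\<^sup>2 \<partial>lebesgue_on (interior K))"
  shows "1 / 2 * m\<^sup>2 * elem_form A \<epsilon> K p p \<le> elem_form A \<epsilon> K p q +
    (2 * amax * Ce * (\<epsilon> / d)\<^sup>2 + 2 * sqrt Ce * (H / d)) * (\<integral>x. (p x)\<^sup>2 \<partial>lebesgue_on (interior K))"
proof -
  define D where "D = interior K"
  have D: "open D" "bounded D" "D \<subseteq> \<Omega>" unfolding D_def using K by (auto intro: bounded_interior)
  \<comment> \<open>The deviation of the test polynomial from a constant multiple of p, which the
    last two hypotheses bound in mean square together with its gradient.\<close>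
  define e where "e x = q x - m\<^sup>2 * p x" for x
  have e: "poly_le r e" unfolding e_def[abs_def] by (intro poly_le_diff q poly_le_cmult p)
  have qe: "q = (\<lambda>x. m\<^sup>2 * p x + e x)" by (auto simp: e_def)
  have gq: "grad q x = m\<^sup>2 *\<^sub>R grad p x + grad e x" for x
    using grad_add_cmult[OF p e, of "m\<^sup>2" x] by (simp add: qe[symmetric])
  define P a b c where "P = (\<integral>x. (p x)\<^sup>2 \<partial>lebesgue_on D)" and "a = (\<integral>x. (A x *v grad p x) \<bullet> grad p x \<partial>lebesgue_on D)"
    and "b = (\<integral>x. (A x *v grad p x) \<bullet> grad e x \<partial>lebesgue_on D)" and "c = (\<integral>x. p x * e x \<partial>lebesgue_on D)"
  have P0: "0 \<le> P" unfolding P_def by simp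
  have a0: "0 \<le> a" unfolding a_def D_def by (rule elem_form_nonneg(1)[OF A(1,2) K(2)])
  note ip = poly_form_integrable[OF A(1,2) \<Omega> D p p] and ie = poly_form_integrable[OF A(1,2) \<Omega> D p e]
    and iee = poly_form_integrable[OF A(1,2) \<Omega> D e e]
  have cp: "continuous_on UNIV p" "continuous_on UNIV e" by (intro poly_le_continuous[OF p] poly_le_continuous[OF e])+
  have ipp: "integrable (lebesgue_on D) (\<lambda>x. (p x)\<^sup>2)" "integrable (lebesgue_on D) (\<lambda>x. (e x)\<^sup>2)"
    "integrable (lebesgue_on D) (\<lambda>x. p x * e x)"
    by (intro continuous_integrable_bounded_open D continuous_intros cp)+
  have form: "elem_form A \<epsilon> K p q = m\<^sup>2 * (\<epsilon>\<^sup>2 * a + P) + \<epsilon>\<^sup>2 * b + c"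
  proof -
    have "(\<integral>x. (A x *v grad p x) \<bullet> grad q x \<partial>lebesgue_on D) = m\<^sup>2 * a + b"
      unfolding gq a_def b_def using ip ie by (simp add: inner_add_right)
    moreover have "(\<integral>x. p x * q x \<partial>lebesgue_on D) = (\<integral>x. m\<^sup>2 * (p x)\<^sup>2 + p x * e x \<partial>lebesgue_on D)"
      by (intro Bochner_Integration.integral_cong) (auto simp: qe power2_eq_square algebra_simps)
    moreover have "\<dots> = m\<^sup>2 * P + c" unfolding P_def c_def using ipp by simp
    ultimately show ?thesis unfolding elem_form_def D_def[symmetric] by (simp add: algebra_simps)
  qed
  \<comment> \<open>With the weight s = m^2, half of the gradient energy that m^2 p provides is
    spent, and the factor 1 / m^2 in front of the energy of e cancels against the m^2 in its bound.
    The diameter cancels as well, which leaves 1 / d^2.\<close>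
  have bb: "\<bar>b\<bar> \<le> m\<^sup>2 / 2 * a + 2 * amax * Ce / d\<^sup>2 * P"
  proof -
    have "\<bar>b\<bar> \<le> (\<integral>x. m\<^sup>2 / 2 * ((A x *v grad p x) \<bullet> grad p x) + 1 / (2 * m\<^sup>2) * ((A x *v grad e x) \<bullet> grad e x) \<partial>lebesgue_on D)"
      unfolding b_def
    proof (rule order_trans[OF integral_abs_bound integral_mono])
      show "integrable (lebesgue_on D) (\<lambda>x. \<bar>(A x *v grad p x) \<bullet> grad e x\<bar>)" using ie by (rule integrable_abs)
      show "integrable (lebesgue_on D) (\<lambda>x. m\<^sup>2 / 2 * ((A x *v grad p x) \<bullet> grad p x) + 1 / (2 * m\<^sup>2) * ((A x *v grad e x) \<bullet> grad e x))"
        by (intro Bochner_Integration.integrable_add integrable_mult_right ip iee)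
      fix x assume "x \<in> space (lebesgue_on D)"
      then have x: "x \<in> \<Omega>" using D(3) by auto
      show "\<bar>(A x *v grad p x) \<bullet> grad e x\<bar> \<le> m\<^sup>2 / 2 * ((A x *v grad p x) \<bullet> grad p x) + 1 / (2 * m\<^sup>2) * ((A x *v grad e x) \<bullet> grad e x)"
        using m(1) by (intro elliptic_weighted_Cauchy[OF A(1,2) x]) simp
    qed
    also have "\<dots> = m\<^sup>2 / 2 * a + 1 / (2 * m\<^sup>2) * (\<integral>x. (A x *v grad e x) \<bullet> grad e x \<partial>lebesgue_on D)"
      using ip iee by (simp add: a_def)
    also have "\<dots> \<le> m\<^sup>2 / 2 * a + 1 / (2 * m\<^sup>2) * (amax * (Ce * (2 * m * h / d / h)\<^sup>2 * P))"
    proof (intro add_left_mono mult_left_mono)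
      have "(\<integral>x. (A x *v grad e x) \<bullet> grad e x \<partial>lebesgue_on D) \<le> amax * (\<integral>x. (norm (grad e x))\<^sup>2 \<partial>lebesgue_on D)"
        by (rule poly_form_le_grad[OF A(1,2) \<Omega> D e])
      also have "\<dots> \<le> amax * (Ce * (2 * m * h / d / h)\<^sup>2 * P)"
        using e1 A(3) unfolding P_def D_def e_def[abs_def] by (intro mult_left_mono)
      finally show "(\<integral>x. (A x *v grad e x) \<bullet> grad e x \<partial>lebesgue_on D) \<le> amax * (Ce * (2 * m * h / d / h)\<^sup>2 * P)" .
    qed simp
    also have "1 / (2 * m\<^sup>2) * (amax * (Ce * (2 * m * h / d / h)\<^sup>2 * P)) = 2 * amax * Ce / d\<^sup>2 * P"
      using m(1) h(2) d by (simp add: field_simps power2_eq_square)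
    finally show ?thesis .
  qed
  \<comment> \<open>There is no derivative here to remove the factor h, so the bound keeps h / d; H
    replaces h to make it the same on all elements.\<close>
  have cc: "\<bar>c\<bar> \<le> 2 * sqrt Ce * (H / d) * P"
  proof -
    have mp: "p \<in> borel_measurable (lebesgue_on D)" "e \<in> borel_measurable (lebesgue_on D)"
      using continuous_lebesgue_measurable[OF cp(1)] continuous_lebesgue_measurable[OF cp(2)] by (auto intro: measurable_restrict_space1)
    have "\<bar>c\<bar> \<le> sqrt P * sqrt (\<integral>x. (e x)\<^sup>2 \<partial>lebesgue_on D)"
      unfolding c_def P_def by (rule integral_Cauchy_Schwarz(2)[OF mp ipp(1,2)])
    also have "\<dots> \<le> sqrt P * sqrt (Ce * (2 * m * h / d)\<^sup>2 * P)"
      using e2 P0 unfolding P_def D_def e_def by (intro mult_left_mono) auto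
    also have "\<dots> = sqrt P * (sqrt Ce * (2 * m * h / d) * sqrt P)"
      using m(1) h(2) d by (simp add: real_sqrt_mult)
    also have "\<dots> = sqrt Ce * (2 * m * h / d) * P"
      using P0 by (simp add: algebra_simps)
    also have "\<dots> \<le> sqrt Ce * (2 * 1 * H / d) * P"
      using m h(2,3) d P0 Ce by (intro mult_right_mono mult_left_mono divide_right_mono mult_mono) auto
    finally show ?thesis by (simp add: ac_simps)
  qed
  have "1 / 2 * m\<^sup>2 * elem_form A \<epsilon> K p p = 1 / 2 * m\<^sup>2 * (\<epsilon>\<^sup>2 * a + P)"
    by (simp add: elem_form_def a_def P_def D_def power2_eq_square)
  also have "\<dots> \<le> m\<^sup>2 * (\<epsilon>\<^sup>2 * a + P) - \<epsilon>\<^sup>2 * (m\<^sup>2 / 2 * a)"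
  proof -
    have "0 \<le> 1 / 2 * m\<^sup>2 * P" using P0 by simp
    then show ?thesis by (simp add: algebra_simps)
  qed
  also have "\<dots> \<le> m\<^sup>2 * (\<epsilon>\<^sup>2 * a + P) + \<epsilon>\<^sup>2 * b + c + (\<epsilon>\<^sup>2 * (2 * amax * Ce / d\<^sup>2 * P) + 2 * sqrt Ce * (H / d) * P)"
  proof -
    have "- b \<le> m\<^sup>2 / 2 * a + 2 * amax * Ce / d\<^sup>2 * P" using bb by linarith
    then have "\<epsilon>\<^sup>2 * (- b) \<le> \<epsilon>\<^sup>2 * (m\<^sup>2 / 2 * a + 2 * amax * Ce / d\<^sup>2 * P)" by (rule mult_left_mono) simp
    then have "- (\<epsilon>\<^sup>2 * b) \<le> \<epsilon>\<^sup>2 * (m\<^sup>2 / 2 * a) + \<epsilon>\<^sup>2 * (2 * amax * Ce / d\<^sup>2 * P)"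
      by (simp only: distrib_left mult_minus_right)
    moreover have "- c \<le> 2 * sqrt Ce * (H / d) * P" using cc by linarith
    ultimately show ?thesis by linarith
  qed
  also have "\<dots> = elem_form A \<epsilon> K p q + (2 * amax * Ce * (\<epsilon> / d)\<^sup>2 + 2 * sqrt Ce * (H / d)) * P"
    unfolding form by (simp add: power_divide algebra_simps)
  finally show ?thesis unfolding P_def D_def .
qed

text \<open>Here q stands for the interpolant of a product of p with a Lipschitz factor, m for the
  value of that factor at one node, and q - m p has nodal size G times the diameter; the inverse
  estimate turns this into a gradient of size G, free of the diameter. The factor (1 + \<epsilon>
  G)^2 dominates both 1 and (\<epsilon> G)^2.\<close>

lemma elem_form_product_le:
  fixes A :: "real^'n \<Rightarrow> real^'n^'n"
  assumes A: "elliptic_coefficient \<Omega> amin amax A" "0 < amin" "0 \<le> amax" and \<Omega>: "open \<Omega>" and K: "bounded K" "interior K \<subseteq> \<Omega>"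
    and p: "poly_le r p" and q: "poly_le r q" and m: "0 \<le> m" "m \<le> 1" and G: "0 \<le> G" and \<epsilon>: "0 \<le> \<epsilon>" and Ce: "0 \<le> Ce"
    and q2: "(\<integral>x. (q x)\<^sup>2 \<partial>lebesgue_on (interior K)) \<le> Ce * (\<integral>x. (p x)\<^sup>2 \<partial>lebesgue_on (interior K))"
    and e1: "(\<integral>x. (norm (grad (\<lambda>x. q x - m * p x) x))\<^sup>2 \<partial>lebesgue_on (interior K)) \<le>
      Ce * G\<^sup>2 * (\<integral>x. (p x)\<^sup>2 \<partial>lebesgue_on (interior K))"
  shows "elem_form A \<epsilon> K q q \<le> (2 + 2 * amax * Ce + Ce) * (1 + \<epsilon> * G)\<^sup>2 * elem_form A \<epsilon> K p p"
proof -
  define D where "D = interior K"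
  have D: "open D" "bounded D" "D \<subseteq> \<Omega>" unfolding D_def using K by (auto intro: bounded_interior)
  define e where "e x = q x - m * p x" for x
  have e: "poly_le r e" unfolding e_def[abs_def] by (intro poly_le_diff q poly_le_cmult p)
  have qe: "q = (\<lambda>x. m * p x + e x)" by (auto simp: e_def)
  have gq: "grad q x = m *\<^sub>R grad p x + grad e x" for x
    using grad_add_cmult[OF p e, of m x] by (simp add: qe[symmetric])
  define P a where "P = (\<integral>x. (p x)\<^sup>2 \<partial>lebesgue_on D)" and "a = (\<integral>x. (A x *v grad p x) \<bullet> grad p x \<partial>lebesgue_on D)"
  have P0: "0 \<le> P" unfolding P_def by simp
  have a0: "0 \<le> a" unfolding a_def D_def by (rule elem_form_nonneg(1)[OF A(1,2) K(2)])
  note ip = poly_form_integrable[OF A(1,2) \<Omega> D p p] and iee = poly_form_integrable[OF A(1,2) \<Omega> D e e]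
    and iq = poly_form_integrable[OF A(1,2) \<Omega> D q q]
  have "(\<integral>x. (A x *v grad q x) \<bullet> grad q x \<partial>lebesgue_on D) \<le>
      (\<integral>x. 2 * ((A x *v grad p x) \<bullet> grad p x) + 2 * ((A x *v grad e x) \<bullet> grad e x) \<partial>lebesgue_on D)"
  proof (rule integral_mono[OF iq])
    show "integrable (lebesgue_on D) (\<lambda>x. 2 * ((A x *v grad p x) \<bullet> grad p x) + 2 * ((A x *v grad e x) \<bullet> grad e x))"
      by (intro Bochner_Integration.integrable_add integrable_mult_right ip iee)
    fix x assume "x \<in> space (lebesgue_on D)"
    then have x: "x \<in> \<Omega>" using D(3) by auto
    let ?\<xi> = "m *\<^sub>R grad p x" and ?\<eta> = "grad e x"
    have "(A x *v grad q x) \<bullet> grad q x = (A x *v ?\<xi>) \<bullet> ?\<xi> + 2 * ((A x *v ?\<xi>) \<bullet> ?\<eta>) + (A x *v ?\<eta>) \<bullet> ?\<eta>"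
      unfolding gq using elliptic_symmetric[OF A(1) x, of ?\<eta> ?\<xi>]
      by (simp only: matrix_vector_right_distrib inner_add_left inner_add_right)
    also have "\<dots> \<le> 2 * ((A x *v ?\<xi>) \<bullet> ?\<xi>) + 2 * ((A x *v ?\<eta>) \<bullet> ?\<eta>)"
      using elliptic_weighted_Cauchy[OF A(1,2) x, of 1 ?\<xi> ?\<eta>] by simp
    also have "(A x *v ?\<xi>) \<bullet> ?\<xi> = m\<^sup>2 * ((A x *v grad p x) \<bullet> grad p x)"
      by (simp add: matrix_vector_mult_scaleR power2_eq_square)
    also have "\<dots> \<le> 1 * ((A x *v grad p x) \<bullet> grad p x)"
      using m elliptic_nonneg[OF A(1,2) x] by (intro mult_right_mono) (auto simp: power_le_one)
    finally show "(A x *v grad q x) \<bullet> grad q x \<le> 2 * ((A x *v grad p x) \<bullet> grad p x) + 2 * ((A x *v grad e x) \<bullet> grad e x)" by simp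
  qed
  also have "\<dots> = 2 * a + 2 * (\<integral>x. (A x *v grad e x) \<bullet> grad e x \<partial>lebesgue_on D)" using ip iee by (simp add: a_def)
  also have "\<dots> \<le> 2 * a + 2 * (amax * (Ce * G\<^sup>2 * P))"
  proof -
    have "(\<integral>x. (A x *v grad e x) \<bullet> grad e x \<partial>lebesgue_on D) \<le> amax * (\<integral>x. (norm (grad e x))\<^sup>2 \<partial>lebesgue_on D)"
      by (rule poly_form_le_grad[OF A(1,2) \<Omega> D e])
    also have "\<dots> \<le> amax * (Ce * G\<^sup>2 * P)"
      using e1 A(3) unfolding P_def D_def e_def[abs_def] by (intro mult_left_mono)
    finally show ?thesis by simp
  qed
  finally have g: "(\<integral>x. (A x *v grad q x) \<bullet> grad q x \<partial>lebesgue_on D) \<le> 2 * a + 2 * (amax * (Ce * G\<^sup>2 * P))" .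
  have "elem_form A \<epsilon> K q q = \<epsilon>\<^sup>2 * (\<integral>x. (A x *v grad q x) \<bullet> grad q x \<partial>lebesgue_on D) + (\<integral>x. (q x)\<^sup>2 \<partial>lebesgue_on D)"
    by (simp add: elem_form_def D_def power2_eq_square)
  also have "\<dots> \<le> \<epsilon>\<^sup>2 * (2 * a + 2 * (amax * (Ce * G\<^sup>2 * P))) + Ce * P"
    using g q2 unfolding P_def D_def by (intro add_mono mult_left_mono) auto
  also have "\<dots> = 2 * (\<epsilon>\<^sup>2 * a) + 2 * amax * Ce * (\<epsilon> * G)\<^sup>2 * P + Ce * P" by (simp add: power_mult_distrib algebra_simps)
  also have "\<dots> \<le> (2 + 2 * amax * Ce + Ce) * (1 + \<epsilon> * G)\<^sup>2 * (\<epsilon>\<^sup>2 * a + P)"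
  proof -
    define t where "t = (1 + \<epsilon> * G)\<^sup>2"
    define X where "X = \<epsilon>\<^sup>2 * a + P"
    have eG: "0 \<le> \<epsilon> * G" using G \<epsilon> by simp
    have t: "1 \<le> t" "(\<epsilon> * G)\<^sup>2 \<le> t" unfolding t_def using eG by (auto intro!: power_mono one_le_power)
    have X: "\<epsilon>\<^sup>2 * a \<le> X" "P \<le> X" "0 \<le> X" unfolding X_def using a0 P0 by auto
    have k: "0 \<le> 2 * amax * Ce" using A(3) Ce by simp
    have "2 * (\<epsilon>\<^sup>2 * a) \<le> 2 * (t * X)"
      using mult_mono[of 1 t "\<epsilon>\<^sup>2 * a" X] t X a0 by simp
    moreover have "2 * amax * Ce * (\<epsilon> * G)\<^sup>2 * P \<le> 2 * amax * Ce * (t * X)"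
      using mult_left_mono[OF mult_mono[of "(\<epsilon> * G)\<^sup>2" t P X] k] t X P0 by (simp add: mult.assoc)
    moreover have "Ce * P \<le> Ce * (t * X)"
      using mult_left_mono[OF mult_mono[of 1 t P X] Ce] t X P0 by simp
    ultimately have "2 * (\<epsilon>\<^sup>2 * a) + 2 * amax * Ce * (\<epsilon> * G)\<^sup>2 * P + Ce * P \<le> (2 + 2 * amax * Ce + Ce) * (t * X)"
      by (simp only: distrib_right)
    then show ?thesis unfolding t_def X_def by (simp only: mult.assoc)
  qed
  finally show ?thesis by (simp add: elem_form_def a_def P_def D_def power2_eq_square)
qed

section \<open>The partition of unity function on closed elements\<close>

lemma pu_function_bounds:
  assumes "pu_function \<Omega> \<omega> chi" "x \<in> closure \<Omega>"
  shows "0 \<le> chi x" "chi x \<le> 1"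
proof -
  obtain s where s: "\<And>n. s n \<in> \<Omega>" "s \<longlonglongrightarrow> x" using assms(2) closure_sequential by metis
  have c: "(\<lambda>n. chi (s n)) \<longlonglongrightarrow> chi x"
    using assms s closure_subset[of \<Omega>] unfolding pu_function_def
    by (intro continuous_on_tendsto_compose[of "closure \<Omega>" chi s x]) (auto intro!: always_eventually)
  have b: "0 \<le> chi (s n) \<and> chi (s n) \<le> 1" for n using assms(1) s(1) unfolding pu_function_def by blast
  show "0 \<le> chi x" by (rule LIMSEQ_le_const[OF c]) (use b in auto)
  show "chi x \<le> 1" by (rule LIMSEQ_le_const2[OF c]) (use b in auto)
qed

text \<open>Mollification inside the open convex element makes the essential supremum of the weak
  gradient a true Lipschitz constant there, and continuity of chi carries the bound to the closed
  element. On \<omega> itself, which need not be convex, such a bound need not hold.\<close>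

lemma pu_function_lipschitz:
  fixes \<Omega> :: "(real^'n) set"
  assumes \<Omega>: "open \<Omega>" "bounded \<Omega>" and pu: "pu_function \<Omega> \<omega> chi" and \<omega>: "open \<omega>" "\<omega> \<subseteq> \<Omega>" "\<omega> \<noteq> {}"
  defines "G \<equiv> norm_Linf \<omega> (weak_grad \<Omega> chi)"
  shows "0 \<le> G"
    and "convex K \<Longrightarrow> closure (interior K) = K \<Longrightarrow> interior K \<subseteq> \<omega> \<Longrightarrow> x \<in> K \<Longrightarrow> y \<in> K \<Longrightarrow> \<bar>chi x - chi y\<bar> \<le> G * norm (x - y)"
proof -
  have \<Omega>m: "\<Omega> \<in> sets lebesgue" "\<omega> \<in> sets lebesgue" using \<Omega>(1) \<omega>(1) by (auto intro: open_sets_lebesgue)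
  obtain g where g: "has_weak_grad \<Omega> chi g" "Linf \<Omega> g" using pu unfolding pu_function_def W1inf_def by blast
  let ?W = "weak_grad \<Omega> chi"
  have hW: "has_weak_grad \<Omega> chi ?W" by (rule has_weak_grad_weak_grad[OF g(1)])
  have Wm\<Omega>: "?W \<in> borel_measurable (lebesgue_on \<Omega>)" by (rule has_weak_grad_measurable(1)[OF \<Omega>(1) hW])
  then have Wm: "?W \<in> borel_measurable (lebesgue_on \<omega>)" by (rule measurable_restrict_mono[OF _ \<omega>(2)])
  define E where "E = esssup (lebesgue_on \<omega>) (\<lambda>x. ereal (norm (?W x)))"
  have nm: "(\<lambda>x. ereal (norm (?W x))) \<in> borel_measurable (lebesgue_on \<omega>)" using Wm by simp
  have Efin: "E < \<infinity>"
  proof -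
    have "AE x in lebesgue_on \<Omega>. ereal (norm (g x)) \<le> esssup (lebesgue_on \<Omega>) (\<lambda>x. ereal (norm (g x)))" by (rule esssup_AE)
    then have "AE x in lebesgue_on \<Omega>. ereal (norm (?W x)) \<le> esssup (lebesgue_on \<Omega>) (\<lambda>x. ereal (norm (g x)))"
      using weak_grad_AE[OF \<Omega>(1) g(1)] by eventually_elim simp
    then have "AE x in lebesgue_on \<omega>. ereal (norm (?W x)) \<le> esssup (lebesgue_on \<Omega>) (\<lambda>x. ereal (norm (g x)))"
      unfolding AE_lebesgue_on_iff[OF \<Omega>m(1)] AE_lebesgue_on_iff[OF \<Omega>m(2)] by eventually_elim (use \<omega>(2) in auto)
    then have "E \<le> esssup (lebesgue_on \<Omega>) (\<lambda>x. ereal (norm (g x)))" unfolding E_def by (rule esssup_I[OF nm])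
    then show ?thesis using g(2) unfolding Linf_def by (auto simp: less_le_trans intro: le_less_trans)
  qed
  have AEE: "AE x in lebesgue_on \<omega>. ereal (norm (?W x)) \<le> E" unfolding E_def by (rule esssup_AE)
  \<comment> \<open>The essential supremum over a null set need not be nonnegative; \<omega>, being
    open and nonempty, has positive measure. Together with finiteness this makes the conversion to a
    real number in \<open>norm_Linf\<close> faithful.\<close>
  have E0: "0 \<le> E"
  proof (rule ccontr)
    assume "\<not> 0 \<le> E"
    have "AE x in lebesgue_on \<omega>. False"
      using AEE
    proof eventually_elim
      case (elim x)
      have "0 \<le> ereal (norm (?W x))" by simp
      then show ?case using elim \<open>\<not> 0 \<le> E\<close> order_trans by blast
    qed
    then have "AE x in lebesgue. x \<notin> \<omega>" unfolding AE_lebesgue_on_iff[OF \<Omega>m(2)] by simp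
    then have "negligible \<omega>" using AE_iff_null_sets[OF \<Omega>m(2)] by (simp add: negligible_iff_null_sets)
    then show False using open_not_negligible[OF \<omega>(1,3)] by blast
  qed
  have GE: "ereal G = E" unfolding G_def norm_Linf_def E_def[symmetric] using Efin E0 by (cases E) auto
  show G0: "0 \<le> G" using E0 GE by (metis ereal_less_eq(5))
  have AEG: "AE x in lebesgue_on \<omega>. norm (?W x) \<le> G" using AEE unfolding GE[symmetric] by simp
  \<comment> \<open>The mollification argument asks for an integrable function on the whole space;
    the continuation by zero changes neither values nor weak gradient in \<Omega>.\<close>
  define c where "c x = (if x \<in> \<Omega> then chi x else 0)" for x
  have hc: "has_weak_grad \<Omega> c ?W" by (rule has_weak_grad_cong[OF _ hW]) (simp add: c_def)
  have cont: "continuous_on (closure \<Omega>) chi" using pu unfolding pu_function_def by blast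
  have comp: "compact (closure \<Omega>)" using \<Omega>(2) by simp
  have ci: "integrable lebesgue c"
  proof (rule integrable_bounded_compact_support[OF _ comp])
    show "c \<in> borel_measurable lebesgue"
      unfolding c_def[abs_def] using measurable_if_open[OF \<Omega>(1) continuous_on_subset[OF cont closure_subset]] .
    show "\<bar>c x\<bar> \<le> 1 * indicator (closure \<Omega>) x" for x
      using pu_function_bounds[OF pu, of x] closure_subset[of \<Omega>] by (auto simp: c_def indicator_def)
  qed
  show "\<bar>chi x - chi y\<bar> \<le> G * norm (x - y)"
    if K: "convex K" "closure (interior K) = K" "interior K \<subseteq> \<omega>" and xy: "x \<in> K" "y \<in> K" for K x y
  proof -
    have int\<Omega>: "interior K \<subseteq> \<Omega>" using K(3) \<omega>(2) by blast
    have AEK: "AE x in lebesgue_on (interior K). norm (?W x) \<le> G"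
      using AEG unfolding AE_lebesgue_on_iff[OF \<Omega>m(2)] AE_lebesgue_on_iff[OF open_sets_lebesgue[OF open_interior]]
      by eventually_elim (use K(3) in auto)
    have cc: "isCont c z" if "z \<in> interior K" for z
    proof -
      have z\<Omega>: "z \<in> \<Omega>" using that int\<Omega> by blast
      have "isCont chi z"
        using continuous_on_subset[OF cont closure_subset] z\<Omega> \<Omega>(1) by (simp add: continuous_on_eq_continuous_at)
      moreover have "\<forall>\<^sub>F y in nhds z. chi y = c y"
        using \<Omega>(1) z\<Omega> unfolding eventually_nhds by (intro exI[of _ \<Omega>]) (auto simp: c_def)
      ultimately show ?thesis using isCont_cong by blast
    qed
    have int: "\<bar>chi a - chi b\<bar> \<le> G * norm (a - b)" if ab: "a \<in> interior K" "b \<in> interior K" for a b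
    proof -
      have "\<bar>c a - c b\<bar> \<le> G * norm (a - b)"
        by (rule weak_grad_bounded_lipschitz[OF \<Omega>(1) hc ci open_interior convex_interior[OF K(1)] int\<Omega> AEK G0 ab(1) cc[OF ab(1)] ab(2) cc[OF ab(2)]])
      moreover have "a \<in> \<Omega>" "b \<in> \<Omega>" using ab int\<Omega> by blast+
      ultimately show ?thesis by (simp add: c_def)
    qed
    have K\<Omega>: "K \<subseteq> closure \<Omega>" using closure_mono[OF int\<Omega>] K(2) by simp
    obtain s where s: "\<And>n. s n \<in> interior K" "s \<longlonglongrightarrow> x" using xy(1) K(2) closure_sequential by metis
    obtain t where t: "\<And>n. t n \<in> interior K" "t \<longlonglongrightarrow> y" using xy(2) K(2) closure_sequential by metis
    have lim: "(\<lambda>n. chi (u n)) \<longlonglongrightarrow> chi z" if "\<And>n. u n \<in> interior K" "u \<longlonglongrightarrow> z" "z \<in> K" for u z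
    proof (rule continuous_on_tendsto_compose[OF cont that(2)])
      show "z \<in> closure \<Omega>" using that(3) K\<Omega> by blast
      show "\<forall>\<^sub>F n in sequentially. u n \<in> closure \<Omega>" using that(1) int\<Omega> closure_subset[of \<Omega>] by (intro always_eventually) blast
    qed
    show ?thesis
    proof (rule tendsto_le[OF sequentially_bot])
      show "(\<lambda>n. G * norm (s n - t n)) \<longlonglongrightarrow> G * norm (x - y)" by (intro tendsto_intros s t)
      show "(\<lambda>n. \<bar>chi (s n) - chi (t n)\<bar>) \<longlonglongrightarrow> \<bar>chi x - chi y\<bar>" by (intro tendsto_intros lim s t xy)
      show "\<forall>\<^sub>F n in sequentially. \<bar>chi (s n) - chi (t n)\<bar> \<le> G * norm (s n - t n)"
        using int s(1) t(1) by (intro always_eventually) blast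
    qed
  qed
qed

section \<open>Exponential decay of discrete solutions\<close>

text \<open>The predicate under the choice operator is the same for u and v, so the chosen gradients
  are equal as functions and not merely almost everywhere.\<close>

lemma weak_grad_cong:
  assumes "\<And>x. x \<in> D \<Longrightarrow> u x = v x" shows "weak_grad D u = weak_grad D v"
proof -
  have "has_weak_grad D u = has_weak_grad D v"
    using has_weak_grad_cong[of D u v] has_weak_grad_cong[of D v u] assms by (auto simp: fun_eq_iff)
  then show ?thesis unfolding weak_grad_def by simp
qed

lemma a_form_cong_left:
  assumes "\<And>x. x \<in> D \<Longrightarrow> u x = u' x" shows "a_form A \<epsilon> D u v = a_form A \<epsilon> D u' v"
proof -
  have w: "weak_grad D u = weak_grad D u'" by (rule weak_grad_cong) (rule assms)
  show ?thesis unfolding a_form_def w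
    by (intro arg_cong2[of _ _ _ _ "(+)"] refl Bochner_Integration.integral_cong) (simp_all add: assms)
qed

lemma integrable_lebesgue_on_subset:
  fixes f :: "'a::euclidean_space \<Rightarrow> real"
  assumes "integrable (lebesgue_on D) f" "open D" "open E" "E \<subseteq> D"
  shows "integrable (lebesgue_on E) f"
proof -
  note Dm = open_sets_lebesgue[OF assms(2)] and Em = open_sets_lebesgue[OF assms(3)]
  have "integrable lebesgue (\<lambda>x. indicator E x *\<^sub>R (indicator D x *\<^sub>R f x))"
    using assms(1) unfolding integrable_lebesgue_on_iff[OF Dm] by (rule integrable_mult_indicator[OF Em])
  moreover have "(\<lambda>x. indicator E x *\<^sub>R (indicator D x *\<^sub>R f x)) = (\<lambda>x. indicator E x *\<^sub>R f x)"
    using assms(4) by (auto simp: fun_eq_iff indicator_def)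
  ultimately show ?thesis unfolding integrable_lebesgue_on_iff[OF Em] by (simp only:)
qed

lemma elem_form_zero_right:
  assumes v: "\<And>x. x \<in> K \<Longrightarrow> v x = 0" and u: "\<And>x. x \<in> K \<Longrightarrow> u x = p x" "poly_le r p"
  shows "elem_form A \<epsilon> K u v = 0"
proof -
  have z: "grad (\<lambda>x::real^'a. 0) = (\<lambda>x. 0)" by (rule ext, rule has_derivative_grad_eqI) simp
  have "elem_form A \<epsilon> K u v = elem_form A \<epsilon> K p (\<lambda>x. 0)"
    by (rule elem_form_cong[OF u v poly_le_const])
  also have "\<dots> = 0" by (simp add: elem_form_def z)
  finally show ?thesis .
qed

text \<open>A test function that vanishes on the boundary of \<Omega> and on all elements outside D
  is admissible in both problems, and their right-hand sides agree for it; subtraction gives the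
  orthogonality. As \<psi> is meaningful on the closure of D only, the difference is formed with a
  finite element function on the whole mesh that agrees with \<psi> there.\<close>

lemma discrete_harmonic_difference:
  fixes \<Omega> :: "(real^'n) set" and A :: "real^'n \<Rightarrow> real^'n^'n"
  assumes A: "elliptic_coefficient \<Omega> amin amax A" "0 < amin" and \<Omega>: "open \<Omega>" "bounded \<Omega>" "lipschitz_boundary \<Omega>"
    and T: "fe_mesh T" "\<Union>T = closure \<Omega>" and f: "L2 \<Omega> f"
    and D: "mesh_resolved T D" "D \<subseteq> \<Omega>"
    and u: "fe_solution r T \<Omega> A \<epsilon> f u" and \<psi>: "local_particular r T \<Omega> D A \<epsilon> f \<psi>"
  obtains w where "w \<in> fe_space r T" "\<And>x. x \<in> closure D \<Longrightarrow> w x = u x - \<psi> x"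
    "\<And>x. x \<in> frontier D \<Longrightarrow> x \<in> frontier \<Omega> \<Longrightarrow> w x = 0"
    "\<And>v. v \<in> fe_space r T \<Longrightarrow> (\<And>x. x \<in> frontier \<Omega> \<Longrightarrow> v x = 0) \<Longrightarrow>
      (\<And>K x. K \<in> T - submesh T D \<Longrightarrow> x \<in> K \<Longrightarrow> v x = 0) \<Longrightarrow> (\<Sum>K\<in>submesh T D. elem_form A \<epsilon> K w v) = 0"
proof -
  define S where "S = submesh T D"
  have ST: "S \<subseteq> T" unfolding S_def submesh_def by blast
  have Sm: "fe_mesh S" by (rule fe_mesh_subset[OF T(1) ST])
  have DS: "D = interior (\<Union>S)" "closure D = \<Union>S" unfolding S_def by (rule mesh_resolved_submesh[OF T(1) D(1)])+
  have \<Omega>T: "\<Omega> = interior (\<Union>T)" using T(2) interior_closure_lipschitz[OF \<Omega>(1,3)] by simp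
  have intcl: "interior (closure \<Omega>) = \<Omega>" by (rule interior_closure_lipschitz[OF \<Omega>(1,3)])
  have oD: "open D" unfolding DS by (rule open_interior)
  have bD: "bounded D" using \<Omega>(2) D(2) bounded_subset by blast
  have uT: "u \<in> fe_space r T" "H10 \<Omega> u" using u unfolding fe_solution_def fe_space0_def by auto
  obtain w' where w': "w' \<in> fe_space r T" "\<And>x. x \<in> closure D \<Longrightarrow> \<psi> x = w' x"
    using \<psi> unfolding local_particular_def fe_space_Gamma_def fe_space_on_def by blast
  have \<psi>0: "\<psi> x = 0" if "x \<in> frontier D" "x \<in> frontier \<Omega>" for x
    using \<psi> that unfolding local_particular_def fe_space_Gamma_def by blast
  define w where "w = (\<lambda>x. u x - w' x)"
  have wT: "w \<in> fe_space r T" unfolding w_def by (rule fe_space_diff[OF uT(1) w'(1)])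
  have wd: "w x = u x - \<psi> x" if "x \<in> closure D" for x using w'(2)[OF that] by (simp add: w_def)
  have w0: "w x = 0" if "x \<in> frontier D" "x \<in> frontier \<Omega>" for x
  proof -
    have "u x = 0" by (rule fe_H10_zero_frontier[OF T \<Omega> uT that(2)])
    moreover have "x \<in> closure D" using that(1) unfolding frontier_def by blast
    ultimately show ?thesis using wd \<psi>0[OF that] by simp
  qed
  have orth: "(\<Sum>K\<in>S. elem_form A \<epsilon> K w v) = 0"
    if v: "v \<in> fe_space r T" and v0: "\<And>x. x \<in> frontier \<Omega> \<Longrightarrow> v x = 0" and vS: "\<And>K x. K \<in> T - S \<Longrightarrow> x \<in> K \<Longrightarrow> v x = 0" for v
  proof -
    have vS': "v \<in> fe_space r S" by (rule fe_space_subset[OF v ST])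
    have "v \<in> fe_space0 r T \<Omega>"
    proof -
      have "H10 \<Omega> v" by (rule fe_H10[OF T \<Omega>(1,2) intcl v v0])
      then show ?thesis using v unfolding fe_space0_def by simp
    qed
    then have e1: "a_form A \<epsilon> \<Omega> u v = (\<integral>x. f x * v x \<partial>lebesgue_on \<Omega>)" using u unfolding fe_solution_def by blast
    have "v \<in> fe_space_Gamma r T \<Omega> D" using v v0 unfolding fe_space_Gamma_def fe_space_on_def by blast
    then have "a_form A \<epsilon> D \<psi> v = (\<integral>x. f x * v x \<partial>lebesgue_on D)" using \<psi> unfolding local_particular_def by blast
    moreover have "a_form A \<epsilon> D \<psi> v = a_form A \<epsilon> D w' v"
      by (rule a_form_cong_left) (use w'(2) closure_subset[of D] in auto)
    ultimately have e2: "a_form A \<epsilon> D w' v = (\<integral>x. f x * v x \<partial>lebesgue_on D)" by simp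
    have rest: "elem_form A \<epsilon> K u v = 0" if K: "K \<in> T - S" for K
    proof -
      obtain p where p: "poly_le r p" "\<And>x. x \<in> K \<Longrightarrow> u x = p x" using fe_space_elem[OF uT(1)] K by blast
      show ?thesis by (rule elem_form_zero_right[OF vS[OF K] p(2,1)])
    qed
    have fv: "integrable (lebesgue_on \<Omega>) (\<lambda>x. f x * v x)"
    proof -
      obtain M where M: "0 \<le> M" "has_weak_grad \<Omega> v (grad v)" "AE x in lebesgue_on \<Omega>. norm (grad v x) \<le> M"
        "AE x in lebesgue_on \<Omega>. norm (v x) \<le> M" by (rule fe_weak_grad[OF T(1) v \<Omega>T])
      have "integrable (lebesgue_on \<Omega>) (\<lambda>x. (v x)\<^sup>2)"
        using fe_product_integrable[OF T(1) \<Omega>T \<Omega>(2) v v] by (simp add: power2_eq_square)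
      moreover have "f \<in> borel_measurable (lebesgue_on \<Omega>)" "integrable (lebesgue_on \<Omega>) (\<lambda>x. (f x)\<^sup>2)"
        using f unfolding L2_def by auto
      ultimately show ?thesis
        by (intro integral_Cauchy_Schwarz(1) has_weak_grad_measurable(2)[OF \<Omega>(1) M(2)])
    qed
    have fvD: "integrable (lebesgue_on D) (\<lambda>x. f x * v x)"
      by (rule integrable_lebesgue_on_subset[OF fv \<Omega>(1) oD D(2)])
    have "(\<integral>x. f x * v x \<partial>lebesgue_on \<Omega>) = (\<Sum>K\<in>T. \<integral>x. f x * v x \<partial>lebesgue_on (interior K))"
      by (rule integral_mesh(1)[OF T(1) \<Omega>T fv])
    also have "\<dots> = (\<Sum>K\<in>S. \<integral>x. f x * v x \<partial>lebesgue_on (interior K))"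
    proof (rule sum.mono_neutral_right[OF fe_mesh_finite[OF T(1)] ST], rule ballI)
      fix K assume K: "K \<in> T - S"
      have "(\<integral>x. f x * v x \<partial>lebesgue_on (interior K)) = (\<integral>x. 0 \<partial>lebesgue_on (interior K))"
        by (rule Bochner_Integration.integral_cong[OF refl]) (use vS[OF K] interior_subset[of K] in auto)
      then show "(\<integral>x. f x * v x \<partial>lebesgue_on (interior K)) = 0" by simp
    qed
    also have "\<dots> = (\<integral>x. f x * v x \<partial>lebesgue_on D)" by (rule integral_mesh(1)[OF Sm DS(1) fvD, symmetric])
    finally have "a_form A \<epsilon> \<Omega> u v = a_form A \<epsilon> D w' v" using e1 e2 by simp
    moreover have "a_form A \<epsilon> \<Omega> u v = (\<Sum>K\<in>T. elem_form A \<epsilon> K u v)"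
      by (rule a_form_fe[OF A \<Omega>(1) T(1) \<Omega>T \<Omega>(2) subset_refl uT(1) v])
    moreover have "\<dots> = (\<Sum>K\<in>S. elem_form A \<epsilon> K u v)"
      by (rule sum.mono_neutral_right[OF fe_mesh_finite[OF T(1)] ST]) (use rest in blast)
    moreover have "a_form A \<epsilon> D w' v = (\<Sum>K\<in>S. elem_form A \<epsilon> K w' v)"
      by (rule a_form_fe[OF A \<Omega>(1) Sm DS(1) bD D(2) fe_space_subset[OF w'(1) ST] vS'])
    ultimately have "(\<Sum>K\<in>S. elem_form A \<epsilon> K u v - elem_form A \<epsilon> K w' v) = 0" by (simp add: sum_subtractf)
    moreover have "elem_form A \<epsilon> K w v = elem_form A \<epsilon> K u v - elem_form A \<epsilon> K w' v" if "K \<in> S" for K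
      unfolding w_def using interior_elem_subset[OF that] DS(1) D(2) that ST
      by (intro elem_form_diff_left[OF A \<Omega>(1) T(1) _ _ uT(1) w'(1) v]) auto
    ultimately show ?thesis by simp
  qed
  show thesis by (rule that[OF wT]) (fact wd w0 orth[unfolded S_def])+
qed

text \<open>One step of the decay: the test function is the nodal interpolant of \<open>\<eta>\<^sup>2 w\<close>.\<close>

lemma discrete_Caccioppoli:
  fixes \<Omega> :: "(real^'n) set" and A :: "real^'n \<Rightarrow> real^'n^'n"
  assumes A: "elliptic_coefficient \<Omega> amin amax A" "0 < amin" "0 \<le> amax" and \<Omega>: "open \<Omega>" "bounded \<Omega>" "lipschitz_boundary \<Omega>"
    and T: "fe_mesh T" "\<Union>T = closure \<Omega>" and D: "mesh_resolved T D" "D \<subseteq> \<Omega>" and r: "1 \<le> r"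
    and Ce: "0 \<le> Ce" "\<And>K p q \<eta>. K \<in> T \<Longrightarrow> poly_le r p \<Longrightarrow> poly_le r q \<Longrightarrow> 0 \<le> \<eta> \<Longrightarrow>
      (\<forall>y\<in>lagrange_nodes r K. \<bar>q y\<bar> \<le> \<eta> * \<bar>p y\<bar>) \<Longrightarrow>
      (\<integral>x. (q x)\<^sup>2 \<partial>lebesgue_on (interior K)) \<le> Ce * \<eta>\<^sup>2 * (\<integral>x. (p x)\<^sup>2 \<partial>lebesgue_on (interior K)) \<and>
      (\<integral>x. (norm (grad q x))\<^sup>2 \<partial>lebesgue_on (interior K)) \<le> Ce * (\<eta> / diameter K)\<^sup>2 * (\<integral>x. (p x)\<^sup>2 \<partial>lebesgue_on (interior K))"
    and H: "\<And>K. K \<in> T \<Longrightarrow> 0 < diameter K \<and> diameter K \<le> H"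
    and w: "w \<in> fe_space r T" "\<And>x. x \<in> frontier D \<Longrightarrow> x \<in> frontier \<Omega> \<Longrightarrow> w x = 0"
    and orth: "\<And>v. v \<in> fe_space r T \<Longrightarrow> (\<And>x. x \<in> frontier \<Omega> \<Longrightarrow> v x = 0) \<Longrightarrow>
      (\<And>K x. K \<in> T - submesh T D \<Longrightarrow> x \<in> K \<Longrightarrow> v x = 0) \<Longrightarrow> (\<Sum>K\<in>submesh T D. elem_form A \<epsilon> K w v) = 0"
    and d: "0 < d" and \<eta>: "\<And>x. 0 \<le> \<eta> x" "\<And>x. \<eta> x \<le> 1" "\<And>x y. \<bar>\<eta> x - \<eta> y\<bar> \<le> norm (x - y) / d"
      "\<And>x. x \<in> frontier D \<Longrightarrow> x \<notin> frontier \<Omega> \<Longrightarrow> \<eta> x = 0"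
  defines "m \<equiv> \<lambda>K. Max (\<eta> ` lagrange_nodes r K)"
  shows "(\<Sum>K\<in>submesh T D. 1 / 2 * (m K)\<^sup>2 * elem_form A \<epsilon> K w w) \<le>
    (2 * amax * Ce * (\<epsilon> / d)\<^sup>2 + 2 * sqrt Ce * (H / d)) *
      (\<Sum>K\<in>{K\<in>submesh T D. 0 < m K}. \<integral>x. (w x)\<^sup>2 \<partial>lebesgue_on (interior K))"
proof -
  define S where "S = submesh T D"
  define B where "B = 2 * amax * Ce * (\<epsilon> / d)\<^sup>2 + 2 * sqrt Ce * (H / d)"
  have ST: "S \<subseteq> T" unfolding S_def submesh_def by blast
  have Sm: "fe_mesh S" by (rule fe_mesh_subset[OF T(1) ST])
  have DS: "D = interior (\<Union>S)" "closure D = \<Union>S" unfolding S_def by (rule mesh_resolved_submesh[OF T(1) D(1)])+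
  have oD: "open D" unfolding DS by (rule open_interior)
  have intcl: "interior (closure \<Omega>) = \<Omega>" by (rule interior_closure_lipschitz[OF \<Omega>(1,3)])
  \<comment> \<open>Nodal values of the test function. Cutting off outside the closure of D creates
    no jump: at boundary points of D either w vanishes, on the boundary of \<Omega>, or \<eta> does,
    elsewhere; so c is 0 at every point outside D.\<close>
  define c where "c z = (if z \<in> closure D then (\<eta> z)\<^sup>2 * w z else 0)" for z
  define v where "v = fe_interp r T c"
  have vT: "v \<in> fe_space r T" unfolding v_def by (rule fe_interp_mem[OF T(1)])
  have c0: "c z = 0" if z: "z \<notin> D" for z
  proof (cases "z \<in> closure D")
    case True
    then have fz: "z \<in> frontier D" using z oD unfolding frontier_def by (simp add: interior_open)
    show ?thesis
    proof (cases "z \<in> frontier \<Omega>")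
      case True
      then show ?thesis using w(2)[OF fz] by (simp add: c_def)
    next
      case False
      then show ?thesis using \<eta>(4)[OF fz] by (simp add: c_def)
    qed
  qed (simp add: c_def)
  have v0: "v x = 0" if x: "x \<in> frontier \<Omega>" for x
    unfolding v_def
  proof (rule fe_interp_zero_outside_interior[OF T(1) r])
    fix K z assume "z \<notin> interior (\<Union>T)"
    then have "z \<notin> \<Omega>" using T(2) intcl by simp
    then show "c z = 0" using D(2) by (intro c0) blast
  next
    show "x \<in> \<Union>T" "x \<notin> interior (\<Union>T)" using x \<Omega>(1) unfolding T(2) intcl frontier_def by (auto simp: interior_open)
  qed
  have vS: "v x = 0" if K: "K \<in> T - S" and x: "x \<in> K" for K x
  proof -
    have KT: "K \<in> T" using K by blast
    \<comment> \<open>An element outside the submesh has no node in D, since points of its interior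
      near such a node would lie in D as well.\<close>
    have "c z = 0" if z: "z \<in> lagrange_nodes r K" for z
    proof (rule c0, rule notI)
      assume zD: "z \<in> D"
      have "z \<in> closure (interior K)"
        using lagrange_nodes_subset[OF T(1) r KT z] fe_mesh_closure_interior[OF T(1) KT] by simp
      then have "interior K \<inter> D \<noteq> {}" using zD oD open_Int_closure_eq_empty[OF oD, of "interior K"] by blast
      then have "K \<in> S" using DS(1) by (intro interior_meets_imp_mem[OF T(1) ST KT]) simp
      then show False using K by blast
    qed
    then have "c (node r (verts K) k) = 0" if "k \<in> node_ix r (verts K)" for k
      using that lagrange_nodes_simplex[OF fe_mesh_verts(1)[OF T(1) KT], of r] fe_mesh_verts(2)[OF T(1) KT] by auto
    then show ?thesis unfolding v_def fe_interp_elem[OF T(1) KT x] interp_elem_def by simp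
  qed
  have sum0: "(\<Sum>K\<in>S. elem_form A \<epsilon> K w v) = 0" unfolding S_def by (rule orth[OF vT]) (fact v0 vS[unfolded S_def])+
  have elem: "1 / 2 * (m K)\<^sup>2 * elem_form A \<epsilon> K w w \<le> elem_form A \<epsilon> K w v + (if 0 < m K then B * (\<integral>x. (w x)\<^sup>2 \<partial>lebesgue_on (interior K)) else 0)"
    if KS: "K \<in> S" for K
  proof -
    have KT: "K \<in> T" using KS ST by blast
    have KD: "K \<subseteq> closure D" using KS unfolding DS(2) by blast
    have intK: "interior K \<subseteq> \<Omega>" using interior_elem_subset[OF KS] DS(1) D(2) by blast
    note nod = lagrange_nodes_nonempty[OF T(1) KT, of r]
    have mle: "\<eta> z \<le> m K" if "z \<in> lagrange_nodes r K" for z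
      unfolding m_def using that nod(2) by (intro Max_ge) auto
    have "m K \<in> \<eta> ` lagrange_nodes r K" unfolding m_def using nod by (intro Max_in) auto
    then obtain z0 where z0: "z0 \<in> lagrange_nodes r K" "m K = \<eta> z0" by blast
    obtain p where p: "poly_le r p" "\<And>x. x \<in> K \<Longrightarrow> w x = p x" using fe_space_elem[OF w(1) KT] by blast
    obtain q where q: "poly_le r q" "\<And>x. x \<in> K \<Longrightarrow> v x = q x" using fe_space_elem[OF vT KT] by blast
    have qz: "q z = (\<eta> z)\<^sup>2 * p z" if z: "z \<in> lagrange_nodes r K" for z
    proof -
      have zK: "z \<in> K" by (rule lagrange_nodes_subset[OF T(1) r KT z])
      have "v z = c z" unfolding v_def by (rule fe_interp_node[OF T(1) r KT z])
      then show ?thesis using zK KD p(2) q(2) by (auto simp: c_def)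
    qed
    have wp: "elem_form A \<epsilon> K w w = elem_form A \<epsilon> K p p" "elem_form A \<epsilon> K w v = elem_form A \<epsilon> K p q"
      using elem_form_cong[OF p(2,1) p(2,1)] elem_form_cong[OF p(2,1) q(2,1)] by auto
    have wP: "(\<integral>x. (w x)\<^sup>2 \<partial>lebesgue_on (interior K)) = (\<integral>x. (p x)\<^sup>2 \<partial>lebesgue_on (interior K))"
      by (rule Bochner_Integration.integral_cong[OF refl]) (use p(2) interior_subset[of K] in auto)
    have m01: "0 \<le> m K" "m K \<le> 1" using z0(2) \<eta>(1,2) by auto
    show ?thesis
    proof (cases "0 < m K")
      case True
      let ?h = "diameter K"
      \<comment> \<open>At a node, |\<eta>^2 - m^2| is the product of |\<eta> - m|, at most h_K / d
        because m is attained at a node of the same element, and \<eta> + m, at most 2 m because m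
        is the maximum.\<close>
      have bound: "\<forall>y\<in>lagrange_nodes r K. \<bar>q y - (m K)\<^sup>2 * p y\<bar> \<le> (2 * m K * ?h / d) * \<bar>p y\<bar>"
      proof
        fix y assume y: "y \<in> lagrange_nodes r K"
        have "norm (z0 - y) \<le> ?h"
          using diameter_bounded_bound[OF fe_mesh_elem(4)[OF T(1) KT] lagrange_nodes_subset[OF T(1) r KT z0(1)] lagrange_nodes_subset[OF T(1) r KT y]]
          by (simp add: dist_norm)
        then have "\<bar>\<eta> z0 - \<eta> y\<bar> \<le> ?h / d" using \<eta>(3)[of z0 y] d by (simp add: divide_right_mono order_trans)
        then have "\<bar>\<eta> y - m K\<bar> * \<bar>\<eta> y + m K\<bar> \<le> ?h / d * (2 * m K)"
          using mle[OF y] \<eta>(1)[of y] m01 H[OF KT] d unfolding z0(2) by (intro mult_mono) (auto simp: abs_minus_commute)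
        then have "\<bar>(\<eta> y)\<^sup>2 - (m K)\<^sup>2\<bar> \<le> 2 * m K * ?h / d"
          by (simp add: power2_eq_square square_diff_square_factored abs_mult mult.commute)
        then have "\<bar>(\<eta> y)\<^sup>2 - (m K)\<^sup>2\<bar> * \<bar>p y\<bar> \<le> (2 * m K * ?h / d) * \<bar>p y\<bar>" by (intro mult_right_mono) auto
        moreover have "q y - (m K)\<^sup>2 * p y = ((\<eta> y)\<^sup>2 - (m K)\<^sup>2) * p y" using qz[OF y] by (simp add: left_diff_distrib)
        ultimately show "\<bar>q y - (m K)\<^sup>2 * p y\<bar> \<le> (2 * m K * ?h / d) * \<bar>p y\<bar>" by (simp add: abs_mult)
      qed
      have pe: "poly_le r (\<lambda>x. q x - (m K)\<^sup>2 * p x)" by (intro poly_le_diff q(1) poly_le_cmult p(1))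
      have pos: "0 \<le> 2 * m K * ?h / d" using m01 H[OF KT] d by simp
      note est = Ce(2)[OF KT p(1) pe pos bound]
      have "1 / 2 * (m K)\<^sup>2 * elem_form A \<epsilon> K p p \<le> elem_form A \<epsilon> K p q + B * (\<integral>x. (p x)\<^sup>2 \<partial>lebesgue_on (interior K))"
        unfolding B_def
        by (rule elem_form_cutoff_ge[OF A \<Omega>(1) fe_mesh_elem(4)[OF T(1) KT] intK p(1) q(1) True m01(2) d refl _ _ Ce(1)
            conjunct1[OF est] conjunct2[OF est]]) (use H[OF KT] in auto)
      then show ?thesis using True by (simp add: wp wP)
    next
      \<comment> \<open>All nodal values of \<eta> vanish, so the test function is zero on K and K
        contributes to neither side.\<close>
      case False
      then have m0: "m K = 0" using m01 by simp
      have "q x = 0" for x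
      proof -
        have "q z = 0" if z: "z \<in> lagrange_nodes r K" for z
          using mle[OF z] \<eta>(1)[of z] m0 qz[OF z] by simp
        then show ?thesis
          using poly_le_eq_interp_elem[OF fe_mesh_verts(1)[OF T(1) KT] r q(1), of "\<lambda>_. 0" x] fe_mesh_verts(2)[OF T(1) KT]
          by (simp add: interp_elem_def)
      qed
      then have "elem_form A \<epsilon> K w v = 0" using q(2) by (intro elem_form_zero_right[OF _ p(2,1)]) auto
      then show ?thesis using m0 by simp
    qed
  qed
  have "(\<Sum>K\<in>S. 1 / 2 * (m K)\<^sup>2 * elem_form A \<epsilon> K w w) \<le>
      (\<Sum>K\<in>S. elem_form A \<epsilon> K w v + (if 0 < m K then B * (\<integral>x. (w x)\<^sup>2 \<partial>lebesgue_on (interior K)) else 0))"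
    by (rule sum_mono[OF elem])
  also have "\<dots> = (\<Sum>K\<in>S. if 0 < m K then B * (\<integral>x. (w x)\<^sup>2 \<partial>lebesgue_on (interior K)) else 0)"
    using sum0 by (simp add: sum.distrib)
  also have "\<dots> = (\<Sum>K\<in>{K\<in>S. 0 < m K}. B * (\<integral>x. (w x)\<^sup>2 \<partial>lebesgue_on (interior K)))"
    by (rule sum.inter_filter[symmetric, OF fe_mesh_finite[OF Sm]])
  finally show ?thesis unfolding S_def B_def sum_distrib_left .
qed

text \<open>The energy e of one layer is bounded by the mean square L of the next, and L by e, so
  each layer gains exp (- 2). The chain ends with L and not with e, so that the final bound is in
  terms of a mean square.\<close>

lemma geometric_decay:
  fixes e L :: "nat \<Rightarrow> real"
  assumes step: "\<And>k. k < n \<Longrightarrow> e k \<le> exp (- 2) * L (Suc k)" and le: "\<And>k. L k \<le> e k"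
  shows "1 \<le> n \<Longrightarrow> e 0 \<le> exp (- 2 * real n) * L n"
  using step
proof (induction n)
  case (Suc n)
  show ?case
  proof (cases "n = 0")
    case True
    then show ?thesis using Suc.prems(2)[of 0] by simp
  next
    case False
    then have "e 0 \<le> exp (- 2 * real n) * L n" using Suc by simp
    also have "\<dots> \<le> exp (- 2 * real n) * (exp (- 2) * L (Suc n))"
      using le[of n] Suc.prems(2)[of n] by (intro mult_left_mono) auto
    also have "\<dots> = exp (- 2 * real (Suc n)) * L (Suc n)" by (simp add: exp_add[symmetric] algebra_simps)
    finally show ?thesis .
  qed
qed simp

lemma submesh_mono: "\<omega> \<subseteq> D \<Longrightarrow> submesh T \<omega> \<subseteq> submesh T D"
  unfolding submesh_def using closure_mono by blast

text \<open>Between \<omega> and the part of the boundary of D away from the boundary of \<Omega>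
  there is room for n layers of width d. The layers consist of whole elements selected by their
  nodes, because the cut-off is seen at nodes only.\<close>

lemma discrete_energy_decay:
  fixes \<Omega> :: "(real^'n) set" and A :: "real^'n \<Rightarrow> real^'n^'n"
  assumes A: "elliptic_coefficient \<Omega> amin amax A" "0 < amin" "0 \<le> amax" and \<Omega>: "open \<Omega>" "bounded \<Omega>" "lipschitz_boundary \<Omega>"
    and T: "fe_mesh T" "\<Union>T = closure \<Omega>" and D: "mesh_resolved T D" "D \<subseteq> \<Omega>" and r: "1 \<le> r"
    and Ce: "0 \<le> Ce" "\<And>K p q \<eta>. K \<in> T \<Longrightarrow> poly_le r p \<Longrightarrow> poly_le r q \<Longrightarrow> 0 \<le> \<eta> \<Longrightarrow>
      (\<forall>y\<in>lagrange_nodes r K. \<bar>q y\<bar> \<le> \<eta> * \<bar>p y\<bar>) \<Longrightarrow>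
      (\<integral>x. (q x)\<^sup>2 \<partial>lebesgue_on (interior K)) \<le> Ce * \<eta>\<^sup>2 * (\<integral>x. (p x)\<^sup>2 \<partial>lebesgue_on (interior K)) \<and>
      (\<integral>x. (norm (grad q x))\<^sup>2 \<partial>lebesgue_on (interior K)) \<le> Ce * (\<eta> / diameter K)\<^sup>2 * (\<integral>x. (p x)\<^sup>2 \<partial>lebesgue_on (interior K))"
    and H: "\<And>K. K \<in> T \<Longrightarrow> 0 < diameter K \<and> diameter K \<le> H"
    and w: "w \<in> fe_space r T" "\<And>x. x \<in> frontier D \<Longrightarrow> x \<in> frontier \<Omega> \<Longrightarrow> w x = 0"
    and orth: "\<And>v. v \<in> fe_space r T \<Longrightarrow> (\<And>x. x \<in> frontier \<Omega> \<Longrightarrow> v x = 0) \<Longrightarrow>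
      (\<And>K x. K \<in> T - submesh T D \<Longrightarrow> x \<in> K \<Longrightarrow> v x = 0) \<Longrightarrow> (\<Sum>K\<in>submesh T D. elem_form A \<epsilon> K w v) = 0"
    and \<omega>: "\<omega> \<noteq> {}" "\<omega> \<subseteq> D" and d: "0 < d"
    and small: "2 * (2 * amax * Ce * (\<epsilon> / d)\<^sup>2 + 2 * sqrt Ce * (H / d)) \<le> exp (- 2)"
    and n: "1 \<le> n" "real n * d \<le> oversampling_dist \<Omega> \<omega> D"
  shows "(\<Sum>K\<in>submesh T \<omega>. elem_form A \<epsilon> K w w) \<le> exp (- 2 * real n) * (\<integral>x. (w x)\<^sup>2 \<partial>lebesgue_on D)"
proof -
  define S where "S = submesh T D"
  define B where "B = 2 * amax * Ce * (\<epsilon> / d)\<^sup>2 + 2 * sqrt Ce * (H / d)"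
  have ST: "S \<subseteq> T" unfolding S_def submesh_def by blast
  have Sm: "fe_mesh S" by (rule fe_mesh_subset[OF T(1) ST])
  have fin: "finite S" by (rule fe_mesh_finite[OF Sm])
  have DS: "D = interior (\<Union>S)" "closure D = \<Union>S" unfolding S_def by (rule mesh_resolved_submesh[OF T(1) D(1)])+
  have bD: "bounded D" using \<Omega>(2) D(2) bounded_subset by blast
  have intK: "interior K \<subseteq> \<Omega>" if "K \<in> S" for K using interior_elem_subset[OF that] DS(1) D(2) by blast
  define l2 where "l2 K = (\<integral>x. (w x)\<^sup>2 \<partial>lebesgue_on (interior K))" for K
  define en where "en K = elem_form A \<epsilon> K w w" for K
  have l20: "0 \<le> l2 K" for K by (simp add: l2_def)
  have en: "l2 K \<le> en K" "0 \<le> en K" if "K \<in> S" for K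
    unfolding l2_def en_def using elem_form_nonneg(2,3)[OF A(1,2) intK[OF that]] by auto
  \<comment> \<open>One node within distance k d is enough: it makes the largest nodal value of the
    k-th cut-off equal to 1. Conversely, a positive nodal value of that cut-off puts the element
    into layer k + 1.\<close>
  define Sk where "Sk k = {K\<in>S. \<exists>z\<in>lagrange_nodes r K. infdist z \<omega> \<le> real k * d}" for k
  have Sk: "Sk k \<subseteq> S" "finite (Sk k)" for k unfolding Sk_def using fin by auto
  have step: "sum en (Sk k) \<le> exp (- 2) * sum l2 (Sk (Suc k))" if k: "k < n" for k
  proof -
    define \<eta> where "\<eta> x = max 0 (min 1 (real (Suc k) - infdist x \<omega> / d))" for x
    have \<eta>lip: "\<bar>\<eta> x - \<eta> y\<bar> \<le> norm (x - y) / d" for x y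
    proof -
      have "\<bar>\<eta> x - \<eta> y\<bar> \<le> \<bar>infdist x \<omega> / d - infdist y \<omega> / d\<bar>" unfolding \<eta>_def by (auto simp: max_def min_def abs_if)
      also have "\<dots> = \<bar>infdist x \<omega> - infdist y \<omega>\<bar> / d" using d by (simp flip: diff_divide_distrib)
      also have "\<dots> \<le> norm (x - y) / d" using d by (intro divide_right_mono infdist_lipschitz) simp
      finally show ?thesis .
    qed
    \<comment> \<open>Such boundary points have distance at least n d from \<omega>, and the k-th
      cut-off vanishes from distance (k + 1) d on; this is where k < n is needed.\<close>
    have \<eta>0: "\<eta> x = 0" if x: "x \<in> frontier D" "x \<notin> frontier \<Omega>" for x
    proof -
      have "oversampling_dist \<Omega> \<omega> D \<le> infdist x \<omega>"
        unfolding infdist_notempty[OF \<omega>(1)]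
      proof (rule cINF_greatest[OF \<omega>(1)])
        fix y assume "y \<in> \<omega>"
        then have "setdist \<omega> (frontier D - frontier \<Omega>) \<le> dist y x" using x by (intro setdist_le_dist) auto
        then show "oversampling_dist \<Omega> \<omega> D \<le> dist x y" by (simp add: oversampling_dist_def dist_commute)
      qed
      moreover have "real (Suc k) * d \<le> real n * d" using k d by (intro mult_right_mono) auto
      ultimately have "real (Suc k) * d \<le> infdist x \<omega>" using n(2) by linarith
      then have "real (Suc k) \<le> infdist x \<omega> / d" using d by (simp only: pos_le_divide_eq)
      then show ?thesis by (simp add: \<eta>_def)
    qed
    have \<eta>1: "0 \<le> \<eta> x" and \<eta>2: "\<eta> x \<le> 1" for x by (auto simp: \<eta>_def)
    let ?m = "\<lambda>K. Max (\<eta> ` lagrange_nodes r K)"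
    have main: "(\<Sum>K\<in>S. 1 / 2 * (?m K)\<^sup>2 * en K) \<le> B * (\<Sum>K\<in>{K\<in>S. 0 < ?m K}. l2 K)"
      unfolding S_def B_def en_def l2_def
      by (rule discrete_Caccioppoli[OF A \<Omega> T D r Ce(1)]) (fact Ce(2) H w orth d \<eta>1 \<eta>2 \<eta>lip \<eta>0)+
    have one: "?m K = 1" if K: "K \<in> Sk k" for K
    proof -
      have KT: "K \<in> T" using K Sk(1) ST by blast
      note nod = lagrange_nodes_nonempty[OF T(1) KT, of r]
      obtain z where z: "z \<in> lagrange_nodes r K" "infdist z \<omega> \<le> real k * d" using K unfolding Sk_def by blast
      have "infdist z \<omega> / d \<le> real k" using z(2) d by (simp add: pos_divide_le_eq)
      then have "\<eta> z = 1" by (simp add: \<eta>_def)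
      then have "1 \<le> ?m K" using z(1) nod by (intro Max_ge) (auto intro: rev_image_eqI)
      moreover have "?m K \<le> 1" using nod by (subst Max_le_iff) (auto simp: \<eta>_def)
      ultimately show ?thesis by simp
    qed
    have sub: "{K\<in>S. 0 < ?m K} \<subseteq> Sk (Suc k)"
    proof
      fix K assume K: "K \<in> {K\<in>S. 0 < ?m K}"
      then have KT: "K \<in> T" using ST by blast
      note nod = lagrange_nodes_nonempty[OF T(1) KT, of r]
      have "?m K \<in> \<eta> ` lagrange_nodes r K" using nod by (intro Max_in) auto
      then obtain z where z: "z \<in> lagrange_nodes r K" "0 < \<eta> z" using K by auto
      have "infdist z \<omega> / d < real (Suc k)" using z(2) by (auto simp: \<eta>_def split: if_splits)
      then have "infdist z \<omega> \<le> real (Suc k) * d" using d by (simp add: pos_divide_less_eq)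
      then show "K \<in> Sk (Suc k)" using z(1) K unfolding Sk_def by blast
    qed
    have B0: "0 \<le> B"
    proof -
      obtain K where K: "K \<in> T" using T(2) \<omega> D(2) closure_subset[of \<Omega>] by blast
      then have "0 \<le> H" using H[OF K] by linarith
      then show ?thesis unfolding B_def using A(3) Ce(1) d by simp
    qed
    \<comment> \<open>This undoes the factor 1/2 left over from the absorption, and explains the
      leading 2 in the smallness condition.\<close>
    have "sum en (Sk k) = 2 * (\<Sum>K\<in>Sk k. 1 / 2 * (?m K)\<^sup>2 * en K)"
      unfolding sum_distrib_left using one by (intro sum.cong) auto
    also have "\<dots> \<le> 2 * (\<Sum>K\<in>S. 1 / 2 * (?m K)\<^sup>2 * en K)"
      using en(2) by (intro mult_left_mono sum_mono2 fin Sk) auto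
    also have "\<dots> \<le> 2 * (B * (\<Sum>K\<in>{K\<in>S. 0 < ?m K}. l2 K))" using main by simp
    also have "\<dots> \<le> 2 * (B * sum l2 (Sk (Suc k)))"
      using B0 sub Sk(2) l20 by (intro mult_left_mono sum_mono2) auto
    also have "\<dots> \<le> exp (- 2) * sum l2 (Sk (Suc k))"
      using mult_right_mono[OF small[folded B_def], of "sum l2 (Sk (Suc k))"] l20 by (simp only: sum_nonneg mult.assoc)
    finally show ?thesis .
  qed
  have "sum en (Sk 0) \<le> exp (- 2 * real n) * sum l2 (Sk n)"
  proof (rule geometric_decay[where e = "\<lambda>k. sum en (Sk k)" and L = "\<lambda>k. sum l2 (Sk k)"])
    show "sum l2 (Sk k) \<le> sum en (Sk k)" for k using en(1) Sk(1) by (intro sum_mono) blast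
  qed (fact step n(1))+
  also have "\<dots> \<le> exp (- 2 * real n) * sum l2 S" using l20 by (intro mult_left_mono sum_mono2 fin Sk) auto
  also have "sum l2 S = (\<integral>x. (w x)\<^sup>2 \<partial>lebesgue_on D)"
  proof -
    have "integrable (lebesgue_on D) (\<lambda>x. (w x)\<^sup>2)"
      using fe_product_integrable[OF Sm DS(1) bD fe_space_subset[OF w(1) ST] fe_space_subset[OF w(1) ST]] by (simp add: power2_eq_square)
    then show ?thesis unfolding l2_def by (rule integral_mesh(1)[OF Sm DS(1), symmetric])
  qed
  also have "sum en (submesh T \<omega>) \<le> sum en (Sk 0)"
  proof (rule sum_mono2[OF Sk(2)])
    show "submesh T \<omega> \<subseteq> Sk 0"
    proof
      fix K assume K: "K \<in> submesh T \<omega>"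
      then have KT: "K \<in> T" and K\<omega>: "K \<subseteq> closure \<omega>" unfolding submesh_def by auto
      obtain z where z: "z \<in> lagrange_nodes r K" using lagrange_nodes_nonempty(1)[OF T(1) KT] by blast
      have "z \<in> closure \<omega>" using lagrange_nodes_subset[OF T(1) r KT z] K\<omega> by blast
      then have "infdist z \<omega> = 0" using in_closure_iff_infdist_zero[OF \<omega>(1)] by blast
      moreover have "K \<in> S" using K submesh_mono[OF \<omega>(2)] unfolding S_def by blast
      ultimately show "K \<in> Sk 0" using z unfolding Sk_def by (auto intro!: bexI[of _ z])
    qed
    show "0 \<le> en K" if "K \<in> Sk 0 - submesh T \<omega>" for K using that Sk(1) by (intro en(2)) blast
  qed
  finally show ?thesis unfolding en_def .
qed

text \<open>On each element the nodal estimate is applied twice: to the interpolant, whose nodal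
  values are at most those of w, and to its difference from \<open>chi z0\<close> times w for one
  node z0, whose nodal values carry the factor G times the diameter.\<close>

lemma interpolated_product_energy_le:
  fixes \<Omega> :: "(real^'n) set" and A :: "real^'n \<Rightarrow> real^'n^'n"
  assumes A: "elliptic_coefficient \<Omega> amin amax A" "0 < amin" "0 \<le> amax" and \<Omega>: "open \<Omega>" "bounded \<Omega>"
    and T: "fe_mesh T" "\<Union>T = closure \<Omega>" and \<omega>: "mesh_resolved T \<omega>" "\<omega> \<subseteq> \<Omega>" "\<omega> \<noteq> {}" and r: "1 \<le> r"
    and Ce: "0 \<le> Ce" "\<And>K p q \<eta>. K \<in> T \<Longrightarrow> poly_le r p \<Longrightarrow> poly_le r q \<Longrightarrow> 0 \<le> \<eta> \<Longrightarrow>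
      (\<forall>y\<in>lagrange_nodes r K. \<bar>q y\<bar> \<le> \<eta> * \<bar>p y\<bar>) \<Longrightarrow>
      (\<integral>x. (q x)\<^sup>2 \<partial>lebesgue_on (interior K)) \<le> Ce * \<eta>\<^sup>2 * (\<integral>x. (p x)\<^sup>2 \<partial>lebesgue_on (interior K)) \<and>
      (\<integral>x. (norm (grad q x))\<^sup>2 \<partial>lebesgue_on (interior K)) \<le> Ce * (\<eta> / diameter K)\<^sup>2 * (\<integral>x. (p x)\<^sup>2 \<partial>lebesgue_on (interior K))"
    and H: "\<And>K. K \<in> T \<Longrightarrow> 0 < diameter K"
    and w: "w \<in> fe_space r T" and g: "\<And>x. x \<in> closure \<omega> \<Longrightarrow> g x = chi x * w x" and pu: "pu_function \<Omega> \<omega> chi" and \<epsilon>: "0 \<le> \<epsilon>"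
  shows "(norm_a A \<epsilon> \<omega> (lagrange_interp r (submesh T \<omega>) g))\<^sup>2 \<le>
    (2 + 2 * amax * Ce + Ce) * (1 + \<epsilon> * norm_Linf \<omega> (weak_grad \<Omega> chi))\<^sup>2 * (\<Sum>K\<in>submesh T \<omega>. elem_form A \<epsilon> K w w)"
proof -
  define S where "S = submesh T \<omega>"
  define G where "G = norm_Linf \<omega> (weak_grad \<Omega> chi)"
  define I where "I = lagrange_interp r S g"
  have ST: "S \<subseteq> T" unfolding S_def submesh_def by blast
  have Sm: "fe_mesh S" by (rule fe_mesh_subset[OF T(1) ST])
  have DS: "\<omega> = interior (\<Union>S)" "closure \<omega> = \<Union>S" unfolding S_def by (rule mesh_resolved_submesh[OF T(1) \<omega>(1)])+
  have o\<omega>: "open \<omega>" unfolding DS by (rule open_interior)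
  have b\<omega>: "bounded \<omega>" using \<Omega>(2) \<omega>(2) bounded_subset by blast
  have I: "I \<in> fe_space r S" "\<And>K z. K \<in> S \<Longrightarrow> z \<in> lagrange_nodes r K \<Longrightarrow> I z = g z"
    unfolding I_def by (rule lagrange_interp_props[OF Sm r], rule lagrange_interp_props(2)[OF Sm r])
  note G0 = pu_function_lipschitz(1)[OF \<Omega> pu o\<omega> \<omega>(2,3), folded G_def]
  note lip = pu_function_lipschitz(2)[OF \<Omega> pu o\<omega> \<omega>(2,3), folded G_def]
  have intK: "interior K \<subseteq> \<Omega>" if "K \<in> S" for K using interior_elem_subset[OF that] DS(1) \<omega>(2) by blast
  have elem: "elem_form A \<epsilon> K I I \<le> (2 + 2 * amax * Ce + Ce) * (1 + \<epsilon> * G)\<^sup>2 * elem_form A \<epsilon> K w w" if KS: "K \<in> S" for K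
  proof -
    have KT: "K \<in> T" using KS ST by blast
    have K\<omega>: "K \<subseteq> closure \<omega>" using KS unfolding DS(2) by blast
    have K\<Omega>: "K \<subseteq> closure \<Omega>" using KT T(2) by blast
    obtain p where p: "poly_le r p" "\<And>x. x \<in> K \<Longrightarrow> w x = p x" using fe_space_elem[OF w KT] by blast
    obtain q where q: "poly_le r q" "\<And>x. x \<in> K \<Longrightarrow> I x = q x" using fe_space_elem[OF I(1) KS] by blast
    have nK: "z \<in> K" if "z \<in> lagrange_nodes r K" for z by (rule lagrange_nodes_subset[OF T(1) r KT that])
    have qz: "q z = chi z * p z" if z: "z \<in> lagrange_nodes r K" for z
      using I(2)[OF KS z] q(2)[OF nK[OF z]] p(2)[OF nK[OF z]] g[of z] nK[OF z] K\<omega> by auto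
    obtain z0 where z0: "z0 \<in> lagrange_nodes r K" using lagrange_nodes_nonempty(1)[OF T(1) KT] by blast
    have chi01: "0 \<le> chi z" "chi z \<le> 1" if "z \<in> lagrange_nodes r K" for z
      using pu_function_bounds[OF pu, of z] nK[OF that] K\<Omega> by auto
    have e1: "(\<integral>x. (q x)\<^sup>2 \<partial>lebesgue_on (interior K)) \<le> Ce * 1\<^sup>2 * (\<integral>x. (p x)\<^sup>2 \<partial>lebesgue_on (interior K))"
    proof (rule conjunct1[OF Ce(2)[OF KT p(1) q(1)]])
      have "\<bar>q y\<bar> \<le> 1 * \<bar>p y\<bar>" if "y \<in> lagrange_nodes r K" for y
        using chi01[OF that] by (simp add: qz[OF that] abs_mult mult_left_le_one_le)
      then show "\<forall>y\<in>lagrange_nodes r K. \<bar>q y\<bar> \<le> 1 * \<bar>p y\<bar>" by blast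
    qed simp
    have pe: "poly_le r (\<lambda>x. q x - chi z0 * p x)" by (intro poly_le_diff q(1) poly_le_cmult p(1))
    have e2: "(\<integral>x. (norm (grad (\<lambda>x. q x - chi z0 * p x) x))\<^sup>2 \<partial>lebesgue_on (interior K)) \<le>
        Ce * (G * diameter K / diameter K)\<^sup>2 * (\<integral>x. (p x)\<^sup>2 \<partial>lebesgue_on (interior K))"
    proof (rule conjunct2[OF Ce(2)[OF KT p(1) pe]])
      show "0 \<le> G * diameter K" using G0 H[OF KT] by simp
      show "\<forall>y\<in>lagrange_nodes r K. \<bar>q y - chi z0 * p y\<bar> \<le> G * diameter K * \<bar>p y\<bar>"
      proof
        fix y assume y: "y \<in> lagrange_nodes r K"
        have "\<bar>chi y - chi z0\<bar> \<le> G * norm (y - z0)"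
          using interior_elem_subset[OF KS] DS(1)
          by (intro lip[OF fe_mesh_elem(2)[OF T(1) KT] fe_mesh_closure_interior[OF T(1) KT] _ nK[OF y] nK[OF z0]]) simp
        also have "\<dots> \<le> G * diameter K"
          using diameter_bounded_bound[OF fe_mesh_elem(4)[OF T(1) KT] nK[OF y] nK[OF z0]] G0
          by (intro mult_left_mono) (auto simp: dist_norm)
        finally have "\<bar>chi y - chi z0\<bar> * \<bar>p y\<bar> \<le> G * diameter K * \<bar>p y\<bar>" by (intro mult_right_mono) auto
        moreover have "q y - chi z0 * p y = (chi y - chi z0) * p y" using qz[OF y] by (simp add: left_diff_distrib)
        ultimately show "\<bar>q y - chi z0 * p y\<bar> \<le> G * diameter K * \<bar>p y\<bar>" by (simp add: abs_mult)
      qed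
    qed
    have e1': "(\<integral>x. (q x)\<^sup>2 \<partial>lebesgue_on (interior K)) \<le> Ce * (\<integral>x. (p x)\<^sup>2 \<partial>lebesgue_on (interior K))" using e1 by simp
    have e2': "(\<integral>x. (norm (grad (\<lambda>x. q x - chi z0 * p x) x))\<^sup>2 \<partial>lebesgue_on (interior K)) \<le>
        Ce * G\<^sup>2 * (\<integral>x. (p x)\<^sup>2 \<partial>lebesgue_on (interior K))" using e2 H[OF KT] by simp
    have "elem_form A \<epsilon> K q q \<le> (2 + 2 * amax * Ce + Ce) * (1 + \<epsilon> * G)\<^sup>2 * elem_form A \<epsilon> K p p"
      by (rule elem_form_product_le[OF A \<Omega>(1) fe_mesh_elem(4)[OF T(1) KT] intK[OF KS] p(1) q(1) chi01[OF z0] G0 \<epsilon> Ce(1) e1' e2'])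
    then show ?thesis by (simp add: elem_form_cong[OF p(2,1) p(2,1)] elem_form_cong[OF q(2,1) q(2,1)])
  qed
  have a: "a_form A \<epsilon> \<omega> I I = (\<Sum>K\<in>S. elem_form A \<epsilon> K I I)"
    by (rule a_form_fe[OF A(1,2) \<Omega>(1) Sm DS(1) b\<omega> \<omega>(2) I(1) I(1)])
  have "0 \<le> a_form A \<epsilon> \<omega> I I"
    unfolding a using elem_form_nonneg(3)[OF A(1,2) intK] by (intro sum_nonneg)
  then have "(norm_a A \<epsilon> \<omega> I)\<^sup>2 = (\<Sum>K\<in>S. elem_form A \<epsilon> K I I)" unfolding norm_a_def a by simp
  also have "\<dots> \<le> (\<Sum>K\<in>S. (2 + 2 * amax * Ce + Ce) * (1 + \<epsilon> * G)\<^sup>2 * elem_form A \<epsilon> K w w)" by (rule sum_mono[OF elem])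
  finally show ?thesis unfolding I_def S_def G_def sum_distrib_left .
qed

section \<open>Uniform constants and the choice of the layer width\<close>

lemma shape_regular_nodal_estimate:
  assumes sh: "shape_regular_family (\<Omega> :: (real^'n) set) \<T>" and r: "1 \<le> r"
  obtains Ce where "0 \<le> Ce" "\<And>T K p q \<eta>. T \<in> \<T> \<Longrightarrow> K \<in> T \<Longrightarrow> poly_le r p \<Longrightarrow> poly_le r q \<Longrightarrow> 0 \<le> \<eta> \<Longrightarrow>
      (\<forall>y\<in>lagrange_nodes r K. \<bar>q y\<bar> \<le> \<eta> * \<bar>p y\<bar>) \<Longrightarrow>
      (\<integral>x. (q x)\<^sup>2 \<partial>lebesgue_on (interior K)) \<le> Ce * \<eta>\<^sup>2 * (\<integral>x. (p x)\<^sup>2 \<partial>lebesgue_on (interior K)) \<and>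
      (\<integral>x. (norm (grad q x))\<^sup>2 \<partial>lebesgue_on (interior K)) \<le> Ce * (\<eta> / diameter K)\<^sup>2 * (\<integral>x. (p x)\<^sup>2 \<partial>lebesgue_on (interior K))"
proof -
  obtain \<kappa> where \<kappa>: "\<kappa> > 0" "\<forall>T\<in>\<T>. \<forall>K\<in>T. \<exists>z \<rho>. 0 < \<rho> \<and> cball z \<rho> \<subseteq> K \<and> diameter K \<le> \<kappa> * \<rho>"
    using sh unfolding shape_regular_family_def by (elim conjE exE) (rule that)
  have mesh: "fe_mesh T" if "T \<in> \<T>" for T
    using sh that unfolding shape_regular_family_def mesh_of_def fe_mesh_def by blast
  obtain Ce where Ce: "0 \<le> Ce" "\<forall>(C::(real^'n) set) p q z \<rho> \<eta>. vertex_set C \<longrightarrow> poly_le r p \<longrightarrow> poly_le r q \<longrightarrow> 0 \<le> \<eta> \<longrightarrow>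
     (\<forall>y\<in>lagrange_nodes r (convex hull C). \<bar>q y\<bar> \<le> \<eta> * \<bar>p y\<bar>) \<longrightarrow>
     0 < \<rho> \<longrightarrow> cball z \<rho> \<subseteq> convex hull C \<longrightarrow> diameter (convex hull C) \<le> \<kappa> * \<rho> \<longrightarrow>
     (\<integral>x. (q x)\<^sup>2 \<partial>lebesgue_on (interior (convex hull C))) \<le> Ce * \<eta>\<^sup>2 * (\<integral>x. (p x)\<^sup>2 \<partial>lebesgue_on (interior (convex hull C))) \<and>
     (\<integral>x. (norm (grad q x))\<^sup>2 \<partial>lebesgue_on (interior (convex hull C))) \<le>
        Ce * (\<eta> / diameter (convex hull C))\<^sup>2 * (\<integral>x. (p x)\<^sup>2 \<partial>lebesgue_on (interior (convex hull C)))"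
    using nodal_estimate[where 'n='n, OF r \<kappa>(1)] by (elim exE conjE) (rule that)
  show ?thesis
  proof (rule that[OF Ce(1)])
    fix T K p q and \<eta> :: real
    assume T: "T \<in> \<T>" and K: "K \<in> T" and pq: "poly_le r p" "poly_le r q" "0 \<le> \<eta>" "\<forall>y\<in>lagrange_nodes r K. \<bar>q y\<bar> \<le> \<eta> * \<bar>p y\<bar>"
    obtain z \<rho> where z: "0 < \<rho>" "cball z \<rho> \<subseteq> K" "diameter K \<le> \<kappa> * \<rho>" using bspec[OF bspec[OF \<kappa>(2) T] K] by blast
    note v = fe_mesh_verts[OF mesh[OF T] K]
    show "(\<integral>x. (q x)\<^sup>2 \<partial>lebesgue_on (interior K)) \<le> Ce * \<eta>\<^sup>2 * (\<integral>x. (p x)\<^sup>2 \<partial>lebesgue_on (interior K)) \<and>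
      (\<integral>x. (norm (grad q x))\<^sup>2 \<partial>lebesgue_on (interior K)) \<le> Ce * (\<eta> / diameter K)\<^sup>2 * (\<integral>x. (p x)\<^sup>2 \<partial>lebesgue_on (interior K))"
      by (rule Ce(2)[THEN spec, of "verts K", THEN spec, of p, THEN spec, of q, THEN spec, of z, THEN spec, of \<rho>, THEN spec, of \<eta>,
        unfolded v(2), THEN mp, OF v(1), THEN mp, OF pq(1), THEN mp, OF pq(2), THEN mp, OF pq(3), THEN mp, OF pq(4),
        THEN mp, OF z(1), THEN mp, OF z(2), THEN mp, OF z(3)])
  qed
qed

lemma mesh_size_diameter:
  fixes T :: "(real^'n) set set"
  assumes sh: "shape_regular_family \<Omega> \<T>" and T: "T \<in> \<T>" and K: "K \<in> T"
  shows "0 < diameter K" "diameter K \<le> mesh_size T"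
proof -
  have m: "fe_mesh T" using sh T unfolding shape_regular_family_def mesh_of_def fe_mesh_def by blast
  obtain z \<rho> where z: "0 < \<rho>" "cball z \<rho> \<subseteq> K" using sh T K unfolding shape_regular_family_def by blast
  have "0 < diameter (cball z \<rho>)" using z(1) by (simp add: diameter_cball)
  also have "\<dots> \<le> diameter K" by (rule diameter_subset[OF z(2) fe_mesh_elem(4)[OF m K]])
  finally show "0 < diameter K" .
  show "diameter K \<le> mesh_size T" unfolding mesh_size_def using fe_mesh_finite[OF m] K by (intro Max_ge) auto
qed

lemma norm_L2_diff_le:
  assumes "integrable (lebesgue_on D) (\<lambda>x. (u x)\<^sup>2 :: real)" "integrable (lebesgue_on D) (\<lambda>x. (v x)\<^sup>2)"
    and "integrable (lebesgue_on D) (\<lambda>x. (w x)\<^sup>2)" and w: "\<And>x. x \<in> D \<Longrightarrow> w x = u x - v x"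
  shows "(\<integral>x. (w x)\<^sup>2 \<partial>lebesgue_on D) \<le> 2 * (norm_L2 D u + norm_L2 D v)\<^sup>2"
proof -
  have "(\<integral>x. (w x)\<^sup>2 \<partial>lebesgue_on D) \<le> (\<integral>x. 2 * (u x)\<^sup>2 + 2 * (v x)\<^sup>2 \<partial>lebesgue_on D)"
  proof (rule integral_mono)
    fix x assume "x \<in> space (lebesgue_on D)"
    then have "w x = u x - v x" using w by simp
    moreover have "0 \<le> (u x + v x)\<^sup>2" by simp
    ultimately show "(w x)\<^sup>2 \<le> 2 * (u x)\<^sup>2 + 2 * (v x)\<^sup>2" by (simp add: power2_sum power2_diff)
  qed (use assms in auto)
  also have "\<dots> = 2 * (norm_L2 D u)\<^sup>2 + 2 * (norm_L2 D v)\<^sup>2"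
    using assms by (simp add: norm_L2_def)
  also have "\<dots> \<le> 2 * (norm_L2 D u + norm_L2 D v)\<^sup>2"
    by (simp add: power2_sum norm_L2_def)
  finally show ?thesis .
qed

text \<open>Rounding the number of layers down loses less than one of them, which costs at most a
  factor exp 1. The bound is stated as a square because the decay estimate concerns energies and the
  norms are their roots.\<close>

lemma exp_nat_floor_le:
  assumes "0 < d" "d \<le> \<delta>"
  shows "1 \<le> nat \<lfloor>\<delta> / d\<rfloor>" "real (nat \<lfloor>\<delta> / d\<rfloor>) * d \<le> \<delta>"
    "exp (- 2 * real (nat \<lfloor>\<delta> / d\<rfloor>)) \<le> (exp 1 * exp (- \<delta> / d))\<^sup>2"
proof -
  have 1: "1 \<le> \<delta> / d" using assms by simp
  then have f: "1 \<le> \<lfloor>\<delta> / d\<rfloor>" by linarith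
  then show "1 \<le> nat \<lfloor>\<delta> / d\<rfloor>" by linarith
  have r: "real (nat \<lfloor>\<delta> / d\<rfloor>) = of_int \<lfloor>\<delta> / d\<rfloor>" using f by simp
  have "real (nat \<lfloor>\<delta> / d\<rfloor>) \<le> \<delta> / d" unfolding r by (rule of_int_floor_le)
  then show "real (nat \<lfloor>\<delta> / d\<rfloor>) * d \<le> \<delta>" using assms(1) by (simp only: pos_le_divide_eq)
  have "\<delta> / d - 1 \<le> real (nat \<lfloor>\<delta> / d\<rfloor>)" unfolding r by linarith
  then have "exp (- 2 * real (nat \<lfloor>\<delta> / d\<rfloor>)) \<le> exp (2 * (1 + (- \<delta> / d)))" by simp
  also have "\<dots> = (exp 1 * exp (- \<delta> / d))\<^sup>2" by (simp only: exp_double exp_add)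
  finally show "exp (- 2 * real (nat \<lfloor>\<delta> / d\<rfloor>)) \<le> (exp 1 * exp (- \<delta> / d))\<^sup>2" .
qed

text \<open>Half of the exponential rate is traded for the factor \<open>1 / t\<close>.\<close>

lemma exp_half_rate:
  assumes "0 < l" "0 < (t::real)"
  shows "exp (- t / l) \<le> 2 * l * (1 / t) * exp (- (1 / (2 * l)) * t)"
proof -
  define s where "s = t / (2 * l)"
  have s: "0 < s" using assms by (simp add: s_def)
  have "s \<le> exp s" using exp_ge_add_one_self[of s] by linarith
  then have "exp (- s) \<le> 1 / s" using s by (simp add: exp_minus field_simps)
  then have "exp (- s) * exp (- s) \<le> 1 / s * exp (- s)" by (intro mult_right_mono) auto
  moreover have "exp (- s) * exp (- s) = exp (- t / l)" using assms by (simp add: s_def flip: exp_add)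
  moreover have "1 / s = 2 * l * (1 / t)" "- s = - (1 / (2 * l)) * t" using assms by (auto simp: s_def)
  ultimately show ?thesis by simp
qed

lemma fe_exponential_decay:
  fixes \<Omega> :: "(real^'n) set" and A :: "real^'n \<Rightarrow> real^'n^'n"
  assumes A: "elliptic_coefficient \<Omega> amin amax A" "0 < amin" "0 \<le> amax" and \<Omega>: "open \<Omega>" "bounded \<Omega>" "lipschitz_boundary \<Omega>"
    and r: "1 \<le> r" and sh: "shape_regular_family \<Omega> \<T>"
  obtains l M where "1 \<le> l" "0 < M" "\<And>\<epsilon> T f \<omega> D chi u \<psi>. 0 < \<epsilon> \<Longrightarrow> T \<in> \<T> \<Longrightarrow> L2 \<Omega> f \<Longrightarrow>
      oversampled_subdomain T \<Omega> \<omega> D \<Longrightarrow> pu_function \<Omega> \<omega> chi \<Longrightarrow>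
      fe_solution r T \<Omega> A \<epsilon> f u \<Longrightarrow> local_particular r T \<Omega> D A \<epsilon> f \<psi> \<Longrightarrow>
      l * max \<epsilon> (mesh_size T) \<le> oversampling_dist \<Omega> \<omega> D \<Longrightarrow>
      norm_a A \<epsilon> \<omega> (lagrange_interp r (submesh T \<omega>) (\<lambda>x. chi x * (u x - \<psi> x))) \<le>
        M * (1 + \<epsilon> * norm_Linf \<omega> (weak_grad \<Omega> chi)) * exp (- (oversampling_dist \<Omega> \<omega> D / max \<epsilon> (mesh_size T)) / l) *
        (norm_L2 D u + norm_L2 D \<psi>)"
proof -
  obtain Ce where Ce: "0 \<le> Ce" "\<And>T K p q \<eta>. T \<in> \<T> \<Longrightarrow> K \<in> T \<Longrightarrow> poly_le r p \<Longrightarrow> poly_le r q \<Longrightarrow> 0 \<le> \<eta> \<Longrightarrow>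
      (\<forall>y\<in>lagrange_nodes r K. \<bar>q y\<bar> \<le> \<eta> * \<bar>p y\<bar>) \<Longrightarrow>
      (\<integral>x. (q x)\<^sup>2 \<partial>lebesgue_on (interior K)) \<le> Ce * \<eta>\<^sup>2 * (\<integral>x. (p x)\<^sup>2 \<partial>lebesgue_on (interior K)) \<and>
      (\<integral>x. (norm (grad q x))\<^sup>2 \<partial>lebesgue_on (interior K)) \<le> Ce * (\<eta> / diameter K)\<^sup>2 * (\<integral>x. (p x)\<^sup>2 \<partial>lebesgue_on (interior K))"
    by (fact shape_regular_nodal_estimate[OF sh r])
  \<comment> \<open>B is the one-step constant with both ratios \<epsilon> / d and h / d replaced by
    1. For layers of width l times max \<epsilon> h these ratios are at most 1 / l, so the step
    constant is at most B / l, and l makes twice this at most exp (- 2). In M, the factor C5 belongs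
    to the interpolated product, 2 to the splitting of w into u and \<psi>, and exp 1 to the
    rounding.\<close>
  define B where "B = 2 * amax * Ce + 2 * sqrt Ce"
  define l where "l = 1 + 2 * exp 2 * B"
  define C5 where "C5 = 2 + 2 * amax * Ce + Ce"
  define M where "M = sqrt (2 * C5) * exp 1"
  have B0: "0 \<le> B" using A(3) Ce(1) by (simp add: B_def)
  have l1: "1 \<le> l" using B0 by (simp add: l_def)
  have C5: "0 < C5" using A(3) Ce(1) by (simp add: C5_def add_pos_nonneg)
  show ?thesis
  proof (rule that[OF l1])
    show "0 < M" using C5 by (simp add: M_def)
    fix \<epsilon> :: real and T f \<omega> D chi u \<psi>
    assume \<epsilon>: "0 < \<epsilon>" and T: "T \<in> \<T>" and f: "L2 \<Omega> f" and over: "oversampled_subdomain T \<Omega> \<omega> D" and pu: "pu_function \<Omega> \<omega> chi"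
      and u: "fe_solution r T \<Omega> A \<epsilon> f u" and \<psi>: "local_particular r T \<Omega> D A \<epsilon> f \<psi>"
      and dist: "l * max \<epsilon> (mesh_size T) \<le> oversampling_dist \<Omega> \<omega> D"
    define \<delta> where "\<delta> = oversampling_dist \<Omega> \<omega> D"
    define G where "G = norm_Linf \<omega> (weak_grad \<Omega> chi)"
    define m where "m = max \<epsilon> (mesh_size T)"
    define N where "N = norm_L2 D u + norm_L2 D \<psi>"
    define E where "E = norm_a A \<epsilon> \<omega> (lagrange_interp r (submesh T \<omega>) (\<lambda>x. chi x * (u x - \<psi> x)))"
    have m: "0 < m" "\<epsilon> \<le> m" "mesh_size T \<le> m" using \<epsilon> by (auto simp: m_def)
    have mesh: "fe_mesh T" "\<Union>T = closure \<Omega>"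
      using sh T unfolding shape_regular_family_def mesh_of_def fe_mesh_def by auto
    have \<omega>: "\<omega> \<noteq> {}" "\<omega> \<subseteq> D" "D \<subseteq> \<Omega>" "mesh_resolved T \<omega>" "mesh_resolved T D"
      using over unfolding oversampled_subdomain_def by auto
    have \<omega>\<Omega>: "\<omega> \<subseteq> \<Omega>" using \<omega>(2,3) by blast
    have H: "0 < diameter K \<and> diameter K \<le> mesh_size T" if "K \<in> T" for K
      using mesh_size_diameter[OF sh T that] by blast
    obtain w where w: "w \<in> fe_space r T" "\<And>x. x \<in> closure D \<Longrightarrow> w x = u x - \<psi> x"
      "\<And>x. x \<in> frontier D \<Longrightarrow> x \<in> frontier \<Omega> \<Longrightarrow> w x = 0"
      "\<And>v. v \<in> fe_space r T \<Longrightarrow> (\<And>x. x \<in> frontier \<Omega> \<Longrightarrow> v x = 0) \<Longrightarrow>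
        (\<And>K x. K \<in> T - submesh T D \<Longrightarrow> x \<in> K \<Longrightarrow> v x = 0) \<Longrightarrow> (\<Sum>K\<in>submesh T D. elem_form A \<epsilon> K w v) = 0"
      by (fact discrete_harmonic_difference[OF A(1,2) \<Omega> mesh f \<omega>(5,3) u \<psi>])
    obtain K0 where "K0 \<in> T" using mesh(2) \<omega>(1) \<omega>\<Omega> closure_subset[of \<Omega>] by blast
    then have H0: "0 \<le> mesh_size T" using H[of K0] by linarith
    have lm: "0 < l * m" using l1 m(1) by simp
    have small: "2 * (2 * amax * Ce * (\<epsilon> / (l * m))\<^sup>2 + 2 * sqrt Ce * (mesh_size T / (l * m))) \<le> exp (- 2)"
    proof -
      have "x / (l * m) \<le> 1 / l" if "x \<le> m" for x
        using divide_right_mono[OF that less_imp_le[OF lm]] m(1) by simp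
      then have el: "\<epsilon> / (l * m) \<le> 1 / l" "mesh_size T / (l * m) \<le> 1 / l" using m(2,3) by auto
      have "(\<epsilon> / (l * m))\<^sup>2 \<le> (1 / l)\<^sup>2" using el(1) \<epsilon> lm by (intro power_mono) auto
      also have "\<dots> \<le> 1 / l" using l1 by (simp add: power2_eq_square field_simps)
      finally have "2 * amax * Ce * (\<epsilon> / (l * m))\<^sup>2 + 2 * sqrt Ce * (mesh_size T / (l * m)) \<le>
          2 * amax * Ce * (1 / l) + 2 * sqrt Ce * (1 / l)"
        using el(2) A(3) Ce(1) by (intro add_mono mult_left_mono) auto
      also have "\<dots> = B / l" by (simp add: B_def add_divide_distrib)
      finally have "2 * (2 * amax * Ce * (\<epsilon> / (l * m))\<^sup>2 + 2 * sqrt Ce * (mesh_size T / (l * m))) \<le> 2 * B / l" by simp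
      also have "2 * B / l \<le> exp (- 2)"
      proof -
        have "2 * B = exp (- 2) * (2 * exp 2 * B)" by (simp flip: exp_add mult.assoc)
        also have "\<dots> \<le> exp (- 2) * l" by (simp add: l_def)
        finally show ?thesis using l1 by (simp add: pos_divide_le_eq)
      qed
      finally show ?thesis .
    qed
    define n where "n = nat \<lfloor>\<delta> / (l * m)\<rfloor>"
    have "l * m \<le> \<delta>" using dist by (simp add: m_def \<delta>_def)
    note n = exp_nat_floor_le[OF lm this, folded n_def]
    have decay: "(\<Sum>K\<in>submesh T \<omega>. elem_form A \<epsilon> K w w) \<le> exp (- 2 * real n) * (\<integral>x. (w x)\<^sup>2 \<partial>lebesgue_on D)"
      by (rule discrete_energy_decay[OF A \<Omega> mesh \<omega>(5,3) r Ce(1)]) (fact Ce(2)[OF T] H w(1,3,4) \<omega>(1,2) lm small n(1) n(2)[unfolded \<delta>_def])+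
    have DS: "D = interior (\<Union>(submesh T D))" "closure D = \<Union>(submesh T D)" by (rule mesh_resolved_submesh[OF mesh(1) \<omega>(5)])+
    have ST: "submesh T D \<subseteq> T" unfolding submesh_def by blast
    have bD: "bounded D" using \<Omega>(2) \<omega>(3) bounded_subset by blast
    have sq: "integrable (lebesgue_on D) (\<lambda>x. (v x)\<^sup>2)" if "v \<in> fe_space r T" for v
      using fe_product_integrable[OF fe_mesh_subset[OF mesh(1) ST] DS(1) bD fe_space_subset[OF that ST] fe_space_subset[OF that ST]]
      by (simp add: power2_eq_square)
    have uT: "u \<in> fe_space r T" using u unfolding fe_solution_def fe_space0_def by auto
    obtain w' where w': "w' \<in> fe_space r T" "\<And>x. x \<in> closure D \<Longrightarrow> \<psi> x = w' x"
      using \<psi> unfolding local_particular_def fe_space_Gamma_def fe_space_on_def by blast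
    have Dcl: "x \<in> closure D" if "x \<in> D" for x using that closure_subset[of D] by blast
    \<comment> \<open>The values of \<psi> are constrained on the closure of D only; its square
      integrability is that of the finite element function agreeing with it there.\<close>
    have \<psi>sq: "integrable (lebesgue_on D) (\<lambda>x. (\<psi> x)\<^sup>2)"
      using sq[OF w'(1)] by (subst Bochner_Integration.integrable_cong[OF refl, of _ _ "\<lambda>x. (w' x)\<^sup>2"]) (auto simp: w'(2) Dcl)
    have wN: "(\<integral>x. (w x)\<^sup>2 \<partial>lebesgue_on D) \<le> 2 * N\<^sup>2"
      unfolding N_def by (rule norm_L2_diff_le[OF sq[OF uT] \<psi>sq sq[OF w(1)]]) (simp add: w(2) Dcl)
    have g: "chi x * (u x - \<psi> x) = chi x * w x" if "x \<in> closure \<omega>" for x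
      using w(2)[of x] closure_mono[OF \<omega>(2)] that by auto
    have Hd: "0 < diameter K" if "K \<in> T" for K using H[OF that] by blast
    have "E\<^sup>2 \<le> C5 * (1 + \<epsilon> * G)\<^sup>2 * (\<Sum>K\<in>submesh T \<omega>. elem_form A \<epsilon> K w w)"
      unfolding E_def G_def C5_def
      by (rule interpolated_product_energy_le[OF A \<Omega>(1,2) mesh \<omega>(4) \<omega>\<Omega> \<omega>(1) r Ce(1)]) (fact Ce(2)[OF T] Hd w(1) g pu less_imp_le[OF \<epsilon>])+
    also have "\<dots> \<le> C5 * (1 + \<epsilon> * G)\<^sup>2 * (exp (- 2 * real n) * (\<integral>x. (w x)\<^sup>2 \<partial>lebesgue_on D))"
      using C5 by (intro mult_left_mono[OF decay]) auto
    also have "\<dots> \<le> C5 * (1 + \<epsilon> * G)\<^sup>2 * ((exp 1 * exp (- \<delta> / (l * m)))\<^sup>2 * (2 * N\<^sup>2))"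
      using C5 by (intro mult_left_mono[OF mult_mono[OF n(3) wN]]) auto
    also have "\<dots> = (M * (1 + \<epsilon> * G) * exp (- (\<delta> / m) / l) * N)\<^sup>2"
    proof -
      have "M\<^sup>2 = 2 * C5 * (exp 1)\<^sup>2" using C5 by (simp add: M_def power_mult_distrib)
      moreover have "- \<delta> / (l * m) = - (\<delta> / m) / l" by simp
      ultimately show ?thesis by (simp only: power_mult_distrib mult_ac)
    qed
    finally have E2: "E\<^sup>2 \<le> (M * (1 + \<epsilon> * G) * exp (- (\<delta> / m) / l) * N)\<^sup>2" .
    have o\<omega>: "open \<omega>" using \<omega>(4) unfolding mesh_resolved_def by auto
    have "0 \<le> G" unfolding G_def by (rule pu_function_lipschitz(1)[OF \<Omega>(1,2) pu o\<omega> \<omega>\<Omega> \<omega>(1)])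
    moreover have "0 \<le> N" by (simp add: N_def norm_L2_def)
    ultimately have "0 \<le> M * (1 + \<epsilon> * G) * exp (- (\<delta> / m) / l) * N" using \<epsilon> C5 by (simp add: M_def)
    then show "E \<le> M * (1 + \<epsilon> * G) * exp (- (\<delta> / m) / l) * N" by (rule power2_le_imp_le[OF E2])
  qed
qed

theorem theorem4p4:
  fixes \<Omega> :: "(real^'n) set"
    and A :: "real^'n \<Rightarrow> real^'n^'n"
    and amin amax :: real
    and r :: nat
    and \<T> :: "(real^'n) set set set"
  assumes "CARD('n) = 2 \<or> CARD('n) = 3"
    and "lipschitz_polyhedral_domain \<Omega>"
    and "0 < amin" and "amin < amax"
    and "elliptic_coefficient \<Omega> amin amax A"
    and "1 \<le> r"
    and "shape_regular_family \<Omega> \<T>"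
  shows "\<exists>c0>0. \<exists>c1>0. \<exists>C>0.
    \<forall>(\<epsilon>::real) T f \<omega> \<omega>' chi u \<psi>.
      0 < \<epsilon> \<longrightarrow> \<epsilon> \<le> 1 \<longrightarrow> T \<in> \<T> \<longrightarrow> L2 \<Omega> f \<longrightarrow>
      oversampled_subdomain T \<Omega> \<omega> \<omega>' \<longrightarrow> pu_function \<Omega> \<omega> chi \<longrightarrow>
      fe_solution r T \<Omega> A \<epsilon> f u \<longrightarrow> local_particular r T \<Omega> \<omega>' A \<epsilon> f \<psi> \<longrightarrow>
      (let h = mesh_size T;
           \<delta> = oversampling_dist \<Omega> \<omega> \<omega>';
           E = norm_a A \<epsilon> \<omega> (lagrange_interp r (submesh T \<omega>) (\<lambda>x. chi x * (u x - \<psi> x)));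
           G = norm_Linf \<omega> (weak_grad \<Omega> chi);
           N = norm_L2 \<omega>' u + norm_L2 \<omega>' \<psi>
       in c0 * max \<epsilon> h \<le> \<delta> \<longrightarrow>
          (h \<le> \<epsilon> \<longrightarrow> E \<le> C * (1 + \<epsilon> * G) * (\<epsilon> / \<delta>) * exp (- c1 * \<delta> / \<epsilon>) * N) \<and>
          (\<epsilon> \<le> h \<longrightarrow> E \<le> C * (1 + \<epsilon> * G) * sqrt (h / \<delta>) * exp (- c1 * \<delta> / h) * N))"
proof -
  have \<Omega>: "open \<Omega>" "bounded \<Omega>" "lipschitz_boundary \<Omega>" using assms(2) unfolding lipschitz_polyhedral_domain_def by auto
  have amax: "0 \<le> amax" using assms(3,4) by linarith
  obtain l M where l: "1 \<le> l" and M: "0 < M" and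
    main: "\<And>\<epsilon> T f \<omega> D chi u \<psi>. 0 < \<epsilon> \<Longrightarrow> T \<in> \<T> \<Longrightarrow> L2 \<Omega> f \<Longrightarrow>
      oversampled_subdomain T \<Omega> \<omega> D \<Longrightarrow> pu_function \<Omega> \<omega> chi \<Longrightarrow>
      fe_solution r T \<Omega> A \<epsilon> f u \<Longrightarrow> local_particular r T \<Omega> D A \<epsilon> f \<psi> \<Longrightarrow>
      l * max \<epsilon> (mesh_size T) \<le> oversampling_dist \<Omega> \<omega> D \<Longrightarrow>
      norm_a A \<epsilon> \<omega> (lagrange_interp r (submesh T \<omega>) (\<lambda>x. chi x * (u x - \<psi> x))) \<le>
        M * (1 + \<epsilon> * norm_Linf \<omega> (weak_grad \<Omega> chi)) * exp (- (oversampling_dist \<Omega> \<omega> D / max \<epsilon> (mesh_size T)) / l) *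
        (norm_L2 D u + norm_L2 D \<psi>)"
    by (fact fe_exponential_decay[OF assms(5,3) amax \<Omega> assms(6,7)])
  show ?thesis
  proof (intro exI conjI allI impI)
    \<comment> \<open>The least distance corresponds to one layer, so c0 = l. The rate is halved to
      c1 = 1 / (2 l) to pay for the factor max \<epsilon> h / \<delta>, and this trade puts the
      factor 2 l into C.\<close>
    show "0 < l" "0 < 1 / (2 * l)" "0 < M * (2 * l)" using l M by auto
    fix \<epsilon> :: real and T f \<omega> \<omega>' chi u \<psi>
    assume \<epsilon>: "0 < \<epsilon>" and hyps: "T \<in> \<T>" "L2 \<Omega> f" "oversampled_subdomain T \<Omega> \<omega> \<omega>'" "pu_function \<Omega> \<omega> chi"
      "fe_solution r T \<Omega> A \<epsilon> f u" "local_particular r T \<Omega> \<omega>' A \<epsilon> f \<psi>"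
    define h where "h = mesh_size T"
    define \<delta> where "\<delta> = oversampling_dist \<Omega> \<omega> \<omega>'"
    define E where "E = norm_a A \<epsilon> \<omega> (lagrange_interp r (submesh T \<omega>) (\<lambda>x. chi x * (u x - \<psi> x)))"
    define G where "G = norm_Linf \<omega> (weak_grad \<Omega> chi)"
    define N where "N = norm_L2 \<omega>' u + norm_L2 \<omega>' \<psi>"
    \<comment> \<open>One estimate with m = max \<epsilon> h covers both regimes. It also records
      that m / \<delta> is at most 1, which holds because l \<ge> 1.\<close>
    have bound: "E \<le> M * (2 * l) * (1 + \<epsilon> * G) * (m / \<delta>) * exp (- (1 / (2 * l)) * \<delta> / m) * N \<and> 0 < \<delta> / m \<and> m / \<delta> \<le> 1 \<and> 0 \<le> (1 + \<epsilon> * G) * N"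
      if d: "l * max \<epsilon> h \<le> \<delta>" and m: "m = max \<epsilon> h" for m
    proof -
      have m0: "0 < m" using \<epsilon> m by simp
      have "m \<le> l * m" using l m0 by simp
      then have \<delta>: "m \<le> \<delta>" "0 < \<delta>" using d m m0 by auto
      have \<Omega>\<omega>: "open \<omega>" "\<omega> \<subseteq> \<Omega>" "\<omega> \<noteq> {}"
        using hyps(3) unfolding oversampled_subdomain_def mesh_resolved_def by auto
      have "0 \<le> G" unfolding G_def by (rule pu_function_lipschitz(1)[OF \<Omega>(1,2) hyps(4) \<Omega>\<omega>])
      moreover have "0 \<le> N" by (simp add: N_def norm_L2_def)
      ultimately have GN: "0 \<le> (1 + \<epsilon> * G) * N" using \<epsilon> by simp
      have "E \<le> M * (1 + \<epsilon> * G) * exp (- (\<delta> / m) / l) * N"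
        unfolding E_def G_def N_def m \<delta>_def h_def by (rule main[OF \<epsilon> hyps d[unfolded \<delta>_def h_def]])
      also have "\<dots> = M * ((1 + \<epsilon> * G) * N) * exp (- (\<delta> / m) / l)" by simp
      also have "\<dots> \<le> M * ((1 + \<epsilon> * G) * N) * (2 * l * (1 / (\<delta> / m)) * exp (- (1 / (2 * l)) * (\<delta> / m)))"
        using exp_half_rate[of l "\<delta> / m"] l \<delta>(2) m0 M GN by (intro mult_left_mono) auto
      also have "\<dots> = M * (2 * l) * (1 + \<epsilon> * G) * (m / \<delta>) * exp (- (1 / (2 * l)) * \<delta> / m) * N" by simp
      finally show ?thesis using \<delta> m0 GN by simp
    qed
    have "l * max \<epsilon> h \<le> \<delta> \<longrightarrow>
        (h \<le> \<epsilon> \<longrightarrow> E \<le> M * (2 * l) * (1 + \<epsilon> * G) * (\<epsilon> / \<delta>) * exp (- (1 / (2 * l)) * \<delta> / \<epsilon>) * N) \<and>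
        (\<epsilon> \<le> h \<longrightarrow> E \<le> M * (2 * l) * (1 + \<epsilon> * G) * sqrt (h / \<delta>) * exp (- (1 / (2 * l)) * \<delta> / h) * N)"
    proof (intro impI conjI)
      assume d: "l * max \<epsilon> h \<le> \<delta>"
      show "E \<le> M * (2 * l) * (1 + \<epsilon> * G) * (\<epsilon> / \<delta>) * exp (- (1 / (2 * l)) * \<delta> / \<epsilon>) * N" if "h \<le> \<epsilon>"
        using bound[OF d, of \<epsilon>] that by (simp add: max_absorb1)
      show "E \<le> M * (2 * l) * (1 + \<epsilon> * G) * sqrt (h / \<delta>) * exp (- (1 / (2 * l)) * \<delta> / h) * N" if "\<epsilon> \<le> h"
      proof -
        note b = bound[OF d, of h, unfolded max_absorb2[OF that], OF refl]
        have h: "0 < h / \<delta>" "h / \<delta> \<le> 1" using b \<epsilon> that by (auto simp: zero_less_divide_iff)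
        \<comment> \<open>What has been obtained is the smaller factor h / \<delta>; as it is at
          most 1, it lies below its square root.\<close>
        have "(h / \<delta>)\<^sup>2 \<le> h / \<delta>" using mult_left_le[OF h(2) less_imp_le[OF h(1)]] by (simp only: power2_eq_square)
        then have s: "h / \<delta> \<le> sqrt (h / \<delta>)" by (rule real_le_rsqrt)
        have "E \<le> h / \<delta> * (M * (2 * l) * ((1 + \<epsilon> * G) * N) * exp (- (1 / (2 * l)) * \<delta> / h))" using b by (simp add: mult_ac)
        also have "\<dots> \<le> sqrt (h / \<delta>) * (M * (2 * l) * ((1 + \<epsilon> * G) * N) * exp (- (1 / (2 * l)) * \<delta> / h))"
        proof (rule mult_right_mono[OF s])
          have "0 \<le> M * (2 * l)" "0 \<le> (1 + \<epsilon> * G) * N" using b l M by (simp, blast)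
          then show "0 \<le> M * (2 * l) * ((1 + \<epsilon> * G) * N) * exp (- (1 / (2 * l)) * \<delta> / h)"
            by (intro mult_nonneg_nonneg[OF mult_nonneg_nonneg exp_ge_zero])
        qed
        finally show ?thesis by (simp only: mult_ac)
      qed
    qed
    then show "let h = mesh_size T;
           \<delta> = oversampling_dist \<Omega> \<omega> \<omega>';
           E = norm_a A \<epsilon> \<omega> (lagrange_interp r (submesh T \<omega>) (\<lambda>x. chi x * (u x - \<psi> x)));
           G = norm_Linf \<omega> (weak_grad \<Omega> chi);
           N = norm_L2 \<omega>' u + norm_L2 \<omega>' \<psi>
       in l * max \<epsilon> h \<le> \<delta> \<longrightarrow>
          (h \<le> \<epsilon> \<longrightarrow> E \<le> M * (2 * l) * (1 + \<epsilon> * G) * (\<epsilon> / \<delta>) * exp (- (1 / (2 * l)) * \<delta> / \<epsilon>) * N) \<and>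
          (\<epsilon> \<le> h \<longrightarrow> E \<le> M * (2 * l) * (1 + \<epsilon> * G) * sqrt (h / \<delta>) * exp (- (1 / (2 * l)) * \<delta> / h) * N)"
      unfolding Let_def E_def G_def N_def h_def \<delta>_def .
  qed
qed

end
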